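(* Let $\zeta$ be the Riemann zeta-function. For $\delta>0$, $$\inf_{T\in\mathbb{R}}\max_{t\in[T,T+\delta]}|\zeta(1+it)|=\frac{e^{-\gamma}\pi^2}{24}\,\delta+O(\delta^3),$$ and $$\sup_{T\in\mathbb{R}}\min_{t\in[T,T+\delta]}|\zeta(1+it)|=\frac{4e^{\gamma}}{\delta}+O(\delta).$$
   Context: $\gamma$ denotes Euler's constant. Implied constants do not depend on $\delta$. *)

theory Defs
  imports "HOL-Complex_Analysis.Complex_Analysis"
begin

text \<open>
  The Riemann zeta function is the analytic continuation of its Dirichlet series to the plane
  punctured at 1. By the identity theorem the two conditions below determine the function at
  every point except 1, where its value is left unspecified.
\<close>
definition zeta :: "complex \<Rightarrow> complex" where
  "zeta = (SOME f. f holomorphic_on (- {1}) \<and>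
             (\<forall>s. Re s > 1 \<longrightarrow> (\<lambda>n. of_nat (Suc n) powr (- s)) sums f s))"

text \<open>
  The modulus of zeta at the point 1 + it. The pole at t = 0 is given the value
  \<open>\<infinity>\<close>, which makes this a continuous function into the extended reals, so that its
  extrema on compact intervals are attained even when the interval contains 0.
\<close>
definition abs_zeta_1_line :: "real \<Rightarrow> ereal" where
  "abs_zeta_1_line t = (if t = 0 then \<infinity> else ereal (cmod (zeta (1 + \<i> * of_real t))))"

end

theory Submission
  imports Defs "HOL-Real_Asymp.Real_Asymp"
begin

text \<open>
  Write \<open>a = \<delta> / 2\<close>. The mean of \<open>-ln \<bar>1 - p\<^sup>-\<^sup>1\<^sup>-\<^sup>i\<^sup>t\<bar>\<close> over a window of length \<open>2 a\<close> lies
  between explicit multiples of \<open>\<bar>sin (a ln p)\<bar> / (a p ln p)\<close> up to a constant and \<open>O(a\<^sup>2 (ln p / p)\<^sup>2)\<close>;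
  summed over \<open>p\<close> this bounds the maximum from below and the minimum from above on every window.
  For the opposite bounds one chooses \<open>T\<close> with \<open>p\<^sup>-\<^sup>i\<^sup>T\<close> close to the sign of \<open>\<plusminus> sin (b ln p)\<close> for all
  small primes (\<open>b\<close> slightly larger than \<open>a\<close>), while \<open>\<zeta>(1 + i(T + t))\<close> stays close to its short Euler
  product; such \<open>T\<close> exist by a mean-square argument weighted with a Fejer-type product. Then
  \<open>\<Sum>\<^sub>p sgn (sin (b ln p)) cos (t ln p) / p\<close> is nearly constant for \<open>\<bar>t\<bar> < b\<close>. Both sums are evaluated by
  partial summation from Mertens' second theorem with error \<open>O((ln x)\<^sup>-\<^sup>3)\<close>, obtained from a Newman-type
  contour integral and a polynomial zero-free region, and by the Wallis product.
\<close>

text \<open>The cubic error in Mertens' theorem is what second-order accuracy requires: with y = ln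
  p, partial summation against cos(t y) leaves the integral of |E(y) t sin(t y)| <= t^2 y |E(y)|,
  which is O(t^2) once E(y) = O(y^-3). Both extremal problems share one sum, equal to gamma -
  \<open>log_corr_const\<close> + ln(2/a) + O(a^2); here ln(2/a) is ln(pi/a) from the first
  half-period of the wave less ln(pi/2) from the Wallis product. The higher prime powers contribute
  \<open>log_corr_const\<close> when |zeta| is large and ln zeta(2) - \<open>log_corr_const\<close>
  when it is small, so this constant cancels and e^gamma * 2/a and zeta(2) e^(-gamma) a/2 remain.
  The wave needs b > a because the t-derivative of its truncation carries the amplitude tan(pi t /
  (2b)) / t, singular at t = b; b = a exp(a^2) costs only a^2 in the exponent. The bounds for
  arbitrary windows are proved on Re s > 1, where the Euler product converges uniformly in Im s, and
  reach Re s = 1 by compactness through (s - 1) zeta(s), which absorbs the pole.\<close>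

section \<open>Analytic continuation of zeta by the binomial series\<close>

lemma norm_gbinomial_le:
 fixes w :: complex
 assumes "norm w <= B"
 shows "norm (w gchoose k) <= (-B gchoose k) * (-1) ^ k"
proof -
 have *: "norm (pochhammer (-w) k) <= pochhammer B k"
  unfolding pochhammer_prod prod_norm[symmetric]
 proof (rule prod_mono, safe)
  fix i
  have "norm (-w + of_nat i) <= norm w + real i"
   by (metis norm_minus_cancel norm_of_nat norm_triangle_ineq)
  then show "norm (-w + of_nat i) <= B + of_nat i" using assms by simp
 qed auto
 moreover have "(-B gchoose k) * (-1) ^ k = pochhammer B k / fact k"
  unfolding gbinomial_pochhammer by (simp add: minus_one_power_iff)
 moreover have "norm (w gchoose k) = norm (pochhammer (-w) k) / fact k"
  unfolding gbinomial_pochhammer by (simp add: norm_mult norm_divide norm_power)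
 ultimately show ?thesis
  by (metis divide_right_mono fact_ge_zero)
qed

text \<open>The majorant coefficients of \<open>norm_gbinomial_le\<close> have the generating
  function (1 - x)^(-B), which equals 2^B at x = 1/2. Writing |y|^j as (2|y|)^j (1/2)^j and using
  2|y| <= 1 pulls (2|y|)^(K+1) out of the whole tail.\<close>

lemma binomial_series_remainder:
 fixes w y :: complex
 assumes "norm w <= B" "norm y <= 1/2"
 shows "norm ((1 + y) powr w - (\<Sum>k\<le>K. (w gchoose k) * y ^ k)) <= (2 * norm y) ^ (Suc K) * 2 powr B"
proof -
 define c where "c k = (-B gchoose k) * (-1) ^ k" for k
 have c: "(%k. c k * (1/2) ^ k) sums (2 powr B)"
 proof -
  have "c k * (1/2) ^ k = (-B gchoose k) * (-1/2) ^ k" for k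
   by (simp add: c_def mult.assoc flip: power_mult_distrib)
  moreover have "(1 + -1/2) powr (-B) = 2 powr B"
   by (simp add: powr_minus powr_divide)
  ultimately show ?thesis
   using gen_binomial_real[of "-1/2" "-B"] by simp
 qed
 have nc: "norm (w gchoose k) <= c k" for k
  unfolding c_def using assms(1) by (rule norm_gbinomial_le)
 then have c0: "c k >= 0" for k
  by (meson norm_ge_zero order_trans)
 have s: "(%k. (w gchoose k) * y ^ k) sums (1 + y) powr w"
  using assms by (intro gen_binomial_complex) simp
 have s': "(%k. (w gchoose (k + Suc K)) * y ^ (k + Suc K)) sums
   ((1 + y) powr w - (\<Sum>k\<le>K. (w gchoose k) * y ^ k))"
  unfolding lessThan_Suc_atMost[symmetric] by (rule sums_split_initial_segment[OF s])
 have b: "norm ((w gchoose (k + Suc K)) * y ^ (k + Suc K)) <= (2 * norm y) ^ (Suc K) * (c (k + Suc K) * (1/2) ^ (k + Suc K))" for k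
 proof -
  have "norm y ^ (k + Suc K) = (2 * norm y) ^ (k + Suc K) * (1/2) ^ (k + Suc K)"
   by (subst power_mult_distrib[symmetric]) simp
  also have "... <= (2 * norm y) ^ (Suc K) * (1/2) ^ (k + Suc K)"
   by (intro mult_right_mono power_decreasing) (use assms in auto)
  finally have "c (k + Suc K) * norm y ^ (k + Suc K) <= c (k + Suc K) * ((2 * norm y) ^ (Suc K) * (1/2) ^ (k + Suc K))"
   using c0 by (intro mult_left_mono) auto
  moreover have "norm ((w gchoose (k + Suc K)) * y ^ (k + Suc K)) <= c (k + Suc K) * norm y ^ (k + Suc K)"
   unfolding norm_mult norm_power by (intro mult_right_mono nc) auto
  ultimately show ?thesis by (simp add: mult_ac)
 qed
 have t: "(%k. (2 * norm y) ^ (Suc K) * (c (k + Suc K) * (1/2) ^ (k + Suc K))) sums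
   ((2 * norm y) ^ (Suc K) * (2 powr B - (\<Sum>i<Suc K. c i * (1/2) ^ i)))"
  by (intro sums_mult sums_split_initial_segment c)
 have "norm ((1 + y) powr w - (\<Sum>k\<le>K. (w gchoose k) * y ^ k)) <= (2 * norm y) ^ (Suc K) * (2 powr B - (\<Sum>i<Suc K. c i * (1/2) ^ i))"
  using norm_sums_le[OF s' t b] .
 also have "... <= (2 * norm y) ^ (Suc K) * 2 powr B"
 proof (rule mult_left_mono)
  have "(\<Sum>i<Suc K. c i * (1/2) ^ i) >= 0" by (intro sum_nonneg mult_nonneg_nonneg c0) simp
  then show "2 powr B - (\<Sum>i<Suc K. c i * (1/2) ^ i) <= 2 powr B" by linarith
 qed simp
 finally show ?thesis .
qed

lemma norm_nat_powr: "n > 0 ==> norm (of_nat n powr (s::complex)) = real n powr Re s"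
 by (subst norm_powr_real_powr) auto

lemma summable_nat_powr: "b > 1 ==> summable (%n. real (n + k) powr (-b))"
proof -
 assume "b > 1"
 then have "summable (%n. real n powr (-b))" by (simp add: summable_real_powr_iff)
 then show ?thesis by (rule summable_ignore_initial_segment[of "%n. real n powr (-b)"])
qed

text \<open>Local majorants give locally uniform convergence of the partial sums by the M-test, and
  this preserves holomorphy.\<close>

lemma holomorphic_on_suminf:
 fixes f :: "nat => complex => complex"
 assumes "open S" "\<And>n. f n holomorphic_on S"
  "\<And>z. z \<in> S ==> \<exists>d>0. \<exists>h. summable h & (\<forall>n. \<forall>y\<in>cball z d \<inter> S. norm (f n y) <= h n)"
 shows "(%z. \<Sum>n. f n z) holomorphic_on S"
proof (rule holomorphic_uniform_sequence[OF assms(1), of "%n z. \<Sum>i<n. f i z"])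
 show "(%z. \<Sum>i<n. f i z) holomorphic_on S" for n
  by (intro holomorphic_on_sum assms(2))
 fix z assume z: "z \<in> S"
 obtain d h where d: "d > 0" "summable h" "\<And>n y. y \<in> cball z d \<inter> S ==> norm (f n y) <= h n"
  using assms(3)[OF z] by metis
 obtain e where e: "e > 0" "cball z e \<subseteq> S"
  using assms(1) z open_contains_cball by blast
 have "uniform_limit (cball z (min d e)) (%n x. \<Sum>i<n. f i x) (%x. suminf (%i. f i x)) sequentially"
  by (rule Weierstrass_m_test[OF _ d(2)]) (use d e in auto)
 then show "\<exists>d>0. cball z d \<subseteq> S & uniform_limit (cball z d) (%n x. \<Sum>i<n. f i x) (%x. suminf (%i. f i x)) sequentially"
  using d e by (intro exI[of _ "min d e"]) auto
qed

lemma summable_dirichlet: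
 fixes s :: complex
 assumes "Re s > 1"
 shows "summable (%n. of_nat (n + Suc k) powr (-s))" "summable (%n. norm (of_nat (n + Suc k) powr (-s)))"
proof -
 have "norm (of_nat (n + Suc k) powr (-s)) = real (n + Suc k) powr - Re s" for n
  by (subst norm_nat_powr) auto
 then show *: "summable (%n. norm (of_nat (n + Suc k) powr (-s)))"
  using summable_nat_powr[OF assms, of "Suc k"] by simp
 then show "summable (%n. of_nat (n + Suc k) powr (-s))" by (rule summable_norm_cancel)
qed

lemma dirichlet_tail_holomorphic: "(%s. \<Sum>n. of_nat (n + 2) powr (-s)) holomorphic_on {s. Re s > 1}"
proof (rule holomorphic_on_suminf)
 show "open {s. Re s > 1}" by (rule open_halfspace_Re_gt)
 show "(%s. of_nat (n + 2) powr (-s)) holomorphic_on {s. Re s > 1}" for n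
  by (intro holomorphic_intros)
 fix z :: complex assume z: "z \<in> {s. Re s > 1}"
 define d where "d = (Re z - 1) / 2"
 define b where "b = Re z - d"
 have b: "b > 1" "d > 0" using z by (auto simp: b_def d_def field_simps)
 have "norm (of_nat (n + 2) powr (-y)) <= real (n + 2) powr (-b)" if "y \<in> cball z d" for n and y :: complex
 proof -
  have "Re z - Re y <= d" using that abs_Re_le_cmod[of "z - y"] by (auto simp: dist_norm)
  then show ?thesis by (subst norm_nat_powr) (auto simp: b_def intro!: powr_mono)
 qed
 then show "\<exists>d>0. \<exists>h. summable h & (\<forall>n. \<forall>y\<in>cball z d \<inter> {s. 1 < Re s}. norm (of_nat (n + 2) powr (-y)) <= h n)"
  using summable_nat_powr[OF b(1), of 2] b by blast
qed

text \<open>Expanding \<open>(N - 1) powr (1 - s)\<close> by the binomial series around \<open>N\<close> and summing over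
 \<open>N >= 2\<close> expresses \<open>(s - 1) * (\<Sum>N\<ge>2. N powr - s)\<close> through its own values to the right of \<open>s\<close>.\<close>

definition shift_rem :: "nat => nat => complex => complex" where
 "shift_rem K n s = of_nat (n + 1) powr (1 - s) -
   (\<Sum>k\<le>K. (1 - s gchoose k) * (-1) ^ k * of_nat (n + 2) powr (1 - s - of_nat k))"

text \<open>Factoring out N^(1-s) with N = n + 2 leaves the binomial remainder at y = -1/N. The sums
  start at N = 2 because |y| <= 1/2 is required.\<close>

lemma norm_shift_rem_le:
 assumes "norm (1 - s) <= B"
 shows "norm (shift_rem K n s) <= 2 powr B * 2 ^ Suc K * real (n + 2) powr (- (Re s + real K))"
proof -
 let ?N = "of_nat (n + 2) :: complex" and ?y = "- 1 / of_nat (n + 2) :: complex"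
 have y: "norm ?y <= 1/2" "1 + ?y = of_real (real (n + 1) / real (n + 2))"
  by (auto simp: norm_divide field_simps simp flip: of_nat_Suc of_nat_add)
 have "?N powr (1 - s) * (1 + ?y) powr (1 - s) = of_nat (n + 1) powr (1 - s)"
 proof -
  have "of_real x powr w * of_real y powr w = (of_real (x * y) :: complex) powr w" if "x >= 0" "y >= 0" for x y w
   using that powr_times_real[of "of_real x" "of_real y" w] by simp
  from this[of "real (n + 2)" "real (n + 1) / real (n + 2)" "1 - s"]
  show ?thesis unfolding y(2) by (simp only: of_real_of_nat_eq) simp
 qed
 moreover have "?N powr (1 - s) * ?y ^ k = (-1) ^ k * ?N powr (1 - s - of_nat k)" for k
 proof -
  have "?N ~= 0" by (metis add_is_0 numeral_2_eq_2 of_nat_eq_0_iff nat.simps(3))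
  then have "?N powr (1 - s - of_nat k) = ?N powr (1 - s) / ?N ^ k"
   by (simp only: powr_diff powr_nat') simp
  moreover have "?y ^ k = (-1) ^ k / ?N ^ k" by (rule power_divide)
  ultimately show ?thesis by (simp only: times_divide_eq_right mult.commute)
 qed
 ultimately have "shift_rem K n s = ?N powr (1 - s) * ((1 + ?y) powr (1 - s) - (\<Sum>k\<le>K. (1 - s gchoose k) * ?y ^ k))"
  unfolding shift_rem_def by (simp add: right_diff_distrib sum_distrib_left mult_ac del: of_nat_add of_nat_Suc)
 then have "norm (shift_rem K n s) <= norm (?N powr (1 - s)) * ((2 * norm ?y) ^ (Suc K) * 2 powr B)"
  using binomial_series_remainder[OF assms y(1)] by (simp add: norm_mult mult_left_mono)
 also have "norm (?N powr (1 - s)) = real (n + 2) powr (1 - Re s)"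
  by (subst norm_nat_powr) simp_all
 also have "(2 * norm ?y) ^ (Suc K) = 2 ^ Suc K * real (n + 2) powr (- real (Suc K))"
 proof -
  have "2 * norm ?y = 2 / real (n + 2)" by (simp only: norm_divide norm_minus_cancel norm_one norm_of_nat)
  moreover have "real (n + 2) powr (- real (Suc K)) = 1 / real (n + 2) ^ Suc K"
   by (subst powr_minus, subst powr_realpow) (auto simp: divide_inverse)
  ultimately show ?thesis by (simp only: power_divide times_divide_eq_right mult_1_right)
 qed
 also have "real (n + 2) powr (1 - Re s) * (2 ^ Suc K * real (n + 2) powr (- real (Suc K)) * 2 powr B) =
   2 powr B * 2 ^ Suc K * real (n + 2) powr (- (Re s + real K))"
  by (simp add: flip: powr_add)
 finally show ?thesis .
qed

text \<open>The terms are O(N^(-Re s - K)) locally uniformly, hence the gain of K units over the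
  half-plane of absolute convergence.\<close>

lemma shift_rem_holomorphic: "(%s. \<Sum>n. shift_rem K n s) holomorphic_on {s. Re s > 1 - real K}"
proof (rule holomorphic_on_suminf)
 show "open {s. Re s > 1 - real K}" by (rule open_halfspace_Re_gt)
 show "shift_rem K n holomorphic_on {s. Re s > 1 - real K}" for n
  unfolding shift_rem_def gbinomial_prod_rev by (intro holomorphic_intros) simp_all
 fix z :: complex assume z: "z \<in> {s. Re s > 1 - real K}"
 define d where "d = (Re z + real K - 1) / 2"
 define b where "b = Re z + real K - d"
 have b: "b > 1" "d > 0" using z by (auto simp: b_def d_def field_simps)
 have "norm (shift_rem K n y) <= 2 powr (norm (1 - z) + d) * 2 ^ Suc K * real (n + 2) powr (-b)" if "y \<in> cball z d" for n y
 proof -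
  have "Re z - Re y <= d" using that abs_Re_le_cmod[of "z - y"] by (auto simp: dist_norm)
  then have 1: "real (n + 2) powr (- (Re y + real K)) <= real (n + 2) powr (-b)"
   by (intro powr_mono) (auto simp: b_def)
  have "norm (1 - y) <= norm (1 - z) + d"
   using that norm_triangle_ineq[of "1 - z" "z - y"] by (auto simp: dist_norm)
  from norm_shift_rem_le[OF this, of K n] show ?thesis
   by (rule order_trans) (intro mult_left_mono 1, auto)
 qed
 then show "\<exists>d>0. \<exists>h. summable h & (\<forall>n. \<forall>y\<in>cball z d \<inter> {s. Re s > 1 - real K}. norm (shift_rem K n y) <= h n)"
  using summable_mult[OF summable_nat_powr[OF b(1), of 2], of "2 powr (norm (1 - z) + d) * 2 ^ Suc K"] b
  by (intro exI[of _ d] conjI exI[of _ "%n. 2 powr (norm (1 - z) + d) * 2 ^ Suc K * real (n + 2) powr (-b)"] allI ballI)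
   (simp_all only: Int_iff)
qed

text \<open>The differences (N-1)^(1-s) - N^(1-s) telescope to 1, while their binomial expansion has
  (s - 1) Z(s) as its k = 1 term. Everything is phrased with h(s) = (s - 1) Z(s) because
  \<open>(1 - s gchoose k)\<close> supplies the factor s + k - 2 that cancels the pole of Z(s + k -
  1).\<close>

lemma shift_identity:
 fixes s :: complex
 defines "Z \<equiv> %s. \<Sum>n. of_nat (n + 2) powr (- s) :: complex"
 defines "h \<equiv> %s. (s - 1) * Z s"
 assumes s: "Re s > 1" and K: "K >= 1"
 shows "h s = 1 - (\<Sum>k=2..K. (1 - s gchoose (k - 1)) * (-1) ^ Suc k / of_nat k * h (s + of_nat (k - 1)))
   - (\<Sum>n. shift_rem K n s)"
proof -
 let ?N = "%n. of_nat (n + 2) :: complex"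
 have 1: "(%n. of_nat (n + 1) powr (1 - s) - ?N n powr (1 - s)) sums 1"
 proof -
  have "filterlim (%n. of_nat (n + 1) powr (1 - s)) (nhds 0) sequentially"
  proof (rule tendsto_norm_zero_cancel)
   have "norm (of_nat (n + 1) powr (1 - s)) = real (n + 1) powr (1 - Re s)" for n
    by (subst norm_nat_powr) auto
   moreover have "(%n. real (n + 1) powr (1 - Re s)) \<longlonglongrightarrow> 0"
    using s by real_asymp
   ultimately show "(%n. norm (of_nat (n + 1) powr (1 - s))) \<longlonglongrightarrow> 0" by simp
  qed
  from telescope_sums'[OF this] show ?thesis by (simp add: add_ac)
 qed
 have Z: "(%n. ?N n powr (-(s + of_nat j))) sums Z (s + of_nat j)" for j
  unfolding Z_def using summable_dirichlet(1)[of "s + of_nat j" 1] s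
  by (intro summable_sums) (auto simp: numeral_2_eq_2)
 have 2: "(%n. (1 - s gchoose k) * (-1) ^ k * ?N n powr (1 - s - of_nat k)) sums
   ((1 - s gchoose k) * (-1) ^ k * Z (s + of_nat (k - 1)))" if "k \<in> {1..K}" for k
 proof -
  have "1 - s - of_nat k = -(s + of_nat (k - 1))" using that by (simp add: of_nat_diff)
  then show ?thesis by (simp only: sums_mult[OF Z])
 qed
 have "(%n. of_nat (n + 1) powr (1 - s) - ?N n powr (1 - s)
    - (\<Sum>k=1..K. (1 - s gchoose k) * (-1) ^ k * ?N n powr (1 - s - of_nat k)))
   sums (1 - (\<Sum>k=1..K. (1 - s gchoose k) * (-1) ^ k * Z (s + of_nat (k - 1))))"
  by (intro sums_diff 1 sums_sum 2)
 also have "(%n. of_nat (n + 1) powr (1 - s) - ?N n powr (1 - s)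
    - (\<Sum>k=1..K. (1 - s gchoose k) * (-1) ^ k * ?N n powr (1 - s - of_nat k))) = (%n. shift_rem K n s)"
 proof
  fix n
  have "{..K} = insert 0 {1..K}" by auto
  then show "of_nat (n + 1) powr (1 - s) - ?N n powr (1 - s)
    - (\<Sum>k=1..K. (1 - s gchoose k) * (-1) ^ k * ?N n powr (1 - s - of_nat k)) = shift_rem K n s"
   unfolding shift_rem_def by simp
 qed
 finally have 3: "(\<Sum>n. shift_rem K n s) = 1 - (\<Sum>k=1..K. (1 - s gchoose k) * (-1) ^ k * Z (s + of_nat (k - 1)))"
  by (simp add: sums_iff)
 have 4: "(1 - s gchoose k) * (-1) ^ k * Z (s + of_nat (k - 1)) =
   (1 - s gchoose (k - 1)) * (-1) ^ Suc k / of_nat k * h (s + of_nat (k - 1))" if k: "k \<in> {1..K}" for k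
 proof -
  obtain j where j: "k = Suc j" using k by (cases k) auto
  have "of_nat (Suc j) * (1 - s gchoose Suc j) = (1 - s - of_nat j) * (1 - s gchoose j)"
   using gbinomial_mult_1[of "1 - s" j] by (simp add: algebra_simps)
  then have e: "(1 - s gchoose Suc j) = (1 - s - of_nat j) * (1 - s gchoose j) / of_nat (Suc j)"
   by (simp add: field_simps del: of_nat_Suc)
  show ?thesis
   unfolding j e h_def by (simp add: field_simps del: of_nat_Suc)
 qed
 have "(\<Sum>k=1..K. (1 - s gchoose k) * (-1) ^ k * Z (s + of_nat (k - 1))) =
   (\<Sum>k=1..K. (1 - s gchoose (k - 1)) * (-1) ^ Suc k / of_nat k * h (s + of_nat (k - 1)))"
  by (intro sum.cong refl 4)
 also have "... = h s + (\<Sum>k=2..K. (1 - s gchoose (k - 1)) * (-1) ^ Suc k / of_nat k * h (s + of_nat (k - 1)))"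
  using K by (subst sum.atLeast_Suc_atMost) (auto simp: numeral_2_eq_2)
 finally show ?thesis using 3 by (simp add: algebra_simps)
qed

text \<open>In \<open>shift_identity\<close> with K = m + 1 the function h occurs on the right only
  at s + 1, ..., s + m, so a continuation to Re s > 1 - m gives one unit more.\<close>

lemma continuation_strip:
 "\<exists>h. h holomorphic_on {s. Re s > 1 - real m} &
   (\<forall>s. Re s > 1 --> h s = (s - 1) * (\<Sum>n. of_nat (n + 2) powr (- s)))"
proof (induction m)
 case 0
 show ?case
  by (rule exI[of _ "%s. (s - 1) * (\<Sum>n. of_nat (n + 2) powr (- s))"])
   (use dirichlet_tail_holomorphic in \<open>auto intro!: holomorphic_intros simp del: of_nat_add\<close>)
next
 case (Suc m)
 then obtain h where h: "h holomorphic_on {s. Re s > 1 - real m}"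
  "\<And>s. Re s > 1 ==> h s = (s - 1) * (\<Sum>n. of_nat (n + 2) powr (- s))" by blast
 let ?h = "%s. 1 - (\<Sum>k=2..Suc m. (1 - s gchoose (k - 1)) * (-1) ^ Suc k / of_nat k * h (s + of_nat (k - 1)))
   - (\<Sum>n. shift_rem (Suc m) n s)"
 have *: "(%s. h (s + of_nat (k - 1))) holomorphic_on {s. Re s > 1 - real (Suc m)}" if "k >= 2" for k
  by (rule holomorphic_on_compose_gen[OF _ h(1), unfolded o_def])
   (use that in \<open>auto intro!: holomorphic_intros simp: of_nat_diff\<close>)
 have "?h holomorphic_on {s. Re s > 1 - real (Suc m)}"
  unfolding gbinomial_prod_rev by (intro holomorphic_intros shift_rem_holomorphic *) auto
 moreover have "?h s = (s - 1) * (\<Sum>n. of_nat (n + 2) powr (- s))" if "Re s > 1" for s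
  using shift_identity[OF that, of "Suc m"] that by (simp add: h(2))
 ultimately show ?case by (intro exI[of _ ?h]) blast
qed

lemma zeta_exists:
 "\<exists>f. f holomorphic_on (- {1}) & (\<forall>s. Re s > 1 --> (%n. of_nat (Suc n) powr (- s)) sums f s)"
proof -
 obtain h where h: "\<And>m. h m holomorphic_on {s. Re s > 1 - real m}"
  "\<And>m s. Re s > 1 ==> h m s = (s - 1) * (\<Sum>n. of_nat (n + 2) powr (- s))"
  using continuation_strip by metis
 have agree: "h m s = h m' s" if "m <= m'" "Re s > 1 - real m" for m m' s
 proof (rule analytic_continuation_open[of "{s. Re s > 1}" "{s. Re s > 1 - real m}" "h m" "h m'"])
  show "h m' holomorphic_on {s. Re s > 1 - real m}"
   using that by (intro holomorphic_on_subset[OF h(1)]) auto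
  have "2 \<in> {s::complex. Re s > 1}" by simp
  then show "{s::complex. Re s > 1} ~= {}" by blast
 qed (use that h in \<open>auto intro: open_halfspace_Re_gt convex_connected convex_halfspace_Re_gt\<close>)
 \<comment> \<open>Picks a strip containing s; by \<open>agree\<close> the choice does not
   matter.\<close>
 define H where "H s = h (nat \<lceil>1 - Re s\<rceil> + 1) s" for s
 have H: "H s = h m s" if "Re s > 1 - real m" for m s
 proof -
  have *: "Re s > 1 - real (nat \<lceil>1 - Re s\<rceil> + 1)" by linarith
  show ?thesis unfolding H_def
   using agree[OF _ *, of m] agree[OF _ that, of "nat \<lceil>1 - Re s\<rceil> + 1"] by (metis linorder_le_cases)
 qed
 have "H holomorphic_on (\<Union>m. {s. Re s > 1 - real m})"
 proof (rule holomorphic_on_UN_open)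
  show "H holomorphic_on {s. Re s > 1 - real m}" for m
   using h(1)[of m] H by (metis (no_types, lifting) holomorphic_transform mem_Collect_eq)
 qed (auto intro: open_halfspace_Re_gt)
 moreover have "s \<in> (\<Union>m. {s. Re s > 1 - real m})" for s
  using reals_Archimedean2[of "1 - Re s"] by (auto simp: algebra_simps)
 ultimately have Hh: "H holomorphic_on UNIV" by (metis UNIV_eq_I)
 \<comment> \<open>The summand 1 restores the term n = 1, which the series over N >= 2 leaves
   out.\<close>
 let ?f = "%s. 1 + H s / (s - 1)"
 have "?f holomorphic_on - {1}"
  by (intro holomorphic_intros holomorphic_on_subset[OF Hh]) auto
 moreover have "(%n. of_nat (Suc n) powr (- s)) sums ?f s" if s: "Re s > 1" for s
 proof -
  have "H s = (s - 1) * (\<Sum>n. of_nat (n + 2) powr (- s))"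
   using H[of 0 s] h(2)[of s 0] s by auto
  moreover have "s ~= 1" using s by auto
  ultimately have "H s / (s - 1) = (\<Sum>n. of_nat (n + 2) powr (- s))" by simp
  then have "(%n. of_nat (Suc (Suc n)) powr (- s)) sums (H s / (s - 1))"
   using summable_dirichlet(1)[OF s, of 1] by (simp add: numeral_2_eq_2 summable_sums)
  from sums_Suc[OF this] show ?thesis by (simp add: add.commute)
 qed
 ultimately show ?thesis by (intro exI[of _ ?f]) blast
qed

lemma zeta_holomorphic: "zeta holomorphic_on (- {1})"
 and zeta_sums: "Re s > 1 ==> (%n. of_nat (Suc n) powr (- s)) sums zeta s"
 using someI_ex[OF zeta_exists] unfolding zeta_def by blast+

subsection \<open>Approximation by Dirichlet polynomials\<close>

text \<open>The difference between n^(-s) and the integral of x^(-s) over [n, n+1], that is, the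
  local error of replacing the sum by an integral.\<close>

definition zeta_diff :: "nat => complex => complex" where
 "zeta_diff n s = of_nat n powr (-s) - (of_nat n powr (1 - s) - of_nat (Suc n) powr (1 - s)) / (s - 1)"

text \<open>The mean value inequality is used twice on the segment [n, n+1]: x^(-s) differs from
  n^(-s) by at most the stated bound, and \<open>?g\<close> has exactly this difference as its
  derivative.\<close>

lemma norm_zeta_diff_le:
 assumes "n >= 1" "Re s >= 0" "s ~= 1"
 shows "norm (zeta_diff n s) <= norm s * real n powr (-Re s - 1)"
proof -
 define S where "S = closed_segment (of_nat n :: complex) (of_nat (Suc n))"
 have S: "z \<in> \<real>" "Re z >= real n" "z \<notin> \<real>\<^sub>\<le>\<^sub>0" "norm (z - of_nat n) <= 1" if zS: "z \<in> S" for z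
 proof -
  obtain u where u: "0 <= u" "u <= 1" "z = (1 - u) *\<^sub>R of_nat n + u *\<^sub>R of_nat (Suc n)"
   using zS by (auto simp: S_def in_segment simp del: of_nat_Suc)
  then have z: "z = of_real (real n + u)"
   unfolding u(3) scaleR_conv_of_real of_nat_Suc of_real_add of_real_diff of_real_1 of_real_of_nat_eq
   by (simp only: ring_distribs mult_1_left mult_1_right) simp
  show "z \<in> \<real>" unfolding z by (rule Reals_of_real)
  show "Re z >= real n" unfolding z using u(1) by simp
  then show "z \<notin> \<real>\<^sub>\<le>\<^sub>0" using assms(1) by (auto simp: complex_nonpos_Reals_iff)
  have "z - of_nat n = of_real u" unfolding z by simp
  then show "norm (z - of_nat n) <= 1" using u(1,2) by simp
 qed
 have conv: "convex S" and mem: "of_nat n \<in> S" "of_nat (Suc n) \<in> S"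
  by (auto simp: S_def)
 define B where "B = norm s * real n powr (-Re s - 1)"
 have 1: "norm (z powr (-s) - of_nat n powr (-s)) <= B" if z: "z \<in> S" for z
 proof -
  have "norm (z powr (-s) - of_nat n powr (-s)) <= B * norm (z - of_nat n)"
  proof (rule field_differentiable_bound[OF conv, where f' = "%z. -s * z powr (-s - 1)"])
   fix x assume x: "x \<in> S"
   show "((%z. z powr - s) has_field_derivative - s * x powr (- s - 1)) (at x within S)"
    using S[OF x] by (auto intro!: derivative_eq_intros)
   have "norm (x powr (- s - 1)) = Re x powr (-Re s - 1)"
    using S[OF x] by (subst norm_powr_real_powr) auto
   also have "... <= real n powr (-Re s - 1)"
    using S[OF x] assms by (intro powr_mono2') auto
   finally show "norm (-s * x powr (- s - 1)) <= B"
    by (simp add: norm_mult B_def mult_left_mono)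
  qed (use z mem in auto)
  also have "... <= B * 1" using S[OF z] by (intro mult_left_mono) (auto simp: B_def)
  finally show ?thesis by simp
 qed
 let ?g = "%z. z powr (1 - s) / (1 - s) - z * of_nat n powr (-s)"
 have "norm (?g (of_nat (Suc n)) - ?g (of_nat n)) <= B * norm (of_nat (Suc n) - of_nat n :: complex)"
 proof (rule field_differentiable_bound[OF conv, where f' = "%z. z powr (-s) - of_nat n powr (-s)"])
  fix x assume x: "x \<in> S"
  show "(?g has_field_derivative x powr (-s) - of_nat n powr (-s)) (at x within S)"
   using S[OF x] assms by (auto intro!: derivative_eq_intros)
 qed (use 1 mem in auto)
 moreover have "B / (1 - s) - (1 + m) * c - (A / (1 - s) - m * c) = - (c - (A - B) / (s - 1))" for A B m c :: complex
 proof -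
  have "x / (1 - s) = - (x / (s - 1))" for x by (metis minus_diff_eq minus_divide_right)
  then show ?thesis by (simp add: algebra_simps diff_divide_distrib)
 qed
 then have "?g (of_nat (Suc n)) - ?g (of_nat n) = - zeta_diff n s"
  unfolding zeta_diff_def of_nat_Suc .
 ultimately show ?thesis by (simp add: B_def)
qed

text \<open>Each later term is below a difference of the telescoping sequence n^(-b) / b; the extra
  1 in 1 + 1/b pays for the initial term n = N.\<close>

lemma powr_tail_sum:
 fixes b :: real
 assumes "b > 0" "N >= 1"
 shows "summable (%k. real (k + N) powr (-b - 1))"
  and "(\<Sum>k. real (k + N) powr (-b - 1)) <= (1 + 1 / b) * real N powr (-b)"
proof -
 show s: "summable (%k. real (k + N) powr (-b - 1))"
  using summable_nat_powr[of "b + 1" N] assms by simp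
 have t: "(%k. (real (k + N) powr (-b) - real (Suc k + N) powr (-b)) / b) sums ((real (0 + N) powr (-b) - 0) / b)"
 proof (intro sums_divide telescope_sums')
  show "(%k. real (k + N) powr - b) \<longlonglongrightarrow> 0" using assms by real_asymp
 qed
 have le: "real (Suc k + N) powr (-b - 1) <= (real (k + N) powr (-b) - real (Suc k + N) powr (-b)) / b" for k
 proof -
  let ?x = "real (k + N)"
  have x: "?x > 0" using assms by simp
  have "\<exists>z>?x. z < ?x + 1 & (?x + 1) powr (-b) - ?x powr (-b) = (?x + 1 - ?x) * (-b * z powr (-b - 1))"
   by (rule MVT2) (use x in \<open>auto intro!: derivative_eq_intros\<close>)
  then obtain z where z: "z > ?x" "z < ?x + 1" "(?x + 1) powr (-b) - ?x powr (-b) = -b * z powr (-b - 1)"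
   by auto
  have "(?x + 1) powr (-b - 1) <= z powr (-b - 1)"
   using z x assms by (intro powr_mono2') auto
  moreover have "z powr (-b - 1) = (?x powr (-b) - (?x + 1) powr (-b)) / b"
   using z(3) assms by (simp add: field_simps)
  ultimately show ?thesis by (simp add: add_ac)
 qed
 have "(\<Sum>k. real (k + N) powr (-b - 1)) = real N powr (-b - 1) + (\<Sum>k. real (Suc k + N) powr (-b - 1))"
  using suminf_split_head[OF s] by simp
 also have "(\<Sum>k. real (Suc k + N) powr (-b - 1)) <= (real (0 + N) powr (-b) - 0) / b"
  using t by (subst sums_unique[OF t], intro suminf_le le summable_Suc_iff[THEN iffD2, OF s] sums_summable[OF t])
 also have "real N powr (-b - 1) <= real N powr (-b)"
  using assms by (intro powr_mono) auto
 finally show "(\<Sum>k. real (k + N) powr (-b - 1)) <= (1 + 1 / b) * real N powr (-b)"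
  by (simp add: algebra_simps)
qed

lemma zeta_diff_series:
 assumes "N >= 1" "Re s > 0" "s ~= 1"
 shows "summable (%k. zeta_diff (k + N) s)"
  and "norm (\<Sum>k. zeta_diff (k + N) s) <= norm s * (1 + 1 / Re s) * real N powr (-Re s)"
proof -
 have le: "norm (zeta_diff (k + N) s) <= norm s * real (k + N) powr (-Re s - 1)" for k
  using norm_zeta_diff_le[of "k + N" s] assms by auto
 note p = powr_tail_sum[OF assms(2,1)]
 show "summable (%k. zeta_diff (k + N) s)"
  by (rule summable_comparison_test'[OF summable_mult[OF p(1)] le])
 have "norm (\<Sum>k. zeta_diff (k + N) s) <= (\<Sum>k. norm s * real (k + N) powr (-Re s - 1))"
  by (rule norm_suminf_le[OF le summable_mult[OF p(1)]])
 also have "... = norm s * (\<Sum>k. real (k + N) powr (-Re s - 1))"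
  by (rule suminf_mult[OF p(1)])
 also have "... <= norm s * ((1 + 1 / Re s) * real N powr (-Re s))"
  by (intro mult_left_mono p(2)) auto
 finally show "norm (\<Sum>k. zeta_diff (k + N) s) <= norm s * (1 + 1 / Re s) * real N powr (-Re s)" by simp
qed

text \<open>On Re s > 1 the right side is the Dirichlet series rearranged by a telescoping sum. Both
  sides are holomorphic on the connected set Re s > 0 without 1, so the identity theorem
  applies.\<close>

lemma zeta_eq:
 assumes N: "N >= 1" and s: "Re s > 0" "s ~= 1"
 shows "zeta s = (\<Sum>n=1..<N. of_nat n powr (-s)) + of_nat N powr (1 - s) / (s - 1) + (\<Sum>k. zeta_diff (k + N) s)"
proof -
 let ?S = "{s. Re s > 0} - {1::complex}"
 let ?f = "%s. (\<Sum>n=1..<N. of_nat n powr (-s)) + of_nat N powr (1 - s) / (s - 1) + (\<Sum>k. zeta_diff (k + N) s)"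
 have opS: "open ?S" by (intro open_delete open_halfspace_Re_gt)
 have "(%s. \<Sum>k. zeta_diff (k + N) s) holomorphic_on ?S"
 proof (rule holomorphic_on_suminf[OF opS])
  show "zeta_diff (k + N) holomorphic_on ?S" for k
   unfolding zeta_diff_def by (intro holomorphic_intros) auto
  fix z :: complex assume z: "z \<in> ?S"
  define d where "d = Re z / 2"
  have d: "d > 0" using z by (simp add: d_def)
  have "norm (zeta_diff (k + N) y) <= (norm z + d) * real (k + N) powr (-d - 1)" if y: "y \<in> cball z d \<inter> ?S" for k y
  proof -
   have "Re z - Re y <= d" using y abs_Re_le_cmod[of "z - y"] by (auto simp: dist_norm)
   then have "Re y >= d" by (simp add: d_def)
   moreover have "norm y <= norm z + d"
    using y norm_triangle_ineq[of z "y - z"] by (auto simp: dist_norm norm_minus_commute)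
   moreover have "norm (zeta_diff (k + N) y) <= norm y * real (k + N) powr (-Re y - 1)"
    using norm_zeta_diff_le[of "k + N" y] N y by auto
   moreover have "norm y * real (k + N) powr (-Re y - 1) <= (norm z + d) * real (k + N) powr (-d - 1)"
    using calculation N d by (intro mult_mono powr_mono) auto
   ultimately show ?thesis by linarith
  qed
  then show "\<exists>d>0. \<exists>h. summable h & (\<forall>n. \<forall>y\<in>cball z d \<inter> ?S. norm (zeta_diff (n + N) y) <= h n)"
   using summable_mult[OF powr_tail_sum(1)[OF d N], of "norm z + d"] d
   by (intro exI[of _ d] conjI exI[of _ "%n. (norm z + d) * real (n + N) powr (-d - 1)"]) blast+
 qed
 then have hol: "?f holomorphic_on ?S"
  using N by (intro holomorphic_intros) auto
 show ?thesis
 proof (rule analytic_continuation_open[of "{s. Re s > 1}" ?S zeta ?f])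
  have "2 \<in> {s::complex. Re s > 1}" by simp
  then show "{s::complex. Re s > 1} ~= {}" by blast
  show "connected ?S"
   by (intro connected_open_delete open_halfspace_Re_gt convex_connected convex_halfspace_Re_gt) auto
  show "zeta holomorphic_on ?S" by (rule holomorphic_on_subset[OF zeta_holomorphic]) auto
  show "zeta z = ?f z" if "z \<in> {s. Re s > 1}" for z
  proof -
   have z: "Re z > 1" using that by simp
   then have z1: "z ~= 1" by auto
   have "(%k. of_nat (k + N) powr (-z)) sums (zeta z - (\<Sum>n=1..<N. of_nat n powr (-z)))"
   proof -
    from N have "(%k. of_nat (Suc (k + (N - 1))) powr (-z)) sums (zeta z - (\<Sum>n<N-1. of_nat (Suc n) powr (-z)))"
     using sums_split_initial_segment[OF zeta_sums[OF z], of "N - 1"] by simp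
    moreover have "(\<Sum>n<N-1. of_nat (Suc n) powr (-z)) = (\<Sum>n=1..<N. of_nat n powr (-z))"
     using N by (intro sum.reindex_bij_witness[of _ "%n. n - 1" Suc]) auto
    moreover have "Suc (k + (N - 1)) = k + N" for k using N by simp
    ultimately show ?thesis by (simp only:)
   qed
   moreover have "(%k. (of_nat (k + N) powr (1 - z) - of_nat (Suc k + N) powr (1 - z)) / (z - 1)) sums
     ((of_nat (0 + N) powr (1 - z) - 0) / (z - 1))"
   proof (intro sums_divide telescope_sums')
    have "(%k. real (k + N) powr (1 - Re z)) \<longlonglongrightarrow> 0" using z by real_asymp
    then have "(%k. norm (of_nat (k + N) powr (1 - z))) \<longlonglongrightarrow> 0"
     using N by (subst norm_nat_powr) auto
    then show "(%k. of_nat (k + N) powr (1 - z)) \<longlonglongrightarrow> 0"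
     by (rule tendsto_norm_zero_cancel)
   qed
   ultimately have "(%k. of_nat (k + N) powr (-z) - (of_nat (k + N) powr (1 - z) - of_nat (Suc k + N) powr (1 - z)) / (z - 1))
     sums (zeta z - (\<Sum>n=1..<N. of_nat n powr (-z)) - (of_nat (0 + N) powr (1 - z) - 0) / (z - 1))"
    by (rule sums_diff)
   then have "(%k. zeta_diff (k + N) z) sums (zeta z - (\<Sum>n=1..<N. of_nat n powr (-z)) - of_nat N powr (1 - z) / (z - 1))"
    by (simp add: zeta_diff_def)
   then show ?thesis by (simp add: sums_iff)
  qed
 qed (use hol opS s in \<open>auto intro: open_halfspace_Re_gt\<close>)
qed

lemma zeta_approx:
 assumes "N >= 1" "Re s > 0" "s ~= 1"
 shows "norm (zeta s - (\<Sum>n=1..<N. of_nat n powr (-s)) - of_nat N powr (1 - s) / (s - 1))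
   <= norm s * (1 + 1 / Re s) * real N powr (-Re s)"
 using zeta_diff_series(2)[OF assms] zeta_eq[OF assms] by simp

subsection \<open>Euler product\<close>

definition primes_le :: "nat => nat set" where
 "primes_le N = {p. prime p & p <= N}"

lemma finite_primes_le [simp]: "finite (primes_le N)"
 by (rule finite_subset[of _ "{..N}"]) (auto simp: primes_le_def)

text \<open>One sieving step: among the integers not divisible by any prime of P, the multiples of p
  carry p^(-s) times the whole sum, so removing them multiplies the sum by 1 - p^(-s).\<close>

lemma euler_product_has_sum:
 assumes s: "Re s > 1" and P: "finite P" "\<And>p. p \<in> P ==> prime p"
 shows "((%n. of_nat n powr (-s)) has_sum (zeta s * (\<Prod>p\<in>P. 1 - of_nat p powr (-s))))
   {n::nat. n > 0 & (\<forall>p\<in>P. \<not> p dvd n)}"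
 using P
proof (induction P rule: finite_induct)
 case empty
 have "((%n. of_nat (Suc n) powr (-s)) has_sum zeta s) UNIV"
  using summable_dirichlet(2)[OF s, of 0] zeta_sums[OF s] by (intro norm_summable_imp_has_sum) auto
 then have "((%n. of_nat n powr (-s)) has_sum zeta s) (Suc ` UNIV)"
  by (subst has_sum_reindex) (auto simp: o_def)
 also have "Suc ` UNIV = {n. n > 0}" by (auto simp: image_iff gr0_conv_Suc)
 finally show ?case by simp
next
 case (insert p P)
 let ?R = "{n::nat. n > 0 & (\<forall>p\<in>P. \<not> p dvd n)}"
 define c where "c = zeta s * (\<Prod>p\<in>P. 1 - of_nat p powr (-s))"
 have p: "prime p" "p > 0" using insert.prems by (auto simp: prime_gt_0_nat)
 have 1: "((%n. of_nat n powr (-s)) has_sum c) ?R" using insert by (simp add: c_def)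
 have "((%n. of_nat p powr (-s) * of_nat n powr (-s)) has_sum (of_nat p powr (-s) * c)) ?R"
  by (rule has_sum_cmult_right[OF 1])
 also have "(%n. of_nat p powr (-s) * of_nat n powr (-s)) = (%n. of_nat n powr (-s)) \<circ> (%n. p * n)"
  by (auto simp: fun_eq_iff powr_times_real)
 finally have 2: "((%n. of_nat n powr (-s)) has_sum (of_nat p powr (-s) * c)) ((%n. p * n) ` ?R)"
  using p by (subst has_sum_reindex) (auto simp: inj_on_def o_def)
 have sub: "(%n. p * n) ` ?R \<subseteq> ?R"
 proof safe
  fix n q assume n: "n > 0" "\<forall>p\<in>P. \<not> p dvd n" "q \<in> P" "q dvd p * n"
  then have "prime q" "q ~= p" using insert by auto
  then show False using n p by (metis prime_dvd_multD primes_dvd_imp_eq)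
 qed (use p in auto)
 have "?R - (%n. p * n) ` ?R = {n. n > 0 & (\<forall>q\<in>insert p P. \<not> q dvd n)}"
 proof (intro equalityI subsetI)
  fix n assume n: "n \<in> ?R - (%n. p * n) ` ?R"
  have "\<not> p dvd n"
  proof
   assume "p dvd n"
   then obtain k where k: "n = p * k" by (elim dvdE)
   then have "k \<in> ?R" using n by auto
   then show False using n k by auto
  qed
  then show "n \<in> {n. n > 0 & (\<forall>q\<in>insert p P. \<not> q dvd n)}" using n by auto
 qed auto
 moreover have "c - of_nat p powr (-s) * c = zeta s * (\<Prod>p\<in>insert p P. 1 - of_nat p powr (-s))"
  using insert by (simp add: c_def algebra_simps)
 ultimately show ?case
  using has_sum_Diff[OF 1 2 sub] by simp
qed

text \<open>After sieving by all primes up to N the survivors other than 1 have a prime factor above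
  N. The bound depends on Re s alone and is therefore uniform in Im s.\<close>

lemma euler_product_approx:
 assumes s: "Re s > 1" and N: "N >= 1"
 shows "norm (zeta s * (\<Prod>p\<in>primes_le N. 1 - of_nat p powr (-s)) - 1)
   <= (1 + 1 / (Re s - 1)) * real N powr (1 - Re s)"
proof -
 let ?R = "{n::nat. n > 0 & (\<forall>p\<in>primes_le N. \<not> p dvd n)}"
 let ?c = "zeta s * (\<Prod>p\<in>primes_le N. 1 - of_nat p powr (-s))"
 have 1: "((%n. of_nat n powr (-s)) has_sum ?c) ?R"
  by (rule euler_product_has_sum[OF s]) (auto simp: primes_le_def)
 have "1 \<in> ?R" by (auto simp: primes_le_def)
 moreover have "((%n. of_nat n powr (-s)) has_sum 1) {1}"
  using has_sum_finite[of "{1::nat}" "%n. of_nat n powr (-s)"] by simp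
 ultimately have 2: "((%n. of_nat n powr (-s)) has_sum (?c - 1)) (?R - {1})"
  by (intro has_sum_Diff[OF 1]) auto
 have sub: "?R - {1} \<subseteq> range (%k. k + N)"
 proof
  fix n assume n: "n \<in> ?R - {1}"
  then obtain p where p: "prime p" "p dvd n" using prime_factor_nat[of n] by auto
  with n have "p <= n" "\<not> p <= N" by (auto simp: primes_le_def dvd_imp_le)
  then show "n \<in> range (%k. k + N)" by (intro image_eqI[of _ _ "n - N"]) auto
 qed
 note t = powr_tail_sum[OF _ N, of "Re s - 1"]
 have "((%k. real (k + N) powr (- Re s)) has_sum (\<Sum>k. real (k + N) powr (-Re s))) UNIV"
  using t s by (intro norm_summable_imp_has_sum summable_sums) auto
 then have "((%n. real n powr (- Re s)) has_sum (\<Sum>k. real (k + N) powr (-Re s))) (range (%k. k + N))"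
  by (subst has_sum_reindex) (auto simp: o_def)
 moreover have "norm (of_nat n powr (-s)) = real n powr (-Re s)" for n
  by (cases "n = 0") (auto simp: norm_nat_powr)
 ultimately have 3: "((%n. norm (of_nat n powr (-s))) has_sum (\<Sum>k. real (k + N) powr (-Re s))) (range (%k. k + N))"
  by simp
 have 4: "(%n. norm (of_nat n powr (-s))) summable_on (?R - {1})"
  using summable_on_subset_banach[OF has_sum_imp_summable[OF 3] sub] .
 have "norm (?c - 1) <= infsum (%n. norm (of_nat n powr (-s))) (?R - {1})"
  by (rule norm_has_sum_bound[OF has_sum_infsum[OF 4] 2])
 also have "... <= (\<Sum>k. real (k + N) powr (-Re s))"
  by (rule has_sum_mono2[OF has_sum_infsum[OF 4] 3 sub]) auto
 also have "... <= (1 + 1 / (Re s - 1)) * real N powr (1 - Re s)"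
  using t(2) s by simp
 finally show ?thesis .
qed

lemma euler_product_tendsto:
 assumes "Re s > 1"
 shows "(%N. zeta s * (\<Prod>p\<in>primes_le N. 1 - of_nat p powr (-s))) \<longlonglongrightarrow> 1"
proof (rule LIM_zero_cancel, rule Lim_null_comparison)
 show "\<forall>\<^sub>F N in sequentially. norm (zeta s * (\<Prod>p\<in>primes_le N. 1 - of_nat p powr (-s)) - 1)
   <= (1 + 1 / (Re s - 1)) * real N powr (1 - Re s)"
  using eventually_ge_at_top[of 1] by eventually_elim (rule euler_product_approx[OF assms])
 show "(%N. (1 + 1 / (Re s - 1)) * real N powr (1 - Re s)) \<longlonglongrightarrow> 0"
  using assms by real_asymp
qed

section \<open>Non-vanishing and the 3-4-1 inequality\<close>

lemma zeta_nonzero_right: "Re s > 1 ==> zeta s ~= 0"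
proof
 assume s: "Re s > 1" "zeta s = 0"
 then have "(%N::nat. 0::complex) \<longlonglongrightarrow> 1" using euler_product_tendsto[OF s(1)] by simp
 then show False by (simp add: tendsto_const_iff)
qed

text \<open>With \<open>z = r e\<^sup>i\<^sup>x\<close>, the logarithm of the left side is \<open>-\<Sum>k\<ge>1. r\<^sup>k / k * (3 + 4 cos kx + cos 2kx)\<close>.\<close>
lemma mertens_341_factor:
 fixes z :: complex
 assumes z: "norm z < 1" "norm z = r"
 shows "(1 - r) ^ 3 * norm (1 - z) ^ 4 * norm (1 - z ^ 2 / of_real r) <= 1"
proof (cases "r = 0")
 case False
 then have r: "0 < r" "r < 1" using z by auto
 define w where "w = z ^ 2 / of_real r"
 have w: "norm w < 1" using r z by (simp add: w_def norm_divide norm_mult power2_eq_square)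
 have Ln: "(%n. - Re (u ^ n / of_nat n)) sums ln (norm (1 - u))" if "norm u < 1" for u :: complex
 proof -
  have "(%n. (-1) ^ Suc n / of_nat n * (-u) ^ n) sums Ln (1 + (-u))"
   by (rule Ln_series) (use that in auto)
  also have "(%n. (-1) ^ Suc n / of_nat n * (-u) ^ n) = (%n. - (u ^ n / of_nat n))"
   by (auto simp: fun_eq_iff power_minus' minus_one_power_iff)
  finally have "(%n. Re (- (u ^ n / of_nat n))) sums Re (Ln (1 - u))" by (intro sums_Re) simp
  moreover have "1 - u ~= 0" using that by auto
  ultimately show ?thesis by (simp add: Re_Ln)
 qed
 have s1: "(%n. 3 * (- Re (of_real r ^ n / of_nat n)) + 4 * (- Re (z ^ n / of_nat n)) + (- Re (w ^ n / of_nat n)))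
   sums (3 * ln (norm (1 - of_real r :: complex)) + 4 * ln (norm (1 - z)) + ln (norm (1 - w)))"
  by (intro sums_add sums_mult Ln w z(1)) (use r in auto)
 have s2: "3 * (- Re (of_real r ^ n / of_nat n)) + 4 * (- Re (z ^ n / of_nat n)) + (- Re (w ^ n / of_nat n)) <= 0" for n
 proof -
  define t where "t = Arg z"
  have ze: "z = of_real r * cis t" using z by (metis rcis_cmod_Arg rcis_def t_def)
  have "z ^ n = of_real (r ^ n) * cis (n * t)"
   unfolding ze power_mult_distrib Complex.DeMoivre by simp
  moreover have "w = of_real r * cis (2 * t)"
   using r by (simp add: w_def ze power2_eq_square cis_mult)
  then have "w ^ n = of_real (r ^ n) * cis (2 * (n * t))"
   by (simp only: power_mult_distrib Complex.DeMoivre of_real_power mult.left_commute)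
  ultimately have "3 * (- Re (of_real r ^ n / of_nat n)) + 4 * (- Re (z ^ n / of_nat n)) + (- Re (w ^ n / of_nat n))
    = - (r ^ n / n * (3 + 4 * cos (n * t) + cos (2 * (n * t))))"
   by (simp add: Re_divide_of_nat algebra_simps add_divide_distrib flip: of_real_power)
  moreover have "3 + 4 * cos x + cos (2 * x) = 2 * (1 + cos x)\<^sup>2" for x :: real
   unfolding cos_double_cos by (simp add: power2_eq_square algebra_simps)
  ultimately show ?thesis using r by simp
 qed
 have "3 * ln (norm (1 - of_real r :: complex)) + 4 * ln (norm (1 - z)) + ln (norm (1 - w)) <= 0"
  by (rule sums_le[OF s2 s1 sums_zero])
 moreover have "norm (1 - of_real r :: complex) = 1 - r"
  using r by (metis abs_of_nonneg diff_ge_0_iff_ge less_imp_le norm_of_real of_real_1 of_real_diff)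
 moreover have "norm (1 - z) > 0" "norm (1 - w) > 0" using z w by auto
 ultimately have "ln ((1 - r) ^ 3 * norm (1 - z) ^ 4 * norm (1 - w)) <= 0"
  using r by (simp add: ln_mult ln_realpow)
 then show ?thesis
  using r \<open>norm (1 - z) > 0\<close> \<open>norm (1 - w) > 0\<close> by (simp add: w_def ln_le_zero_iff)
qed (use z in auto)

text \<open>The inequality of \<open>mertens_341_factor\<close> is multiplied over p <= N with z =
  p^(-\<sigma>-it) and r = p^(-\<sigma>), so that z^2 / r is the term at height 2t. The Euler
  factors are inverse to zeta, so the limit in N reverses the inequality.\<close>

lemma mertens_341:
 assumes "\<sigma> > 1"
 shows "norm (zeta (of_real \<sigma>)) ^ 3 * norm (zeta (Complex \<sigma> t)) ^ 4 * norm (zeta (Complex \<sigma> (2 * t))) >= 1"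
proof -
 define Q where "Q N s = (\<Prod>p\<in>primes_le N. 1 - of_nat p powr (-s) :: complex)" for N s
 have Qle: "norm (Q N (of_real \<sigma>)) ^ 3 * norm (Q N (Complex \<sigma> t)) ^ 4 * norm (Q N (Complex \<sigma> (2 * t))) <= 1" for N
 proof -
  have "norm (Q N (of_real \<sigma>)) ^ 3 * norm (Q N (Complex \<sigma> t)) ^ 4 * norm (Q N (Complex \<sigma> (2 * t))) =
   (\<Prod>p\<in>primes_le N. norm (1 - of_nat p powr (- of_real \<sigma>) :: complex) ^ 3 * norm (1 - of_nat p powr (- Complex \<sigma> t)) ^ 4
     * norm (1 - of_nat p powr (- Complex \<sigma> (2 * t))))"
   by (simp only: Q_def prod_norm[symmetric] prod.distrib prod_power_distrib)
  also have "... <= 1"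
  proof (intro prod_le_1 conjI)
   fix p assume "p \<in> primes_le N"
   then have p: "p >= 2" by (auto simp: primes_le_def prime_ge_2_nat)
   define z where "z = of_nat p powr (- Complex \<sigma> t)"
   define r where "r = real p powr (- \<sigma>)"
   have z: "norm z = r" using p by (simp add: z_def norm_nat_powr r_def)
   have r: "r < 1" "r > 0" using p assms by (auto simp: r_def powr_less_one)
   have "of_nat p powr (- of_real \<sigma>) = complex_of_real r"
    using powr_of_real[of "real p" "-\<sigma>"] by (simp add: r_def)
   moreover have "of_nat p powr (- Complex \<sigma> (2 * t)) = z ^ 2 / of_real r"
   proof -
    have "of_nat p powr (- Complex \<sigma> (2 * t)) * of_nat p powr (- of_real \<sigma>) = z ^ 2"
     unfolding z_def power2_eq_square powr_add[symmetric]
     by (rule arg_cong[of _ _ "(powr) _"]) (simp add: complex_eq_iff)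
    with calculation r show ?thesis by (simp add: field_simps)
   qed
   moreover have "norm (1 - complex_of_real r) = 1 - r"
    using r by (metis abs_of_nonneg diff_ge_0_iff_ge less_imp_le norm_of_real of_real_1 of_real_diff)
   ultimately show "norm (1 - of_nat p powr (- of_real \<sigma>) :: complex) ^ 3 * norm (1 - of_nat p powr (- Complex \<sigma> t)) ^ 4
     * norm (1 - of_nat p powr (- Complex \<sigma> (2 * t))) <= 1"
    using mertens_341_factor[of z r] z r by (simp add: z_def)
  qed auto
  finally show ?thesis .
 qed
 have "(%N. norm (zeta s * Q N s)) \<longlonglongrightarrow> 1" if "Re s > 1" for s
  using tendsto_norm[OF euler_product_tendsto[OF that]] by (simp add: Q_def)
 then have lim: "(%N. norm (zeta (of_real \<sigma>) * Q N (of_real \<sigma>)) ^ 3 * norm (zeta (Complex \<sigma> t) * Q N (Complex \<sigma> t)) ^ 4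
   * norm (zeta (Complex \<sigma> (2 * t)) * Q N (Complex \<sigma> (2 * t)))) \<longlonglongrightarrow> 1 ^ 3 * 1 ^ 4 * 1"
  by (intro tendsto_intros) (use assms in auto)
 define Z where "Z = norm (zeta (of_real \<sigma>)) ^ 3 * norm (zeta (Complex \<sigma> t)) ^ 4 * norm (zeta (Complex \<sigma> (2 * t)))"
 have "1 ^ 3 * 1 ^ 4 * 1 <= Z"
 proof (rule LIMSEQ_le_const2[OF lim], intro exI allI impI)
  fix N
  have "norm (zeta (of_real \<sigma>) * Q N (of_real \<sigma>)) ^ 3 * norm (zeta (Complex \<sigma> t) * Q N (Complex \<sigma> t)) ^ 4
   * norm (zeta (Complex \<sigma> (2 * t)) * Q N (Complex \<sigma> (2 * t))) = Z *
    (norm (Q N (of_real \<sigma>)) ^ 3 * norm (Q N (Complex \<sigma> t)) ^ 4 * norm (Q N (Complex \<sigma> (2 * t))))"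
   by (simp add: Z_def norm_mult power_mult_distrib)
  also have "... <= Z * 1" using Qle by (intro mult_left_mono) (auto simp: Z_def)
  finally show "norm (zeta (of_real \<sigma>) * Q N (of_real \<sigma>)) ^ 3 * norm (zeta (Complex \<sigma> t) * Q N (Complex \<sigma> t)) ^ 4
   * norm (zeta (Complex \<sigma> (2 * t)) * Q N (Complex \<sigma> (2 * t))) <= Z" by simp
 qed
 then show ?thesis by (simp add: Z_def)
qed

subsection \<open>Bounds near the line \<open>Re s = 1\<close>\<close>

lemma sum_powr_le:
 assumes "0 < b" "b <= 1" "N >= 1"
 shows "(\<Sum>n=1..N. real n powr (b - 1)) <= real N powr b / b"
 using assms(3)
proof (induction N rule: dec_induct)
 case base
 then show ?case using assms by simp
next
 case (step N)
 let ?x = "real N"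
 have x: "?x > 0" using step by simp
 have "\<exists>z>?x. z < ?x + 1 & (?x + 1) powr b - ?x powr b = (?x + 1 - ?x) * (b * z powr (b - 1))"
  by (rule MVT2) (use x in \<open>auto intro!: derivative_eq_intros\<close>)
 then obtain z where z: "z > ?x" "z < ?x + 1" "(?x + 1) powr b - ?x powr b = b * z powr (b - 1)"
  by auto
 have "(?x + 1) powr (b - 1) <= z powr (b - 1)"
  using z x assms by (intro powr_mono2') auto
 moreover have "z powr (b - 1) = ((?x + 1) powr b - ?x powr b) / b"
  using z(3) assms by (simp add: field_simps)
 ultimately show ?case using step.IH by (simp add: add_ac diff_divide_distrib)
qed

lemma norm_sum_dirichlet_le:
 assumes "Re s >= 1 - b" "0 < b" "b <= 1" "N >= 1"
 shows "norm (\<Sum>n=1..<N. of_nat n powr (-s)) <= real N powr b / b"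
proof -
 have "norm (\<Sum>n=1..<N. of_nat n powr (-s)) <= (\<Sum>n=1..<N. real n powr (b - 1))"
 proof (rule sum_norm_le)
  fix n assume n: "n \<in> {1..<N}"
  then have "norm (of_nat n powr (-s)) = real n powr (- Re s)" by (simp add: norm_nat_powr)
  also have "... <= real n powr (b - 1)" using n assms by (intro powr_mono) auto
  finally show "norm (of_nat n powr (-s)) <= real n powr (b - 1)" .
 qed
 also have "... <= (\<Sum>n=1..N. real n powr (b - 1))" by (intro sum_mono2) auto
 also have "... <= real N powr b / b" by (rule sum_powr_le) (use assms in auto)
 finally show ?thesis .
qed

text \<open>Truncation at N of size |Im s| balances the pieces: the partial sum, the integral term
  and the remainder are all O(N^(1/100)), the exponent being the allowed distance 1 - 99/100 to the
  left of the line.\<close>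

lemma zeta_upper:
 assumes s: "99/100 <= Re s" "Re s <= 3" "\<bar>Im s\<bar> >= 1/8"
 shows "norm (zeta s) <= 2000 * \<bar>Im s\<bar> powr (1/100)"
proof -
 define t where "t = \<bar>Im s\<bar>"
 define N where "N = nat \<lceil>t\<rceil>"
 have t: "t >= 1/8" using s by (simp add: t_def)
 have N: "N >= 1" "t <= real N" "real N <= 9 * t" using t unfolding N_def by linarith+
 have s1: "s ~= 1" "Re s > 0" using s by (auto simp: complex_eq_iff)
 define B where "B = real N powr (1/100)"
 have 1: "norm (\<Sum>n=1..<N. of_nat n powr (-s)) <= 100 * B"
  using norm_sum_dirichlet_le[of "1/100" s N] s N by (simp add: B_def)
 have "norm (of_nat N powr (1 - s) / (s - 1)) = real N powr (1 - Re s) / norm (s - 1)"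
  using N by (simp add: norm_divide norm_nat_powr)
 also have "... <= B / (1/8)"
 proof (rule frac_le)
  show "real N powr (1 - Re s) <= B" unfolding B_def using s N by (intro powr_mono) auto
  show "1/8 <= norm (s - 1)" using abs_Im_le_cmod[of "s - 1"] t by (simp add: t_def)
 qed (auto simp: B_def)
 finally have 2: "norm (of_nat N powr (1 - s) / (s - 1)) <= 8 * B" by simp
 have ns: "norm s <= 25 * real N"
  using cmod_le[of s] s N t by (auto simp: t_def)
 have "norm s * (1 + 1 / Re s) * real N powr (-Re s) <= (25 * real N) * 3 * real N powr (1/100 - 1)"
 proof -
  have "1 + 1 / Re s <= 3" "0 <= 1 + 1 / Re s" using s by (auto simp: field_simps)
  then show ?thesis using s N by (intro mult_mono ns powr_mono) auto
 qed
 also have "... = 75 * B"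
  using N powr_mult_base[of "real N" "1/100 - 1"] by (simp add: B_def)
 finally have 3: "norm (zeta s - (\<Sum>n=1..<N. of_nat n powr (-s)) - of_nat N powr (1 - s) / (s - 1)) <= 75 * B"
  using zeta_approx[OF N(1) s1(2,1)] by simp
 have "norm (zeta s) <= 183 * B"
  using 1 2 3 norm_triangle_sub[of "zeta s" "\<Sum>n=1..<N. of_nat n powr (-s)"]
   norm_triangle_sub[of "zeta s - (\<Sum>n=1..<N. of_nat n powr (-s))" "of_nat N powr (1 - s) / (s - 1)"]
  by linarith
 also have "B <= (9 * t) powr (1/100)" unfolding B_def using N by (intro powr_mono2) auto
 also have "... = 9 powr (1/100) * t powr (1/100)" using t by (simp add: powr_mult)
 also have "... <= 9 * t powr (1/100)" using powr_mono[of "1/100" 1 "9::real"] by (intro mult_right_mono) auto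
 finally have "norm (zeta s) <= 183 * (9 * t powr (1/100))" by linarith
 moreover have "t powr (1/100) >= 0" by simp
 ultimately show ?thesis unfolding t_def by linarith
qed

text \<open>Cauchy's estimate with radius 1/200, the gap between the abscissas 199/200 and 99/100;
  on the circle |Im| at most doubles.\<close>

lemma zeta_deriv_upper:
 assumes s: "199/200 <= Re s" "Re s <= 2" "\<bar>Im s\<bar> >= 1/4"
 shows "norm (deriv zeta s) <= 800000 * \<bar>Im s\<bar> powr (1/100)"
proof -
 define B where "B = 2000 * (2 * \<bar>Im s\<bar>) powr (1/100)"
 have main: "norm ((deriv ^^ 1) zeta s) <= fact 1 * B / (1/200) ^ 1"
 proof (rule Cauchy_inequality)
  have 1: "cball s (1/200) \<subseteq> - {1}"
  proof safe
   assume "1 \<in> cball s (1/200)"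
   then show False using abs_Im_le_cmod[of "s - 1"] s by (simp add: dist_norm)
  qed
  show "zeta holomorphic_on ball s (1/200)"
   by (rule holomorphic_on_subset[OF zeta_holomorphic]) (use 1 ball_subset_cball in blast)
  show "continuous_on (cball s (1/200)) zeta"
   by (intro holomorphic_on_imp_continuous_on holomorphic_on_subset[OF zeta_holomorphic 1])
  fix x assume x: "norm (s - x) = 1/200"
  have "\<bar>Re s - Re x\<bar> <= 1/200" "\<bar>Im s - Im x\<bar> <= 1/200"
   using abs_Im_le_cmod[of "s - x"] abs_Re_le_cmod[of "s - x"] x by auto
  then have y: "99/100 <= Re x" "Re x <= 3" "\<bar>Im x\<bar> >= 1/8" "\<bar>Im x\<bar> <= 2 * \<bar>Im s\<bar>" using s by linarith+
  show "norm (zeta x) <= B"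
   using zeta_upper[OF y(1-3)] powr_mono2[OF _ _ y(4), of "1/100"] by (simp add: B_def)
 qed auto
 have "(2 * \<bar>Im s\<bar>) powr (1/100) = 2 powr (1/100) * \<bar>Im s\<bar> powr (1/100)" by (simp add: powr_mult)
 moreover have "2 powr (1/100) * \<bar>Im s\<bar> powr (1/100) <= 2 * \<bar>Im s\<bar> powr (1/100)"
  using powr_mono[of "1/100" 1 "2::real"] by (intro mult_right_mono) auto
 ultimately have "B <= 2000 * (2 * \<bar>Im s\<bar> powr (1/100))" by (simp add: B_def mult.commute)
 then show ?thesis using main by simp
qed

lemma zeta_horizontal:
 assumes "199/200 <= x" "x <= y" "y <= 2" "\<bar>t\<bar> >= 1/4"
 shows "norm (zeta (Complex y t) - zeta (Complex x t)) <= 800000 * \<bar>t\<bar> powr (1/100) * (y - x)"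
proof -
 let ?S = "closed_segment (Complex x t) (Complex y t)"
 have S: "Im z = t & x <= Re z & Re z <= y" if "z \<in> ?S" for z
  using that assms by (auto simp: closed_segment_same_Im closed_segment_eq_real_ivl)
 have "norm (zeta (Complex y t) - zeta (Complex x t)) <= 800000 * \<bar>t\<bar> powr (1/100) * norm (Complex y t - Complex x t)"
 proof (rule field_differentiable_bound[where S = ?S and f' = "deriv zeta"])
  fix z assume z: "z \<in> ?S"
  have "z ~= 1" using S[OF z] assms by auto
  then have "zeta field_differentiable at z"
   using zeta_holomorphic by (simp add: holomorphic_on_open open_delete field_differentiable_def Compl_eq_Diff_UNIV)
  then show "(zeta has_field_derivative deriv zeta z) (at z within ?S)"
   using field_differentiable_derivI has_field_derivative_at_within by blast
  show "norm (deriv zeta z) <= 800000 * \<bar>t\<bar> powr (1/100)"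
   using zeta_deriv_upper[of z] S[OF z] assms by auto
 qed auto
 also have "norm (Complex y t - Complex x t) = y - x"
  using assms by (simp add: complex_diff cmod_eq_Re)
 finally show ?thesis .
qed

text \<open>The 3-4-1 inequality, fed with |zeta(\<sigma>)| <= 4 / \<eta> and with the growth bound
  at height 2t, bounds the fourth power of |zeta| from below.\<close>

lemma zeta_lower_right:
 assumes \<eta>: "0 < \<eta>" "\<eta> <= \<sigma> - 1" "\<sigma> <= 2" and t: "\<bar>t\<bar> >= 1/4"
 shows "norm (zeta (Complex \<sigma> t)) ^ 4 >= \<eta> ^ 3 / (500000 * \<bar>t\<bar> powr (1/100))"
proof -
 have "of_real \<sigma> ~= (1::complex)" using \<eta> by (metis less_add_same_cancel1 of_real_eq_1_iff add_0 diff_add_cancel diff_gt_0_iff_gt less_le_trans order_less_irrefl)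
 then have "norm (zeta (of_real \<sigma>) - 1 / (of_real \<sigma> - 1)) <= \<sigma> * (1 + 1 / \<sigma>)"
  using zeta_approx[of 1 "of_real \<sigma>"] \<eta> by simp
 moreover have "norm (1 / (of_real \<sigma> - 1 :: complex)) = 1 / (\<sigma> - 1)"
  using \<eta> by (metis norm_divide norm_of_real norm_one of_real_1 of_real_diff abs_of_nonneg less_imp_le order_trans)
 moreover have "\<sigma> * (1 + 1 / \<sigma>) <= 3" using \<eta> by (simp add: algebra_simps)
 ultimately have "norm (zeta (of_real \<sigma>)) <= 1 / (\<sigma> - 1) + 3"
  using norm_triangle_sub[of "zeta (of_real \<sigma>)" "1 / (of_real \<sigma> - 1)"] by linarith
 also have "... <= 1 / \<eta> + 3 / \<eta>" using \<eta> by (intro add_mono frac_le) (auto simp: field_simps)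
 finally have z1: "norm (zeta (of_real \<sigma>)) <= 4 / \<eta>" using \<eta> by (simp add: field_simps)
 have z2: "norm (zeta (Complex \<sigma> (2 * t))) <= 4000 * \<bar>t\<bar> powr (1/100)"
 proof -
  have "norm (zeta (Complex \<sigma> (2 * t))) <= 2000 * \<bar>2 * t\<bar> powr (1/100)"
   using zeta_upper[of "Complex \<sigma> (2 * t)"] \<eta> t by simp
  also have "\<bar>2 * t\<bar> powr (1/100) = 2 powr (1/100) * \<bar>t\<bar> powr (1/100)" by (simp add: abs_mult powr_mult)
  also have "... <= 2 * \<bar>t\<bar> powr (1/100)" using powr_mono[of "1/100" 1 "2::real"] by (intro mult_right_mono) auto
  finally show ?thesis by simp
 qed
 have "1 <= norm (zeta (of_real \<sigma>)) ^ 3 * norm (zeta (Complex \<sigma> t)) ^ 4 * norm (zeta (Complex \<sigma> (2 * t)))"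
  by (rule mertens_341) (use \<eta> in auto)
 also have "... <= (4 / \<eta>) ^ 3 * norm (zeta (Complex \<sigma> t)) ^ 4 * (4000 * \<bar>t\<bar> powr (1/100))"
  by (intro mult_mono power_mono z1 z2) (use \<eta> in auto)
 also have "... = 256000 * norm (zeta (Complex \<sigma> t)) ^ 4 * \<bar>t\<bar> powr (1/100) / \<eta> ^ 3"
  by (simp add: power_divide)
 finally have "\<eta> ^ 3 <= 256000 * norm (zeta (Complex \<sigma> t)) ^ 4 * \<bar>t\<bar> powr (1/100)"
  using \<eta> by (simp add: field_simps)
 also have "... <= norm (zeta (Complex \<sigma> t)) ^ 4 * (500000 * \<bar>t\<bar> powr (1/100))"
  by (simp add: mult_right_mono mult_ac)
 finally show ?thesis using t by (simp add: divide_le_eq)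
qed

text \<open>At distance \<eta> to the right of the line |zeta|^4 is at least of order \<eta>^3 / u,
  where u = |t|^(1/100); moving left by at most (3/2) \<eta> changes zeta by at most (3/2) D u
  \<eta>. The lower bound wins for \<eta> of order u^(-5), whence the exponent 1/20 for the region
  and, as \<eta> u is of order u^(-4), the exponent 1/25 for |zeta|.\<close>

lemma zeta_lower:
 "\<exists>c>0. \<forall>\<sigma> t. \<bar>t\<bar> >= 1/4 --> 1 - c * \<bar>t\<bar> powr (-1/20) <= \<sigma> --> \<sigma> <= 2 -->
   199/200 <= \<sigma> & norm (zeta (Complex \<sigma> t)) >= c * \<bar>t\<bar> powr (-1/25)"
proof -
 define D :: real where "D = 800000"
 \<comment> \<open>Chosen so that \<eta> = a / u^5 solves \<eta>^3 / (500000 u) = (2 D \<eta> u)^4.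
   The guaranteed size 2 D \<eta> u then exceeds the loss (3/2) D \<eta> u.\<close>
 define a :: real where "a = 1 / (16 * D ^ 4 * 500000)"
 have a: "a > 0" "a <= 1/1000" by (auto simp: a_def D_def)
 define c where "c = a / 2"
 have c: "c > 0" using a by (simp add: c_def)
 have "199/200 <= \<sigma> & norm (zeta (Complex \<sigma> t)) >= c * \<bar>t\<bar> powr (-1/25)"
  if t: "\<bar>t\<bar> >= 1/4" and s: "1 - c * \<bar>t\<bar> powr (-1/20) <= \<sigma>" "\<sigma> <= 2" for \<sigma> t
 proof -
  define u where "u = \<bar>t\<bar> powr (1/100)"
  have u: "u > 0" using t by (auto simp: u_def)
  have up: "\<bar>t\<bar> powr (-(real n / 100)) = 1 / u ^ n" for n
   using t u unfolding u_def by (subst powr_power) (auto simp: powr_minus_divide)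
  have up1: "\<bar>t\<bar> powr (-1/20) = 1 / u ^ 5" "\<bar>t\<bar> powr (-1/25) = 1 / u ^ 4"
   using up[of 5] up[of 4] by simp_all
  have "\<bar>t\<bar> powr (-1/20) <= (1/4) powr (-1/20)" using t by (intro powr_mono2') auto
  also have "... = 4 powr (1/20)" by (simp add: powr_minus powr_divide)
  also have "... <= (4::real) powr (1/2)" by (intro powr_mono) auto
  finally have u5: "1 / u ^ 5 <= 2" using up1 by (simp add: powr_half_sqrt real_sqrt_eq_iff)
  define \<eta> where "\<eta> = a / u ^ 5"
  have \<eta>: "\<eta> > 0" "\<eta> <= 1/500"
   using a u u5 mult_mono[of a "1/1000" "1 / u^5" 2] by (auto simp: \<eta>_def)
  have s': "1 - \<eta> / 2 <= \<sigma>" using s(1) unfolding up1 c_def \<eta>_def by simp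
  define \<sigma>' where "\<sigma>' = max \<sigma> (1 + \<eta>)"
  have \<sigma>': "\<sigma> <= \<sigma>'" "\<sigma>' <= 2" "\<eta> <= \<sigma>' - 1" using s \<eta> by (auto simp: \<sigma>'_def)
  have "norm (zeta (Complex \<sigma>' t)) ^ 4 >= \<eta> ^ 3 / (500000 * u)"
   using zeta_lower_right[OF \<eta>(1) \<sigma>'(3,2) t] by (simp add: u_def)
  moreover have "\<eta> ^ 3 / (500000 * u) = (2 * D * \<eta> * u) ^ 4"
   using u by (simp add: \<eta>_def a_def power_divide power_mult_distrib field_simps D_def flip: power_Suc)
  ultimately have "(2 * D * \<eta> * u) ^ 4 <= norm (zeta (Complex \<sigma>' t)) ^ 4" by simp
  then have l: "2 * D * \<eta> * u <= norm (zeta (Complex \<sigma>' t))"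
   by (rule power_le_imp_le_base[of _ 3, simplified]) auto
  have "norm (zeta (Complex \<sigma>' t) - zeta (Complex \<sigma> t)) <= D * u * (\<sigma>' - \<sigma>)"
   using zeta_horizontal[OF _ \<sigma>'(1,2) t] s' \<eta> by (simp add: u_def D_def)
  also have "... <= D * u * (3/2 * \<eta>)"
   using s' \<eta> u by (intro mult_left_mono) (auto simp: \<sigma>'_def D_def max_def)
  finally have "norm (zeta (Complex \<sigma> t)) >= 2 * D * \<eta> * u - D * u * (3/2 * \<eta>)"
   using l norm_triangle_sub[of "zeta (Complex \<sigma>' t)" "zeta (Complex \<sigma> t)"] by linarith
  also have "2 * D * \<eta> * u - D * u * (3/2 * \<eta>) = D * (c / u ^ 4)"
   using u by (simp add: \<eta>_def c_def field_simps power_eq_if)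
  finally have "norm (zeta (Complex \<sigma> t)) >= D * (c / u ^ 4)" .
  moreover have "1 * (c / u ^ 4) <= D * (c / u ^ 4)"
   using c u by (intro mult_right_mono) (auto simp: D_def)
  ultimately show ?thesis unfolding up1 using s' \<eta> by simp
 qed
 then show ?thesis using c by blast
qed

section \<open>The entire function (s - 1) zeta(s) and its logarithmic derivative\<close>

definition zeta_reg :: "complex => complex" where
 "zeta_reg s = (if s = 1 then 1 else (s - 1) * zeta s)"

lemma zeta_reg_near_1:
 assumes "Re s > 0"
 shows "norm (zeta_reg s - 1) <= norm (s - 1) * (norm s * (1 + 1 / Re s))"
proof (cases "s = 1")
 case False
 then have "norm (zeta s - 1 / (s - 1)) <= norm s * (1 + 1 / Re s)"
  using zeta_approx[of 1 s] assms by simp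
 moreover have "zeta_reg s - 1 = (s - 1) * (zeta s - 1 / (s - 1))"
  using False by (simp add: zeta_reg_def algebra_simps)
 ultimately show ?thesis by (simp add: norm_mult mult_left_mono)
qed (simp add: zeta_reg_def)

text \<open>The singularity at 1 is removable: \<open>zeta_reg_near_1\<close> gives continuity there
  with value 1, the residue of zeta.\<close>

lemma zeta_reg_holomorphic: "zeta_reg holomorphic_on UNIV"
proof (rule no_isolated_singularity)
 have "(%s. (s - 1) * zeta s) holomorphic_on - {1}"
  by (intro holomorphic_intros zeta_holomorphic)
 then show hol: "zeta_reg holomorphic_on UNIV - {1}"
  by (rule holomorphic_transform[of _ "- {1}", THEN holomorphic_on_subset]) (auto simp: zeta_reg_def)
 have "isCont zeta_reg s" for s
 proof (cases "s = 1")
  case True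
  have "(zeta_reg \<longlongrightarrow> 1) (at 1)"
  proof (rule LIM_zero_cancel, rule Lim_null_comparison)
   have "\<forall>\<^sub>F s in at (1::complex). Re s > 0"
    by (rule order_tendstoD[OF tendsto_Re[OF tendsto_ident_at]]) simp
   then show "\<forall>\<^sub>F s in at 1. norm (zeta_reg s - 1) <= norm (s - 1) * (norm s * (1 + 1 / Re s))"
    by eventually_elim (rule zeta_reg_near_1)
   show "((%s. norm (s - 1) * (norm s * (1 + 1 / Re s))) \<longlongrightarrow> 0) (at (1::complex))"
    by (rule tendsto_eq_intros refl | simp)+
  qed
  then show ?thesis using True by (simp add: isCont_def zeta_reg_def)
 next
  case False
  then show ?thesis
   using holomorphic_on_imp_continuous_on[OF hol] continuous_on_eq_continuous_at[of "UNIV - {1}" zeta_reg]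
   by (auto simp: open_delete)
 qed
 then show "continuous_on UNIV zeta_reg" by (simp add: continuous_on_eq_continuous_within)
qed auto

text \<open>Around s = 1 a fixed box is handled by compactness. Away from it the zero-free region
  gives zeta'/zeta = O(t^(1/100) / t^(-1/25)) = O(t^(1/20)).\<close>

lemma zeta_reg_logderiv_bound:
 "\<exists>c>0. \<exists>C>0. c <= 1/8 & (\<forall>R\<ge>1. \<forall>z. - c * R powr (-1/20) <= Re z --> Re z <= 1 --> \<bar>Im z\<bar> <= R -->
   zeta_reg (1 + z) ~= 0 & norm (deriv zeta_reg (1 + z) / zeta_reg (1 + z)) <= C * R powr (1/20))"
proof -
 obtain c0 where c0: "c0 > 0" "\<And>\<sigma> t. \<bar>t\<bar> >= 1/4 ==> 1 - c0 * \<bar>t\<bar> powr (-1/20) <= \<sigma> ==> \<sigma> <= 2 ==>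
   199/200 <= \<sigma> & norm (zeta (Complex \<sigma> t)) >= c0 * \<bar>t\<bar> powr (-1/25)"
  using zeta_lower by metis
 \<comment> \<open>In this box \<open>zeta_reg\<close> is nonzero by the Euler product when Re s >
   1, and otherwise because \<open>zeta_reg_near_1\<close> bounds its distance from 1 by
   (3/10)(21/20)(15/7) < 1.\<close>
 define K where "K = {s. 7/8 <= Re s & Re s <= 2 & \<bar>Im s\<bar> <= 1/4}"
 have K: "K = cbox (Complex (7/8) (-1/4)) (Complex 2 (1/4))"
  by (auto simp: K_def in_cbox_complex_iff)
 have nzK: "zeta_reg s ~= 0" if s: "s \<in> K" for s
 proof (cases "Re s > 1")
  case True
  then show ?thesis using zeta_nonzero_right[OF True] by (auto simp: zeta_reg_def)
 next
  case False
  have "1 + 1 / Re s <= 15/7" using s by (auto simp: K_def field_simps)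
  have "norm (s - 1) ^ 2 <= (1/8)\<^sup>2 + (1/4)\<^sup>2"
   unfolding cmod_power2 using s False
   by (intro add_mono; subst abs_le_square_iff[symmetric]) (auto simp: K_def)
  also have "... <= (3/10)\<^sup>2" by (simp add: power2_eq_square)
  finally have n1: "norm (s - 1) <= 3/10" by (rule power2_le_imp_le) simp
  have "norm s ^ 2 <= 1\<^sup>2 + (1/4)\<^sup>2"
   unfolding cmod_power2 using s False
   by (intro add_mono; subst abs_le_square_iff[symmetric]) (auto simp: K_def)
  also have "... <= (21/20)\<^sup>2" by (simp add: power2_eq_square)
  finally have n2: "norm s <= 21/20" by (rule power2_le_imp_le) simp
  have "norm (s - 1) * (norm s * (1 + 1 / Re s)) <= 3/10 * (21/20 * (15/7))"
   using s n1 n2 \<open>1 + 1 / Re s <= 15/7\<close> by (intro mult_mono) (auto simp: K_def)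
  also have "... < 1" by simp
  finally have lt: "norm (s - 1) * (norm s * (1 + 1 / Re s)) < 1" .
  have "Re s > 0" using s by (simp add: K_def)
  from zeta_reg_near_1[OF this] lt have "norm (zeta_reg s - 1) < 1" by (rule le_less_trans)
  then show ?thesis by auto
 qed
 have "continuous_on K (%s. deriv zeta_reg s / zeta_reg s)"
  by (intro continuous_intros holomorphic_on_imp_continuous_on holomorphic_on_subset[OF holomorphic_deriv[OF zeta_reg_holomorphic]]
   holomorphic_on_subset[OF zeta_reg_holomorphic]) (use nzK in auto)
 then have "bounded ((%s. deriv zeta_reg s / zeta_reg s) ` K)"
  unfolding K by (intro compact_imp_bounded compact_continuous_image compact_cbox)
 then obtain C1 where C1: "C1 > 0" "\<And>s. s \<in> K ==> norm (deriv zeta_reg s / zeta_reg s) <= C1"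
  unfolding bounded_pos by auto
 define c where "c = min c0 (1/8)"
 define C where "C = C1 + 4 + 800000 / c0"
 have "zeta_reg (1 + z) ~= 0 & norm (deriv zeta_reg (1 + z) / zeta_reg (1 + z)) <= C * R powr (1/20)"
  if R: "R >= 1" and z: "- c * R powr (-1/20) <= Re z" "Re z <= 1" "\<bar>Im z\<bar> <= R" for R z
 proof (cases "\<bar>Im z\<bar> <= 1/4")
  case True
  have "R powr (-1/20) <= 1" using R powr_mono[of "-1/20" 0 R] by simp
  then have "c * R powr (-1/20) <= 1/8 * 1" using c0 by (intro mult_mono) (auto simp: c_def)
  then have "1 + z \<in> K" using z True by (auto simp: K_def)
  moreover have "C1 <= C * R powr (1/20)"
  proof -
   have "C1 * 1 <= C * R powr (1/20)" using c0 C1(1) R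
    by (intro mult_mono) (auto simp: C_def intro: ge_one_powr_ge_zero)
   then show ?thesis by simp
  qed
  ultimately show ?thesis using nzK C1(2) order_trans by blast
 next
  case False
  define t where "t = \<bar>Im z\<bar>"
  have t: "t > 1/4" "t <= R" using False z by (auto simp: t_def)
  have "R powr (-1/20) <= t powr (-1/20)" using t by (intro powr_mono2') auto
  then have "c * R powr (-1/20) <= c0 * t powr (-1/20)" using c0 by (intro mult_mono) (auto simp: c_def)
  moreover have "Complex (1 + Re z) (Im z) = 1 + z" by (simp add: complex_eq_iff)
  ultimately have zz: "199/200 <= 1 + Re z" "norm (zeta (1 + z)) >= c0 * t powr (-1/25)"
   using c0(2)[of "Im z" "1 + Re z"] z t by (auto simp: t_def)
  have s1: "1 + z ~= 1" using t by (auto simp: t_def)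
  have pos: "c0 * t powr (-1/25) > 0" using c0 t by simp
  then have nz: "zeta (1 + z) ~= 0" using zz by auto
  have D: "zeta field_differentiable at (1 + z)"
   using zeta_holomorphic s1 by (simp add: holomorphic_on_open open_delete field_differentiable_def Compl_eq_Diff_UNIV)
  then have "((%s. (s - 1) * zeta s) has_field_derivative (z * deriv zeta (1 + z) + zeta (1 + z))) (at (1 + z))"
   by (auto intro!: derivative_eq_intros simp: DERIV_deriv_iff_field_differentiable)
  then have "(zeta_reg has_field_derivative (z * deriv zeta (1 + z) + zeta (1 + z))) (at (1 + z))"
   by (rule has_field_derivative_transform_within_open[of _ _ _ "- {1}"]) (use s1 in \<open>auto simp: zeta_reg_def\<close>)
  then have "deriv zeta_reg (1 + z) = z * deriv zeta (1 + z) + zeta (1 + z)" by (rule DERIV_imp_deriv)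
  moreover have "zeta_reg (1 + z) = z * zeta (1 + z)" using s1 by (simp add: zeta_reg_def)
  ultimately have eq: "deriv zeta_reg (1 + z) / zeta_reg (1 + z) = deriv zeta (1 + z) / zeta (1 + z) + 1 / z"
   using nz s1 by (simp add: field_simps)
  have "norm (1 / z) <= 4"
   using abs_Im_le_cmod[of z] t frac_le[of 1 1 "1/4" "norm z"] by (simp add: t_def norm_divide)
  moreover have "norm (deriv zeta (1 + z) / zeta (1 + z)) <= (800000 * t powr (1/100)) / (c0 * t powr (-1/25))"
   unfolding norm_divide using zeta_deriv_upper[of "1 + z"] zz z t pos
   by (intro frac_le) (auto simp: t_def)
  moreover have "(800000 * t powr (1/100)) / (c0 * t powr (-1/25)) = 800000 / c0 * t powr (1/20)"
   using t by (simp add: powr_minus field_simps flip: powr_add)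
  ultimately have "norm (deriv zeta_reg (1 + z) / zeta_reg (1 + z)) <= 800000 / c0 * t powr (1/20) + 4"
   unfolding eq using norm_triangle_ineq[of "deriv zeta (1 + z) / zeta (1 + z)" "1 / z"] by linarith
  also have "... <= 800000 / c0 * R powr (1/20) + (C1 + 4) * R powr (1/20)"
  proof (intro add_mono mult_left_mono powr_mono2)
   have "(4::real) * 1 <= (C1 + 4) * R powr (1/20)" using R C1
    by (intro mult_mono) (auto intro: ge_one_powr_ge_zero)
   then show "4 <= (C1 + 4) * R powr (1/20)" by simp
  qed (use t c0 in auto)
  also have "... = C * R powr (1/20)" by (simp add: C_def algebra_simps)
  finally show ?thesis using nz s1 by (simp add: zeta_reg_def)
 qed
 moreover have "c > 0" "c <= 1/8" "C > 0" using c0 C1 by (auto simp: c_def C_def add_pos_pos)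
 ultimately show ?thesis by blast
qed

subsection \<open>The prime sum \<open>\<Sum> ln p / p powr (1 + z)\<close>\<close>

definition prime_ln :: "nat => real" where
 "prime_ln n = (if prime n then ln (real n) else 0)"

lemma prime_ln_nonneg [simp]: "prime_ln n >= 0"
 by (auto simp: prime_ln_def prime_gt_0_nat Suc_leI)

lemma norm_prime_powr:
 assumes "prime p" "Re s >= 3/4"
 shows "norm (of_nat p powr (-s)) = real p powr (- Re s)" "real p powr (- Re s) <= 2/3"
proof -
 have p: "p >= 2" using assms prime_ge_2_nat by blast
 then show "norm (of_nat p powr (-s)) = real p powr (- Re s)" by (simp add: norm_nat_powr)
 have "real p powr (- Re s) <= real p powr (-3/4)" using p assms by (intro powr_mono) auto
 also have "... <= 2 powr (-3/4)" using p by (intro powr_mono2') auto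
 also have "... <= 2/3"
 proof -
  have "(2 powr (-3/4)) ^ 4 = (2::real) powr (-3)" by (subst powr_power) auto
  also have "... = 1/8" by (simp add: powr_minus_divide)
  also have "... <= (2/3)^4" by (simp add: power_divide)
  finally show ?thesis by (rule power_le_imp_le_base[of _ 3, simplified]) auto
 qed
 finally show "real p powr (- Re s) <= 2/3" .
qed

text \<open>The series of -Ln(1 - p^(-s)) converges locally uniformly on Re s > 1 to a holomorphic
  logarithm g of zeta, and may be differentiated term by term.\<close>

lemma zeta_logderiv_sums:
 assumes s: "Re s > 1"
 shows "(%n. of_real (prime_ln n) * (of_nat n powr (-s) / (1 - of_nat n powr (-s)))) sums (- deriv zeta s / zeta s)"
proof -
 define S where "S = {s::complex. Re s > 1}"
 have opS: "open S" unfolding S_def by (rule open_halfspace_Re_gt)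
 define f where "f n s = (if prime n then - Ln (1 - of_nat n powr (-s)) else 0)" for n and s :: complex
 define f' where "f' n s = - (of_real (prime_ln n) * (of_nat n powr (-s) / (1 - of_nat n powr (-s))))" for n and s :: complex
 have half: "norm (of_nat n powr (-x)) < 1/2" if "prime n" "x \<in> S" for n x
 proof -
  have n: "n >= 2" using that prime_ge_2_nat by blast
  then have "norm (of_nat n powr (-x)) = real n powr (- Re x)" by (simp add: norm_nat_powr)
  also have "... < real n powr (-1)" using n that by (intro powr_less_mono) (auto simp: S_def)
  also have "... <= 1/2" using n by (simp add: powr_minus_divide field_simps)
  finally show ?thesis .
 qed
 have re: "Re (1 - of_nat n powr (-x)) > 0" if "prime n" "x \<in> S" for n x
  using half[OF that] complex_Re_le_cmod[of "of_nat n powr (-x)"] by simp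
 have der: "(f n has_field_derivative f' n x) (at x)" if x: "x \<in> S" for n x
 proof (cases "prime n")
  case True
  then have "n > 0" by (rule prime_gt_0_nat)
  have "((%s. of_nat n powr (-s)) has_field_derivative (Ln (of_nat n) * of_nat n powr (-x) * (-1))) (at x)"
   by (rule DERIV_chain2[where f = "%z. of_nat n powr z" and g = uminus])
    (use \<open>n > 0\<close> in \<open>auto intro!: has_field_derivative_powr_right derivative_eq_intros\<close>)
  then have "((%s. - Ln (1 - of_nat n powr (-s))) has_field_derivative
    - (inverse (1 - of_nat n powr (-x)) * (0 - Ln (of_nat n) * of_nat n powr (-x) * (-1)))) (at x)"
   using re[OF True x]
   by (intro DERIV_minus DERIV_chain2[where f = Ln] DERIV_diff DERIV_const has_field_derivative_Ln)
    (auto simp: complex_nonpos_Reals_iff)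
  moreover have "- (inverse (1 - of_nat n powr (-x)) * (0 - Ln (of_nat n) * of_nat n powr (-x) * (-1))) = f' n x"
   using True \<open>n > 0\<close> by (simp add: f'_def prime_ln_def Ln_of_nat divide_inverse mult_ac)
  ultimately have "((%s. - Ln (1 - of_nat n powr (-s))) has_field_derivative f' n x) (at x)" by (simp only:)
  then show ?thesis using True by (simp add: f_def[abs_def])
 qed (simp add: f_def[abs_def] f'_def prime_ln_def)
 have "\<exists>g g'. \<forall>x\<in>S. (%n. f n x) sums g x & (%n. f' n x) sums g' x & (g has_field_derivative g' x) (at x)"
 proof (rule series_and_derivative_comparison_local[OF opS der])
  fix x assume x: "x \<in> S"
  define d where "d = (Re x - 1) / 2"
  have d: "d > 0" using x by (simp add: S_def d_def)
  have "norm (f n y) <= 2 * real n powr (-(1 + d))" if y: "y \<in> ball x d \<inter> S" for n y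
  proof (cases "prime n")
   case True
   have "Re x - Re y <= d" using y abs_Re_le_cmod[of "x - y"] by (auto simp: dist_norm)
   then have yd: "Re y >= 1 + d" by (simp add: d_def field_simps)
   have n: "n >= 1" using True prime_ge_1_nat by blast
   have "norm (Ln (1 + (- (of_nat n powr (-y))))) <= 2 * norm (- (of_nat n powr (-y)))"
    by (rule norm_Ln_le) (use half[OF True, of y] y in auto)
   also have "norm (- (of_nat n powr (-y))) = real n powr (- Re y)" using n by (simp add: norm_nat_powr)
   also have "... <= real n powr (-(1 + d))" using n yd by (intro powr_mono) auto
   finally show ?thesis using True by (simp add: f_def)
  qed (simp add: f_def)
  moreover have "summable (%n. 2 * real n powr (-(1 + d)))"
   using summable_nat_powr[of "1 + d" 0] d by (intro summable_mult) auto
  ultimately show "\<exists>d h. 0 < d & summable h & (\<forall>\<^sub>F n in sequentially. \<forall>y\<in>ball x d \<inter> S. norm (f n y) <= h n)"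
   using d by (intro exI[of _ d] exI[of _ "%n. 2 * real n powr (-(1 + d))"] conjI always_eventually allI ballI)
 qed
 then obtain g g' where g: "\<And>x. x \<in> S ==> (%n. f n x) sums g x" "\<And>x. x \<in> S ==> (%n. f' n x) sums g' x"
  "\<And>x. x \<in> S ==> (g has_field_derivative g' x) (at x)" by blast
 \<comment> \<open>The exponential of a partial sum of g is inverse to the partial product of the 1
   - p^(-x), and zeta times that product tends to 1.\<close>
 have zg: "zeta x = exp (g x)" if x: "x \<in> S" for x
 proof -
  have lim: "(%N. exp (\<Sum>n<Suc N. f n x)) \<longlonglongrightarrow> exp (g x)"
   using g(1)[OF x] by (intro tendsto_exp LIMSEQ_Suc) (simp add: sums_def)
  have "exp (\<Sum>n<Suc N. f n x) * (\<Prod>p\<in>primes_le N. 1 - of_nat p powr (-x)) = 1" for N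
  proof -
   have "(\<Sum>n<Suc N. f n x) = (\<Sum>p\<in>primes_le N. - Ln (1 - of_nat p powr (-x)))"
    by (rule sum.mono_neutral_cong_right) (auto simp: primes_le_def f_def)
   also have "exp ... = (\<Prod>p\<in>primes_le N. exp (- Ln (1 - of_nat p powr (-x))))"
    by (rule exp_sum) simp
   also have "... * (\<Prod>p\<in>primes_le N. 1 - of_nat p powr (-x)) =
     (\<Prod>p\<in>primes_le N. exp (- Ln (1 - of_nat p powr (-x))) * (1 - of_nat p powr (-x)))"
    by (rule prod.distrib[symmetric])
   also have "... = 1"
   proof (intro prod.neutral ballI)
    fix p assume "p \<in> primes_le N"
    then have "Re (1 - of_nat p powr (-x)) > 0" using re[OF _ x] by (simp add: primes_le_def)
    then have "1 - of_nat p powr (-x) ~= 0" by (metis less_irrefl zero_complex.simps(1))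
    then show "exp (- Ln (1 - of_nat p powr (-x))) * (1 - of_nat p powr (-x)) = 1"
     by (simp add: exp_minus)
   qed
   finally show ?thesis .
  qed
  then have eq: "zeta x = (zeta x * (\<Prod>p\<in>primes_le N. 1 - of_nat p powr (-x))) * exp (\<Sum>n<Suc N. f n x)" for N
   by (metis mult.assoc mult.commute mult_1_right)
  have "Re x > 1" using x by (simp add: S_def)
  from tendsto_mult[OF euler_product_tendsto[OF this] lim] have "(%N::nat. zeta x) \<longlonglongrightarrow> 1 * exp (g x)"
   by (simp only: eq[symmetric])
  then show ?thesis by (simp add: LIMSEQ_const_iff)
 qed
 have sS: "s \<in> S" using s by (simp add: S_def)
 have "((%x. exp (g x)) has_field_derivative exp (g s) * g' s) (at s)"
  by (rule DERIV_chain2[OF DERIV_exp g(3)[OF sS]])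
 then have "(zeta has_field_derivative zeta s * g' s) (at s)"
  unfolding zg[OF sS] by (rule has_field_derivative_transform_within_open[OF _ opS sS]) (simp add: zg)
 then have "deriv zeta s = zeta s * g' s" by (rule DERIV_imp_deriv)
 then have "g' s = deriv zeta s / zeta s" using zeta_nonzero_right[OF s] by simp
 then show ?thesis using sums_minus[OF g(2)[OF sS]] by (simp add: f'_def)
qed

lemma summable_prime_ln:
 assumes "b > 1"
 shows "summable (%n. prime_ln n * real n powr (-b))"
proof (rule summable_comparison_test'[of _ 1])
 define d where "d = (b - 1) / 2"
 have d: "d > 0" "b - d = 1 + d" using assms by (auto simp: d_def field_simps)
 show "summable (%n. (1 / d) * real n powr (-(1 + d)))"
  using summable_nat_powr[of "1 + d" 0] d by (intro summable_mult) auto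
 show "norm (prime_ln n * real n powr (-b)) <= (1 / d) * real n powr (-(1 + d))" if "n >= 1" for n
 proof -
  have "prime_ln n <= real n powr d / d"
   using ln_powr_bound[of "real n" d] that d by (auto simp: prime_ln_def)
  then have "prime_ln n * real n powr (-b) <= real n powr d / d * real n powr (-b)"
   by (rule mult_right_mono) simp
  also have "... = (1 / d) * real n powr (d - b)" by (simp add: powr_diff powr_minus_divide)
  also have "d - b = -(1 + d)" using d by simp
  finally show ?thesis by simp
 qed
qed

text \<open>With w = p^(-s) one has w / (1 - w) = w + w^2 / (1 - w); the second summand collects the
  prime powers p^k with k >= 2, which are harmless to the left of Re s = 1.\<close>

definition prime_corr :: "complex => complex" where
 "prime_corr s = (\<Sum>n. of_real (prime_ln n) * (of_nat n powr (-s) * of_nat n powr (-s) / (1 - of_nat n powr (-s))))"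

lemma prime_corr_term_le:
 assumes "Re s >= 3/4"
 shows "norm (of_real (prime_ln n) * (of_nat n powr (-s) * of_nat n powr (-s) / (1 - of_nat n powr (-s))))
  <= 3 * (prime_ln n * real n powr (-3/2))"
proof (cases "prime n")
 case True
 note n = norm_prime_powr[OF True assms]
 have n1: "n >= 1" using True prime_ge_1_nat by blast
 have "norm (1 - of_nat n powr (-s)) >= 1/3"
  using norm_triangle_ineq2[of 1 "of_nat n powr (-s)"] n by simp
 then have "norm (of_nat n powr (-s) * of_nat n powr (-s) / (1 - of_nat n powr (-s))) <= (real n powr (- Re s) * real n powr (- Re s)) / (1/3)"
  unfolding norm_divide norm_mult n(1) by (intro frac_le) auto
 also have "... = 3 * real n powr (-2 * Re s)" by (simp flip: powr_add)
 also have "... <= 3 * real n powr (-3/2)" using n1 assms by (intro mult_left_mono powr_mono) auto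
 finally have "prime_ln n * norm (of_nat n powr (-s) * of_nat n powr (-s) / (1 - of_nat n powr (-s)))
   <= prime_ln n * (3 * real n powr (-3/2))" by (intro mult_left_mono) auto
 moreover have "norm (of_real (prime_ln n) * x) = prime_ln n * norm x" for x :: complex
  by (simp only: norm_mult norm_of_real abs_of_nonneg[OF prime_ln_nonneg])
 ultimately show ?thesis by (simp only: mult.left_commute)
qed (simp add: prime_ln_def)

lemma prime_corr:
 shows prime_corr_holomorphic: "prime_corr holomorphic_on {s. Re s > 3/4}"
  and prime_corr_sums: "Re s >= 3/4 ==>
   (%n. of_real (prime_ln n) * (of_nat n powr (-s) * of_nat n powr (-s) / (1 - of_nat n powr (-s)))) sums prime_corr s"
  and prime_corr_bound: "\<exists>C>0. \<forall>s. Re s >= 3/4 --> norm (prime_corr s) <= C"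
proof -
 have sm: "summable (%n. 3 * (prime_ln n * real n powr (-3/2)))"
  using summable_prime_ln[of "3/2"] by (intro summable_mult) simp
 show "prime_corr holomorphic_on {s. Re s > 3/4}"
  unfolding prime_corr_def
 proof (rule holomorphic_on_suminf)
  show "open {s. Re s > 3/4}" by (rule open_halfspace_Re_gt)
  show "(%s. of_real (prime_ln n) * (of_nat n powr (-s) * of_nat n powr (-s) / (1 - of_nat n powr (-s)))) holomorphic_on {s. Re s > 3/4}" for n
  proof (cases "prime n")
   case True
   have "of_nat n powr (-s) ~= 1" if "Re s > 3/4" for s :: complex
    using norm_prime_powr[OF True, of s] that by auto
   then show ?thesis using True by (intro holomorphic_intros) (auto simp: prime_gt_0_nat)
  qed (simp add: prime_ln_def)
  show "\<exists>d>0. \<exists>h. summable h & (\<forall>n. \<forall>y\<in>cball z d \<inter> {s. Re s > 3/4}. norm (of_real (prime_ln n) * (of_nat n powr (-y) * of_nat n powr (-y) / (1 - of_nat n powr (-y)))) <= h n)" for z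
   using sm prime_corr_term_le by (intro exI[of _ 1] conjI exI[of _ "%n. 3 * (prime_ln n * real n powr (-3/2))"]) auto
 qed
 show "(%n. of_real (prime_ln n) * (of_nat n powr (-s) * of_nat n powr (-s) / (1 - of_nat n powr (-s)))) sums prime_corr s"
  if "Re s >= 3/4" for s
  unfolding prime_corr_def
  by (intro summable_sums summable_comparison_test'[OF sm] prime_corr_term_le that)
 define C where "C = (\<Sum>n. 3 * (prime_ln n * real n powr (-3/2)))"
 have "norm (prime_corr s) <= C" if "Re s >= 3/4" for s
  unfolding prime_corr_def C_def by (intro norm_suminf_le[OF _ sm] prime_corr_term_le that)
 moreover have "C >= 0" unfolding C_def by (intro suminf_nonneg sm) simp
 ultimately show "\<exists>C>0. \<forall>s. Re s >= 3/4 --> norm (prime_corr s) <= C"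
  by (intro exI[of _ "C + 1"]) force
qed

text \<open>Removing the pole 1 / z and the higher prime powers from -zeta'/zeta at s = 1 + z leaves
  H, built from \<open>zeta_reg\<close> and \<open>prime_corr\<close>. The known domain narrows with
  the height, so holomorphy and growth are stated for each R separately.\<close>

lemma prime_sum_continuation:
 obtains H :: "complex => complex" and c C :: real where "c > 0" "c <= 1/8" "C > 0"
  "\<And>z. Re z > 0 ==> (%n. of_real (prime_ln n) * of_nat n powr (-1 - z)) sums (1 / z + H z)"
  "\<And>R. R >= 1 ==> H holomorphic_on ({z. Re z > 0} \<union> {z. - c * R powr (-1/20) < Re z & \<bar>Im z\<bar> < R})"
  "\<And>R z. R >= 1 ==> - c * R powr (-1/20) <= Re z ==> Re z <= 1 ==> \<bar>Im z\<bar> <= R ==> norm (H z) <= C * R powr (1/20)"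
proof -
 obtain c C1 where c: "c > 0" "c <= 1/8" "C1 > 0"
  "\<And>R z. R >= 1 ==> - c * R powr (-1/20) <= Re z ==> Re z <= 1 ==> \<bar>Im z\<bar> <= R ==> zeta_reg (1 + z) ~= 0"
  "\<And>R z. R >= 1 ==> - c * R powr (-1/20) <= Re z ==> Re z <= 1 ==> \<bar>Im z\<bar> <= R ==>
    norm (deriv zeta_reg (1 + z) / zeta_reg (1 + z)) <= C1 * R powr (1/20)"
  using zeta_reg_logderiv_bound by metis
 obtain C2 where C2: "C2 > 0" "\<And>s. Re s >= 3/4 ==> norm (prime_corr s) <= C2"
  using prime_corr_bound by metis
 define H where "H z = - deriv zeta_reg (1 + z) / zeta_reg (1 + z) - prime_corr (1 + z)" for z
 have cR: "c * R powr (-1/20) <= 1/8" if "R >= 1" for R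
 proof -
  have "R powr (-1/20) <= 1" using that powr_mono[of "-1/20" 0 R] by simp
  then have "c * R powr (-1/20) <= 1/8 * 1" using c by (intro mult_mono) auto
  then show ?thesis by simp
 qed
 have 1: "(%n. of_real (prime_ln n) * of_nat n powr (-1 - z)) sums (1 / z + H z)" if z: "Re z > 0" for z
 proof -
  define s where "s = 1 + z"
  have s: "Re s > 1" "s ~= 1" using z by (auto simp: s_def)
  have "(%n. of_real (prime_ln n) * (of_nat n powr (-s) / (1 - of_nat n powr (-s))) -
    of_real (prime_ln n) * (of_nat n powr (-s) * of_nat n powr (-s) / (1 - of_nat n powr (-s)))) sums
    (- deriv zeta s / zeta s - prime_corr s)"
   by (intro sums_diff zeta_logderiv_sums prime_corr_sums) (use s in auto)
  also have "(%n. of_real (prime_ln n) * (of_nat n powr (-s) / (1 - of_nat n powr (-s))) -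
    of_real (prime_ln n) * (of_nat n powr (-s) * of_nat n powr (-s) / (1 - of_nat n powr (-s)))) =
    (%n. of_real (prime_ln n) * of_nat n powr (-s))"
  proof
   fix n
   show "of_real (prime_ln n) * (of_nat n powr (-s) / (1 - of_nat n powr (-s))) -
    of_real (prime_ln n) * (of_nat n powr (-s) * of_nat n powr (-s) / (1 - of_nat n powr (-s))) =
    of_real (prime_ln n) * of_nat n powr (-s)"
   proof (cases "prime n")
    case True
    define w where "w = of_nat n powr (-s)"
    have "w ~= 1" using norm_prime_powr[OF True, of s] s by (auto simp: w_def)
    moreover have "w / (1 - w) - w * w / (1 - w) = w * (1 - w) / (1 - w)"
     by (simp add: diff_divide_distrib right_diff_distrib)
    ultimately have "w / (1 - w) - w * w / (1 - w) = w" by simp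
    then show ?thesis unfolding w_def[symmetric] right_diff_distrib[symmetric] by simp
   qed (simp add: prime_ln_def)
  qed
  finally have *: "(%n. of_real (prime_ln n) * of_nat n powr (-s)) sums (- deriv zeta s / zeta s - prime_corr s)" .
  have D: "zeta field_differentiable at s"
   using zeta_holomorphic s by (simp add: holomorphic_on_open open_delete field_differentiable_def Compl_eq_Diff_UNIV)
  then have "((%s. (s - 1) * zeta s) has_field_derivative ((s - 1) * deriv zeta s + zeta s)) (at s)"
   by (auto intro!: derivative_eq_intros simp: DERIV_deriv_iff_field_differentiable)
  then have "(zeta_reg has_field_derivative ((s - 1) * deriv zeta s + zeta s)) (at s)"
   by (rule has_field_derivative_transform_within_open[of _ _ _ "- {1}"]) (use s in \<open>auto simp: zeta_reg_def\<close>)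
  then have "deriv zeta_reg s = (s - 1) * deriv zeta s + zeta s" by (rule DERIV_imp_deriv)
  moreover have "zeta_reg s = (s - 1) * zeta s" using s by (simp add: zeta_reg_def)
  moreover have "- d / w = - (a * d + w) / (a * w) + 1 / a" if "a ~= 0" "w ~= 0" for a d w :: complex
   using that by (simp add: field_simps)
  ultimately have "- deriv zeta s / zeta s = - deriv zeta_reg s / zeta_reg s + 1 / (s - 1)"
   using zeta_nonzero_right[OF s(1)] s by (metis right_minus_eq)
  then have "1 / z + H z = - deriv zeta s / zeta s - prime_corr s" by (simp add: H_def s_def)
  moreover have "-1 - z = -s" by (simp add: s_def)
  ultimately show ?thesis using * by (simp only:)
 qed
 have 2: "H holomorphic_on ({z. Re z > 0} \<union> {z. - c * R powr (-1/20) < Re z & \<bar>Im z\<bar> < R})" if R: "R >= 1" for R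
 proof -
  let ?S = "{z. Re z > 0} \<union> {z. - c * R powr (-1/20) < Re z & \<bar>Im z\<bar> < R}"
  have "zeta_reg (1 + z) ~= 0" if z: "z \<in> ?S" for z
  proof (cases "Re z > 0")
   case True
   then show ?thesis using zeta_nonzero_right[of "1 + z"] by (auto simp: zeta_reg_def)
  next
   case False
   then show ?thesis using z c(4)[OF R, of z] by auto
  qed
  moreover have "(%z. deriv zeta_reg (1 + z)) holomorphic_on ?S"
   by (rule holomorphic_on_compose_gen[OF _ holomorphic_deriv[OF zeta_reg_holomorphic], unfolded o_def])
    (auto intro!: holomorphic_intros)
  moreover have "(%z. zeta_reg (1 + z)) holomorphic_on ?S"
   by (rule holomorphic_on_compose_gen[OF _ zeta_reg_holomorphic, unfolded o_def])
    (auto intro!: holomorphic_intros)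
  moreover have "(%z. prime_corr (1 + z)) holomorphic_on ?S"
   by (rule holomorphic_on_compose_gen[OF _ prime_corr_holomorphic, unfolded o_def])
    (use cR[OF R] in \<open>auto intro!: holomorphic_intros\<close>)
  ultimately show ?thesis unfolding H_def
   by (intro holomorphic_intros open_Un open_Collect_conj open_Collect_less continuous_intros) auto
 qed
 have 3: "norm (H z) <= (C1 + C2) * R powr (1/20)"
  if R: "R >= 1" and z: "- c * R powr (-1/20) <= Re z" "Re z <= 1" "\<bar>Im z\<bar> <= R" for R z
 proof -
  have "norm (H z) <= norm (deriv zeta_reg (1 + z) / zeta_reg (1 + z)) + norm (prime_corr (1 + z))"
   unfolding H_def using norm_triangle_ineq4[of "- deriv zeta_reg (1 + z) / zeta_reg (1 + z)"] by simp
  also have "... <= C1 * R powr (1/20) + C2 * 1"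
   using c(5)[OF R z] C2(2)[of "1 + z"] cR[OF R] z by (intro add_mono) auto
  also have "... <= C1 * R powr (1/20) + C2 * R powr (1/20)"
   using C2 R c(3) by (intro add_mono mult_left_mono) (auto intro: ge_one_powr_ge_zero)
  finally show ?thesis by (simp add: algebra_simps)
 qed
 show ?thesis
  by (rule that[OF c(1,2) _ 1 2 3]) (use c C2 in auto)
qed

subsection \<open>Newman's contour argument with a remainder\<close>

text \<open>A starlike S is simply connected, so winding numbers about points outside S vanish and
  the residue theorem applies with the single pole 0.\<close>

lemma contour_integral_pole:
 assumes S: "open S" "starlike S" "0 \<in> S" and f: "f holomorphic_on S"
  and g: "valid_path g" "pathfinish g = pathstart g" "path_image g \<subseteq> S - {0}" "winding_number g 0 = 1"
 shows "contour_integral g (%z. f z / z ^ Suc n) = 2 * of_real pi * \<i> * ((deriv ^^ n) f 0 / fact n)"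
proof -
 have "contour_integral g (%z. f z / z ^ Suc n) = of_real (2 * pi) * \<i> * (\<Sum>p\<in>{0}. winding_number g p * residue (%z. f z / z ^ Suc n) p)"
 proof (rule Residue_theorem[OF S(1) starlike_imp_connected[OF S(2)]])
  show "(%z. f z / z ^ Suc n) holomorphic_on S - {0}"
   by (intro holomorphic_intros holomorphic_on_subset[OF f]) auto
  show "\<forall>z. z \<notin> S --> winding_number g z = 0"
   using simply_connected_imp_winding_number_zero[OF starlike_imp_simply_connected[OF S(2)] valid_path_imp_path[OF g(1)] _ g(2)] g(3)
   by blast
 qed (use g in auto)
 moreover have "residue (%z. f z / z ^ Suc n) 0 = (deriv ^^ n) f 0 / fact n"
  by (rule residue_holomorphic_over_power'[OF S(1,3) f])
 ultimately show ?thesis using g(4) by simp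
qed

text \<open>Off the nonnegative real axis \<open>Ln (- z)\<close> is a primitive of 1 / z, so only
  the end points matter. Together with its mirror image this gives the winding number of a contour
  composed of a right and a left half.\<close>

lemma inverse_integral_left:
 assumes g: "valid_path g" "pathstart g = \<i> * of_real R" "pathfinish g = - \<i> * of_real R"
  and im: "\<And>z. z \<in> path_image g ==> Im z = 0 ==> Re z < 0" and R: "R > 0"
 shows "((%z. 1 / z) has_contour_integral (\<i> * of_real pi)) g"
proof -
 have "((%z. 1 / z) has_contour_integral (Ln (- pathfinish g) - Ln (- pathstart g))) g"
 proof (rule contour_integral_primitive[of "path_image g" "%z. Ln (- z)"])
  fix x assume "x \<in> path_image g"
  then have "- x \<notin> \<real>\<^sub>\<le>\<^sub>0" using im[of x] by (auto simp: complex_nonpos_Reals_iff)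
  moreover then have "x ~= 0" by auto
  ultimately show "((%z. Ln (- z)) has_field_derivative 1 / x) (at x within path_image g)"
   by (auto intro!: derivative_eq_intros simp: field_simps)
 qed (use g in auto)
 moreover have "Ln (- pathfinish g) - Ln (- pathstart g) = \<i> * of_real pi"
 proof -
  have "Ln (\<i> * of_real R) = of_real (ln R) + \<i> * of_real pi / 2"
   "Ln (- \<i> * of_real R) = of_real (ln R) - \<i> * of_real pi / 2"
   using R Ln_times_of_real[of R "\<i>"] Ln_times_of_real[of R "-\<i>"] Ln_of_real[OF R] by (simp_all add: mult.commute)
  then have "Ln (\<i> * of_real R) - Ln (- \<i> * of_real R) = \<i> * of_real pi" by (simp only:) simp
  then show ?thesis using g by simp
 qed
 ultimately show ?thesis by simp
qed

lemma inverse_integral_right: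
 assumes g: "valid_path g" "pathstart g = - \<i> * of_real R" "pathfinish g = \<i> * of_real R"
  and im: "\<And>z. z \<in> path_image g ==> Im z = 0 ==> Re z > 0" and R: "R > 0"
 shows "((%z. 1 / z) has_contour_integral (\<i> * of_real pi)) g"
proof -
 have "((%z. 1 / z) has_contour_integral (Ln (pathfinish g) - Ln (pathstart g))) g"
 proof (rule contour_integral_primitive[of "path_image g" Ln])
  fix x assume "x \<in> path_image g"
  then have "x \<notin> \<real>\<^sub>\<le>\<^sub>0" using im[of x] by (auto simp: complex_nonpos_Reals_iff)
  then show "(Ln has_field_derivative 1 / x) (at x within path_image g)"
   by (auto intro!: derivative_eq_intros simp: field_simps)
 qed (use g in auto)
 moreover have "Ln (pathfinish g) - Ln (pathstart g) = \<i> * of_real pi"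
 proof -
  have "Ln (\<i> * of_real R) = of_real (ln R) + \<i> * of_real pi / 2"
   "Ln (- \<i> * of_real R) = of_real (ln R) - \<i> * of_real pi / 2"
   using R Ln_times_of_real[of R "\<i>"] Ln_times_of_real[of R "-\<i>"] Ln_of_real[OF R] by (simp_all add: mult.commute)
  then have "Ln (\<i> * of_real R) - Ln (- \<i> * of_real R) = \<i> * of_real pi" by (simp only:) simp
  then show ?thesis using g by simp
 qed
 ultimately show ?thesis by simp
qed

lemma winding_number_join_1:
 assumes R: "R > 0"
  and g: "valid_path g" "pathstart g = - \<i> * of_real R" "pathfinish g = \<i> * of_real R"
   "\<And>z. z \<in> path_image g ==> Im z = 0 ==> Re z > 0"
  and h: "valid_path h" "pathstart h = \<i> * of_real R" "pathfinish h = - \<i> * of_real R"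
   "\<And>z. z \<in> path_image h ==> Im z = 0 ==> Re z < 0"
 shows "winding_number (g +++ h) 0 = 1"
proof -
 have "((%z. 1 / z) has_contour_integral (\<i> * of_real pi + \<i> * of_real pi)) (g +++ h)"
  by (intro has_contour_integral_join inverse_integral_left[OF h R] inverse_integral_right[OF g R] g h)
 then have "contour_integral (g +++ h) (%z. 1 / z) = 2 * of_real pi * \<i>"
  by (simp add: contour_integral_unique)
 moreover have "0 \<notin> path_image (g +++ h)"
  using g h by (force simp: path_image_join)
 ultimately show ?thesis
  using g h by (subst winding_number_valid_path) auto
qed

text \<open>On |z| = R the rational factor has modulus (2 |Re z| / R)^2, which offsets the growth 1
  / Re z of the prime series near the imaginary axis. The excess 4 / R^2 of its second derivative at
  0 reappears as 2 / R^2 in \<open>newman_bound\<close>.\<close>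

definition newman_kernel :: "real => real => complex => complex" where
 "newman_kernel R T z = exp (of_real T * z) * (1 + z\<^sup>2 / of_real R ^ 2)\<^sup>2"

lemma newman_kernel_holomorphic [holomorphic_intros]: "newman_kernel R T holomorphic_on S"
 unfolding newman_kernel_def divide_inverse by (intro holomorphic_intros)

lemma newman_kernel_derivs:
 shows "newman_kernel R T 0 = 1" "deriv (newman_kernel R T) 0 = of_real T"
  "(deriv ^^ 2) (newman_kernel R T) 0 = of_real (T ^ 2 + 4 / R ^ 2)"
proof -
 define r where "r = inverse (of_real R ^ 2 :: complex)"
 define f where "f = (%z. exp (of_real T * z) * (1 + z\<^sup>2 * r)\<^sup>2)"
 define f' where "f' = (%z. exp (of_real T * z) * (of_real T * (1 + z\<^sup>2 * r)\<^sup>2 + 4 * r * z * (1 + z\<^sup>2 * r)))"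
 have k: "newman_kernel R T = f" by (simp add: newman_kernel_def f_def r_def divide_inverse fun_eq_iff)
 have 1: "(f has_field_derivative f' z) (at z)" for z
  unfolding f_def f'_def by (auto intro!: derivative_eq_intros simp: algebra_simps power2_eq_square)
 then have d: "deriv f = f'" by (intro ext DERIV_imp_deriv)
 have 2: "(f' has_field_derivative (of_real T ^ 2 + 4 * r)) (at 0)"
  unfolding f'_def by (auto intro!: derivative_eq_intros simp: algebra_simps power2_eq_square)
 show "newman_kernel R T 0 = 1" "deriv (newman_kernel R T) 0 = of_real T"
  unfolding k d by (auto simp: f_def f'_def)
 show "(deriv ^^ 2) (newman_kernel R T) 0 = of_real (T ^ 2 + 4 / R ^ 2)"
 proof -
  have "(deriv ^^ 2) f 0 = deriv (deriv f) 0" by (simp add: numeral_2_eq_2)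
  then show ?thesis unfolding k using DERIV_imp_deriv[OF 2] by (simp add: d r_def divide_inverse)
 qed
qed

lemma norm_newman_kernel_circle:
 assumes "norm z = R" "R > 0"
 shows "norm (newman_kernel R T z) = exp (T * Re z) * (2 * \<bar>Re z\<bar> / R)\<^sup>2"
proof -
 have "of_real R ^ 2 = z * cnj z" using assms complex_norm_square[of z] by simp
 moreover have z0: "z ~= 0" using assms by auto
 ultimately have "1 + z\<^sup>2 / of_real R ^ 2 = (cnj z + z) / cnj z" by (simp add: field_simps power2_eq_square)
 then have "norm (1 + z\<^sup>2 / of_real R ^ 2) = norm (z + cnj z) / R"
  using assms by (simp add: norm_divide add.commute)
 also have "norm (z + cnj z) = 2 * \<bar>Re z\<bar>" by (simp add: complex_add_cnj)
 finally show ?thesis by (simp add: newman_kernel_def norm_mult norm_power)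
qed

lemma norm_newman_kernel_le:
 assumes "norm z <= 3/2 * R" "R > 0"
 shows "norm (newman_kernel R T z) <= exp (T * Re z) * 16"
proof -
 have "norm (z\<^sup>2 / of_real R ^ 2) = (norm z / R)\<^sup>2" using assms by (simp add: norm_divide norm_power power_divide)
 also have "... <= (3/2)\<^sup>2" using assms by (intro power_mono) (auto simp: field_simps)
 finally have "norm (1 + z\<^sup>2 / of_real R ^ 2) <= 4"
  using norm_triangle_ineq[of 1 "z\<^sup>2 / of_real R ^ 2"] by (simp add: power2_eq_square)
 then have "norm ((1 + z\<^sup>2 / of_real R ^ 2)\<^sup>2) <= 4\<^sup>2" unfolding norm_power by (intro power_mono) auto
 then show ?thesis by (simp add: newman_kernel_def norm_mult mult_left_mono)
qed

text \<open>Primes are ordered by u = ln p, the variable in which p^(-it) is a pure oscillation of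
  frequency t.\<close>

definition prime_set :: "real => nat set" where
 "prime_set T = {p. prime p & ln (real p) <= T}"

lemma prime_set_subset: "prime_set T \<subseteq> {..nat \<lfloor>exp T\<rfloor>}"
proof
 fix p assume p: "p \<in> prime_set T"
 then have "real p > 0" by (simp add: prime_set_def prime_gt_0_nat)
 with p have "real p <= exp T" by (simp add: prime_set_def ln_ge_iff flip: ln_le_cancel_iff)
 then show "p \<in> {..nat \<lfloor>exp T\<rfloor>}" by (simp add: le_nat_floor)
qed

lemma finite_prime_set [simp]: "finite (prime_set T)"
 using prime_set_subset by (rule finite_subset) simp

context
 fixes H :: "complex => complex" and c C :: real
 assumes c: "c > 0" "c <= 1/8" and C: "C > 0"
  and F: "\<And>z. Re z > 0 ==> (%n. of_real (prime_ln n) * of_nat n powr (-1 - z)) sums (1 / z + H z)"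
  and H_hol: "\<And>R. R >= 1 ==> H holomorphic_on ({z. Re z > 0} \<union> {z. - c * R powr (-1/20) < Re z & \<bar>Im z\<bar> < R})"
  and H_le: "\<And>R z. R >= 1 ==> - c * R powr (-1/20) <= Re z ==> Re z <= 1 ==> \<bar>Im z\<bar> <= R ==> norm (H z) <= C * R powr (1/20)"
begin

lemma prime_series_real:
 assumes "0 < x" "x <= 1"
 shows "summable (%n. prime_ln n * real n powr (-1 - x))" "(\<Sum>n. prime_ln n * real n powr (-1 - x)) <= 1 / x + C"
proof -
 have e: "of_real (prime_ln n) * of_nat n powr (-1 - of_real x) = complex_of_real (prime_ln n * real n powr (-1 - x))" for n
  using powr_of_real[of "real n" "-1 - x"] by simp
 have s: "(%n. complex_of_real (prime_ln n * real n powr (-1 - x))) sums (1 / of_real x + H (of_real x))"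
  using F[of "of_real x"] assms by (simp add: e)
 then have s': "(%n. prime_ln n * real n powr (-1 - x)) sums (1 / x + Re (H (of_real x)))"
  using sums_Re[OF s] assms by (simp add: Re_divide_of_real)
 then show "summable (%n. prime_ln n * real n powr (-1 - x))" by (rule sums_summable)
 have "norm (H (of_real x)) <= C * 1 powr (1/20)"
  by (rule H_le) (use assms c in auto)
 then show "(\<Sum>n. prime_ln n * real n powr (-1 - x)) <= 1 / x + C"
  using s' complex_Re_le_cmod[of "H (of_real x)"] by (simp add: sums_iff)
qed

text \<open>Rankin's trick with exponent 1/T: e p^(-1/T) >= 1 whenever ln p <= T, and the completed
  series is controlled by its pole.\<close>

lemma prime_mertens_upper:
 assumes "T >= 1"
 shows "(\<Sum>p\<in>prime_set T. ln p / p) <= exp 1 * (T + C)"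
proof -
 note s = prime_series_real[of "1/T"]
 have "(\<Sum>p\<in>prime_set T. ln p / p) <= (\<Sum>p\<in>prime_set T. exp 1 * (prime_ln p * real p powr (-1 - 1/T)))"
 proof (rule sum_mono)
  fix p assume p: "p \<in> prime_set T"
  then have p1: "p > 0" "prime p" "ln p <= T" by (auto simp: prime_set_def prime_gt_0_nat)
  then have p0: "ln p >= 0" by simp
  have "real p powr (-1 - 1/T) = (1 / p) * exp (- (ln p / T))"
   using p1 by (simp add: powr_def powr_diff exp_diff exp_minus field_simps)
  moreover have "exp (- (ln p / T)) >= exp (-1)" using p1 assms by (simp add: field_simps)
  then have "exp 1 * exp (- (ln p / T)) >= 1" by (simp add: exp_minus field_simps)
  then have "ln p / p * 1 <= ln p / p * (exp 1 * exp (- (ln p / T)))" using p1 p0 by (intro mult_left_mono) auto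
  ultimately show "ln p / p <= exp 1 * (prime_ln p * real p powr (-1 - 1/T))"
   using p1 by (simp add: prime_ln_def mult_ac)
 qed
 also have "... = exp 1 * (\<Sum>p\<in>prime_set T. prime_ln p * real p powr (-1 - 1/T))"
  by (simp add: sum_distrib_left)
 also have "(\<Sum>p\<in>prime_set T. prime_ln p * real p powr (-1 - 1/T)) <= (\<Sum>n. prime_ln n * real n powr (-1 - 1/T))"
  using assms by (intro sum_le_suminf s) auto
 also have "... <= T + C" using s(2) assms by simp
 finally show ?thesis by simp
qed

text \<open>The bracket is the sum over ln p > T, and |p^(-z) e^(Tz)| = exp(-x (ln p - T)) with x =
  Re z. Lowering x to y = min x (1/T) only increases it; e^(yT) <= e then leaves a series bounded by
  1 / y + C.\<close>

lemma prime_tail_bound: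
 assumes T: "T >= 1" and z: "Re z > 0"
 shows "norm ((1 / z + H z - (\<Sum>p\<in>prime_set T. of_real (ln p) * of_nat p powr (-1 - z))) * exp (of_real T * z))
   <= exp 1 * (1 / Re z + T + C)"
proof -
 define x where "x = Re z"
 define y where "y = min x (1 / T)"
 have y: "0 < y" "y <= 1" "y <= x" "y <= 1/T" using z T by (auto simp: y_def x_def intro: min.coboundedI2)
 note s = prime_series_real[OF y(1,2)]
 define f where "f n = (if n \<in> prime_set T then 0 else of_real (prime_ln n) * of_nat n powr (-1 - z))" for n
 have "(%n. if n \<in> prime_set T then of_real (prime_ln n) * of_nat n powr (-1 - z) else 0) sums
   (\<Sum>p\<in>prime_set T. of_real (prime_ln p) * of_nat p powr (-1 - z))"
  by (rule sums_If_finite_set) simp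
 then have "(%n. of_real (prime_ln n) * of_nat n powr (-1 - z) - (if n \<in> prime_set T then of_real (prime_ln n) * of_nat n powr (-1 - z) else 0))
   sums (1 / z + H z - (\<Sum>p\<in>prime_set T. of_real (prime_ln p) * of_nat p powr (-1 - z)))"
  by (intro sums_diff F z)
 also have "(%n. of_real (prime_ln n) * of_nat n powr (-1 - z) - (if n \<in> prime_set T then of_real (prime_ln n) * of_nat n powr (-1 - z) else 0)) = f"
  by (auto simp: f_def)
 also have "(\<Sum>p\<in>prime_set T. of_real (prime_ln p) * of_nat p powr (-1 - z)) = (\<Sum>p\<in>prime_set T. of_real (ln p) * of_nat p powr (-1 - z))"
  by (intro sum.cong) (auto simp: prime_ln_def prime_set_def)
 finally have "(%n. f n * exp (of_real T * z)) sums
   ((1 / z + H z - (\<Sum>p\<in>prime_set T. of_real (ln p) * of_nat p powr (-1 - z))) * exp (of_real T * z))"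
  by (rule sums_mult2)
 moreover have "(%n. exp 1 * (prime_ln n * real n powr (-1 - y))) sums (exp 1 * (\<Sum>n. prime_ln n * real n powr (-1 - y)))"
  by (intro sums_mult summable_sums s)
 moreover have "norm (f n * exp (of_real T * z)) <= exp 1 * (prime_ln n * real n powr (-1 - y))" for n
 proof (cases "prime n & n \<notin> prime_set T")
  case True
  then have n: "n > 0" "ln n > T" by (auto simp: prime_set_def prime_gt_0_nat)
  have "norm (of_nat n powr (-1 - z) * exp (of_real T * z)) = exp (- ln n) * exp (- x * (ln n - T))"
   using n by (simp add: norm_mult norm_nat_powr powr_def x_def algebra_simps flip: exp_add)
  also have "... <= exp (- ln n) * exp (- y * (ln n - T))"
   using n y by (intro mult_left_mono) (auto intro!: mult_right_mono)
  also have "... = exp (y * T) * (exp (- ln n) * exp (- y * ln n))"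
   by (simp add: algebra_simps flip: exp_add)
  also have "exp (- ln n) * exp (- y * ln n) = real n powr (-1 - y)"
   using n by (simp add: powr_def algebra_simps flip: exp_add)
  also have "exp (y * T) * real n powr (-1 - y) <= exp 1 * real n powr (-1 - y)"
   using y T by (intro mult_right_mono) (auto simp: field_simps)
  finally have "prime_ln n * norm (of_nat n powr (-1 - z) * exp (of_real T * z)) <= prime_ln n * (exp 1 * real n powr (-1 - y))"
   by (intro mult_left_mono) auto
  moreover have "norm (f n * exp (of_real T * z)) = prime_ln n * norm (of_nat n powr (-1 - z) * exp (of_real T * z))"
   using True by (simp add: f_def norm_mult)
  ultimately show ?thesis by (simp add: mult_ac)
 qed (use prime_ln_nonneg[of n] in \<open>auto simp: f_def prime_ln_def intro!: mult_nonneg_nonneg\<close>)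
 ultimately have "norm ((1 / z + H z - (\<Sum>p\<in>prime_set T. of_real (ln p) * of_nat p powr (-1 - z))) * exp (of_real T * z))
   <= exp 1 * (\<Sum>n. prime_ln n * real n powr (-1 - y))"
  by (rule norm_sums_le)
 also have "... <= exp 1 * (1 / y + C)" by (intro mult_left_mono s) auto
 also have "1 / y <= 1 / x + T" using z T by (auto simp: y_def x_def min_def)
 finally show ?thesis by (simp add: x_def)
qed

text \<open>At the double pole 0 the kernel turns the finite sum \<open>F1\<close> into the smoothed
  sum with weights T - ln p, the term 1 / z into T^2 / 2 + 2 / R^2, and H into T H(0) + H'(0).
  \<open>F1\<close> and 1 / z can be integrated over the full circle, whereas H is available only on
  the right and close to the imaginary axis, so its contour is closed by a thin rectangle.\<close>

lemma newman_bound: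
 fixes T R :: real
 defines "\<Delta> \<equiv> of_real ((\<Sum>p\<in>prime_set T. ln p / p * (T - ln p)) - T ^ 2 / 2 - 2 / R ^ 2) - (of_real T * H 0 + deriv H 0)"
 defines "l \<equiv> c / 2 * (2 * R) powr (-1/20)"
 assumes T: "T >= 1" and R: "R >= 1"
 shows "norm \<Delta> <= 200 * (1 + T + C) / R + 500 * C / R + 500 * C * R ^ 2 * exp (- l * T) / l ^ 2"
proof -
 define F1 where "F1 z = (\<Sum>p\<in>prime_set T. of_real (ln p) * of_nat p powr (-1 - z))" for z :: complex
 define K where "K = newman_kernel R T"
 define S where "S = {z. Re z > 0} \<union> {z. - c * (2 * R) powr (-1/20) < Re z & \<bar>Im z\<bar> < 2 * R}"
 have R0: "R > 0" using R by simp
 have l: "0 < l" "l <= 1/16"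
 proof -
  have "(2 * R) powr (-1/20) <= 1" using R powr_mono[of "-1/20" 0 "2 * R"] by simp
  then have "c * (2 * R) powr (-1/20) <= 1/8 * 1" using c by (intro mult_mono) auto
  then show "0 < l" "l <= 1/16" using c R by (auto simp: l_def)
 qed
 \<comment> \<open>On the left the domain \<open>S\<close> has depth 2 l and height 2 R, so a
   contour of depth l and height R stays inside.\<close>
 have lS: "c * (2 * R) powr (-1/20) = 2 * l" by (simp add: l_def)
 have H_S: "H holomorphic_on S" unfolding S_def by (rule H_hol) (use R in simp)
 have openS: "open S" unfolding S_def
  by (intro open_Un open_Collect_conj open_Collect_less continuous_intros)
 have starS: "starlike S"
  unfolding starlike_def
 proof (intro bexI ballI subsetI)
  show "1 \<in> S" by (simp add: S_def)
  fix z w assume z: "z \<in> S" and w: "w \<in> closed_segment 1 z"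
  then obtain u where u: "0 <= u" "u <= 1" "w = (1 - u) *\<^sub>R 1 + u *\<^sub>R z" by (auto simp: in_segment)
  have w': "Re w = 1 - u + u * Re z" "Im w = u * Im z" by (auto simp: u)
  show "w \<in> S"
  proof (cases "Re z > 0")
   case True
   then have "Re w > 0" using u unfolding w' by (cases "u = 0") (auto intro: add_nonneg_pos)
   then show ?thesis by (simp add: S_def)
  next
   case False
   then have zz: "- 2 * l < Re z" "\<bar>Im z\<bar> < 2 * R" using z lS by (auto simp: S_def)
   have "u * Re z >= 1 * Re z" using False u by (intro mult_right_mono_neg) auto
   then have "- 2 * l < Re w" using zz u unfolding w' by linarith
   moreover have "\<bar>Im w\<bar> <= 1 * \<bar>Im z\<bar>" unfolding w' abs_mult using u by (intro mult_right_mono) auto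
   ultimately show ?thesis using zz lS by (simp add: S_def)
  qed
 qed
 have S0: "0 \<in> S" using lS l R by (simp add: S_def)
 define Cp where "Cp = part_circlepath 0 R (- (pi/2)) (pi/2)"
 define Cl where "Cl = part_circlepath 0 R (pi/2) (3/2 * pi)"
 define L1 where "L1 = linepath (Complex 0 R) (Complex (-l) R)"
 define L2 where "L2 = linepath (Complex (-l) R) (Complex (-l) (-R))"
 define L3 where "L3 = linepath (Complex (-l) (-R)) (Complex 0 (-R))"
 define Cm where "Cm = L1 +++ L2 +++ L3"
 have arc: "of_real R * exp (\<i> * of_real t) = Complex (R * cos t) (R * sin t)" for t
  by (simp add: complex_eq_iff flip: cis_conv_exp)
 have sc: "cos (3 * pi / 2) = 0" "sin (3 * pi / 2) = -1"
  using cos_3over2_pi sin_3over2_pi by (simp_all only: times_divide_eq_left)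
 have iR: "\<i> * of_real R = Complex 0 R" "- \<i> * of_real R = Complex 0 (-R)" by (simp_all add: complex_eq_iff)
 have ends: "pathstart Cp = Complex 0 (-R)" "pathfinish Cp = Complex 0 R"
  "pathstart Cl = Complex 0 R" "pathfinish Cl = Complex 0 (-R)"
  "pathstart Cm = Complex 0 R" "pathfinish Cm = Complex 0 (-R)"
  unfolding Cp_def Cl_def Cm_def L1_def L2_def L3_def pathstart_part_circlepath pathfinish_part_circlepath arc
  by (simp_all add: sc cos_minus sin_minus)
 have vp: "valid_path Cp" "valid_path Cl" "valid_path L1" "valid_path L2" "valid_path L3" "valid_path Cm"
  unfolding Cp_def Cl_def Cm_def L1_def L2_def L3_def by (auto intro!: valid_path_join)
 have imCp: "norm z = R" "Re z >= 0" "Re z = 0 ==> z \<in> {Complex 0 R, Complex 0 (-R)}" if z: "z \<in> path_image Cp" for z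
 proof -
  show nz: "norm z = R" using z in_path_image_part_circlepath[of z 0 R "-(pi/2)" "pi/2"] R0 by (simp add: Cp_def)
  obtain t where t: "- (pi/2) <= t" "t <= pi/2" "z = 0 + of_real R * exp (\<i> * of_real t)"
   using z unfolding Cp_def by (subst (asm) path_image_part_circlepath) auto
  have "Re z = R * cos t" using t(3) arc by simp
  then show "Re z >= 0" using t cos_ge_zero R0 by simp
  assume "Re z = 0"
  then have "\<bar>Im z\<bar> = R" using nz by (simp add: cmod_eq_Im)
  then show "z \<in> {Complex 0 R, Complex 0 (-R)}" using \<open>Re z = 0\<close> by (auto simp: complex_eq_iff abs_if split: if_splits)
 qed
 have imCl: "norm z = R" "Re z <= 0" if z: "z \<in> path_image Cl" for z
 proof -
  show nz: "norm z = R" using z in_path_image_part_circlepath[of z 0 R "pi/2" "3/2*pi"] R0 by (simp add: Cl_def)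
  obtain t where t: "pi/2 <= t" "t <= 3/2*pi" "z = 0 + of_real R * exp (\<i> * of_real t)"
   using z unfolding Cl_def by (subst (asm) path_image_part_circlepath) auto
  have "Re z = R * cos t" using t(3) arc by simp
  moreover have "cos (t - pi) >= 0" using t by (intro cos_ge_zero) auto
  then have "cos t <= 0" by (simp add: cos_diff)
  ultimately show "Re z <= 0" using R0 by (simp add: mult_nonneg_nonpos)
 qed
 have piCm: "path_image Cm = path_image L1 \<union> path_image L2 \<union> path_image L3"
  unfolding Cm_def by (simp add: path_image_join L1_def L2_def L3_def Un_assoc)
 have imL1: "Im z = R" "- l <= Re z" "Re z <= 0" if "z \<in> path_image L1" for z
  using that l by (auto simp: L1_def closed_segment_same_Im closed_segment_eq_real_ivl)
 have imL3: "Im z = - R" "- l <= Re z" "Re z <= 0" if "z \<in> path_image L3" for z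
  using that l by (auto simp: L3_def closed_segment_same_Im closed_segment_eq_real_ivl)
 have imL2: "Re z = - l" "\<bar>Im z\<bar> <= R" if "z \<in> path_image L2" for z
  using that R0 by (auto simp: L2_def closed_segment_same_Re closed_segment_eq_real_ivl)
 have imCm: "Im z = 0 ==> Re z < 0" "z \<in> S" "z ~= 0" if z: "z \<in> path_image Cm" for z
 proof -
  have *: "(Im z = R \<or> Im z = - R \<or> Re z = - l) & - l <= Re z & \<bar>Im z\<bar> <= R"
   using z l R0 imL1[of z] imL2[of z] imL3[of z] unfolding piCm by auto
  then show "z \<in> S" "z ~= 0" using l R0 lS by (auto simp: S_def)
  show "Re z < 0" if "Im z = 0" using * that l R0 by auto
 qed
 have S_Cp: "z \<in> S" if "z \<in> path_image Cp" for z
 proof -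
  have "\<bar>Im z\<bar> <= R" using abs_Im_le_cmod[of z] imCp(1)[OF that] by simp
  then show ?thesis using imCp(2)[OF that] l lS R0 by (auto simp: S_def)
 qed
 have Cp_right: "Im z = 0 ==> Re z > 0" if "z \<in> path_image Cp" for z
  using imCp(1,2)[OF that] R0 by (metis cmod_eq_Re abs_of_nonneg)
 have Cl_left: "Im z = 0 ==> Re z < 0" if "z \<in> path_image Cl" for z
  using imCl[OF that] R0 by (metis cmod_eq_Re abs_of_nonpos neg_0_less_iff_less)
 have w1: "winding_number (Cp +++ Cl) 0 = 1"
  by (rule winding_number_join_1[OF R0 vp(1) _ _ Cp_right vp(2) _ _ Cl_left]) (simp_all only: ends iR)
 have w2: "winding_number (Cp +++ Cm) 0 = 1"
  by (rule winding_number_join_1[OF R0 vp(1) _ _ Cp_right vp(6) _ _ imCm(1)]) (simp_all only: ends iR)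
 have nz: "0 \<notin> path_image Cp" "0 \<notin> path_image Cl" "0 \<notin> path_image Cm"
  using imCp(1)[of 0] imCl(1)[of 0] imCm(3)[of 0] R0 by auto
 have "path_image (Cp +++ Cl) = path_image Cp \<union> path_image Cl" "path_image (Cp +++ Cm) = path_image Cp \<union> path_image Cm"
  by (rule path_image_join; simp add: ends)+
 then have pi1: "path_image (Cp +++ Cl) \<subseteq> UNIV - {0}" and pi2: "path_image (Cp +++ Cm) \<subseteq> S - {0}"
  using nz S_Cp imCm(2) by auto
 have F1_hol [holomorphic_intros]: "F1 holomorphic_on A" for A
  unfolding F1_def by (intro holomorphic_intros) (auto simp: prime_set_def prime_gt_0_nat)
 have K_hol [holomorphic_intros]: "K holomorphic_on A" for A
  unfolding K_def by (rule newman_kernel_holomorphic)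
 have v1: "valid_path (Cp +++ Cl)" "pathfinish (Cp +++ Cl) = pathstart (Cp +++ Cl)"
  using vp ends by auto
 have v2: "valid_path (Cp +++ Cm)" "pathfinish (Cp +++ Cm) = pathstart (Cp +++ Cm)"
  using vp ends by auto
 have int1: "contour_integral (Cp +++ Cl) (%z. F1 z * K z / z ^ 2) =
   2 * of_real pi * \<i> * of_real (\<Sum>p\<in>prime_set T. ln p / p * (T - ln p))"
 proof -
  \<comment> \<open>The factor p^(-z) only shifts T to T - ln p in the kernel, whose derivative at 0
    is then the weight.\<close>
  have eq: "F1 z * K z = (\<Sum>p\<in>prime_set T. of_real (ln p / p) * newman_kernel R (T - ln p) z)" for z
  proof -
   have "of_real (ln p) * of_nat p powr (-1 - z) * K z = of_real (ln p / p) * newman_kernel R (T - ln p) z"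
    if "p \<in> prime_set T" for p
   proof -
    have p: "p > 0" using that by (simp add: prime_set_def prime_gt_0_nat)
    then have "of_nat p powr (-1 - z) = exp (- of_real (ln p) * z) / of_nat p"
    proof -
     have "of_nat p powr (-1 - z) = exp (- of_real (ln p)) * exp (- of_real (ln p) * z)"
      using p by (simp add: powr_def Ln_of_nat algebra_simps flip: exp_add)
     moreover have "exp (- of_real (ln p)) = 1 / (of_nat p :: complex)"
      using p by (simp add: exp_minus exp_of_real divide_inverse)
     ultimately show ?thesis by simp
    qed
    moreover have "exp (of_real T * z) * exp (- of_real (ln p) * z) = exp (of_real (T - ln p) * z)"
     by (simp add: algebra_simps flip: exp_add)
    ultimately show ?thesis
     unfolding K_def newman_kernel_def by (simp add: mult_ac)
   qed
   then show ?thesis by (simp add: F1_def sum_distrib_right)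
  qed
  have der: "deriv (%z. F1 z * K z) 0 = (\<Sum>p\<in>prime_set T. of_real (ln p / p) * of_real (T - ln p))"
  proof (rule DERIV_imp_deriv)
   have "(newman_kernel R t has_field_derivative of_real t) (at 0)" for t
    using newman_kernel_holomorphic[of R t UNIV] newman_kernel_derivs(2)[of R t]
    by (metis UNIV_I holomorphic_derivI open_UNIV)
   then show "((%z. F1 z * K z) has_field_derivative (\<Sum>p\<in>prime_set T. of_real (ln p / p) * of_real (T - ln p))) (at 0)"
    unfolding eq by (intro DERIV_sum DERIV_cmult)
  qed
  have "contour_integral (Cp +++ Cl) (%z. F1 z * K z / z ^ Suc 1) =
   2 * of_real pi * \<i> * ((deriv ^^ 1) (%z. F1 z * K z) 0 / fact 1)"
   by (rule contour_integral_pole[OF open_UNIV _ UNIV_I _ v1 pi1 w1]) (auto intro!: holomorphic_intros simp: starlike_UNIV)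
  then show ?thesis using der by (simp add: numeral_2_eq_2)
 qed
 have int2: "contour_integral (Cp +++ Cl) (%z. K z / z ^ 3) = 2 * of_real pi * \<i> * of_real (T ^ 2 / 2 + 2 / R ^ 2)"
 proof -
  have "contour_integral (Cp +++ Cl) (%z. K z / z ^ Suc 2) = 2 * of_real pi * \<i> * ((deriv ^^ 2) K 0 / fact 2)"
   by (rule contour_integral_pole[OF open_UNIV _ UNIV_I _ v1 pi1 w1]) (auto intro!: holomorphic_intros simp: starlike_UNIV)
  also have "(deriv ^^ 2) K 0 / fact 2 = of_real (T ^ 2 / 2 + 2 / R ^ 2)"
   unfolding K_def newman_kernel_derivs(3) by (simp add: add_divide_distrib fact_2)
  finally show ?thesis by (simp add: numeral_3_eq_3 numeral_2_eq_2)
 qed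
 have int3: "contour_integral (Cp +++ Cm) (%z. H z * K z / z ^ 2) = 2 * of_real pi * \<i> * (of_real T * H 0 + deriv H 0)"
 proof -
  have "contour_integral (Cp +++ Cm) (%z. H z * K z / z ^ Suc 1) = 2 * of_real pi * \<i> * ((deriv ^^ 1) (%z. H z * K z) 0 / fact 1)"
   by (rule contour_integral_pole[OF openS starS S0 _ v2 pi2 w2]) (intro holomorphic_intros H_S)
  moreover have "deriv (%z. H z * K z) 0 = of_real T * H 0 + deriv H 0"
  proof (rule DERIV_imp_deriv)
   have "(H has_field_derivative deriv H 0) (at 0)" by (rule holomorphic_derivI[OF H_S openS S0])
   moreover have "(K has_field_derivative of_real T) (at 0)"
    using newman_kernel_holomorphic[of R T UNIV] newman_kernel_derivs(2)[of R T]
    unfolding K_def by (metis UNIV_I holomorphic_derivI open_UNIV)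
   moreover have "K 0 = 1" by (simp add: K_def newman_kernel_derivs)
   ultimately show "((%z. H z * K z) has_field_derivative of_real T * H 0 + deriv H 0) (at 0)"
    by (auto intro!: derivative_eq_intros simp: mult.commute)
  qed
  ultimately show ?thesis by (simp add: numeral_2_eq_2)
 qed
 have i_F1: "(%z. F1 z * K z / z ^ 2) contour_integrable_on p" "(%z. K z / z ^ 3) contour_integrable_on p"
  if "valid_path p" "0 \<notin> path_image p" for p
  by (rule contour_integrable_holomorphic_simple[of _ "- {0}"]; use that in \<open>auto intro!: holomorphic_intros\<close>)+
 have i_H: "(%z. H z * K z / z ^ 2) contour_integrable_on p" if "valid_path p" "path_image p \<subseteq> S - {0}" for p
  by (rule contour_integrable_holomorphic_simple[of _ "S - {0}"])
   (use that openS in \<open>auto intro!: holomorphic_intros open_delete holomorphic_on_subset[OF H_S]\<close>)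
 have subS: "path_image Cp \<subseteq> S - {0}" "path_image Cm \<subseteq> S - {0}" "path_image L1 \<subseteq> S - {0}" "path_image L2 \<subseteq> S - {0}" "path_image L3 \<subseteq> S - {0}"
  using S_Cp nz imCm piCm by auto
 \<comment> \<open>On the common right arc the three integrands combine into minus the tail of the
   prime series; on the left arc \<open>F1\<close> and 1 / z are estimated without H; the rectangle
   carries H alone.\<close>
 define I1 where "I1 = contour_integral Cp (%z. F1 z * K z / z ^ 2 - K z / z ^ 3 - H z * K z / z ^ 2)"
 define I2 where "I2 = contour_integral Cl (%z. F1 z * K z / z ^ 2 - K z / z ^ 3)"
 define I3 where "I3 = contour_integral Cm (%z. H z * K z / z ^ 2)"
 have e1: "I1 = contour_integral Cp (%z. F1 z * K z / z ^ 2) - contour_integral Cp (%z. K z / z ^ 3) - contour_integral Cp (%z. H z * K z / z ^ 2)"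
  unfolding I1_def using vp(1) nz(1) subS(1) by (simp add: contour_integral_diff contour_integrable_diff i_F1 i_H)
 have e2: "I2 = contour_integral Cl (%z. F1 z * K z / z ^ 2) - contour_integral Cl (%z. K z / z ^ 3)"
  unfolding I2_def using vp(2) nz(2) by (simp add: contour_integral_diff i_F1)
 have "2 * of_real pi * \<i> * \<Delta> = I1 + I2 - I3"
 proof -
  have j1: "contour_integral (Cp +++ Cl) (%z. F1 z * K z / z ^ 2) = contour_integral Cp (%z. F1 z * K z / z ^ 2) + contour_integral Cl (%z. F1 z * K z / z ^ 2)"
   by (rule contour_integral_join) (use vp nz i_F1 in auto)
  have j2: "contour_integral (Cp +++ Cl) (%z. K z / z ^ 3) = contour_integral Cp (%z. K z / z ^ 3) + contour_integral Cl (%z. K z / z ^ 3)"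
   by (rule contour_integral_join) (use vp nz i_F1 in auto)
  have j3: "contour_integral (Cp +++ Cm) (%z. H z * K z / z ^ 2) = contour_integral Cp (%z. H z * K z / z ^ 2) + I3"
   unfolding I3_def by (rule contour_integral_join) (use vp subS i_H in auto)
  have "I1 + I2 - I3 = 2 * of_real pi * \<i> * of_real (\<Sum>p\<in>prime_set T. ln p / p * (T - ln p)) - 2 * of_real pi * \<i> * of_real (T ^ 2 / 2 + 2 / R ^ 2)
    - 2 * of_real pi * \<i> * (of_real T * H 0 + deriv H 0)"
   using e1 e2 j1 j2 j3 int1 int2 int3 by simp
  also have "... = 2 * of_real pi * \<i> * \<Delta>"
   unfolding \<Delta>_def by (simp only: of_real_diff of_real_add ring_distribs) simp
  finally show ?thesis by simp
 qed
 then have "norm (2 * of_real pi * \<i> * \<Delta>) <= norm I1 + norm I2 + norm I3"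
  using norm_triangle_ineq4[of "I1 + I2" I3] norm_triangle_ineq[of I1 I2] by simp
 moreover have "1 * norm \<Delta> <= (2 * pi) * norm \<Delta>"
  using pi_gt3 by (intro mult_right_mono) auto
 ultimately have \<Delta>: "norm \<Delta> <= norm I1 + norm I2 + norm I3"
  by (simp add: norm_mult)
 have e3: "exp 1 <= (3::real)" by (rule exp_le)
 have pi4: "pi <= 4" using pi_less_4 by simp
 have b1: "norm I1 <= 16 * (exp 1 * (1 + T + C)) / R"
 proof -
  let ?B = "4 * (exp 1 * (1 + T + C)) / R ^ 2"
  have "norm I1 <= ?B * R * (pi/2 - - (pi/2))"
   unfolding I1_def Cp_def
  \<comment> \<open>The end points of the arc are excepted because \<open>prime_tail_bound\<close>
    needs Re z > 0.\<close>
  proof (rule contour_integral_bound_part_circlepath_strong[where k = "{Complex 0 R, Complex 0 (-R)}"])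
   show "(%z. F1 z * K z / z ^ 2 - K z / z ^ 3 - H z * K z / z ^ 2) contour_integrable_on part_circlepath 0 R (-(pi/2)) (pi/2)"
    using i_F1[OF vp(1) nz(1)] i_H[OF vp(1) subS(1)] unfolding Cp_def by (intro contour_integrable_diff)
   fix z assume "z \<in> path_image (part_circlepath 0 R (-(pi/2)) (pi/2)) - {Complex 0 R, Complex 0 (-R)}"
   then have z: "norm z = R" "Re z > 0" using imCp[of z] by (force simp: Cp_def)+
   define x where "x = Re z"
   have x: "x > 0" "x <= R" using z complex_Re_le_cmod[of z] by (auto simp: x_def)
   have z0: "z ~= 0" using z R0 by auto
   have "f * (E * Q) / z ^ 2 - E * Q / z ^ 3 - h * (E * Q) / z ^ 2 = - ((1 / z + h - f) * E) * Q / z ^ 2" for f E Q h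
    using z0 by (simp add: field_simps power2_eq_square power3_eq_cube)
   then have "F1 z * K z / z ^ 2 - K z / z ^ 3 - H z * K z / z ^ 2 = - ((1 / z + H z - F1 z) * exp (of_real T * z)) * (1 + z\<^sup>2 / of_real R ^ 2)\<^sup>2 / z ^ 2"
    unfolding K_def newman_kernel_def .
   then have "norm (F1 z * K z / z ^ 2 - K z / z ^ 3 - H z * K z / z ^ 2) =
     norm ((1 / z + H z - F1 z) * exp (of_real T * z)) * norm ((1 + z\<^sup>2 / of_real R ^ 2)\<^sup>2) / R ^ 2"
    using z by (simp add: norm_mult norm_divide norm_power)
   also have "norm ((1 + z\<^sup>2 / of_real R ^ 2)\<^sup>2) = (2 * x / R)\<^sup>2"
    using norm_newman_kernel_circle[OF z(1) R0, of 0] x by (simp add: newman_kernel_def x_def)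
   also have "norm ((1 / z + H z - F1 z) * exp (of_real T * z)) * (2 * x / R)\<^sup>2 / R ^ 2 <= (exp 1 * (1 / x + T + C)) * (2 * x / R)\<^sup>2 / R ^ 2"
    using prime_tail_bound[OF T, of z] z by (intro divide_right_mono mult_right_mono) (auto simp: F1_def x_def)
   also have "... = 4 * exp 1 * (x + (T + C) * x ^ 2) / R ^ 2 / R ^ 2"
    using x by (simp add: field_simps power2_eq_square)
   also have "... <= 4 * exp 1 * (R ^ 2 + (T + C) * R ^ 2) / R ^ 2 / R ^ 2"
   proof (intro divide_right_mono mult_left_mono add_mono power_mono)
    have "x <= R * 1" using x by simp
    also have "... <= R ^ 2" using R unfolding power2_eq_square by (intro mult_left_mono) auto
    finally show "x <= R ^ 2" .
   qed (use x T C in auto)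
   also have "... = ?B" using R0 by (simp add: field_simps)
   finally show "norm (F1 z * K z / z ^ 2 - K z / z ^ 3 - H z * K z / z ^ 2) <= ?B" .
  qed (use R0 T C in auto)
  also have "... = 4 * (exp 1 * (1 + T + C)) / R * pi" using R0 by (simp add: power2_eq_square)
  also have "... <= 4 * (exp 1 * (1 + T + C)) / R * 4" using R0 T C pi4 by (intro mult_left_mono) auto
  finally show ?thesis by simp
 qed
 have b2: "norm I2 <= 16 * (exp 1 * (1 + T + C)) / R"
 proof -
  let ?B = "4 * (exp 1 * (1 + T + C)) / R ^ 2"
  have "norm I2 <= ?B * R * (3/2*pi - pi/2)"
   unfolding I2_def Cl_def
  proof (rule contour_integral_bound_part_circlepath_strong[where k = "{}"])
   show "(%z. F1 z * K z / z ^ 2 - K z / z ^ 3) contour_integrable_on part_circlepath 0 R (pi/2) (3/2*pi)"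
    using i_F1[OF vp(2) nz(2)] unfolding Cl_def by (intro contour_integrable_diff)
   fix z assume "z \<in> path_image (part_circlepath 0 R (pi/2) (3/2*pi)) - {}"
   then have z: "norm z = R" "Re z <= 0" using imCl[of z] by (auto simp: Cl_def)
   define x where "x = - Re z"
   have x: "x >= 0" "x <= R" using z abs_Re_le_cmod[of z] by (auto simp: x_def)
   have z0: "z ~= 0" using z R0 by auto
   have "f * (E * Q) / z ^ 2 - E * Q / z ^ 3 = (f * E - E / z) * Q / z ^ 2" for f E Q
    using z0 by (simp add: field_simps power2_eq_square power3_eq_cube)
   then have "F1 z * K z / z ^ 2 - K z / z ^ 3 = (F1 z * exp (of_real T * z) - exp (of_real T * z) / z) * (1 + z\<^sup>2 / of_real R ^ 2)\<^sup>2 / z ^ 2"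
    unfolding K_def newman_kernel_def .
   then have "norm (F1 z * K z / z ^ 2 - K z / z ^ 3) =
     norm (F1 z * exp (of_real T * z) - exp (of_real T * z) / z) * norm ((1 + z\<^sup>2 / of_real R ^ 2)\<^sup>2) / R ^ 2"
    using z by (simp add: norm_mult norm_divide norm_power)
   also have "norm ((1 + z\<^sup>2 / of_real R ^ 2)\<^sup>2) = (2 * x / R)\<^sup>2"
    using norm_newman_kernel_circle[OF z(1) R0, of 0] z by (simp add: newman_kernel_def x_def)
   also have "norm (F1 z * exp (of_real T * z) - exp (of_real T * z) / z) * (2 * x / R)\<^sup>2 / R ^ 2 <= (exp 1 * (1 + T + C)) * 2\<^sup>2 / R ^ 2"
   proof (intro divide_right_mono mult_mono power_mono)
    have "norm (F1 z * exp (of_real T * z)) <= (\<Sum>p\<in>prime_set T. ln p / p)"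
     unfolding F1_def sum_distrib_right
    proof (rule sum_norm_le)
     fix p assume p: "p \<in> prime_set T"
     then have p1: "p > 0" "ln p <= T" "ln p >= 0" by (auto simp: prime_set_def prime_gt_0_nat Suc_leI)
     have "norm (of_nat p powr (-1 - z) * exp (of_real T * z)) = (1 / p) * exp (- x * (T - ln p))"
     proof -
      have "real p powr (-1 - Re z) = exp (- ln p) * exp (x * ln p)"
       using p1 by (simp add: powr_def x_def algebra_simps flip: exp_add)
      moreover have "exp (- ln (real p)) = 1 / p" using p1 by (simp add: exp_minus divide_inverse)
      moreover have "exp (x * ln p) * exp (T * Re z) = exp (- x * (T - ln p))"
       by (simp add: x_def algebra_simps flip: exp_add)
      ultimately show ?thesis using p1 by (simp add: norm_mult norm_nat_powr)
     qed
     also have "... <= (1 / p) * 1" using p1 x by (intro mult_left_mono) (auto simp: mult_nonneg_nonneg)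
     finally have "ln p * norm (of_nat p powr (-1 - z) * exp (of_real T * z)) <= ln p * (1 / p * 1)"
      using p1 by (intro mult_left_mono) auto
     then show "norm (of_real (ln p) * of_nat p powr (-1 - z) * exp (of_real T * z)) <= ln p / p"
      using p1 by (simp add: norm_mult mult.assoc)
    qed
    also have "... <= exp 1 * (T + C)" by (rule prime_mertens_upper[OF T])
    finally have 1: "norm (F1 z * exp (of_real T * z)) <= exp 1 * (T + C)" .
    have "norm (exp (of_real T * z) / z) = exp (- (T * x)) / R" using z by (simp add: norm_divide x_def)
    also have "... <= 1 / 1" using x T R by (intro frac_le) auto
    finally have "norm (exp (of_real T * z) / z) <= exp 1 * 1" using exp_ge_add_one_self[of 1] by simp
    then show "norm (F1 z * exp (of_real T * z) - exp (of_real T * z) / z) <= exp 1 * (1 + T + C)"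
     using 1 norm_triangle_ineq4[of "F1 z * exp (of_real T * z)" "exp (of_real T * z) / z"] by (simp add: algebra_simps)
    show "2 * x / R <= 2" using x R0 by (simp add: field_simps)
   qed (use x T C R0 in auto)
   also have "... = ?B" by simp
   finally show "norm (F1 z * K z / z ^ 2 - K z / z ^ 3) <= ?B" .
  qed (use R0 T C in auto)
  also have "... = 4 * (exp 1 * (1 + T + C)) / R * pi" using R0 by (simp add: power2_eq_square)
  also have "... <= 4 * (exp 1 * (1 + T + C)) / R * 4" using R0 T C pi4 by (intro mult_left_mono) auto
  finally show ?thesis by simp
 qed
 have R20: "(2 * R) powr (1/20) <= 2 * R" using R powr_mono[of "1/20" 1 "2 * R"] by simp
 have Hb: "norm (H z) <= C * (2 * R)" if "- l <= Re z" "Re z <= 0" "\<bar>Im z\<bar> <= R" for z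
 proof -
  have "norm (H z) <= C * (2 * R) powr (1/20)"
   by (rule H_le) (use that R lS l in auto)
  also have "... <= C * (2 * R)" using R20 C by (intro mult_left_mono) auto
  finally show ?thesis .
 qed
 have Kb: "norm (K z) <= exp (T * Re z) * 16" if "- l <= Re z" "Re z <= 0" "\<bar>Im z\<bar> <= R" for z
  unfolding K_def
 proof (rule norm_newman_kernel_le[OF _ R0])
  show "norm z <= 3/2 * R" using cmod_le[of z] that l R by linarith
 qed
 have R20': "(2 * R) powr (1/20) <= 2 * R powr (1/20)"
 proof -
  have "(2 * R) powr (1/20) = 2 powr (1/20) * R powr (1/20)" using R by (simp add: powr_mult)
  also have "... <= 2 * R powr (1/20)" using powr_mono[of "1/20" 1 "2::real"] by (intro mult_right_mono) auto
  finally show ?thesis .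
 qed
 \<comment> \<open>The horizontal sides have length at most 1, and on them |H| <= 2 C R, |K| <= 16
   and |z| >= R.\<close>
 have bh: "norm i <= 32 * C / R" if i: "((%z. H z * K z / z ^ 2) has_contour_integral i) (linepath a b)"
  and ab: "norm (b - a) <= 1" and seg: "\<And>z. z \<in> closed_segment a b ==> \<bar>Im z\<bar> = R & - l <= Re z & Re z <= 0" for a b i
 proof -
  have "norm i <= (32 * C / R) * norm (b - a)"
  proof (rule has_contour_integral_bound_linepath[OF i])
   fix z assume z: "z \<in> closed_segment a b"
   note s = seg[OF z]
   have "norm z >= R" using abs_Im_le_cmod[of z] s by simp
   then have zR: "norm z ^ 2 >= R ^ 2" using R0 by (intro power_mono) auto
   have "norm (K z) <= exp (T * Re z) * 16" using Kb s by simp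
   also have "... <= 1 * 16" using s T by (intro mult_right_mono) (auto simp: mult_nonneg_nonpos)
   finally have "norm (H z * K z / z ^ 2) <= (C * (2 * R)) * (1 * 16) / R ^ 2"
    unfolding norm_mult norm_divide norm_power using Hb[of z] s zR C R0
    by (intro frac_le mult_mono) auto
   also have "... = 32 * C / R" using R0 by (simp add: power2_eq_square)
   finally show "norm (H z * K z / z ^ 2) <= 32 * C / R" .
  qed (use C R0 in auto)
  also have "... <= (32 * C / R) * 1" using ab C R0 by (intro mult_left_mono) auto
  finally show ?thesis by simp
 qed
 have h1: "((%z. H z * K z / z ^ 2) has_contour_integral contour_integral L1 (%z. H z * K z / z ^ 2)) L1"
  "((%z. H z * K z / z ^ 2) has_contour_integral contour_integral L2 (%z. H z * K z / z ^ 2)) L2"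
  "((%z. H z * K z / z ^ 2) has_contour_integral contour_integral L3 (%z. H z * K z / z ^ 2)) L3"
  using i_H[OF vp(3) subS(3)] i_H[OF vp(4) subS(4)] i_H[OF vp(5) subS(5)] by (simp_all add: has_contour_integral_integral)
 have c1: "norm (contour_integral L1 (%z. H z * K z / z ^ 2)) <= 32 * C / R"
  by (rule bh[OF h1(1)[unfolded L1_def], folded L1_def])
   (use l imL1 R0 in \<open>auto simp: L1_def complex_diff cmod_def\<close>)
 have c3: "norm (contour_integral L3 (%z. H z * K z / z ^ 2)) <= 32 * C / R"
  by (rule bh[OF h1(3)[unfolded L3_def], folded L3_def])
   (use l imL3 R0 in \<open>auto simp: L3_def complex_diff cmod_def\<close>)
 \<comment> \<open>Only here Re z = -l throughout, which supplies the decay exp(-l T).\<close>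
 have c2: "norm (contour_integral L2 (%z. H z * K z / z ^ 2)) <= (32 * C * R * exp (- l * T) / l ^ 2) * (2 * R)"
 proof -
  have "norm (contour_integral L2 (%z. H z * K z / z ^ 2)) <= (32 * C * R * exp (- l * T) / l ^ 2) * norm (Complex (-l) (-R) - Complex (-l) R)"
  proof (rule has_contour_integral_bound_linepath[OF h1(2)[unfolded L2_def], folded L2_def])
   fix z assume z: "z \<in> closed_segment (Complex (-l) R) (Complex (-l) (-R))"
   then have s: "Re z = - l" "\<bar>Im z\<bar> <= R" using imL2[of z] by (auto simp: L2_def)
   have "norm z >= l" using abs_Re_le_cmod[of z] s l by simp
   then have zl: "norm z ^ 2 >= l ^ 2" using l by (intro power_mono) auto
   have "norm (H z * K z / z ^ 2) <= (C * (2 * R)) * (exp (T * Re z) * 16) / l ^ 2"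
    unfolding norm_mult norm_divide norm_power using Hb[of z] Kb[of z] s zl C R0 l
    by (intro frac_le mult_mono) auto
   then show "norm (H z * K z / z ^ 2) <= 32 * C * R * exp (- l * T) / l ^ 2"
    using s by (simp add: mult_ac)
  qed (use C R0 in auto)
  also have "Complex (-l) (-R) - Complex (-l) R = - (of_real (2 * R) * \<i>)"
   by (simp add: complex_eq_iff)
  also have "norm (- (of_real (2 * R) * \<i>)) = 2 * R" using R0 by (simp add: norm_mult)
  finally show ?thesis .
 qed
 have "I3 = contour_integral L1 (%z. H z * K z / z ^ 2) + (contour_integral L2 (%z. H z * K z / z ^ 2) + contour_integral L3 (%z. H z * K z / z ^ 2))"
  unfolding I3_def Cm_def
  by (intro contour_integral_unique has_contour_integral_join h1 valid_path_join vp) (auto simp: L1_def L2_def L3_def)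
 then have "norm I3 <= norm (contour_integral L1 (%z. H z * K z / z ^ 2)) + (norm (contour_integral L2 (%z. H z * K z / z ^ 2)) + norm (contour_integral L3 (%z. H z * K z / z ^ 2)))"
  by (metis (no_types, lifting) add_left_mono norm_triangle_ineq order_trans)
 then have b3: "norm I3 <= 64 * C / R + (32 * C * R * exp (- l * T) / l ^ 2) * (2 * R)"
  using c1 c2 c3 by simp
 have "16 * (exp 1 * (1 + T + C)) / R <= 16 * (3 * (1 + T + C)) / R"
  using e3 T C R0 by (intro divide_right_mono mult_left_mono mult_right_mono) auto
 then have "norm \<Delta> <= 96 * (1 + T + C) / R + 64 * C / R + 64 * C * R ^ 2 * exp (- l * T) / l ^ 2"
 proof -
  have "(32 * C * R * exp (- l * T) / l ^ 2) * (2 * R) = 64 * C * R ^ 2 * exp (- l * T) / l ^ 2"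
   by (simp add: power2_eq_square)
  moreover have "96 * (1 + T + C) / R = 2 * (16 * (3 * (1 + T + C)) / R)" by simp
  moreover have "\<And>d i j k x y z z' v w :: real. d <= i + j + k ==> i <= x ==> j <= x ==> k <= y + z ==> x <= w ==> z = z' ==> v = 2 * w ==> d <= v + y + z'"
   by linarith
  ultimately show ?thesis
   using \<Delta> b1 b2 b3 \<open>16 * (exp 1 * (1 + T + C)) / R <= 16 * (3 * (1 + T + C)) / R\<close> by blast
 qed
 also have "... <= 200 * (1 + T + C) / R + 500 * C / R + 500 * C * R ^ 2 * exp (- l * T) / l ^ 2"
  using T C R0 l by (intro add_mono divide_right_mono mult_right_mono) auto
 finally show ?thesis .
qed

end

subsection \<open>Mertens' theorems with a remainder\<close>

lemma prime_mertens_integrated: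
 obtains c d C T0 :: real where "T0 >= 1" "C > 0"
  "\<And>T. T >= T0 ==> \<bar>(\<Sum>p\<in>prime_set T. ln p / p * (T - ln p)) - T ^ 2 / 2 - c * T - d\<bar> <= C / T ^ 4"
proof -
 obtain H c C where H: "c > 0" "c <= 1/8" "C > 0"
  "\<And>z. Re z > 0 ==> (%n. of_real (prime_ln n) * of_nat n powr (-1 - z)) sums (1 / z + H z)"
  "\<And>R. R >= 1 ==> H holomorphic_on ({z. Re z > 0} \<union> {z. - c * R powr (-1/20) < Re z & \<bar>Im z\<bar> < R})"
  "\<And>R z. R >= 1 ==> - c * R powr (-1/20) <= Re z ==> Re z <= 1 ==> \<bar>Im z\<bar> <= R ==> norm (H z) <= C * R powr (1/20)"
  by (rule prime_sum_continuation, rule that, assumption+)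
 \<comment> \<open>The choice R = T^5: l is of order T^(-1/4), so exp(-l T) decays like exp(-c'
   T^(3/4)) for some c' > 0 and beats R^2 / l^2, while the terms of order T / R are
   O(T^(-4)).\<close>
 define f where "f T = 500 * C * (T ^ 5) ^ 2 * exp (- (c / 2 * (2 * T ^ 5) powr (-1/20)) * T) / (c / 2 * (2 * T ^ 5) powr (-1/20)) ^ 2" for T :: real
 have "\<forall>\<^sub>F T in at_top. f T <= 1 / T ^ 4"
  unfolding f_def using H(1,3) by real_asymp
 then obtain T1 where T1: "\<And>T. T >= T1 ==> f T <= 1 / T ^ 4"
  by (auto simp: eventually_at_top_linorder)
 define T0 where "T0 = max 1 T1"
 define B where "B = 200 * (2 + C) + 500 * C + 3"
 have "\<bar>(\<Sum>p\<in>prime_set T. ln p / p * (T - ln p)) - T ^ 2 / 2 - Re (H 0) * T - Re (deriv H 0)\<bar> <= B / T ^ 4" if T: "T >= T0" for T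
 proof -
  have T': "T >= 1" "T >= T1" using T by (auto simp: T0_def)
  define D where "D = complex_of_real ((\<Sum>p\<in>prime_set T. ln p / p * (T - ln p)) - T ^ 2 / 2 - 2 / (T ^ 5) ^ 2) - (of_real T * H 0 + deriv H 0)"
  have "norm D <= 200 * (1 + T + C) / T ^ 5 + 500 * C / T ^ 5 + f T"
   unfolding D_def f_def
   by (rule newman_bound[OF H T'(1)]) (use T' in auto)
  also have "... <= 200 * (2 + C) / T ^ 4 + 500 * C / T ^ 4 + 1 / T ^ 4"
  proof (intro add_mono T1 T')
   have "C * 1 <= C * T" using T' H by (intro mult_left_mono) auto
   then have "200 * (1 + T + C) <= 200 * (2 + C) * T" using T' by (simp add: algebra_simps)
   then have "200 * (1 + T + C) / T ^ 5 <= 200 * (2 + C) * T / T ^ 5" using T' by (intro divide_right_mono) auto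
   also have "... = 200 * (2 + C) / T ^ 4" using T' by (simp add: field_simps power_eq_if)
   finally show "200 * (1 + T + C) / T ^ 5 <= 200 * (2 + C) / T ^ 4" .
   show "500 * C / T ^ 5 <= 500 * C / T ^ 4"
    using T' H by (intro divide_left_mono power_increasing mult_pos_pos) auto
  qed
  finally have "\<bar>Re D\<bar> <= 200 * (2 + C) / T ^ 4 + 500 * C / T ^ 4 + 1 / T ^ 4"
   using abs_Re_le_cmod[of D] by linarith
  moreover have "Re D = (\<Sum>p\<in>prime_set T. ln p / p * (T - ln p)) - T ^ 2 / 2 - 2 / (T ^ 5) ^ 2 - Re (H 0) * T - Re (deriv H 0)"
   by (simp add: D_def)
  moreover have "2 / (T ^ 5) ^ 2 <= 2 / T ^ 4"
   unfolding power_mult[symmetric] using T' by (intro divide_left_mono power_increasing mult_pos_pos) auto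
  moreover have "0 <= 2 / (T ^ 5) ^ 2" by simp
  moreover have "B / T ^ 4 = 200 * (2 + C) / T ^ 4 + 500 * C / T ^ 4 + 1 / T ^ 4 + 2 / T ^ 4"
   by (simp add: B_def add_divide_distrib)
  ultimately show ?thesis by linarith
 qed
 moreover have "T0 >= 1" "B > 0" using H by (auto simp: T0_def B_def intro!: add_pos_pos)
 ultimately show ?thesis using that by blast
qed

lemma prime_set_mono: "u <= v ==> prime_set u \<subseteq> prime_set v"
 by (auto simp: prime_set_def)

lemma prime_setD: "p \<in> prime_set u ==> prime p & p > 0 & ln (real p) >= 0 & ln (real p) <= u"
 by (auto simp: prime_set_def prime_gt_0_nat Suc_leI)

text \<open>The smoothed sum I is an integral of the nondecreasing function A, so its increment over
  a step h lies between h times the two end values of A.\<close>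

lemma prime_mertens_increment:
 fixes T h :: real
 assumes "h >= 0"
 defines "A \<equiv> %T. \<Sum>p\<in>prime_set T. ln p / p"
 defines "I \<equiv> %T. \<Sum>p\<in>prime_set T. ln p / p * (T - ln p)"
 shows "h * A T <= I (T + h) - I T" "I (T + h) - I T <= h * A (T + h)"
proof -
 let ?D = "prime_set (T + h) - prime_set T"
 have sub: "prime_set T \<subseteq> prime_set (T + h)" using assms by (intro prime_set_mono) auto
 have "I (T + h) = (\<Sum>p\<in>?D. ln p / p * (T + h - ln p)) + (\<Sum>p\<in>prime_set T. ln p / p * (T + h - ln p))"
  unfolding I_def by (rule sum.subset_diff[OF sub]) simp
 also have "(\<Sum>p\<in>prime_set T. ln p / p * (T + h - ln p)) = I T + h * A T"
 proof -
  have "a * (T + h - l) = a * (T - l) + h * a" for a l by (simp add: algebra_simps)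
  then show ?thesis unfolding I_def A_def sum_distrib_left sum.distrib[symmetric] by (simp only:)
 qed
 finally have eq: "I (T + h) - I T = (\<Sum>p\<in>?D. ln p / p * (T + h - ln p)) + h * A T" by simp
 have "0 <= (\<Sum>p\<in>?D. ln p / p * (T + h - ln p))"
  by (intro sum_nonneg mult_nonneg_nonneg divide_nonneg_nonneg) (auto dest!: prime_setD)
 then show "h * A T <= I (T + h) - I T" using eq by simp
 have "(\<Sum>p\<in>?D. ln p / p * (T + h - ln p)) <= (\<Sum>p\<in>?D. ln p / p * h)"
 proof (intro sum_mono mult_left_mono)
  fix p assume "p \<in> ?D"
  then have p: "p \<in> prime_set (T + h)" "ln p > T" by (auto simp: prime_set_def)
  then show "T + h - ln p <= h" by simp
  show "0 <= ln p / p" using prime_setD[OF p(1)] by simp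
 qed
 also have "... + h * A T = h * A (T + h)"
  unfolding A_def sum.subset_diff[OF sub finite_prime_set] by (simp add: sum_distrib_left algebra_simps)
 finally show "I (T + h) - I T <= h * A (T + h)" using eq by simp
qed

lemma prime_mertens_first:
 obtains c C T0 :: real where "T0 >= 1" "C > 0"
  "\<And>T. T >= T0 ==> \<bar>(\<Sum>p\<in>prime_set T. ln p / p) - T - c\<bar> <= C / T ^ 2"
proof -
 obtain c d C T0 where T0: "T0 >= 1" "C > 0" and
  I: "\<And>T. T >= T0 ==> \<bar>(\<Sum>p\<in>prime_set T. ln p / p * (T - ln p)) - T ^ 2 / 2 - c * T - d\<bar> <= C / T ^ 4"
  by (rule prime_mertens_integrated, rule that, assumption+)
 define A where "A T = (\<Sum>p\<in>prime_set T. ln p / p)" for T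
 define J where "J T = (\<Sum>p\<in>prime_set T. ln p / p * (T - ln p))" for T
 have "\<bar>A T - T - c\<bar> <= (1 + 17 * C) / T ^ 2" if T: "T >= 2 * T0" for T
 proof -
  have T1: "T >= 2" using T T0 by simp
  \<comment> \<open>Balance: differencing turns the error T^(-4) of the smoothed sum into T^(-4) /
    h, and the quadratic main term costs h / 2. Both are O(T^(-2)) for this h.\<close>
  define h where "h = 1 / T ^ 2"
  have h: "h > 0" "h <= 1" "T - h >= T0" "T - h >= T / 2"
  proof -
   show "h > 0" using T1 by (simp add: h_def)
   have "1 <= T ^ 2" using T1 by (simp add: one_le_power)
   then show "h <= 1" by (simp add: h_def divide_le_eq_1)
   then show "T - h >= T0" "T - h >= T / 2" using T T1 T0 by linarith+
  qed
  have "C / (T + h) ^ 4 <= C / T ^ 4" using h T0 T1 by (intro divide_left_mono power_mono) auto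
  then have 1: "\<bar>J (T + h) - (T + h) ^ 2 / 2 - c * (T + h) - d\<bar> <= C / T ^ 4"
   using I[of "T + h"] h T T0 unfolding J_def by linarith
  have 2: "\<bar>J T - T ^ 2 / 2 - c * T - d\<bar> <= C / T ^ 4" using I[of T] T T0 unfolding J_def by linarith
  have "C / (T - h) ^ 4 <= C / (T / 2) ^ 4" using h T0 T1 by (intro divide_left_mono power_mono) auto
  also have "... = 16 * (C / T ^ 4)" by (simp add: power_divide)
  finally have 3: "\<bar>J (T - h) - (T - h) ^ 2 / 2 - c * (T - h) - d\<bar> <= 16 * (C / T ^ 4)"
   using I[of "T - h"] h unfolding J_def by linarith
  have e4: "C / T ^ 4 = h * (C / T ^ 2)" by (simp add: h_def flip: power_add)
  have "h * A T <= J (T + h) - J T"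
   unfolding A_def J_def by (rule prime_mertens_increment(1)) (use h in simp)
  also have "... <= (T + h) ^ 2 / 2 - T ^ 2 / 2 + c * h + 2 * (C / T ^ 4)"
   using 1 2 by (simp add: algebra_simps)
  also have "... = h * (T + h / 2 + c + 2 * (C / T ^ 2))"
   unfolding e4 by (simp add: power2_eq_square algebra_simps)
  finally have up: "A T <= T + h / 2 + c + 2 * (C / T ^ 2)" using h by simp
  have "h * (T - h / 2 + c - 17 * (C / T ^ 2)) = T ^ 2 / 2 - (T - h) ^ 2 / 2 + c * h - 17 * (C / T ^ 4)"
   unfolding e4 by (simp add: power2_eq_square algebra_simps add_divide_distrib diff_divide_distrib)
  also have "... <= J (T - h + h) - J (T - h)"
   using 2 3 by (simp add: algebra_simps)
  also have "... <= h * A (T - h + h)"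
   unfolding A_def J_def by (rule prime_mertens_increment(2)) (use h in simp)
  finally have lo: "T - h / 2 + c - 17 * (C / T ^ 2) <= A T" using h by simp
  have "(1 + 17 * C) / T ^ 2 = h + 17 * (C / T ^ 2)" by (simp add: h_def add_divide_distrib)
  moreover have "C / T ^ 2 >= 0" using T0 by simp
  ultimately show ?thesis using up lo h by linarith
 qed
 moreover have "2 * T0 >= 1" "1 + 17 * C > 0" using T0 by auto
 ultimately show ?thesis using that unfolding A_def by blast
qed

section \<open>Partial summation and Mertens' second theorem\<close>

text \<open>A is a finite sum of unit steps, so A g' is a finite sum of pieces integrated by the
  fundamental theorem. The positions x stay abstract: they are ln p for the primes and n itself for
  the harmonic sum.\<close>

lemma abel_summation:
 fixes x c :: "'i => real" and g g' :: "real => real"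
 assumes fin: "\<And>y. finite {i \<in> I. x i <= y}" and uv: "u <= v"
  and g: "\<And>y. y \<in> {u..v} ==> (g has_real_derivative g' y) (at y within {u..v})"
 defines "A \<equiv> %y. \<Sum>i | i \<in> I & x i <= y. c i"
 shows "((%y. A y * g' y) has_integral (A v * g v - A u * g u - (\<Sum>i | i \<in> I & u < x i & x i <= v. c i * g (x i)))) {u..v}"
proof -
 define S where "S = {i. i \<in> I & u < x i & x i <= v}"
 define U where "U = {i \<in> I. x i <= u}"
 have finS: "finite S" "finite U" by (rule finite_subset[OF _ fin[of v]]; auto simp: S_def)(use fin in \<open>simp add: U_def\<close>)
 have A: "A y = (\<Sum>i\<in>U. c i) + (\<Sum>i\<in>S. if x i <= y then c i else 0)" if "y \<in> {u..v}" for y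
 proof -
  have "{i \<in> I. x i <= y} = U \<union> {i \<in> S. x i <= y}" using that by (auto simp: U_def S_def)
  moreover have "finite {i \<in> S. x i <= y}" using finS(1) by simp
  moreover have "U \<inter> {i \<in> S. x i <= y} = {}" by (auto simp: U_def S_def)
  ultimately have "A y = (\<Sum>i\<in>U. c i) + (\<Sum>i | i \<in> S & x i <= y. c i)"
   unfolding A_def using finS(2) by (simp add: sum.union_disjoint)
  also have "(\<Sum>i | i \<in> S & x i <= y. c i) = (\<Sum>i\<in>S. if x i <= y then c i else 0)"
   using finS by (simp add: sum.inter_filter)
  finally show ?thesis .
 qed
 have 1: "(g' has_integral (g v - g w)) {w..v}" if "w \<in> {u..v}" for w
  by (rule fundamental_theorem_of_calculus)
   (use that in \<open>auto intro!: has_field_derivative_subset[OF g] simp flip: has_real_derivative_iff_has_vector_derivative\<close>)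
 have 2: "((%y. if x i <= y then g' y else 0) has_integral (g v - g (x i))) {u..v}" if "i \<in> S" for i
 proof -
  have "((%y. if y \<in> {x i..v} then g' y else 0) has_integral (g v - g (x i))) {u..v}"
   using 1[of "x i"] that by (subst has_integral_restrict) (auto simp: S_def)
  then show ?thesis by (rule has_integral_eq[rotated]) auto
 qed
 have "((%y. (\<Sum>i\<in>U. c i) * g' y + (\<Sum>i\<in>S. c i * (if x i <= y then g' y else 0))) has_integral
   ((\<Sum>i\<in>U. c i) * (g v - g u) + (\<Sum>i\<in>S. c i * (g v - g (x i))))) {u..v}"
  by (intro has_integral_add has_integral_mult_right has_integral_sum finS 1 2) (use uv in auto)
 then have "((%y. A y * g' y) has_integral
   ((\<Sum>i\<in>U. c i) * (g v - g u) + (\<Sum>i\<in>S. c i * (g v - g (x i))))) {u..v}"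
  by (rule has_integral_eq[rotated]) (auto simp: A distrib_right sum_distrib_right intro!: sum.cong)
 also have "(\<Sum>i\<in>U. c i) * (g v - g u) + (\<Sum>i\<in>S. c i * (g v - g (x i))) =
   A v * g v - A u * g u - (\<Sum>i\<in>S. c i * g (x i))"
 proof -
  have "A u = (\<Sum>i\<in>U. c i)" by (simp add: A_def U_def)
  moreover have "A v = (\<Sum>i\<in>U. c i) + (\<Sum>i\<in>S. c i)"
   using uv by (subst A) (auto simp: S_def intro!: sum.cong)
  ultimately show ?thesis by (simp add: algebra_simps sum_subtractf sum_distrib_left)
 qed
 finally show ?thesis by (simp add: S_def)
qed

lemma abel_summation_primes:
 fixes c :: "nat => real" and g g' :: "real => real"
 assumes uv: "u <= v"
  and g: "\<And>y. y \<in> {u..v} ==> (g has_real_derivative g' y) (at y within {u..v})"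
 shows "((%y. (\<Sum>p\<in>prime_set y. c p) * g' y) has_integral
   ((\<Sum>p\<in>prime_set v. c p) * g v - (\<Sum>p\<in>prime_set u. c p) * g u - (\<Sum>p\<in>prime_set v - prime_set u. c p * g (ln p)))) {u..v}"
proof -
 have "((%y. (\<Sum>p | p \<in> {p. prime p} & ln (real p) <= y. c p) * g' y) has_integral
   ((\<Sum>p | p \<in> {p. prime p} & ln (real p) <= v. c p) * g v - (\<Sum>p | p \<in> {p. prime p} & ln (real p) <= u. c p) * g u
   - (\<Sum>p | p \<in> {p. prime p} & u < ln (real p) & ln (real p) <= v. c p * g (ln p)))) {u..v}"
  by (rule abel_summation[where x = "%p. ln (real p)", OF _ uv g])
   (use finite_prime_set in \<open>auto simp: prime_set_def\<close>)
 moreover have "{p. p \<in> {p. prime p} & u < ln (real p) & ln (real p) <= v} = prime_set v - prime_set u"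
  by (auto simp: prime_set_def)
 moreover have "{p. p \<in> {p. prime p} & ln (real p) <= y} = prime_set y" for y
  by (auto simp: prime_set_def)
 ultimately show ?thesis by (simp only:)
qed

definition prime_recip_sum :: "real => real" where
 "prime_recip_sum u = (\<Sum>p\<in>prime_set u. 1 / p)"

lemma prime_recip_sum_mono: "u <= v ==> prime_recip_sum u <= prime_recip_sum v"
 unfolding prime_recip_sum_def by (intro sum_mono2 prime_set_mono) auto

lemma prime_recip_sum_nonneg: "prime_recip_sum u >= 0"
 unfolding prime_recip_sum_def by (intro sum_nonneg) auto

text \<open>Partial summation with g(y) = 1 / y turns the error C / y^2 of the first theorem into an
  integral of C / y^4, hence the rate u^(-3). The threshold 1/2 lies below ln 2, so a sum started
  there begins before all primes.\<close>

lemma prime_mertens_second: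
 obtains M C :: real where "C > 0" "\<And>u. u >= 1/2 ==> \<bar>prime_recip_sum u - ln u - M\<bar> <= C / u ^ 3"
proof -
 obtain c C T0 where T0: "T0 >= 1" "C > 0" and
  A0: "\<And>T. T >= T0 ==> \<bar>(\<Sum>p\<in>prime_set T. ln p / p) - T - c\<bar> <= C / T ^ 2"
  by (rule prime_mertens_first, rule that, assumption+)
 define A where "A y = (\<Sum>p\<in>prime_set y. ln p / p)" for y
 define e where "e y = A y - y - c" for y
 have eb: "\<bar>e y\<bar> <= C / y ^ 2" if "y >= T0" for y using A0[OF that] by (simp add: e_def A_def)
 define r where "r u = prime_recip_sum u - ln u" for u
 have r: "\<bar>r v - r u\<bar> <= 3 * C / u ^ 3" if uv: "T0 <= u" "u <= v" for u v
 proof -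
  have u0: "u > 0" using uv T0 by simp
  have "((%y. A y * (- 1 / y\<^sup>2)) has_integral (A v * (1 / v) - A u * (1 / u) - (\<Sum>p\<in>prime_set v - prime_set u. ln p / p * (1 / ln p)))) {u..v}"
   unfolding A_def
  proof (rule abel_summation_primes[OF uv(2)])
   show "((/) 1 has_real_derivative - 1 / y\<^sup>2) (at y within {u..v})" if "y \<in> {u..v}" for y
    using that u0 by (auto intro!: derivative_eq_intros simp: power2_eq_square)
  qed
  also have "(\<Sum>p\<in>prime_set v - prime_set u. ln p / p * (1 / ln p)) = prime_recip_sum v - prime_recip_sum u"
  proof -
   have "(\<Sum>p\<in>prime_set v - prime_set u. ln p / p * (1 / ln p)) = (\<Sum>p\<in>prime_set v - prime_set u. 1 / p)"
   proof (intro sum.cong refl)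
    fix p assume "p \<in> prime_set v - prime_set u"
    then have "ln (real p) > 0" using u0 by (auto simp: prime_set_def)
    then show "ln p / p * (1 / ln p) = 1 / p" by simp
   qed
   also have "... = prime_recip_sum v - prime_recip_sum u"
    unfolding prime_recip_sum_def using prime_set_mono[OF uv(2)] by (simp add: sum_diff)
   finally show ?thesis .
  qed
  finally have 1: "((%y. A y * (- 1 / y\<^sup>2)) has_integral (A v * (1 / v) - A u * (1 / u) - (prime_recip_sum v - prime_recip_sum u))) {u..v}" .
  have 2: "((%y. 1 / y + c / y\<^sup>2) has_integral ((ln v - c / v) - (ln u - c / u))) {u..v}"
  proof (rule fundamental_theorem_of_calculus[OF uv(2)])
   show "((%y. ln y - c / y) has_vector_derivative 1 / y + c / y\<^sup>2) (at y within {u..v})" if "y \<in> {u..v}" for y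
    unfolding has_real_derivative_iff_has_vector_derivative[symmetric]
    using that u0 by (auto intro!: derivative_eq_intros simp: power2_eq_square)
  qed
  have 3: "((%y. A y * (- 1 / y\<^sup>2) + (1 / y + c / y\<^sup>2)) has_integral
   (A v * (1 / v) - A u * (1 / u) - (prime_recip_sum v - prime_recip_sum u) + ((ln v - c / v) - (ln u - c / u)))) {u..v}"
   by (rule has_integral_add[OF 1 2])
  have eqv: "A v * (1 / v) - A u * (1 / u) - (prime_recip_sum v - prime_recip_sum u) + ((ln v - c / v) - (ln u - c / u))
    = e v / v - e u / u - (r v - r u)"
  proof -
   have "e v / v = A v * (1 / v) - 1 - c / v" "e u / u = A u * (1 / u) - 1 - c / u"
    using u0 uv by (auto simp: e_def diff_divide_distrib)
   then show ?thesis by (simp add: r_def)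
  qed
  have "A y * (- 1 / y\<^sup>2) + (1 / y + c / y\<^sup>2) = - (e y / y\<^sup>2)" if "y \<in> {u..v}" for y
   using that u0 by (simp add: e_def diff_divide_distrib power2_eq_square)
  then have 4: "((%y. - (e y / y\<^sup>2)) has_integral (e v / v - e u / u - (r v - r u))) {u..v}"
   by (rule has_integral_eq[OF _ 3[unfolded eqv]])
  have 5: "((%y. C / y ^ 4) has_integral ((- C / (3 * v ^ 3)) - (- C / (3 * u ^ 3)))) {u..v}"
  proof (rule fundamental_theorem_of_calculus[OF uv(2)])
   show "((%y. - C / (3 * y ^ 3)) has_vector_derivative C / y ^ 4) (at y within {u..v})" if "y \<in> {u..v}" for y
    unfolding has_real_derivative_iff_has_vector_derivative[symmetric]
    using that u0 by (auto intro!: derivative_eq_intros simp: power_eq_if)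
  qed
  have "norm (integral {u..v} (%y. - (e y / y\<^sup>2))) <= integral {u..v} (%y. C / y ^ 4)"
  proof (rule integral_norm_bound_integral)
   fix y assume y: "y \<in> {u..v}"
   then have "\<bar>e y\<bar> <= C / y ^ 2" using uv by (intro eb) auto
   then have "\<bar>e y\<bar> / y\<^sup>2 <= (C / y ^ 2) / y\<^sup>2" by (intro divide_right_mono) auto
   also have "... = C / y ^ 4" by (simp flip: power_add)
   finally show "norm (- (e y / y\<^sup>2)) <= C / y ^ 4" by simp
  qed (use 4 5 in auto)
  then have "\<bar>e v / v - e u / u - (r v - r u)\<bar> <= (- C / (3 * v ^ 3)) - (- C / (3 * u ^ 3))"
   unfolding integral_unique[OF 4] integral_unique[OF 5] by (simp only: real_norm_def)
  also have "... <= C / (3 * u ^ 3)" using T0 u0 uv by simp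
  also have "... <= C / u ^ 3" using T0 u0 by (intro divide_left_mono) auto
  finally have "\<bar>e v / v - e u / u - (r v - r u)\<bar> <= C / u ^ 3" .
  moreover have "\<bar>e u / u\<bar> <= C / u ^ 3"
  proof -
   have "\<bar>e u\<bar> / u <= C / u ^ 2 / u" using eb[OF uv(1)] u0 by (intro divide_right_mono) auto
   then show ?thesis using u0 by (simp add: power_eq_if)
  qed
  moreover have "\<bar>e v / v\<bar> <= C / u ^ 3"
  proof -
   have "\<bar>e v\<bar> / v <= C / v ^ 2 / v" using eb[of v] uv u0 by (intro divide_right_mono) auto
   also have "... = C / v ^ 3" by (simp add: power_eq_if)
   also have "... <= C / u ^ 3" using T0 u0 uv by (intro divide_left_mono power_mono) auto
   finally show ?thesis using u0 uv by simp
  qed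
  ultimately show ?thesis by linarith
 qed
 have lim: "\<exists>M. (%n. r (T0 + real n)) \<longlonglongrightarrow> M"
 proof -
  have "Cauchy (%n. r (T0 + real n))"
  proof (rule metric_CauchyI)
   fix \<epsilon> :: real assume "\<epsilon> > 0"
   have "(%n. 3 * C / (T0 + real n) ^ 3) \<longlonglongrightarrow> 0" by real_asymp
   then have "\<forall>\<^sub>F n in sequentially. 3 * C / (T0 + real n) ^ 3 < \<epsilon> / 2" using \<open>\<epsilon> > 0\<close> by (intro order_tendstoD) auto
   then obtain N where N: "3 * C / (T0 + real N) ^ 3 < \<epsilon> / 2" by (auto simp: eventually_sequentially)
   have "dist (r (T0 + real m)) (r (T0 + real n)) < \<epsilon>" if "m >= N" "n >= N" for m n
    using r[of "T0 + real N" "T0 + real m"] r[of "T0 + real N" "T0 + real n"] that N by (auto simp: dist_real_def)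
   then show "\<exists>N. \<forall>m\<ge>N. \<forall>n\<ge>N. dist (r (T0 + real m)) (r (T0 + real n)) < \<epsilon>"
    by blast
  qed
  then show ?thesis using Cauchy_convergent_iff convergent_def by blast
 qed
 then obtain M where M: "(%n. r (T0 + real n)) \<longlonglongrightarrow> M" by blast
 have rM: "\<bar>r u - M\<bar> <= 3 * C / u ^ 3" if u: "u >= T0" for u
 proof -
  have "(%n. \<bar>r (T0 + real n) - r u\<bar>) \<longlonglongrightarrow> \<bar>M - r u\<bar>" by (intro tendsto_intros M)
  moreover have "\<forall>\<^sub>F n in sequentially. \<bar>r (T0 + real n) - r u\<bar> <= 3 * C / u ^ 3"
  proof -
   obtain N where "u <= T0 + real N" using reals_Archimedean2[of "u - T0"] by (metis add.commute less_eq_real_def diff_le_eq)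
   then show ?thesis
    using r[OF u] by (intro eventually_sequentiallyI[of N]) (meson add_left_mono of_nat_le_iff order_trans)
  qed
  ultimately have "\<bar>M - r u\<bar> <= 3 * C / u ^ 3" by (intro tendsto_upperbound[of _ _ sequentially]) auto
  then show ?thesis by linarith
 qed
 \<comment> \<open>On the bounded range 1/2 <= u < T0 everything is at most a constant, which is
   absorbed into the coefficient of u^(-3).\<close>
 define K where "K = prime_recip_sum T0 + ln T0 + 1 + \<bar>M\<bar>"
 define C' where "C' = max (3 * C) (K * T0 ^ 3)"
 have "\<bar>prime_recip_sum u - ln u - M\<bar> <= C' / u ^ 3" if u: "u >= 1/2" for u
 proof (cases "u >= T0")
  case True
  then have "\<bar>prime_recip_sum u - ln u - M\<bar> <= 3 * C / u ^ 3" using rM by (simp add: r_def)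
  also have "... <= C' / u ^ 3" using u by (intro divide_right_mono) (auto simp: C'_def)
  finally show ?thesis .
 next
  case False
  have "ln u <= ln T0" using False u by simp
  moreover have "ln u >= -1"
  proof -
   have "ln (1/2) <= ln u" using u by simp
   moreover have "ln (1/2::real) = - ln 2" by (simp add: ln_div)
   ultimately show ?thesis using ln2_le_25_over_36 by simp
  qed
  moreover have "ln T0 >= 0" using T0 by simp
  ultimately have "\<bar>prime_recip_sum u - ln u - M\<bar> <= K"
   using prime_recip_sum_mono[of u T0] prime_recip_sum_nonneg[of u] False unfolding K_def by linarith
  also have "K <= K * T0 ^ 3 / u ^ 3"
  proof -
   have "u ^ 3 <= T0 ^ 3" using False u by (intro power_mono) auto
   moreover have "K >= 0" unfolding K_def using prime_recip_sum_nonneg[of T0] T0 by simp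
   ultimately have "K * u ^ 3 <= K * T0 ^ 3" by (intro mult_left_mono)
   then show ?thesis using u by (simp add: field_simps)
  qed
  also have "... <= C' / u ^ 3" using u by (intro divide_right_mono) (auto simp: C'_def)
  finally show ?thesis .
 qed
 moreover have "C' > 0" using T0 by (simp add: C'_def)
 ultimately show ?thesis using that by blast
qed

subsection \<open>The constant in Mertens' second theorem\<close>

text \<open>For 0 <= x < 1 this is the sum of x^k / k over k >= 2, the share of the higher prime
  powers in -ln(1 - x).\<close>

definition log_corr :: "real => real" where
 "log_corr x = - ln (1 - x) - x"

lemma log_corr_diff_le:
 assumes "0 <= y" "y <= x" "x <= 1/2"
 shows "0 <= log_corr x - log_corr y" "log_corr x - log_corr y <= 2 * x * (x - y)"
proof -
 have "0 <= log_corr x - log_corr y & log_corr x - log_corr y <= 2 * x * (x - y)"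
 proof (cases "y = x")
  case False
  then have yx: "y < x" using assms by simp
  have "\<exists>z>y. z < x & log_corr x - log_corr y = (x - y) * (z / (1 - z))"
   unfolding log_corr_def
   by (rule MVT2[OF yx]) (use assms in \<open>auto intro!: derivative_eq_intros simp: field_simps\<close>)
  then obtain z where z: "y < z" "z < x" "log_corr x - log_corr y = (x - y) * (z / (1 - z))" by blast
  have "z / (1 - z) <= x / (1/2)" using z assms by (intro frac_le) auto
  then have "(x - y) * (z / (1 - z)) <= (x - y) * (x / (1/2))" using yx by (intro mult_left_mono) auto
  moreover have "0 <= (x - y) * (z / (1 - z))" using z assms by (intro mult_nonneg_nonneg divide_nonneg_nonneg) auto
  ultimately show ?thesis using z(3) by (simp add: mult_ac)
 qed simp
 then show "0 <= log_corr x - log_corr y" "log_corr x - log_corr y <= 2 * x * (x - y)" by auto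
qed

lemma log_corr_bounds:
 assumes "0 <= x" "x <= 1/2"
 shows "0 <= log_corr x" "log_corr x <= 2 * x\<^sup>2"
 using log_corr_diff_le[of 0 x] assms by (simp_all add: log_corr_def power2_eq_square)

definition prime_log_corr :: "real => nat => real" where
 "prime_log_corr \<eta> n = (if prime n then log_corr (real n powr (-1 - \<eta>)) else 0)"

text \<open>The sum of 1 / (k p^k) over all primes p and k >= 2; Euler's constant minus it is the
  Meissel-Mertens constant.\<close>

definition log_corr_const :: real where
 "log_corr_const = (\<Sum>n. prime_log_corr 0 n)"

lemma prime_powr_le_half:
 assumes "prime n" "\<eta> >= 0"
 shows "real n powr (-1 - \<eta>) <= 1 / real n" "1 / real n <= 1/2"
proof -
 have n: "n >= 2" using assms prime_ge_2_nat by blast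
 have "real n powr (-1 - \<eta>) <= real n powr (-1)" using n assms by (intro powr_mono) auto
 then show "real n powr (-1 - \<eta>) <= 1 / real n" using n by (simp add: powr_minus_divide)
 show "1 / real n <= 1/2" using n by (intro divide_left_mono) auto
qed

lemma prime_log_corr_summable:
 assumes "\<eta> >= 0"
 shows "summable (prime_log_corr \<eta>)" "prime_log_corr \<eta> n >= 0" "prime_log_corr \<eta> n <= 2 * real n powr (-2)"
proof -
 have *: "0 <= prime_log_corr \<eta> n & prime_log_corr \<eta> n <= 2 * real n powr (-2)" for n
 proof (cases "prime n")
  case True
  note p = prime_powr_le_half[OF True assms]
  let ?x = "real n powr (-1 - \<eta>)"
  have "log_corr ?x <= 2 * ?x\<^sup>2" "0 <= log_corr ?x" using log_corr_bounds[of ?x] p by auto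
  moreover have "?x\<^sup>2 <= (1 / real n)\<^sup>2" using p by (intro power_mono) auto
  moreover have "(1 / real n)\<^sup>2 = real n powr (-2)"
   using prime_gt_0_nat[OF True] powr_realpow[of "real n" 2] by (simp add: powr_minus_divide power_divide)
  ultimately show ?thesis using True by (simp add: prime_log_corr_def)
 qed (simp add: prime_log_corr_def)
 then show "prime_log_corr \<eta> n >= 0" "prime_log_corr \<eta> n <= 2 * real n powr (-2)" by auto
 show "summable (prime_log_corr \<eta>)"
  by (rule summable_comparison_test'[of "%n. 2 * real n powr (-2)" 0])
   (use * summable_nat_powr[of 2 0] in \<open>auto intro!: summable_mult\<close>)
qed

lemma nat_powr_minus_one: "n > 0 ==> real n powr (-1 - \<eta>) = 1 / n * exp (- (\<eta> * ln n))"
proof -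
 assume n: "n > 0"
 have "real n powr (-1 - \<eta>) = exp (- ln n) * exp (- (\<eta> * ln n))"
  using n by (simp add: powr_def algebra_simps flip: exp_add)
 then show ?thesis using n by (simp add: exp_minus divide_inverse)
qed

text \<open>Lipschitz at 0, since 1/n - n^(-1-\<eta>) <= \<eta> ln n / n and the resulting weights
  ln n / n^2 are summable.\<close>

lemma prime_log_corr_tendsto:
 "((%\<eta>. \<Sum>n. prime_log_corr \<eta> n) \<longlongrightarrow> log_corr_const) (at_right 0)"
proof (rule LIM_zero_cancel, rule Lim_null_comparison)
 define K where "K = (\<Sum>n. 2 * (prime_ln n * real n powr (-2)))"
 have sK: "summable (%n. 2 * (prime_ln n * real n powr (-2)))"
  using summable_prime_ln[of 2] by (intro summable_mult) auto
 have "norm ((\<Sum>n. prime_log_corr \<eta> n) - log_corr_const) <= \<eta> * K" if \<eta>: "\<eta> > 0" for \<eta>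
 proof -
  have "norm (prime_log_corr \<eta> n - prime_log_corr 0 n) <= \<eta> * (2 * (prime_ln n * real n powr (-2)))" for n
  proof (cases "prime n")
   case True
   have n: "n > 0" using True by (rule prime_gt_0_nat)
   note p = prime_powr_le_half[OF True less_imp_le[OF \<eta>]]
   have e: "real n powr (-1 - 0) = 1 / n" using n by (simp add: powr_minus_divide)
   have "real n powr (-1 - \<eta>) = 1 / n * exp (- (\<eta> * ln n))"
    using n by (rule nat_powr_minus_one)
   moreover have "exp (- (\<eta> * ln n)) >= 1 + - (\<eta> * ln n)" by (rule exp_ge_add_one_self)
   then have "1 / n * exp (- (\<eta> * ln n)) >= 1 / n * (1 + - (\<eta> * ln n))" by (intro mult_left_mono) auto
   ultimately have d: "1 / n - real n powr (-1 - \<eta>) <= \<eta> * ln n / n" using n by (simp add: field_simps)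
   have "norm (prime_log_corr \<eta> n - prime_log_corr 0 n) = log_corr (1 / n) - log_corr (real n powr (-1 - \<eta>))"
    using log_corr_diff_le(1)[of "real n powr (-1 - \<eta>)" "1 / n"] p True e by (simp add: prime_log_corr_def)
   also have "... <= 2 * (1 / n) * (1 / n - real n powr (-1 - \<eta>))"
    using log_corr_diff_le(2)[of "real n powr (-1 - \<eta>)" "1 / n"] p by simp
   also have "... <= 2 * (1 / n) * (\<eta> * ln n / n)" by (intro mult_left_mono d) auto
   also have "... = \<eta> * (2 * (prime_ln n * real n powr (-2)))"
    using n True powr_realpow[of "real n" 2] by (simp add: prime_ln_def powr_minus_divide power2_eq_square)
   finally show ?thesis .
  qed (simp add: prime_log_corr_def prime_ln_def)
  then have "norm (\<Sum>n. prime_log_corr \<eta> n - prime_log_corr 0 n) <= (\<Sum>n. \<eta> * (2 * (prime_ln n * real n powr (-2))))"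
   by (intro norm_suminf_le summable_mult sK)
  then show ?thesis
   using \<eta> suminf_diff[of "prime_log_corr \<eta>" "prime_log_corr 0"] prime_log_corr_summable(1) suminf_mult[OF sK]
   by (simp add: log_corr_const_def K_def)
 qed
 then show "\<forall>\<^sub>F \<eta> in at_right 0. norm ((\<Sum>n. prime_log_corr \<eta> n) - log_corr_const) <= \<eta> * K"
  by (auto simp: eventually_at_filter)
 show "((%\<eta>. \<eta> * K) \<longlongrightarrow> 0) (at_right 0)" by (rule tendsto_eq_intros refl | simp)+
qed

lemma log_zeta_tendsto:
 assumes "\<sigma> > 1"
 shows "(%N. \<Sum>p\<in>primes_le N. - ln (1 - real p powr (-\<sigma>))) \<longlonglongrightarrow> ln (norm (zeta (of_real \<sigma>)))"
proof -
 have s: "Re (of_real \<sigma> :: complex) > 1" using assms by simp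
 have lt: "real p powr (-\<sigma>) < 1" if "prime p" for p
  using that assms prime_gt_1_nat by (simp add: powr_less_one)
 have n0: "norm (zeta (of_real \<sigma>)) > 0" using zeta_nonzero_right[OF s] by simp
 have eq: "ln (norm (zeta (of_real \<sigma>) * (\<Prod>p\<in>primes_le N. 1 - of_nat p powr (- of_real \<sigma>)))) =
   ln (norm (zeta (of_real \<sigma>))) - (\<Sum>p\<in>primes_le N. - ln (1 - real p powr (-\<sigma>)))" for N
 proof -
  have "norm (1 - of_nat p powr (- of_real \<sigma>) :: complex) = 1 - real p powr (-\<sigma>)" if "p \<in> primes_le N" for p
  proof -
   have "(1 - of_nat p powr (- of_real \<sigma>) :: complex) = of_real (1 - real p powr (-\<sigma>))"
    using powr_of_real[of "real p" "-\<sigma>"] by simp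
   then show ?thesis using lt[of p] that by (simp only: norm_of_real) (simp add: primes_le_def)
  qed
  then have "norm (\<Prod>p\<in>primes_le N. 1 - of_nat p powr (- of_real \<sigma>) :: complex) = (\<Prod>p\<in>primes_le N. 1 - real p powr (-\<sigma>))"
   unfolding prod_norm[symmetric] by (intro prod.cong) auto
  moreover have "(\<Prod>p\<in>primes_le N. 1 - real p powr (-\<sigma>)) > 0"
   using lt by (intro prod_pos) (auto simp: primes_le_def)
  moreover have "ln (\<Prod>p\<in>primes_le N. 1 - real p powr (-\<sigma>)) = (\<Sum>p\<in>primes_le N. ln (1 - real p powr (-\<sigma>)))"
  proof (rule ln_prod)
   fix p assume "p \<in> primes_le N"
   then have "real p powr (-\<sigma>) < 1" using lt by (simp add: primes_le_def)
   then show "1 - real p powr (-\<sigma>) ~= 0" by linarith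
  qed simp
  ultimately show ?thesis using n0
   by (simp only: norm_mult ln_mult_pos sum_negf)
 qed
 have "(%N. ln (norm (zeta (of_real \<sigma>) * (\<Prod>p\<in>primes_le N. 1 - of_nat p powr (- of_real \<sigma>))))) \<longlonglongrightarrow> ln (norm (1::complex))"
  by (intro tendsto_ln tendsto_norm euler_product_tendsto s) auto
 then have "(%N. ln (norm (zeta (of_real \<sigma>))) - (ln (norm (zeta (of_real \<sigma>))) - (\<Sum>p\<in>primes_le N. - ln (1 - real p powr (-\<sigma>)))))
   \<longlonglongrightarrow> ln (norm (zeta (of_real \<sigma>))) - ln (norm (1::complex))"
  unfolding eq by (intro tendsto_intros)
 then show ?thesis by simp
qed

lemma prime_set_eq: "prime_set u = primes_le (nat \<lfloor>exp u\<rfloor>)"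
proof -
 have "ln (real p) <= u \<longleftrightarrow> p <= nat \<lfloor>exp u\<rfloor>" if "prime p" for p
 proof -
  have "real p > 0" using that by (simp add: prime_gt_0_nat)
  then have "ln (real p) <= u \<longleftrightarrow> real p <= exp u" by (metis exp_le_cancel_iff exp_ln)
  then show ?thesis by (simp add: le_nat_iff le_floor_iff)
 qed
 then show ?thesis by (auto simp: prime_set_def primes_le_def)
qed

lemma filterlim_nat_floor_exp: "filterlim (%n. nat \<lfloor>exp (real n)\<rfloor>) at_top sequentially"
proof (rule filterlim_at_top_mono[OF filterlim_ident])
 have "n <= nat \<lfloor>exp (real n)\<rfloor>" for n
  using exp_ge_add_one_self[of "real n"] by (intro le_nat_floor) linarith
 then show "\<forall>\<^sub>F n in sequentially. n <= nat \<lfloor>exp (real n)\<rfloor>" by simp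
qed

lemma prime_powr_sum_tendsto:
 assumes "\<eta> > 0"
 shows "(%n. \<Sum>p\<in>prime_set (real n). 1 / p * exp (- \<eta> * ln p)) \<longlonglongrightarrow> ln (norm (zeta (of_real (1 + \<eta>)))) - (\<Sum>n. prime_log_corr \<eta> n)"
proof -
 have eq: "(%N. \<Sum>p\<in>primes_le N. prime_log_corr \<eta> p) = (%N. \<Sum>p<Suc N. prime_log_corr \<eta> p)"
  by (rule ext, rule sum.mono_neutral_left) (auto simp: primes_le_def prime_log_corr_def)
 have lim: "(%N. \<Sum>p<N. prime_log_corr \<eta> p) \<longlonglongrightarrow> (\<Sum>n. prime_log_corr \<eta> n)"
  using prime_log_corr_summable(1)[of \<eta>] assms by (intro summable_LIMSEQ) auto
 have 1: "(%N. \<Sum>p\<in>primes_le N. prime_log_corr \<eta> p) \<longlonglongrightarrow> (\<Sum>n. prime_log_corr \<eta> n)"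
  unfolding eq by (rule LIMSEQ_Suc[OF lim])
 have "(%N. (\<Sum>p\<in>primes_le N. - ln (1 - real p powr (-(1 + \<eta>)))) - (\<Sum>p\<in>primes_le N. prime_log_corr \<eta> p))
   \<longlonglongrightarrow> ln (norm (zeta (of_real (1 + \<eta>)))) - (\<Sum>n. prime_log_corr \<eta> n)"
  using assms by (intro tendsto_diff log_zeta_tendsto 1) auto
 also have "(%N. (\<Sum>p\<in>primes_le N. - ln (1 - real p powr (-(1 + \<eta>)))) - (\<Sum>p\<in>primes_le N. prime_log_corr \<eta> p))
   = (%N. \<Sum>p\<in>primes_le N. 1 / p * exp (- \<eta> * ln p))"
 proof
  fix N
  have "- ln (1 - real p powr (-(1 + \<eta>))) - prime_log_corr \<eta> p = 1 / p * exp (- \<eta> * ln p)" if "p \<in> primes_le N" for p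
  proof -
   have p: "prime p" "p > 0" using that by (auto simp: primes_le_def prime_gt_0_nat)
   have "real p powr (-1 - \<eta>) = 1 / p * exp (- \<eta> * ln p)"
    using nat_powr_minus_one[OF p(2)] by simp
   moreover have "-(1 + \<eta>) = -1 - \<eta>" by simp
   ultimately show ?thesis using p by (simp only: prime_log_corr_def log_corr_def if_True)
  qed
  then show "(\<Sum>p\<in>primes_le N. - ln (1 - real p powr (-(1 + \<eta>)))) - (\<Sum>p\<in>primes_le N. prime_log_corr \<eta> p)
   = (\<Sum>p\<in>primes_le N. 1 / p * exp (- \<eta> * ln p))"
   unfolding sum_subtractf[symmetric] by (intro sum.cong refl)
 qed
 finally show ?thesis
  unfolding prime_set_eq by (rule filterlim_compose[OF _ filterlim_nat_floor_exp])
qed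

lemma harm_floor_tendsto: "((%u. (\<Sum>n | n \<in> {1..} & real n <= u. 1 / real n) - ln u) \<longlongrightarrow> euler_mascheroni) at_top"
proof -
 have eq: "(\<Sum>n | n \<in> {1..} & real n <= u. 1 / real n) = harm (nat \<lfloor>u\<rfloor>)" if "u >= 1" for u
 proof -
  have "{n. n \<in> {1..} & real n <= u} = {1..nat \<lfloor>u\<rfloor>}" using that by (auto simp: le_nat_floor) linarith
  then show ?thesis by (simp add: harm_def inverse_eq_divide)
 qed
 have fl: "filterlim (%u::real. nat \<lfloor>u\<rfloor>) sequentially at_top"
  by (rule filterlim_compose[OF filterlim_nat_sequentially filterlim_floor_sequentially])
 have "((%u::real. harm (nat \<lfloor>u\<rfloor>) - ln (real (nat \<lfloor>u\<rfloor>))) \<longlongrightarrow> euler_mascheroni) at_top"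
  by (rule filterlim_compose[OF euler_mascheroni_LIMSEQ fl])
 moreover have "((%u. ln (real (nat \<lfloor>u\<rfloor>)) - ln u) \<longlongrightarrow> 0) at_top"
 proof (rule Lim_null_comparison)
  show "((%u::real. ln u - ln (u - 1)) \<longlongrightarrow> 0) at_top" by real_asymp
  show "\<forall>\<^sub>F u in at_top. norm (ln (real (nat \<lfloor>u\<rfloor>)) - ln u) <= ln u - ln (u - 1)"
   using eventually_gt_at_top[of 1]
  proof eventually_elim
   case (elim u)
   have r: "real (nat \<lfloor>u\<rfloor>) <= u" "real (nat \<lfloor>u\<rfloor>) > u - 1" using elim by linarith+
   then have "ln (real (nat \<lfloor>u\<rfloor>)) <= ln u" "ln (real (nat \<lfloor>u\<rfloor>)) >= ln (u - 1)" using elim by (simp_all del: of_nat_nat)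
   then show ?case by simp
  qed
 qed
 ultimately have "((%u. harm (nat \<lfloor>u\<rfloor>) - ln (real (nat \<lfloor>u\<rfloor>)) + (ln (real (nat \<lfloor>u\<rfloor>)) - ln u)) \<longlongrightarrow> euler_mascheroni + 0) at_top"
  by (rule tendsto_add)
 note lim = this[unfolded add_0_right]
 have "\<forall>\<^sub>F u in at_top. harm (nat \<lfloor>u\<rfloor>) - ln (real (nat \<lfloor>u\<rfloor>)) + (ln (real (nat \<lfloor>u\<rfloor>)) - ln u)
   = (\<Sum>n | n \<in> {1..} & real n <= u. 1 / real n) - ln u"
  using eventually_ge_at_top[of 1]
 proof eventually_elim
  case (elim u)
  show ?case unfolding eq[OF elim] by simp
 qed
 then show ?thesis by (rule Lim_transform_eventually[OF lim])
qed

text \<open>An Abelian comparison of two sums that both are ln u plus a constant: 1/p placed at ln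
  p, and 1/n placed at n. Weighted with e^(-\<eta> y) they become ln zeta(1 + \<eta>) minus the
  prime power part, and -ln(1 - e^(-\<eta>)). Both logarithms behave like -ln \<eta>, so the
  constants differ by \<open>log_corr_const\<close>.\<close>

lemma mertens_constant:
 assumes M: "((%u. prime_recip_sum u - ln u) \<longlongrightarrow> M) at_top"
 shows "M = euler_mascheroni - log_corr_const"
proof -
 define hs where "hs u = (\<Sum>n | n \<in> {1..} & real n <= u. 1 / real n)" for u
 define L where "L = M - euler_mascheroni"
 define D where "D u = prime_recip_sum u - hs u" for u
 have finN: "finite {n. n \<in> {1..} & real n <= u}" for u
  by (rule finite_subset[of _ "{..nat \<lfloor>u\<rfloor>}"]) (auto simp: le_nat_floor)
 have "((%u. (prime_recip_sum u - ln u) - (hs u - ln u)) \<longlongrightarrow> L) at_top"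
  unfolding L_def hs_def by (intro tendsto_diff M harm_floor_tendsto)
 then have DL: "(D \<longlongrightarrow> L) at_top" by (simp add: D_def[abs_def])
 define Z where "Z \<eta> = ln (norm (zeta (of_real (1 + \<eta>)))) - (\<Sum>n. prime_log_corr \<eta> n) + ln (1 - exp (- \<eta>))" for \<eta>
 \<comment> \<open>By partial summation the weighted difference minus L is an average of D - L
   against \<eta> e^(-\<eta> y) dy plus a boundary term. The range beyond \<open>u0\<close> and the
   boundary term cost \<epsilon> each, the range before \<open>u0\<close> costs at most K u0
   \<eta>.\<close>
 have key: "\<exists>K. \<forall>\<eta>>0. \<bar>Z \<eta> - L\<bar> <= 2 * \<epsilon> + K * \<eta>" if \<epsilon>: "\<epsilon> > 0" for \<epsilon>
 proof -
  have "\<forall>\<^sub>F u in at_top. \<bar>D u - L\<bar> < \<epsilon>"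
   using tendstoD[OF DL \<epsilon>] by (simp add: dist_real_def)
  then obtain u1 where u1: "\<And>u. u >= u1 ==> \<bar>D u - L\<bar> < \<epsilon>" by (auto simp: eventually_at_top_linorder)
  define u0 where "u0 = max u1 1"
  define K where "K = prime_recip_sum u0 + hs u0 + \<bar>L\<bar>"
  have hs_mono: "hs u <= hs v" if "u <= v" for u v
   unfolding hs_def by (intro sum_mono2 finN) (use that in auto)
  have hs0: "hs u >= 0" for u unfolding hs_def by (intro sum_nonneg) auto
  have DK: "\<bar>D u - L\<bar> <= K" if "u <= u0" for u
   using prime_recip_sum_mono[OF that] hs_mono[OF that] prime_recip_sum_nonneg[of u] hs0[of u]
   unfolding D_def K_def by linarith
  have K0: "K >= 0" using prime_recip_sum_nonneg[of u0] hs0[of u0] by (simp add: K_def)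
  have "\<bar>Z \<eta> - L\<bar> <= 2 * \<epsilon> + (K * u0) * \<eta>" if \<eta>: "\<eta> > 0" for \<eta>
  proof -
   define X where "X N = (\<Sum>p\<in>prime_set (real N). 1 / p * exp (- \<eta> * ln p)) - (\<Sum>n | n \<in> {1..} & 0 < real n & real n <= real N. 1 / n * exp (- \<eta> * n))" for N :: nat
   have X: "\<bar>X N - L\<bar> <= 2 * \<epsilon> + (K * u0) * \<eta>" if N: "real N >= u0" for N
   proof -
    let ?U = "real N"
    let ?g = "%y. exp (- \<eta> * y)" and ?g' = "%y. - \<eta> * exp (- \<eta> * y)"
    have U: "0 <= ?U" by simp
    have d: "(?g has_real_derivative ?g' y) (at y within A)" for y A
     by (auto intro!: derivative_eq_intros)
    have ps0: "prime_set 0 = {}" by (auto simp: prime_set_def dest: prime_gt_1_nat)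
    have 1: "((%y. prime_recip_sum y * ?g' y) has_integral
      (prime_recip_sum ?U * ?g ?U - 0 * ?g 0 - (\<Sum>p\<in>prime_set ?U. 1 / p * exp (- \<eta> * ln p)))) {0..?U}"
     using abel_summation_primes[OF U d, of "%p. 1 / p"] by (simp add: prime_recip_sum_def ps0)
    have "{n. n \<in> {1..} & real n <= 0} = {}" by auto
    then have 2: "((%y. hs y * ?g' y) has_integral
      (hs ?U * ?g ?U - 0 * ?g 0 - (\<Sum>n | n \<in> {1..} & 0 < real n & real n <= ?U. 1 / n * exp (- \<eta> * n)))) {0..?U}"
     using abel_summation[where x = real and I = "{1..}" and c = "%n. 1 / real n", OF finN U d] by (simp add: hs_def)
    have 3: "((%y. ?g' y) has_integral (?g ?U - ?g 0)) {0..?U}"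
     by (rule fundamental_theorem_of_calculus[OF U]) (use d in \<open>simp flip: has_real_derivative_iff_has_vector_derivative\<close>)
    have "((%y. - (prime_recip_sum y * ?g' y - hs y * ?g' y - L * ?g' y)) has_integral
      - ((prime_recip_sum ?U * ?g ?U - 0 * ?g 0 - (\<Sum>p\<in>prime_set ?U. 1 / p * exp (- \<eta> * ln p)))
      - (hs ?U * ?g ?U - 0 * ?g 0 - (\<Sum>n | n \<in> {1..} & 0 < real n & real n <= ?U. 1 / n * exp (- \<eta> * n)))
      - L * (?g ?U - ?g 0))) {0..?U}"
     by (intro has_integral_neg has_integral_diff 1 2 has_integral_mult_right 3)
    also have "- ((prime_recip_sum ?U * ?g ?U - 0 * ?g 0 - (\<Sum>p\<in>prime_set ?U. 1 / p * exp (- \<eta> * ln p)))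
      - (hs ?U * ?g ?U - 0 * ?g 0 - (\<Sum>n | n \<in> {1..} & 0 < real n & real n <= ?U. 1 / n * exp (- \<eta> * n)))
      - L * (?g ?U - ?g 0)) = X N - L - (D ?U - L) * ?g ?U"
     by (simp add: X_def D_def algebra_simps)
    also have "(%y. - (prime_recip_sum y * ?g' y - hs y * ?g' y - L * ?g' y)) = (%y. (D y - L) * (\<eta> * ?g y))"
     by (auto simp: D_def fun_eq_iff algebra_simps)
    finally have 4: "((%y. (D y - L) * (\<eta> * ?g y)) has_integral (X N - L - (D ?U - L) * ?g ?U)) {0..?U}" .
    have 5: "((%y. \<epsilon> * (\<eta> * ?g y)) has_integral (\<epsilon> * (?g 0 - ?g ?U))) {0..?U}"
     using has_integral_mult_right[OF has_integral_neg[OF 3], of \<epsilon>] by simp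
    have 6: "((%y. if y \<in> {0..u0} then K * \<eta> else 0) has_integral (K * \<eta> * u0)) {0..?U}"
    proof (subst has_integral_restrict)
     have "u0 >= 0" by (simp add: u0_def)
     then show "((%y. K * \<eta>) has_integral (K * \<eta> * u0)) {0..u0}"
      using has_integral_const_real[of "K * \<eta>" 0 u0] by (simp add: mult_ac)
    qed (use N in auto)
    have "norm (integral {0..?U} (%y. (D y - L) * (\<eta> * ?g y))) <= integral {0..?U} (%y. \<epsilon> * (\<eta> * ?g y) + (if y \<in> {0..u0} then K * \<eta> else 0))"
    proof (rule integral_norm_bound_integral)
     fix y assume y: "y \<in> {0..?U}"
     have g1: "0 <= \<eta> * ?g y" "\<eta> * ?g y <= \<eta>" using \<eta> y by auto
     have nrm: "norm ((D y - L) * (\<eta> * ?g y)) = \<bar>D y - L\<bar> * (\<eta> * ?g y)"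
      by (simp only: real_norm_def abs_mult[of "D y - L"] abs_of_nonneg[OF g1(1)])
     show "norm ((D y - L) * (\<eta> * ?g y)) <= \<epsilon> * (\<eta> * ?g y) + (if y \<in> {0..u0} then K * \<eta> else 0)"
     proof (cases "y <= u0")
      case True
      have "\<bar>D y - L\<bar> * (\<eta> * ?g y) <= K * \<eta>" using DK[OF True] g1 K0 by (intro mult_mono) auto
      moreover have "0 <= \<epsilon> * (\<eta> * ?g y)" using \<epsilon> g1 by simp
      moreover have "y \<in> {0..u0}" using True y by simp
      ultimately show ?thesis unfolding nrm by (simp only: if_True)
     next
      case False
      then have "u1 <= y" by (simp add: u0_def)
      then have "\<bar>D y - L\<bar> <= \<epsilon>" using u1 by (intro less_imp_le)
      then have "\<bar>D y - L\<bar> * (\<eta> * ?g y) <= \<epsilon> * (\<eta> * ?g y)" using g1 by (intro mult_right_mono) auto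
      moreover have "y \<notin> {0..u0}" using False by simp
      ultimately show ?thesis unfolding nrm by (simp only: if_False add_0_right)
     qed
    qed (use 4 has_integral_add[OF 5 6] in \<open>auto dest: has_integral_integrable\<close>)
    then have "\<bar>X N - L - (D ?U - L) * ?g ?U\<bar> <= \<epsilon> * (?g 0 - ?g ?U) + K * \<eta> * u0"
     using integral_unique[OF 4] integral_unique[OF has_integral_add[OF 5 6]] by simp
    moreover have "\<epsilon> * (?g 0 - ?g ?U) <= \<epsilon> * 1" using \<epsilon> by (intro mult_left_mono) auto
    moreover have "\<bar>(D ?U - L) * ?g ?U\<bar> <= \<epsilon> * 1"
     unfolding abs_mult using u1[of ?U] N \<eta> \<epsilon> by (intro mult_mono) (auto simp: u0_def)
    ultimately show ?thesis by (simp add: mult_ac)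
   qed
   have "(%N. \<Sum>n | n \<in> {1..} & 0 < real n & real n <= real N. 1 / n * exp (- \<eta> * n)) \<longlonglongrightarrow> - ln (1 - exp (- \<eta>))"
   proof -
    let ?x = "exp (- \<eta>)"
    have x: "0 < ?x" "?x < 1" using \<eta> by auto
    have "(%n. - ((-1) ^ Suc n / of_nat n * (- complex_of_real ?x) ^ n)) sums - Ln (1 + - complex_of_real ?x)"
     by (intro sums_minus Ln_series) (use x in simp)
    then have "(%n. Re (- ((-1) ^ Suc n / of_nat n * (- complex_of_real ?x) ^ n))) sums Re (- Ln (1 + - complex_of_real ?x))"
     by (rule sums_Re)
    moreover have "Re (- ((-1) ^ Suc n / of_nat n * (- complex_of_real ?x) ^ n)) = 1 / n * ?x ^ n" for n
    proof -
     have "- ((-1) ^ Suc n / of_nat n * (- complex_of_real ?x) ^ n) = complex_of_real (1 / n * ?x ^ n)"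
      by (simp add: power_minus' minus_one_power_iff)
     then show ?thesis by (simp only: Re_complex_of_real)
    qed
    moreover have "Re (- Ln (1 + - complex_of_real ?x)) = - ln (1 - ?x)"
     using Ln_of_real[of "1 - ?x"] x by simp
    ultimately have "(%n. 1 / n * ?x ^ n) sums (- ln (1 - ?x))" by (simp only:)
    then have "(%N. \<Sum>n<Suc N. 1 / n * ?x ^ n) \<longlonglongrightarrow> - ln (1 - ?x)"
     unfolding sums_def by (rule LIMSEQ_Suc)
    moreover have "(\<Sum>n<Suc N. 1 / n * ?x ^ n) = (\<Sum>n | n \<in> {1..} & 0 < real n & real n <= real N. 1 / n * exp (- \<eta> * n))" for N
     by (rule sum.mono_neutral_cong_right) (auto simp: exp_of_nat_mult[symmetric] mult.commute)
    ultimately show ?thesis by simp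
   qed
   then have "X \<longlonglongrightarrow> ln (norm (zeta (of_real (1 + \<eta>)))) - (\<Sum>n. prime_log_corr \<eta> n) - (- ln (1 - exp (- \<eta>)))"
    unfolding X_def[abs_def] by (intro tendsto_diff prime_powr_sum_tendsto \<eta>)
   then have "(%N. \<bar>X N - L\<bar>) \<longlonglongrightarrow> \<bar>Z \<eta> - L\<bar>"
    by (intro tendsto_intros) (simp add: Z_def)
   moreover obtain N0 :: nat where "u0 <= real N0" using real_arch_simple by blast
   then have "\<forall>\<^sub>F N in sequentially. \<bar>X N - L\<bar> <= 2 * \<epsilon> + (K * u0) * \<eta>"
    by (intro eventually_sequentiallyI[of N0] X) (meson of_nat_le_iff order_trans)
   ultimately show ?thesis by (intro tendsto_upperbound[of _ _ sequentially]) auto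
  qed
  then show ?thesis by blast
 qed
 \<comment> \<open>The two logarithms cancel in the limit because \<eta> zeta(1 + \<eta>) and (1 -
   e^(-\<eta>)) / \<eta> both tend to 1.\<close>
 have Zlim: "(Z \<longlongrightarrow> 0 - log_corr_const) (at_right 0)"
 proof -
  have "((%\<eta>. norm (zeta_reg (of_real (1 + \<eta>)))) \<longlongrightarrow> norm (zeta_reg (of_real (1 + 0)))) (at_right (0::real))"
   by (intro tendsto_norm isCont_tendsto_compose[of _ zeta_reg] tendsto_intros)
    (use holomorphic_on_imp_continuous_on[OF zeta_reg_holomorphic] in \<open>auto simp: continuous_on_eq_continuous_at\<close>)
  then have 1: "((%\<eta>. norm (zeta_reg (of_real (1 + \<eta>)))) \<longlongrightarrow> 1) (at_right (0::real))" by (simp add: zeta_reg_def)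
  have 2: "((%\<eta>::real. (1 - exp (- \<eta>)) / \<eta>) \<longlongrightarrow> 1) (at_right 0)" by real_asymp
  have "((%\<eta>. ln (norm (zeta_reg (of_real (1 + \<eta>)))) + ln ((1 - exp (- \<eta>)) / \<eta>)) \<longlongrightarrow> ln 1 + ln 1) (at_right (0::real))"
   by (intro tendsto_add tendsto_ln 1 2) auto
  moreover have "\<forall>\<^sub>F \<eta> in at_right (0::real). ln (norm (zeta_reg (of_real (1 + \<eta>)))) + ln ((1 - exp (- \<eta>)) / \<eta>)
    = ln (norm (zeta (of_real (1 + \<eta>)))) + ln (1 - exp (- \<eta>))"
   using eventually_at_right_less[of "0::real"]
  proof eventually_elim
   case (elim \<eta>)
   have "zeta (of_real (1 + \<eta>)) ~= 0" by (rule zeta_nonzero_right) (use elim in simp)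
   moreover have "norm (zeta_reg (of_real (1 + \<eta>))) = \<eta> * norm (zeta (of_real (1 + \<eta>)))"
    using elim by (simp add: zeta_reg_def norm_mult)
   moreover have "1 - exp (- \<eta>) > 0" using elim by simp
   ultimately show ?case using elim by (simp add: ln_mult ln_div)
  qed
  ultimately have 3: "((%\<eta>. ln (norm (zeta (of_real (1 + \<eta>)))) + ln (1 - exp (- \<eta>))) \<longlongrightarrow> 0) (at_right (0::real))"
   by (simp add: tendsto_cong)
  have "((%\<eta>. (ln (norm (zeta (of_real (1 + \<eta>)))) + ln (1 - exp (- \<eta>))) - (\<Sum>n. prime_log_corr \<eta> n)) \<longlongrightarrow> 0 - log_corr_const) (at_right 0)"
   by (intro tendsto_diff 3 prime_log_corr_tendsto)
  then show ?thesis by (simp add: Z_def[abs_def] algebra_simps)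
 qed
 have "\<bar>(0 - log_corr_const) - L\<bar> <= 2 * \<epsilon>" if "\<epsilon> > 0" for \<epsilon>
 proof -
  obtain K where K: "\<And>\<eta>. \<eta> > 0 ==> \<bar>Z \<eta> - L\<bar> <= 2 * \<epsilon> + K * \<eta>" using key[OF \<open>\<epsilon> > 0\<close>] by blast
  have "((%\<eta>. \<bar>Z \<eta> - L\<bar>) \<longlongrightarrow> \<bar>(0 - log_corr_const) - L\<bar>) (at_right 0)" by (intro tendsto_intros Zlim)
  moreover have "((%\<eta>. 2 * \<epsilon> + K * \<eta>) \<longlongrightarrow> 2 * \<epsilon> + K * 0) (at_right 0)" by (intro tendsto_intros)
  moreover have "\<forall>\<^sub>F \<eta> in at_right 0. \<bar>Z \<eta> - L\<bar> <= 2 * \<epsilon> + K * \<eta>"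
   using eventually_at_right_less[of "0::real"] by eventually_elim (rule K)
  ultimately have "\<bar>(0 - log_corr_const) - L\<bar> <= 2 * \<epsilon> + K * 0"
   by (intro tendsto_le[of "at_right (0::real)"]) auto
  then show ?thesis by simp
 qed
 from this[of "\<bar>(0 - log_corr_const) - L\<bar> / 4"] have "\<bar>(0 - log_corr_const) - L\<bar> = 0"
  by (cases "\<bar>(0 - log_corr_const) - L\<bar> = 0") auto
 then show ?thesis by (simp add: L_def)
qed

theorem prime_mertens:
 obtains C :: real where "C > 0"
  "\<And>u. u >= 1/2 ==> \<bar>prime_recip_sum u - ln u - (euler_mascheroni - log_corr_const)\<bar> <= C / u ^ 3"
proof -
 obtain M C :: real where M: "C > 0" "\<And>u. u >= 1/2 ==> \<bar>prime_recip_sum u - ln u - M\<bar> <= C / u ^ 3"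
  by (rule prime_mertens_second, rule that, assumption+)
 have "((%u. prime_recip_sum u - ln u) \<longlongrightarrow> M) at_top"
 proof (rule LIM_zero_cancel, rule Lim_null_comparison)
  show "\<forall>\<^sub>F u in at_top. norm (prime_recip_sum u - ln u - M) <= C / u ^ 3"
   using eventually_ge_at_top[of "1/2"] by eventually_elim (use M in simp)
  show "((%u. C / u ^ 3) \<longlongrightarrow> 0) at_top" by real_asymp
 qed
 then have "M = euler_mascheroni - log_corr_const" by (rule mertens_constant)
 then show ?thesis using M that by blast
qed

subsection \<open>Square waves and prime sums\<close>

text \<open>The sign of sin(b u) for u > 0, except that at a zero k pi / b it keeps the value of the
  block on its left. It is never 0, so it can be prescribed as a sign, and its blocks match the
  half-open differences of \<open>prime_set\<close>.\<close>

definition square_wave :: "real => real => real" where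
 "square_wave b u = (- 1) ^ (nat (\<lceil>u * b / pi\<rceil> - 1))"

definition wave_sum :: "real => nat => real => real" where
 "wave_sum b K t = (\<Sum>p\<in>prime_set (real K * pi / b). square_wave b (ln p) * cos (t * ln p) / p)"

definition cos_int :: "real => real => real => real" where
 "cos_int u v t = integral {u..v} (%y. cos (t * y) / y)"

text \<open>What \<open>wave_sum\<close> becomes, up to an additive constant, when the weights 1/p
  are replaced by their density dy / y in y = ln p, started at 1/2.\<close>

definition wave_int :: "real => nat => real => real" where
 "wave_int b K t = cos_int (1/2) (pi / b) t +
   (\<Sum>k=1..<K. (- 1) ^ k * cos_int (real k * pi / b) (real (Suc k) * pi / b) t)"

lemma square_wave_eq:
 assumes "b > 0" "real k * pi / b < u" "u <= real (Suc k) * pi / b"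
 shows "square_wave b u = (- 1) ^ k"
proof -
 have "real k < u * b / pi" "u * b / pi <= real (Suc k)" using assms by (simp_all add: field_simps)
 then have "\<lceil>u * b / pi\<rceil> = int (Suc k)" by (intro ceiling_unique) auto
 then show ?thesis by (simp add: square_wave_def)
qed

lemma abs_square_wave [simp]: "\<bar>square_wave b u\<bar> = 1"
 by (simp add: square_wave_def power_abs)

lemma square_wave_sin:
 assumes "b > 0" "u > 0"
 shows "square_wave b u * sin (b * u) = \<bar>sin (b * u)\<bar>"
proof -
 define k where "k = nat (\<lceil>u * b / pi\<rceil> - 1)"
 have pos: "u * b / pi > 0" using assms by simp
 then have "\<lceil>u * b / pi\<rceil> >= 1" by linarith
 then have k: "real k = of_int \<lceil>u * b / pi\<rceil> - 1" by (simp add: k_def)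
 then have "real k < u * b / pi" "u * b / pi <= real k + 1" by linarith+
 then have r: "0 <= b * u - real k * pi" "b * u - real k * pi <= pi" by (simp_all add: field_simps)
 have "sin (b * u) = sin (real k * pi + (b * u - real k * pi))" by simp
 also have "... = (- 1) ^ k * sin (b * u - real k * pi)"
  unfolding sin_add by (simp add: cos_npi mult.commute)
 finally have s: "sin (b * u) = (- 1) ^ k * sin (b * u - real k * pi)" .
 have "sin (b * u - real k * pi) >= 0" using r by (rule sin_ge_zero)
 then have "\<bar>sin (b * u)\<bar> = sin (b * u - real k * pi)" unfolding s by (simp add: abs_mult power_abs)
 moreover have "square_wave b u * sin (b * u) = sin (b * u - real k * pi)"
  unfolding s square_wave_def k_def[symmetric] by (simp flip: power_add mult.assoc)
 ultimately show ?thesis by simp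
qed

lemma cos_int_integrable: "0 < u ==> (%y. cos (t * y) / y) integrable_on {u..v}" for t u v :: real
 by (intro integrable_continuous_interval continuous_intros) auto

lemma one_minus_cos_le: "1 - cos x <= x\<^sup>2 / 2" for x :: real
proof -
 have "1 - cos x = 2 * (sin (x / 2))\<^sup>2" using cos_double_sin[of "x / 2"] by simp
 also have "(sin (x / 2))\<^sup>2 <= (x / 2)\<^sup>2" using abs_sin_x_le_abs_x[of "x / 2"] by (simp only: abs_le_square_iff)
 finally show ?thesis by (simp add: power2_eq_square)
qed

context
 fixes M C :: real and E :: "real => real"
 assumes C: "C > 0" and Mert: "\<And>u. u >= 1/2 ==> \<bar>prime_recip_sum u - ln u - M\<bar> <= C / u ^ 3"
 defines "E \<equiv> %u. prime_recip_sum u - ln u - M"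
begin

text \<open>Partial summation against the error E. Since |t sin(t y)| <= t^2 y, the bound E =
  O(y^(-3)) leaves an integral of t^2 / y^2, so the blocks add up to O(t^2) without a
  logarithm.\<close>

lemma prime_cos_block:
 assumes "1/2 <= u" "u <= v"
 shows "\<bar>(\<Sum>p\<in>prime_set v - prime_set u. cos (t * ln p) / p) - cos_int u v t - (E v * cos (t * v) - E u * cos (t * u))\<bar>
   <= C * t\<^sup>2 * (1 / u - 1 / v)"
proof -
 have u0: "u > 0" using assms by simp
 have 1: "((%y. prime_recip_sum y * (- (t * sin (t * y)))) has_integral
   (prime_recip_sum v * cos (t * v) - prime_recip_sum u * cos (t * u) - (\<Sum>p\<in>prime_set v - prime_set u. 1 / p * cos (t * ln p)))) {u..v}"
  unfolding prime_recip_sum_def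
  by (rule abel_summation_primes[OF assms(2)]) (auto intro!: derivative_eq_intros)
 have 2: "((%y. (ln y + M) * (- (t * sin (t * y))) + 1 / y * cos (t * y)) has_integral
   ((ln v + M) * cos (t * v) - (ln u + M) * cos (t * u))) {u..v}"
 proof (rule fundamental_theorem_of_calculus[OF assms(2)])
  show "((%y. (ln y + M) * cos (t * y)) has_vector_derivative
    (ln y + M) * (- (t * sin (t * y))) + 1 / y * cos (t * y)) (at y within {u..v})" if "y \<in> {u..v}" for y
   unfolding has_real_derivative_iff_has_vector_derivative[symmetric]
   using that u0 by (auto intro!: derivative_eq_intros)
 qed
 have 3: "((%y. cos (t * y) / y) has_integral cos_int u v t) {u..v}"
  unfolding cos_int_def by (intro integrable_integral cos_int_integrable u0)
 have "((%y. prime_recip_sum y * (- (t * sin (t * y))) - ((ln y + M) * (- (t * sin (t * y))) + 1 / y * cos (t * y)) + cos (t * y) / y) has_integral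
   (prime_recip_sum v * cos (t * v) - prime_recip_sum u * cos (t * u) - (\<Sum>p\<in>prime_set v - prime_set u. 1 / p * cos (t * ln p))
   - ((ln v + M) * cos (t * v) - (ln u + M) * cos (t * u)) + cos_int u v t)) {u..v}"
  by (intro has_integral_add has_integral_diff 1 2 3)
 also have "(%y. prime_recip_sum y * (- (t * sin (t * y))) - ((ln y + M) * (- (t * sin (t * y))) + 1 / y * cos (t * y)) + cos (t * y) / y) =
   (%y. E y * (- (t * sin (t * y))))"
  by (auto simp: E_def fun_eq_iff algebra_simps)
 also have "prime_recip_sum v * cos (t * v) - prime_recip_sum u * cos (t * u) - (\<Sum>p\<in>prime_set v - prime_set u. 1 / p * cos (t * ln p))
   - ((ln v + M) * cos (t * v) - (ln u + M) * cos (t * u)) + cos_int u v t =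
   (E v * cos (t * v) - E u * cos (t * u)) - (\<Sum>p\<in>prime_set v - prime_set u. cos (t * ln p) / p) + cos_int u v t"
  by (simp add: E_def algebra_simps)
 finally have 4: "((%y. E y * (- (t * sin (t * y)))) has_integral
   (E v * cos (t * v) - E u * cos (t * u)) - (\<Sum>p\<in>prime_set v - prime_set u. cos (t * ln p) / p) + cos_int u v t) {u..v}" .
 have 5: "((%y. C * t\<^sup>2 / y\<^sup>2) has_integral ((- (C * t\<^sup>2) / v) - (- (C * t\<^sup>2) / u))) {u..v}"
 proof (rule fundamental_theorem_of_calculus[OF assms(2)])
  show "((%y. - (C * t\<^sup>2) / y) has_vector_derivative C * t\<^sup>2 / y\<^sup>2) (at y within {u..v})" if "y \<in> {u..v}" for y
   unfolding has_real_derivative_iff_has_vector_derivative[symmetric]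
   using that u0 by (auto intro!: derivative_eq_intros simp: power2_eq_square)
 qed
 have "norm (integral {u..v} (%y. E y * (- (t * sin (t * y))))) <= integral {u..v} (%y. C * t\<^sup>2 / y\<^sup>2)"
 proof (rule integral_norm_bound_integral)
  fix y assume y: "y \<in> {u..v}"
  then have y0: "y > 0" using u0 by auto
  have "\<bar>E y\<bar> <= C / y ^ 3" unfolding E_def using y assms by (intro Mert) auto
  moreover have "\<bar>t * sin (t * y)\<bar> <= t\<^sup>2 * y"
  proof -
   have "\<bar>t\<bar> * \<bar>sin (t * y)\<bar> <= \<bar>t\<bar> * \<bar>t * y\<bar>" by (intro mult_left_mono abs_sin_x_le_abs_x) auto
   then show ?thesis using y0 by (simp add: abs_mult power2_eq_square mult.assoc[symmetric])
  qed
  ultimately have "\<bar>E y\<bar> * \<bar>t * sin (t * y)\<bar> <= C / y ^ 3 * (t\<^sup>2 * y)"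
   using C y0 by (intro mult_mono) auto
  also have "... = C * t\<^sup>2 / y\<^sup>2" using y0 by (simp add: power2_eq_square power3_eq_cube)
  finally show "norm (E y * (- (t * sin (t * y)))) <= C * t\<^sup>2 / y\<^sup>2" by (simp add: abs_mult)
 qed (use 4 5 in \<open>auto dest: has_integral_integrable\<close>)
 then have "\<bar>(E v * cos (t * v) - E u * cos (t * u)) - (\<Sum>p\<in>prime_set v - prime_set u. cos (t * ln p) / p) + cos_int u v t\<bar>
   <= (- (C * t\<^sup>2) / v) - (- (C * t\<^sup>2) / u)"
  unfolding integral_unique[OF 4] integral_unique[OF 5] by (simp only: real_norm_def)
 moreover have "(- (C * t\<^sup>2) / v) - (- (C * t\<^sup>2) / u) = C * t\<^sup>2 * (1 / u - 1 / v)" by (simp add: right_diff_distrib)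
 ultimately show ?thesis by linarith
qed

lemma sum_inverse_cubes_le: "(\<Sum>k=1..K. 1 / real k ^ 3) <= 2"
proof (cases "K = 0")
 case False
 have "(\<Sum>k=1..K. 1 / real k ^ 3) <= 2 - 1 / real K" if "K >= 1" for K
  using that
 proof (induction K rule: dec_induct)
  case (step n)
  have n: "real n > 0" using step by simp
  have "1 / real (Suc n) ^ 3 <= 1 / (real n * real (Suc n))"
  proof (rule divide_left_mono)
   have "real n * real (Suc n) * 1 <= real (Suc n) * real (Suc n) * real (Suc n)" by (intro mult_mono) auto
   then show "real n * real (Suc n) <= real (Suc n) ^ 3" by (simp add: power3_eq_cube)
  qed (use n in auto)
  also have "... = 1 / real n - 1 / real (Suc n)" using n by (simp add: field_simps)
  finally show ?case using step.IH by simp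
 qed simp
 from this[of K] have "(\<Sum>k=1..K. 1 / real k ^ 3) <= 2 - 1 / real K" using False by simp
 moreover have "0 <= 1 / real K" by simp
 ultimately show ?thesis by linarith
qed simp

text \<open>The estimate of \<open>prime_cos_block\<close> is added over the half-periods. Boundary
  errors at k pi / b are O(b^3 / k^3), hence summable, and the left end contributes E(1/2) = -(M +
  ln(1/2)), as no prime has ln p <= 1/2; this is the constant in the statement.\<close>

lemma wave_sum_approx:
 assumes b: "0 < b" "b <= 1" and K: "K >= 1"
 shows "\<bar>wave_sum b K t - (M + ln (1/2) + wave_int b K t)\<bar> <= (12 * C) * t\<^sup>2 + 4 * C * b\<^sup>2"
proof -
 define x where "x k = real k * pi / b" for k
 define S where "S u v = (\<Sum>p\<in>prime_set v - prime_set u. cos (t * ln p) / p)" for u v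
 define e where "e k = E (x k) * cos (t * x k)" for k
 have x1: "x 1 >= 1" using b pi_gt3 by (simp add: x_def field_simps)
 have xmono: "x k <= x l" if "k <= l" for k l using that b by (auto simp: x_def intro!: divide_right_mono mult_right_mono)
 have xk: "x k >= 1" if "k >= 1" for k using xmono[OF that] x1 by simp
 have ek: "\<bar>e k\<bar> <= C * b\<^sup>2 * (1 / real k ^ 3)" if k: "k >= 1" for k
 proof -
  have "\<bar>e k\<bar> <= \<bar>E (x k)\<bar> * 1" unfolding e_def abs_mult by (intro mult_left_mono) auto
  also have "... <= C / x k ^ 3" unfolding E_def using xk[OF k] Mert[of "x k"] by simp
  also have "... = C * (b ^ 3 / (pi ^ 3 * real k ^ 3))" using b by (simp add: x_def power_divide power_mult_distrib)
  also have "... <= C * (b\<^sup>2 / (1 * real k ^ 3))"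
  proof (intro mult_left_mono frac_le mult_right_mono)
   show "b ^ 3 <= b\<^sup>2" using b by (intro power_decreasing) auto
   show "1 <= pi ^ 3" using pi_gt3 by (intro one_le_power) auto
  qed (use C k b in auto)
  finally show ?thesis by simp
 qed
 have half: "prime_set (1/2) = {}"
 proof -
  have "ln (real p) > 1/2" if "prime p" for p
  proof -
   have "2 <= real p" using prime_ge_2_nat[OF that] by simp
   then have "ln 2 <= ln (real p)" by simp
   moreover have "ln (2::real) > 1/2" using ln2_ge_two_thirds by simp
   ultimately show ?thesis by linarith
  qed
  then show ?thesis unfolding prime_set_def by (metis (no_types, lifting) Collect_empty_eq not_le)
 qed
 have ws: "wave_sum b K t = S (1/2) (x 1) + (\<Sum>k=1..<K. (- 1) ^ k * S (x k) (x (Suc k)))"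
  using K
 proof (induction K rule: dec_induct)
  case base
  have "wave_sum b 1 t = S (1/2) (x 1)"
   unfolding wave_sum_def S_def half x_def
  proof (intro sum.cong)
   fix p assume "p \<in> prime_set (real 1 * pi / b) - {}"
   then have "square_wave b (ln p) = (- 1) ^ 0"
    using half b by (intro square_wave_eq) (auto simp: prime_set_def prime_gt_1_nat)
   then show "square_wave b (ln p) * cos (t * ln p) / p = cos (t * ln p) / p" by simp
  qed simp
  then show ?case by simp
 next
  case (step k)
  have sub: "prime_set (x k) \<subseteq> prime_set (x (Suc k))" by (intro prime_set_mono xmono) simp
  have "wave_sum b (Suc k) t = (\<Sum>p\<in>prime_set (x (Suc k)) - prime_set (x k). square_wave b (ln p) * cos (t * ln p) / p) + wave_sum b k t"
   unfolding wave_sum_def x_def[symmetric] by (rule sum.subset_diff[OF sub]) simp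
  also have "(\<Sum>p\<in>prime_set (x (Suc k)) - prime_set (x k). square_wave b (ln p) * cos (t * ln p) / p) = (- 1) ^ k * S (x k) (x (Suc k))"
   unfolding S_def sum_distrib_left
  proof (intro sum.cong refl)
   fix p assume "p \<in> prime_set (x (Suc k)) - prime_set (x k)"
   then have "square_wave b (ln p) = (- 1) ^ k"
    using b by (intro square_wave_eq) (auto simp: prime_set_def x_def)
   then show "square_wave b (ln p) * cos (t * ln p) / p = (- 1) ^ k * (cos (t * ln p) / p)" by simp
  qed
  finally show ?case using step by simp
 qed
 have blk: "\<bar>S u v - cos_int u v t - (E v * cos (t * v) - E u * cos (t * u))\<bar> <= C * t\<^sup>2 * (1 / u - 1 / v)" if "1/2 <= u" "u <= v" for u v
  unfolding S_def using prime_cos_block[OF that] .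
 have first: "\<bar>S (1/2) (x 1) - cos_int (1/2) (x 1) t - (M + ln (1/2)) - e 1\<bar> <= C * t\<^sup>2 * (2 - 1 / x 1) + C * t\<^sup>2"
 proof -
  have E0: "E (1/2) = - (M + ln (1/2))" by (simp add: E_def prime_recip_sum_def half)
  have "\<bar>E (1/2)\<bar> <= C / (1/2) ^ 3" unfolding E_def by (rule Mert) simp
  then have "\<bar>E (1/2)\<bar> * (1 - cos (t * (1/2))) <= (8 * C) * ((t * (1/2))\<^sup>2 / 2)"
   using one_minus_cos_le[of "t * (1/2)"] C by (intro mult_mono) (auto simp: power3_eq_cube)
  then have "\<bar>E (1/2) * (1 - cos (t * (1/2)))\<bar> <= C * t\<^sup>2" by (simp add: abs_mult power2_eq_square)
  moreover have "\<bar>S (1/2) (x 1) - cos_int (1/2) (x 1) t - (e 1 - E (1/2) * cos (t * (1/2)))\<bar> <= C * t\<^sup>2 * (1 / (1/2) - 1 / x 1)"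
   using blk[of "1/2" "x 1"] x1 by (simp add: e_def)
  moreover have "E (1/2) * (1 - cos (t * (1/2))) = E (1/2) - E (1/2) * cos (t * (1/2))" by (simp add: algebra_simps)
  ultimately show ?thesis unfolding E0 by (simp add: abs_le_iff)
 qed
 have main: "\<bar>wave_sum b K t - (M + ln (1/2) + wave_int b K t)\<bar> <= C * t\<^sup>2 * (2 - 1 / x K) + C * t\<^sup>2 + 2 * C * b\<^sup>2 * (\<Sum>k=1..K. 1 / real k ^ 3)"
  unfolding ws wave_int_def x_def[symmetric]
 proof -
  have "\<bar>(S (1/2) (x 1) + (\<Sum>k=1..<K. (- 1) ^ k * S (x k) (x (Suc k)))) -
    (M + ln (1/2) + (cos_int (1/2) (x 1) t + (\<Sum>k=1..<K. (- 1) ^ k * cos_int (x k) (x (Suc k)) t))) \<bar>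
    <= C * t\<^sup>2 * (2 - 1 / x K) + C * t\<^sup>2 + 2 * C * b\<^sup>2 * (\<Sum>k=1..K. 1 / real k ^ 3) - \<bar>e K\<bar>"
   using K
  proof (induction K rule: dec_induct)
   case base
   show ?case using first ek[of 1] by simp
  next
   case (step k)
   have k1: "k >= 1" using step by simp
   have "\<bar>S (x k) (x (Suc k)) - cos_int (x k) (x (Suc k)) t - (e (Suc k) - e k)\<bar> <= C * t\<^sup>2 * (1 / x k - 1 / x (Suc k))"
    unfolding e_def using xk[OF k1] xmono[of k "Suc k"] by (intro blk) auto
   then have "\<bar>S (x k) (x (Suc k)) - cos_int (x k) (x (Suc k)) t\<bar> <= C * t\<^sup>2 * (1 / x k - 1 / x (Suc k)) + \<bar>e (Suc k)\<bar> + \<bar>e k\<bar>"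
    by linarith
   then have "\<bar>(- 1) ^ k * (S (x k) (x (Suc k)) - cos_int (x k) (x (Suc k)) t)\<bar> <= C * t\<^sup>2 * (1 / x k - 1 / x (Suc k)) + \<bar>e (Suc k)\<bar> + \<bar>e k\<bar>"
    by (simp add: abs_mult power_abs)
   moreover have "2 * \<bar>e (Suc k)\<bar> <= 2 * C * b\<^sup>2 * (1 / real (Suc k) ^ 3)" using ek[of "Suc k"] by simp
   moreover have "(S (1/2) (x 1) + (\<Sum>k=1..<Suc k. (- 1) ^ k * S (x k) (x (Suc k)))) -
     (M + ln (1/2) + (cos_int (1/2) (x 1) t + (\<Sum>k=1..<Suc k. (- 1) ^ k * cos_int (x k) (x (Suc k)) t))) =
    ((S (1/2) (x 1) + (\<Sum>k=1..<k. (- 1) ^ k * S (x k) (x (Suc k)))) -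
     (M + ln (1/2) + (cos_int (1/2) (x 1) t + (\<Sum>k=1..<k. (- 1) ^ k * cos_int (x k) (x (Suc k)) t)))) +
    (- 1) ^ k * (S (x k) (x (Suc k)) - cos_int (x k) (x (Suc k)) t)"
    unfolding sum.atLeastLessThan_Suc[OF k1] by (simp only: right_diff_distrib)
   moreover have "C * t\<^sup>2 * (2 - 1 / x (Suc k)) = C * t\<^sup>2 * (2 - 1 / x k) + C * t\<^sup>2 * (1 / x k - 1 / x (Suc k))"
    by (simp only: right_diff_distrib)
   moreover have "2 * C * b\<^sup>2 * (\<Sum>k=1..Suc k. 1 / real k ^ 3) = 2 * C * b\<^sup>2 * (\<Sum>k=1..k. 1 / real k ^ 3) + 2 * C * b\<^sup>2 * (1 / real (Suc k) ^ 3)"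
    by (simp add: distrib_left)
   ultimately show ?case using step.IH by linarith
  qed
  then show "\<bar>S (1/2) (x 1) + (\<Sum>k=1..<K. (- 1) ^ k * S (x k) (x (Suc k))) -
    (M + ln (1/2) + (cos_int (1/2) (pi / b) t + (\<Sum>k=1..<K. (- 1) ^ k * cos_int (x k) (x (Suc k)) t))) \<bar>
    <= C * t\<^sup>2 * (2 - 1 / x K) + C * t\<^sup>2 + 2 * C * b\<^sup>2 * (\<Sum>k=1..K. 1 / real k ^ 3)"
   by (simp add: x_def)
 qed
 have "C * t\<^sup>2 * (2 - 1 / x K) <= C * t\<^sup>2 * 2" using C xk[OF K] by (intro mult_left_mono) auto
 moreover have "2 * C * b\<^sup>2 * (\<Sum>k=1..K. 1 / real k ^ 3) <= 2 * C * b\<^sup>2 * 2"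
  using C by (intro mult_left_mono sum_inverse_cubes_le) auto
 moreover have "0 <= C * t\<^sup>2" using C by simp
 ultimately show ?thesis using main by linarith
qed

end

subsection \<open>The limiting profile of the square wave\<close>

text \<open>Multiplication by cos(\<theta>/2) makes the alternating sum telescope, as 2
  cos(\<theta>/2) sin((K + 1/2) \<theta>) is the sum of two neighbouring sines.\<close>

lemma alternating_trig_sum:
 "cos (\<theta> / 2) * (\<Sum>k<K. (- 1) ^ k * (cos (real (Suc k) * \<theta>) - cos (real k * \<theta>))) = (- 1) ^ K * sin (\<theta> / 2) * sin (real K * \<theta>)"
proof (induction K)
 case (Suc K)
 have *: "c * (e * (c1 - c0)) = - (e * h * (s1 + s0))" if "c1 - c0 = - 2 * S * h" "2 * c * S = s1 + s0" for c e c1 c0 h s1 s0 S :: real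
  unfolding that(1) that(2)[symmetric] by simp
 have "cos (real (Suc K) * \<theta>) - cos (real K * \<theta>) = - 2 * sin ((real K + 1/2) * \<theta>) * sin (\<theta> / 2)"
  using cos_diff_cos[of "real (Suc K) * \<theta>" "real K * \<theta>"] by (simp add: algebra_simps add_divide_distrib)
 moreover have "2 * cos (\<theta> / 2) * sin ((real K + 1/2) * \<theta>) = sin (real (Suc K) * \<theta>) + sin (real K * \<theta>)"
  using sin_times_cos[of "(real K + 1/2) * \<theta>" "\<theta> / 2"] by (simp add: algebra_simps add_divide_distrib)
 ultimately have "cos (\<theta> / 2) * ((- 1) ^ K * (cos (real (Suc K) * \<theta>) - cos (real K * \<theta>))) =
   - ((- 1) ^ K * sin (\<theta> / 2) * (sin (real (Suc K) * \<theta>) + sin (real K * \<theta>)))"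
  by (rule *)
 then show ?case using Suc.IH by (simp add: distrib_left algebra_simps del: of_nat_Suc)
qed simp

lemma sin_integral: "s ~= 0 ==> u <= v ==> integral {u..v} (%y. sin (s * y)) = (cos (s * u) - cos (s * v)) / s" for s :: real
proof -
 assume s: "s ~= 0" "u <= v"
 have "((%y. sin (s * y)) has_integral (- cos (s * v) / s - (- cos (s * u) / s))) {u..v}"
  by (rule fundamental_theorem_of_calculus[OF s(2)])
   (use s in \<open>auto intro!: derivative_eq_intros simp flip: has_real_derivative_iff_has_vector_derivative\<close>)
 then show ?thesis using s by (simp add: integral_unique diff_divide_distrib)
qed

lemma cos_int_deriv:
 assumes "0 < u" "u <= v"
 shows "(cos_int u v has_real_derivative - integral {u..v} (%y. sin (t * y))) (at t)"
proof -
 have "((%t. integral (cbox u v) (%y. cos (t * y) / y)) has_field_derivative integral (cbox u v) (%y. - sin (t * y))) (at t within UNIV)"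
 proof (rule leibniz_rule_field_derivative)
  show "((%t. cos (t * y) / y) has_field_derivative - sin (t * y)) (at t within UNIV)" if "y \<in> cbox u v" for t y
   using that assms by (auto intro!: derivative_eq_intros)
  show "(%y. cos (t * y) / y) integrable_on cbox u v" for t using cos_int_integrable[OF assms(1)] by simp
  show "continuous_on (UNIV \<times> cbox u v) (%(t, y). - sin (t * y))"
   unfolding case_prod_beta by (intro continuous_intros)
 qed auto
 then show ?thesis by (simp add: cos_int_def[abs_def])
qed

definition wave_deriv :: "real => nat => real => real" where
 "wave_deriv b K s = - integral {1/2..pi / b} (%y. sin (s * y)) -
   (\<Sum>k=1..<K. (- 1) ^ k * integral {real k * pi / b..real (Suc k) * pi / b} (%y. sin (s * y)))"

lemma wave_int_deriv:
 assumes "0 < b" "b <= 1"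
 shows "(wave_int b K has_real_derivative wave_deriv b K s) (at s)"
proof -
 have *: "(cos_int (1/2) (pi / b) has_real_derivative - integral {1/2..pi / b} (%y. sin (s * y))) (at s)"
  by (rule cos_int_deriv) (use assms pi_gt3 in \<open>auto simp: field_simps\<close>)
 have **: "(cos_int (real k * pi / b) (real (Suc k) * pi / b) has_real_derivative
   - integral {real k * pi / b..real (Suc k) * pi / b} (%y. sin (s * y))) (at s)" if "k \<in> {1..<K}" for k
  by (rule cos_int_deriv) (use assms that in \<open>auto intro!: divide_right_mono mult_right_mono divide_pos_pos\<close>)
 have "((%s. cos_int (1/2) (pi / b) s + (\<Sum>k=1..<K. (- 1) ^ k * cos_int (real k * pi / b) (real (Suc k) * pi / b) s)) has_real_derivative
   (- integral {1/2..pi / b} (%y. sin (s * y)) + (\<Sum>k=1..<K. (- 1) ^ k * - integral {real k * pi / b..real (Suc k) * pi / b} (%y. sin (s * y))))) (at s)"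
  by (intro DERIV_add DERIV_sum DERIV_cmult * **)
 then show ?thesis by (simp add: wave_int_def[abs_def] wave_deriv_def sum_negf)
qed

text \<open>The first term comes from starting at 1/2, the second is an oscillation of frequency K
  pi / b. Its amplitude blows up at s = b, which is why a window of half-length a calls for a wave
  with b > a.\<close>

lemma wave_deriv_eq:
 assumes "0 < b" "b <= 1" "K >= 1" "0 < s" "s < b"
 shows "wave_deriv b K s = (1 - cos (s / 2)) / s + (- 1) ^ K * (tan (pi * s / (2 * b)) / s) * sin (real K * pi / b * s)"
proof -
 define \<theta> where "\<theta> = s * pi / b"
 have \<theta>: "0 < \<theta>" "\<theta> < pi" using assms by (auto simp: \<theta>_def field_simps)
 have c0: "cos (\<theta> / 2) > 0" using \<theta> by (intro cos_gt_zero) auto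
 have "s * integral {1/2..pi / b} (%y. sin (s * y)) = cos (s / 2) - cos \<theta>"
  using assms pi_gt3 by (subst sin_integral) (auto simp: field_simps \<theta>_def)
 moreover have "s * integral {real k * pi / b..real (Suc k) * pi / b} (%y. sin (s * y)) = - (cos (real (Suc k) * \<theta>) - cos (real k * \<theta>))" for k
 proof -
  have "integral {real k * pi / b..real (Suc k) * pi / b} (%y. sin (s * y)) = (cos (s * (real k * pi / b)) - cos (s * (real (Suc k) * pi / b))) / s"
   by (rule sin_integral) (use assms in \<open>auto intro!: divide_right_mono mult_right_mono\<close>)
  moreover have "s * (real j * pi / b) = real j * \<theta>" for j by (simp add: \<theta>_def)
  ultimately show ?thesis using assms by (simp del: of_nat_Suc)
 qed
 then have "s * (\<Sum>k=1..<K. (- 1) ^ k * integral {real k * pi / b..real (Suc k) * pi / b} (%y. sin (s * y))) =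
   - (\<Sum>k=1..<K. (- 1) ^ k * (cos (real (Suc k) * \<theta>) - cos (real k * \<theta>)))"
  unfolding sum_distrib_left sum_negf[symmetric] by (intro sum.cong refl) (metis mult.left_commute mult_minus_right)
 ultimately have "s * wave_deriv b K s = - cos (s / 2) + cos \<theta> + (\<Sum>k=1..<K. (- 1) ^ k * (cos (real (Suc k) * \<theta>) - cos (real k * \<theta>)))"
  unfolding wave_deriv_def by (simp add: right_diff_distrib)
 also have "(\<Sum>k=1..<K. (- 1) ^ k * (cos (real (Suc k) * \<theta>) - cos (real k * \<theta>))) =
   (\<Sum>k<K. (- 1) ^ k * (cos (real (Suc k) * \<theta>) - cos (real k * \<theta>))) - (cos \<theta> - 1)"
  using assms(3) by (simp add: lessThan_atLeast0 sum.atLeast_Suc_lessThan)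
 also have "(\<Sum>k<K. (- 1) ^ k * (cos (real (Suc k) * \<theta>) - cos (real k * \<theta>))) = (- 1) ^ K * tan (\<theta> / 2) * sin (real K * \<theta>)"
  using alternating_trig_sum[of \<theta> K] c0 by (simp add: tan_def field_simps)
 finally have "s * wave_deriv b K s = (1 - cos (s / 2)) + (- 1) ^ K * tan (\<theta> / 2) * sin (real K * \<theta>)" by simp
 moreover have "\<theta> / 2 = pi * s / (2 * b)" "real K * \<theta> = real K * pi / b * s" by (simp_all add: \<theta>_def mult_ac)
 ultimately have e: "s * wave_deriv b K s = (1 - cos (s / 2)) + (- 1) ^ K * tan (pi * s / (2 * b)) * sin (real K * pi / b * s)"
  by (simp only:)
 have "wave_deriv b K s = ((1 - cos (s / 2)) + (- 1) ^ K * tan (pi * s / (2 * b)) * sin (real K * pi / b * s)) / s"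
  unfolding e[symmetric] using assms by simp
 then show ?thesis by (simp add: add_divide_distrib)
qed

text \<open>The derivative has the sign of z - sin z cos z.\<close>

lemma tan_over_mono:
 fixes x y :: real
 assumes "0 < x" "x <= y" "y < pi / 2"
 shows "tan x / x <= tan y / y"
proof (rule DERIV_nonneg_imp_nondecreasing[OF assms(2), of "%x. tan x / x"])
 fix z assume z: "x <= z" "z <= y"
 have c: "cos z > 0" using z assms by (intro cos_gt_zero) auto
 have "sin z * cos z <= z * 1"
  using z assms c sin_x_le_x[of z] by (intro mult_mono) auto
 then have "tan z * (cos z)\<^sup>2 <= z" using c by (simp add: tan_def power2_eq_square)
 then have "0 <= (inverse ((cos z)\<^sup>2) * z - tan z) / (z * z)"
  using c by (intro divide_nonneg_nonneg) (auto simp: field_simps)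
 moreover have "((%x. tan x / x) has_real_derivative (inverse ((cos z)\<^sup>2) * z - tan z * 1) / (z * z)) (at z)"
  using z assms c by (intro DERIV_divide DERIV_tan DERIV_ident) auto
 ultimately show "\<exists>d. ((%x. tan x / x) has_real_derivative d) (at z) & 0 <= d" by auto
qed

lemma tan_over_ge_1: "0 < x ==> x < pi / 2 ==> tan x / x >= 1" for x :: real
proof -
 assume x: "0 < x" "x < pi / 2"
 have cz: "cos z ~= 0" if "0 <= z" "z <= x" for z
  using cos_gt_zero_pi[of z] that x by auto
 have "\<exists>z>0. z < x & tan x - tan 0 = (x - 0) * inverse ((cos z)\<^sup>2)"
  by (rule MVT2[OF x(1)]) (use cz in \<open>auto intro!: DERIV_tan\<close>)
 then obtain z where z: "0 < z" "z < x" "tan x = x * inverse ((cos z)\<^sup>2)" by auto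
 have "cos z > 0" using z x by (intro cos_gt_zero) auto
 then have "(cos z)\<^sup>2 <= 1" "(cos z)\<^sup>2 > 0" by (auto simp: power_le_one)
 then have "inverse ((cos z)\<^sup>2) >= 1" by (simp add: one_le_inverse)
 then show ?thesis using z x by simp
qed

text \<open>At t = 0 the integrals are logarithms of ratios of consecutive break points. With the
  odd number 2 n + 1 of half-periods the alternating ones pair up into the factors 4k^2 / (4k^2 - 1)
  of the Wallis product.\<close>

lemma wave_int_0:
 assumes "0 < b" "b <= 1"
 shows "ln (1/2) + wave_int b (2 * n + 1) 0 = ln (pi / b) - ln (\<Prod>k=1..n. (4 * real k ^ 2) / (4 * real k ^ 2 - 1))"
proof -
 have c: "cos_int u v 0 = ln v - ln u" if "0 < u" "u <= v" for u v
 proof -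
  have "((%y. 1 / y) has_integral (ln v - ln u)) {u..v}"
   by (rule fundamental_theorem_of_calculus[OF that(2)])
    (use that in \<open>auto intro!: derivative_eq_intros simp flip: has_real_derivative_iff_has_vector_derivative\<close>)
  then show ?thesis by (simp add: cos_int_def integral_unique)
 qed
 have c1: "cos_int (1/2) (pi / b) 0 = ln (pi / b) - ln (1/2)"
  by (rule c) (use assms pi_gt3 in \<open>auto simp: field_simps\<close>)
 have c2: "cos_int (real k * pi / b) (real (Suc k) * pi / b) 0 = ln (real (Suc k) / real k)" if "k >= 1" for k
 proof -
  have "cos_int (real k * pi / b) (real (Suc k) * pi / b) 0 = ln (real (Suc k) * pi / b) - ln (real k * pi / b)"
   by (rule c) (use assms that in \<open>auto intro!: divide_right_mono mult_right_mono divide_pos_pos\<close>)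
  also have "... = ln ((real (Suc k) * pi / b) / (real k * pi / b))"
   using assms that by (intro ln_divide_pos[symmetric]) auto
  also have "(real (Suc k) * pi / b) / (real k * pi / b) = real (Suc k) / real k" using assms by simp
  finally show ?thesis .
 qed
 have "(\<Sum>k=1..<2 * n + 1. (- 1) ^ k * ln (real (Suc k) / real k)) = - ln (\<Prod>k=1..n. (4 * real k ^ 2) / (4 * real k ^ 2 - 1))"
 proof (induction n)
  case (Suc n)
  have pos: "(4 * real k ^ 2) / (4 * real k ^ 2 - 1) > 0" if "k >= 1" for k
  proof -
   have "1 <= real k ^ 2" using that by simp
   then show ?thesis by (intro divide_pos_pos) linarith+
  qed
  have S: "(\<Sum>k=1..<2 * Suc n + 1. f k) = (\<Sum>k=1..<2 * n + 1. f k) + f (2 * n + 1) + f (2 * n + 2)" for f :: "nat => real"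
   by (simp add: numeral_eq_Suc)
  have "(\<Sum>k=1..<2 * Suc n + 1. (- 1) ^ k * ln (real (Suc k) / real k)) =
    (\<Sum>k=1..<2 * n + 1. (- 1) ^ k * ln (real (Suc k) / real k)) - ln (real (2 * n + 2) / real (2 * n + 1)) + ln (real (2 * n + 3) / real (2 * n + 2))"
   unfolding S by (simp add: algebra_simps)
  also have "- ln (real (2 * n + 2) / real (2 * n + 1)) + ln (real (2 * n + 3) / real (2 * n + 2)) =
    - ln ((4 * real (Suc n) ^ 2) / (4 * real (Suc n) ^ 2 - 1))"
  proof -
   have e: "4 * real (Suc n) ^ 2 = real (2 * n + 2) * real (2 * n + 2)"
    "4 * real (Suc n) ^ 2 - 1 = real (2 * n + 1) * real (2 * n + 3)"
    by (simp_all add: power2_eq_square algebra_simps)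
   have "- ln (y / x) + ln (z / y) = - ln ((y * y) / (x * z))" if "x > 0" "y > 0" "z > 0" for x y z :: real
    using that by (simp add: ln_divide_pos ln_mult_pos)
   then show ?thesis unfolding e(2) unfolding e(1) by simp
  qed
  then have "- ln (real (2 * n + 2) / real (2 * n + 1)) + ln (real (2 * n + 3) / real (2 * n + 2)) =
    - ln ((4 * real (Suc n) ^ 2) / (4 * real (Suc n) ^ 2 - 1))" .
  moreover have "ln (\<Prod>k=1..Suc n. (4 * real k ^ 2) / (4 * real k ^ 2 - 1)) =
    ln (\<Prod>k=1..n. (4 * real k ^ 2) / (4 * real k ^ 2 - 1)) + ln ((4 * real (Suc n) ^ 2) / (4 * real (Suc n) ^ 2 - 1))"
  proof -
   have "(\<Prod>k=1..Suc n. (4 * real k ^ 2) / (4 * real k ^ 2 - 1)) = (\<Prod>k=1..n. (4 * real k ^ 2) / (4 * real k ^ 2 - 1)) * ((4 * real (Suc n) ^ 2) / (4 * real (Suc n) ^ 2 - 1))"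
    by (rule trans[OF prod.nat_ivl_Suc' mult.commute]) simp
   then show ?thesis using pos[of "Suc n"] by (simp only:) (intro ln_mult_pos prod_pos; use pos in auto)
  qed
  ultimately show ?case using Suc.IH by linarith
 qed simp
 moreover have "(\<Sum>k=1..<2 * n + 1. (- 1) ^ k * cos_int (real k * pi / b) (real (Suc k) * pi / b) 0) =
   (\<Sum>k=1..<2 * n + 1. (- 1) ^ k * ln (real (Suc k) / real k))"
  by (intro sum.cong refl) (use c2 in auto)
 ultimately show ?thesis unfolding wave_int_def c1 by simp
qed

lemma wave_int_0_tendsto:
 assumes "0 < b" "b <= 1"
 shows "(%n. ln (1/2) + wave_int b (2 * n + 1) 0) \<longlonglongrightarrow> ln (2 / b)"
proof -
 have "(%n. ln (pi / b) - ln (\<Prod>k=1..n. (4 * real k ^ 2) / (4 * real k ^ 2 - 1))) \<longlonglongrightarrow> ln (pi / b) - ln (pi / 2)"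
  by (intro tendsto_intros wallis) auto
 moreover have "ln (pi / b) - ln (pi / 2) = ln (2 / b)"
  using assms by (simp add: ln_div)
 ultimately show ?thesis unfolding wave_int_0[OF assms] by simp
qed

lemma abs_sin_mult_le: "\<bar>sin (real n * x)\<bar> <= real n * \<bar>sin x\<bar>"
proof (induction n)
 case (Suc n)
 have "\<bar>sin (real (Suc n) * x)\<bar> = \<bar>sin (real n * x) * cos x + cos (real n * x) * sin x\<bar>"
  by (simp only: sin_add[symmetric]) (simp add: algebra_simps)
 also have "... <= \<bar>sin (real n * x)\<bar> * 1 + 1 * \<bar>sin x\<bar>"
  by (rule order_trans[OF abs_triangle_ineq]) (unfold abs_mult, intro add_mono mult_mono; simp)
 finally show ?case using Suc.IH by (simp add: algebra_simps)
qed simp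

text \<open>The derivative is integrated over [0, t]: the term (1 - cos(s/2)) / s is O(s) and gives
  t^2. The oscillating term has a monotone amplitude, so the second mean value theorem reduces it to
  integrals of the sine, each at most 2 b / (K pi).\<close>

lemma wave_int_osc:
 assumes b: "0 < b" "b <= 1" and K: "K >= 1" and t: "0 < t" "t < b"
 shows "\<bar>wave_int b K t - wave_int b K 0\<bar> <= t\<^sup>2 + 4 * b / (real K * pi) * (tan (pi * t / (2 * b)) / t)"
proof -
 \<comment> \<open>Continued by its limit pi / (2 b) at 0, so that \<open>q\<close> is monotone on
   all of [0, t].\<close>
 define q where "q s = (if s <= 0 then pi / (2 * b) else tan (pi * s / (2 * b)) / s)" for s
 define f where "f s = sin (real K * pi / b * s)" for s
 define P where "P s = (1 - cos (s / 2)) / s" for s :: real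
 have c: "real K * pi / b ~= 0" "real K * pi / b > 0" using b K by auto
 have eqq: "tan (pi * s / (2 * b)) / s = pi / (2 * b) * (tan (pi * s / (2 * b)) / (pi * s / (2 * b)))" if "s > 0" for s
  using that b by simp
 have rng: "0 < pi * s / (2 * b)" "pi * s / (2 * b) < pi / 2" if "0 < s" "s <= t" for s
  using that t b by (auto simp: field_simps)
 have qmono: "q x <= q y" if "0 <= x" "x <= y" "y <= t" for x y
 proof (cases "x = 0")
  case True
  show ?thesis
  proof (cases "y = 0")
   case False
   then have y: "0 < y" using that by simp
   have "pi / (2 * b) * 1 <= pi / (2 * b) * (tan (pi * y / (2 * b)) / (pi * y / (2 * b)))"
    using rng[OF y that(3)] b by (intro mult_left_mono tan_over_ge_1) auto
   then show ?thesis using True y eqq[OF y] by (simp add: q_def)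
  qed (use True in simp)
 next
  case False
  then have x: "0 < x" using that by simp
  then have y: "0 < y" using that by simp
  have "pi / (2 * b) * (tan (pi * x / (2 * b)) / (pi * x / (2 * b))) <= pi / (2 * b) * (tan (pi * y / (2 * b)) / (pi * y / (2 * b)))"
   using rng[OF x] rng[OF y that(3)] that b
   by (intro mult_left_mono tan_over_mono) (auto intro!: divide_right_mono mult_left_mono)
  then show ?thesis using x y eqq[OF x] eqq[OF y] by (simp add: q_def)
 qed
 have q0: "q 0 >= 0" using b by (simp add: q_def)
 have fint: "\<bar>integral {u..v} f\<bar> <= 2 / (real K * pi / b)" if "u <= v" for u v
 proof -
  have "integral {u..v} f = (cos (real K * pi / b * u) - cos (real K * pi / b * v)) / (real K * pi / b)"
   unfolding f_def using c(1) that by (rule sin_integral)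
  moreover have "\<bar>cos x - cos y\<bar> <= 2" for x y :: real
   using abs_cos_le_one[of x] abs_cos_le_one[of y] by linarith
  moreover have "\<bar>x / c\<bar> <= 2 / c" if "\<bar>x\<bar> <= 2" "c > 0" for x c :: real
   using that by (simp add: divide_right_mono)
  ultimately show ?thesis using c(2) by metis
 qed
 have f_int: "f integrable_on {0..t}"
  unfolding f_def by (intro integrable_continuous_interval continuous_intros)
 obtain \<xi> where \<xi>: "\<xi> \<in> {0..t}"
  "((%x. q x * f x) has_integral (q 0 * integral {0..\<xi>} f + q t * integral {\<xi>..t} f)) {0..t}"
  by (rule second_mean_value_theorem_full[OF f_int less_imp_le[OF t(1)], where g = q]) (use qmono that in auto)
 define I where "I = q 0 * integral {0..\<xi>} f + q t * integral {\<xi>..t} f"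
 have qt: "q 0 <= q t" using qmono[of 0 t] t by simp
 have "\<bar>I\<bar> <= q t * (2 / (real K * pi / b)) + q t * (2 / (real K * pi / b))"
  unfolding I_def using fint[of 0 \<xi>] fint[of \<xi> t] \<xi>(1) q0 qt
  by (intro order_trans[OF abs_triangle_ineq] add_mono; unfold abs_mult, intro mult_mono) auto
 also have "... = 4 * b / (real K * pi) * (tan (pi * t / (2 * b)) / t)"
  using t by (simp add: q_def mult_ac)
 finally have I: "\<bar>I\<bar> <= 4 * b / (real K * pi) * (tan (pi * t / (2 * b)) / t)" .
 have "(wave_deriv b K has_integral (wave_int b K t - wave_int b K 0)) {0..t}"
  by (rule fundamental_theorem_of_calculus)
   (use t wave_int_deriv[OF b] in \<open>auto intro: has_field_derivative_at_within simp flip: has_real_derivative_iff_has_vector_derivative\<close>)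
 then have "((%s. wave_deriv b K s - (- 1) ^ K * (q s * f s)) has_integral (wave_int b K t - wave_int b K 0 - (- 1) ^ K * I)) {0..t}"
  unfolding I_def by (intro has_integral_diff has_integral_mult_right \<xi>(2))
 then have Pi: "(P has_integral (wave_int b K t - wave_int b K 0 - (- 1) ^ K * I)) {0..t}"
  by (rule has_integral_spike_finite[of "{0}", rotated 2])
   (use t wave_deriv_eq[OF b K] in \<open>auto simp: q_def f_def P_def\<close>)
 have "norm (integral {0..t} P) <= integral {0..t} (%s. t)"
 proof (rule integral_norm_bound_integral)
  fix s assume s: "s \<in> {0..t}"
  show "norm (P s) <= t"
  proof (cases "s = 0")
   case False
   then have s0: "s > 0" using s by simp
   have "(1 - cos (s / 2)) / s <= ((s / 2)\<^sup>2 / 2) / s" using s0 by (intro divide_right_mono one_minus_cos_le) auto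
   also have "... <= t" using s0 s by (simp add: power2_eq_square)
   finally show ?thesis using s0 by (simp add: P_def)
  qed (use t in \<open>simp add: P_def\<close>)
 qed (use Pi in auto)
 then have "\<bar>wave_int b K t - wave_int b K 0 - (- 1) ^ K * I\<bar> <= t\<^sup>2"
  using t by (simp add: integral_unique[OF Pi] power2_eq_square)
 moreover have "\<bar>(- 1) ^ K * I\<bar> = \<bar>I\<bar>" by (simp add: abs_mult power_abs)
 ultimately show ?thesis using I by linarith
qed

text \<open>Uniform up to t = b, where \<open>wave_int_osc\<close> fails. Up to t1 = b (1 - 1/K) the
  tangent is at most 2 K / pi, which the factor 1 / K absorbs. On the rest, of length at most b / K,
  the derivative is O(K / b) because |tan(\<theta>/2) sin(K \<theta>)| <= 2 K.\<close>

lemma wave_int_osc_bounded: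
 assumes b: "0 < b" "b <= 1" and K: "K >= 2" and t: "0 < t" "t <= b"
 shows "\<bar>wave_int b K t - wave_int b K 0\<bar> <= 10"
proof -
 define t1 where "t1 = b * (1 - 1 / real K)"
 have rK: "real K >= 2" using K by simp
 have t1: "b / 2 <= t1" "t1 < b" "t1 > 0"
 proof -
  have "1 / real K <= 1 / 2" using rK by (intro divide_left_mono) auto
  then have "b * (1/2) <= t1" unfolding t1_def using b by (intro mult_left_mono) auto
  then show "b / 2 <= t1" "t1 > 0" using b by auto
  show "t1 < b" using b rK by (simp add: t1_def)
 qed
 have tt1: "tan (pi * t1 / (2 * b)) <= 2 * real K / pi"
 proof -
  have e: "pi * t1 / (2 * b) = pi / 2 - pi / (2 * real K)" using b rK by (simp add: t1_def field_simps)
  have x: "0 < pi / (2 * real K)" "pi / (2 * real K) < pi / 2" using rK by (auto simp: field_simps)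
  have "tan (pi / (2 * real K)) >= pi / (2 * real K)"
   using tan_over_ge_1[OF x] x(1) by (simp only: le_divide_eq if_True mult_1)
  then have "inverse (tan (pi / (2 * real K))) <= inverse (pi / (2 * real K))"
   using x by (intro le_imp_inverse_le) auto
  moreover have "tan (pi / 2 - pi / (2 * real K)) = inverse (tan (pi / (2 * real K)))"
   by (simp add: tan_def cos_sin_eq[symmetric] sin_cos_eq[symmetric] sin_diff cos_diff)
  ultimately show ?thesis unfolding e by simp
 qed
 have first: "\<bar>wave_int b K s - wave_int b K 0\<bar> <= 3" if s: "0 < s" "s <= t1" for s
 proof -
  have sb: "s < b" using s t1 by simp
  have "\<bar>wave_int b K s - wave_int b K 0\<bar> <= s\<^sup>2 + 4 * b / (real K * pi) * (tan (pi * s / (2 * b)) / s)"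
   using wave_int_osc[OF b _ s(1) sb, of K] K by simp
  also have "4 * b / (real K * pi) * (tan (pi * s / (2 * b)) / s) <= 4 * b / (real K * pi) * ((2 * real K / pi) / (b / 2))"
  proof (rule mult_left_mono)
  have "tan (pi * s / (2 * b)) / s <= tan (pi * t1 / (2 * b)) / t1"
  proof -
   have eqq: "tan (pi * s / (2 * b)) / s = pi / (2 * b) * (tan (pi * s / (2 * b)) / (pi * s / (2 * b)))" if "s > 0" for s
    using that b by simp
   show ?thesis unfolding eqq[OF s(1)] eqq[OF t1(3)]
    using s t1 b by (intro mult_left_mono tan_over_mono) (auto simp: field_simps)
  qed
  also have "... <= (2 * real K / pi) / (b / 2)"
   using tt1 t1 b rK by (intro frac_le) auto
  finally show "tan (pi * s / (2 * b)) / s <= (2 * real K / pi) / (b / 2)" .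
  qed (use b rK in auto)
  also have "s\<^sup>2 + 4 * b / (real K * pi) * ((2 * real K / pi) / (b / 2)) = s\<^sup>2 + 16 / pi\<^sup>2"
   using b rK by (simp add: power2_eq_square field_simps)
  also have "... <= 1 + 2"
  proof (intro add_mono)
   show "s\<^sup>2 <= 1" using s sb b by (intro power_le_one) auto
   have "3 * 3 <= pi * pi" using pi_gt3 by (intro mult_mono) auto
   then show "16 / pi\<^sup>2 <= 2" by (simp add: power2_eq_square divide_le_eq)
  qed
  finally show ?thesis by simp
 qed
 show ?thesis
 proof (cases "t <= t1")
  case True
  then show ?thesis using first t by force
 next
  case False
  then have tt: "t1 < t" by simp
  have "\<exists>\<xi>>t1. \<xi> < t & wave_int b K t - wave_int b K t1 = (t - t1) * wave_deriv b K \<xi>"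
   by (rule MVT2[OF tt]) (rule wave_int_deriv[OF b])
  then obtain \<xi> where \<xi>: "t1 < \<xi>" "\<xi> < t" "wave_int b K t - wave_int b K t1 = (t - t1) * wave_deriv b K \<xi>" by blast
  define \<theta> where "\<theta> = pi / b * \<xi>"
  have \<xi>b: "0 < \<xi>" "\<xi> < b" using \<xi> t t1 by auto
  have \<theta>: "0 < \<theta>" "\<theta> < pi" using \<xi>b b by (auto simp: \<theta>_def field_simps)
  have "\<bar>tan (\<theta> / 2) * sin (real K * \<theta>)\<bar> <= 2 * real K"
  proof -
   have c: "cos (\<theta> / 2) > 0" using \<theta> by (intro cos_gt_zero) auto
   have "\<bar>tan (\<theta> / 2) * sin (real K * \<theta>)\<bar> <= \<bar>tan (\<theta> / 2)\<bar> * (real K * \<bar>sin \<theta>\<bar>)"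
    unfolding abs_mult by (intro mult_left_mono abs_sin_mult_le) auto
   also have "... = real K * \<bar>tan (\<theta> / 2) * sin (2 * (\<theta> / 2))\<bar>" by (simp add: abs_mult)
   also have "tan (\<theta> / 2) * sin (2 * (\<theta> / 2)) = 2 * (sin (\<theta> / 2))\<^sup>2"
    using c unfolding sin_double by (simp add: tan_def power2_eq_square)
   also have "real K * \<bar>2 * (sin (\<theta> / 2))\<^sup>2\<bar> <= real K * (2 * 1)"
    using abs_square_le_1[of "sin (\<theta> / 2)"] by (intro mult_left_mono) auto
   finally show ?thesis by simp
  qed
  moreover have "\<theta> / 2 = pi * \<xi> / (2 * b)" "real K * \<theta> = real K * pi / b * \<xi>" by (simp_all add: \<theta>_def)
  ultimately have ts: "\<bar>tan (pi * \<xi> / (2 * b)) * sin (real K * pi / b * \<xi>)\<bar> <= 2 * real K" by (simp only:)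
  have "\<bar>wave_deriv b K \<xi>\<bar> <= \<bar>(1 - cos (\<xi> / 2)) / \<xi>\<bar> + \<bar>(- 1) ^ K * (tan (pi * \<xi> / (2 * b)) / \<xi>) * sin (real K * pi / b * \<xi>)\<bar>"
   unfolding wave_deriv_eq[OF b order_trans[OF one_le_numeral K] \<xi>b] by (rule abs_triangle_ineq)
  also have "\<bar>(- 1) ^ K * (tan (pi * \<xi> / (2 * b)) / \<xi>) * sin (real K * pi / b * \<xi>)\<bar> = \<bar>tan (pi * \<xi> / (2 * b)) * sin (real K * pi / b * \<xi>)\<bar> / \<xi>"
   using \<xi>b by (simp add: abs_mult power_abs)
  also have "\<bar>(1 - cos (\<xi> / 2)) / \<xi>\<bar> + \<bar>tan (pi * \<xi> / (2 * b)) * sin (real K * pi / b * \<xi>)\<bar> / \<xi> <= 2 / \<xi> + 2 * real K / \<xi>"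
  proof (intro add_mono divide_right_mono ts)
   have "\<bar>1 - cos (\<xi> / 2)\<bar> / \<xi> <= 2 / \<xi>"
    using abs_cos_le_one[of "\<xi> / 2"] \<xi>b by (intro divide_right_mono) auto
   then show "\<bar>(1 - cos (\<xi> / 2)) / \<xi>\<bar> <= 2 / \<xi>" using \<xi>b by simp
  qed (use \<xi>b in auto)
  also have "... = (2 + 2 * real K) / \<xi>" by (simp add: add_divide_distrib)
  also have "... <= (3 * real K) / (b / 2)"
   using rK \<xi> t1 b by (intro frac_le) auto
  finally have d: "\<bar>wave_deriv b K \<xi>\<bar> <= 6 * real K / b" by simp
  have "t - t1 <= b / real K" using t by (simp add: t1_def algebra_simps)
  then have "\<bar>(t - t1) * wave_deriv b K \<xi>\<bar> <= b / real K * (6 * real K / b)"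
   unfolding abs_mult using d tt b by (intro mult_mono) auto
  also have "... = 6" using b rK by simp
  finally have "\<bar>wave_int b K t - wave_int b K t1\<bar> <= 6" using \<xi>(3) by simp
  then show ?thesis using first[OF t1(3)] by linarith
 qed
qed

lemma wave_int_even: "wave_int b K (- t) = wave_int b K t"
 by (simp add: wave_int_def cos_int_def)

text \<open>Only the 1 / K term of \<open>wave_int_osc\<close> is sensitive to the gap between a and
  b. For fixed a < b it tends to 0 and is absorbed into \<epsilon>, so the constant C is the same
  for all a and b.\<close>

theorem wave_sum_lower:
 obtains C :: real where "C > 0"
  "\<And>a b \<epsilon>. 0 < a ==> a < b ==> b <= 1 ==> \<epsilon> > 0 ==> \<exists>n0. \<forall>n\<ge>n0. \<forall>t. \<bar>t\<bar> <= a -->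
    wave_sum b (2 * n + 1) t >= euler_mascheroni - log_corr_const + ln (2 / b) - C * b\<^sup>2 - \<epsilon>"
proof -
 obtain C :: real where C: "C > 0"
  "\<And>u. u >= 1/2 ==> \<bar>prime_recip_sum u - ln u - (euler_mascheroni - log_corr_const)\<bar> <= C / u ^ 3"
  by (rule prime_mertens, rule that, assumption+)
 define C' where "C' = 16 * C + 1"
 have "\<exists>n0. \<forall>n\<ge>n0. \<forall>t. \<bar>t\<bar> <= a --> wave_sum b (2 * n + 1) t >= euler_mascheroni - log_corr_const + ln (2 / b) - C' * b\<^sup>2 - \<epsilon>"
  if a: "0 < a" "a < b" "b <= 1" and \<epsilon>: "\<epsilon> > 0" for a b \<epsilon>
 proof -
  have b: "0 < b" using a by simp
  define D where "D n = 4 * b / (real (2 * n + 1) * pi) * (tan (pi * a / (2 * b)) / a)" for n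
  have "D \<longlonglongrightarrow> 0" unfolding D_def by real_asymp
  then have "\<forall>\<^sub>F n in sequentially. D n < \<epsilon> / 2" using \<epsilon> by (intro order_tendstoD) auto
  moreover have "\<forall>\<^sub>F n in sequentially. ln (1/2) + wave_int b (2 * n + 1) 0 > ln (2 / b) - \<epsilon> / 2"
   using wave_int_0_tendsto[OF b a(3)] \<epsilon> by (intro order_tendstoD(1)) auto
  ultimately have "\<forall>\<^sub>F n in sequentially. \<forall>t. \<bar>t\<bar> <= a -->
    wave_sum b (2 * n + 1) t >= euler_mascheroni - log_corr_const + ln (2 / b) - C' * b\<^sup>2 - \<epsilon>"
  proof eventually_elim
   case (elim n)
   show ?case
   proof (intro allI impI)
    fix t assume t: "\<bar>t\<bar> <= a"
    let ?K = "2 * n + 1"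
    have osc: "\<bar>wave_int b ?K t - wave_int b ?K 0\<bar> <= t\<^sup>2 + D n"
    proof (cases "t = 0")
     case True
     have "0 < pi * a / (2 * b)" "pi * a / (2 * b) < pi / 2" using a by (auto simp: field_simps)
     then have "tan (pi * a / (2 * b)) > 0" by (rule tan_gt_zero)
     then have "D n >= 0" unfolding D_def using a b by (intro mult_nonneg_nonneg) auto
     then show ?thesis using True by simp
    next
     case False
     define s where "s = \<bar>t\<bar>"
     have s: "0 < s" "s <= a" "s < b" using False t a by (auto simp: s_def)
     have "wave_int b ?K t = wave_int b ?K s" unfolding s_def by (cases "t >= 0") (simp_all add: wave_int_even)
     moreover have "\<bar>wave_int b ?K s - wave_int b ?K 0\<bar> <= s\<^sup>2 + 4 * b / (real ?K * pi) * (tan (pi * s / (2 * b)) / s)"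
      by (rule wave_int_osc[OF b a(3) _ s(1,3)]) simp
     moreover have "tan (pi * s / (2 * b)) / s <= tan (pi * a / (2 * b)) / a"
     proof -
      have eqq: "tan (pi * s / (2 * b)) / s = pi / (2 * b) * (tan (pi * s / (2 * b)) / (pi * s / (2 * b)))" if "s > 0" for s
       using that b by simp
      show ?thesis unfolding eqq[OF s(1)] eqq[OF a(1)]
       using s a b by (intro mult_left_mono tan_over_mono) (auto simp: field_simps)
     qed
     then have "4 * b / (real ?K * pi) * (tan (pi * s / (2 * b)) / s) <= D n"
      unfolding D_def using b by (intro mult_left_mono) auto
     moreover have "s\<^sup>2 = t\<^sup>2" by (simp add: s_def)
     ultimately show ?thesis by linarith
    qed
    have "\<bar>wave_sum b ?K t - (euler_mascheroni - log_corr_const + ln (1/2) + wave_int b ?K t)\<bar> <= 12 * C * t\<^sup>2 + 4 * C * b\<^sup>2"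
     by (rule wave_sum_approx[OF C b a(3)]) simp_all
    moreover have t2: "t\<^sup>2 <= b\<^sup>2" using t a b by (simp add: abs_le_square_iff[symmetric])
    moreover have "12 * C * t\<^sup>2 <= 12 * C * b\<^sup>2" using t2 C by (intro mult_left_mono) auto
    moreover have "C' * b\<^sup>2 = 12 * C * b\<^sup>2 + 4 * C * b\<^sup>2 + b\<^sup>2" by (simp add: C'_def algebra_simps)
    ultimately show "wave_sum b ?K t >= euler_mascheroni - log_corr_const + ln (2 / b) - C' * b\<^sup>2 - \<epsilon>"
     using osc elim by linarith
   qed
  qed
  then show ?thesis by (simp add: eventually_sequentially)
 qed
 moreover have "C' > 0" using C by (simp add: C'_def)
 ultimately show ?thesis using that by blast
qed

section \<open>The wave sum averaged over a window\<close>

definition abs_sinc :: "real => real" where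
 "abs_sinc x = (if x = 0 then 1 else \<bar>sin x / x\<bar>)"

text \<open>For l > 0 the mean of \<open>square_wave a l * cos (t * l)\<close> over 0 <= t <= a is
  |sin(a l)| / (a l), so the sum over primes is at most the mean of \<open>wave_sum a K\<close>.
  Here b = a, and the layer near t = a, where the profile is merely bounded, is made
  negligible.\<close>

theorem sinc_prime_sum_upper:
 obtains C :: real where "C > 0"
  "\<And>a N. 0 < a ==> a <= 1 ==> (\<Sum>p\<in>primes_le N. abs_sinc (a * ln p) / p) \<le>
    euler_mascheroni - log_corr_const + ln (2 / a) + C * a\<^sup>2"
proof -
 obtain C :: real where C: "C > 0"
  "\<And>u. u >= 1/2 ==> \<bar>prime_recip_sum u - ln u - (euler_mascheroni - log_corr_const)\<bar> <= C / u ^ 3"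
  by (rule prime_mertens, rule that, assumption+)
 define M where "M = (euler_mascheroni - log_corr_const :: real)"
 have "(\<Sum>p\<in>primes_le N. abs_sinc (a * ln p) / p) <= M + ln (2 / a) + (16 * C + 1) * a\<^sup>2"
  if a: "0 < a" "a <= 1" for a N
 proof (rule field_le_epsilon)
  fix \<epsilon> :: real assume \<epsilon>: "\<epsilon> > 0"
  \<comment> \<open>The layer from \<rho> a to a has relative length at most \<epsilon> / 40 and
    error at most 10 there, so it contributes at most \<epsilon> / 4 to the mean.\<close>
  define \<rho> where "\<rho> = max (1/2) (1 - \<epsilon> / 40)"
  have "1 - \<epsilon> / 40 <= \<rho>" unfolding \<rho>_def by (rule max.cobounded2)
  then have "1 - \<rho> <= \<epsilon> / 40" by linarith
  moreover have "1/2 <= \<rho>" "\<rho> < 1" using \<epsilon> by (auto simp: \<rho>_def)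
  ultimately have \<rho>: "1/2 <= \<rho>" "\<rho> < 1" "1 - \<rho> <= \<epsilon> / 40" by auto
  define s where "s = \<rho> * a"
  have s: "0 < s" "s < a" "s >= 0" using \<rho> a by (auto simp: s_def)
  define D where "D n = 4 * a / (real (2 * n + 1) * pi) * (tan (pi * s / (2 * a)) / s)" for n
  have "D \<longlonglongrightarrow> 0" unfolding D_def by real_asymp
  then have "\<forall>\<^sub>F n in sequentially. D n < \<epsilon> / 4" using \<epsilon> by (intro order_tendstoD) auto
  moreover have "\<forall>\<^sub>F n in sequentially. ln (1/2) + wave_int a (2 * n + 1) 0 < ln (2 / a) + \<epsilon> / 4"
   using wave_int_0_tendsto[OF a] \<epsilon> by (intro order_tendstoD(2)) auto
  moreover have "\<forall>\<^sub>F n in sequentially. n >= 1 & real n >= ln (real (N + 1))"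
   using eventually_ge_at_top[of "nat \<lceil>ln (real (N + 1))\<rceil>"] eventually_ge_at_top[of 1]
   by eventually_elim linarith
  ultimately have "\<forall>\<^sub>F n in sequentially. D n < \<epsilon> / 4 & ln (1/2) + wave_int a (2 * n + 1) 0 < ln (2 / a) + \<epsilon> / 4 & n >= 1 & real n >= ln (real (N + 1))"
   by eventually_elim auto
  then obtain n where n: "D n < \<epsilon> / 4" "ln (1/2) + wave_int a (2 * n + 1) 0 < ln (2 / a) + \<epsilon> / 4" "n >= 1" "real n >= ln (real (N + 1))"
   by (auto simp: eventually_sequentially)
  define K where "K = 2 * n + 1"
  have K: "K >= 2" using n by (simp add: K_def)
  define X where "X = real K * pi / a"
  have sub: "primes_le N \<subseteq> prime_set X"
  proof
   fix p assume p: "p \<in> primes_le N"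
   then have "ln (real p) <= ln (real (N + 1))" by (auto simp: primes_le_def prime_gt_0_nat)
   also have "... <= real K * 1" using n by (simp add: K_def)
   also have "... <= real K * (pi / a)" using a pi_gt3 by (intro mult_left_mono) (auto simp: field_simps)
   finally show "p \<in> prime_set X" using p by (simp add: primes_le_def prime_set_def X_def)
  qed
  have "(\<Sum>p\<in>primes_le N. abs_sinc (a * ln p) / p) <= (\<Sum>p\<in>prime_set X. abs_sinc (a * ln p) / p)"
   by (intro sum_mono2 sub) (auto simp: abs_sinc_def)
  also have "... = (\<Sum>p\<in>prime_set X. square_wave a (ln p) * (sin (a * ln p) / (ln p * a)) / p)"
  proof (intro sum.cong refl)
   fix p assume "p \<in> prime_set X"
   then have l: "ln (real p) > 0" by (auto simp: prime_set_def dest: prime_gt_1_nat)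
   have "square_wave a (ln p) * sin (a * ln p) = \<bar>sin (a * ln p)\<bar>"
    by (rule square_wave_sin[OF a(1) l])
   then show "abs_sinc (a * ln p) / p = square_wave a (ln p) * (sin (a * ln p) / (ln p * a)) / p"
    using l a by (simp add: abs_sinc_def abs_mult mult.commute)
  qed
  also have "... = integral {0..a} (wave_sum a K) / a"
  proof -
   have "((%t. \<Sum>p\<in>prime_set X. square_wave a (ln p) * cos (t * ln p) / p) has_integral
     (\<Sum>p\<in>prime_set X. square_wave a (ln p) * (sin (a * ln p) / ln p) / p)) {0..a}"
   proof (intro has_integral_sum finite_prime_set)
    fix p assume "p \<in> prime_set X"
    then have l: "ln (real p) > 0" by (auto simp: prime_set_def dest: prime_gt_1_nat)
    have "((%t. cos (t * ln p)) has_integral (sin (a * ln p) / ln p - sin (0 * ln p) / ln p)) {0..a}"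
     by (rule fundamental_theorem_of_calculus)
      (use a l in \<open>auto intro!: derivative_eq_intros simp flip: has_real_derivative_iff_has_vector_derivative\<close>)
    then have "((%t. square_wave a (ln p) * cos (t * ln p)) has_integral (square_wave a (ln p) * (sin (a * ln p) / ln p))) {0..a}"
     by (intro has_integral_mult_right) simp
    then show "((%t. square_wave a (ln p) * cos (t * ln p) / p) has_integral (square_wave a (ln p) * (sin (a * ln p) / ln p) / p)) {0..a}"
     by (rule has_integral_divide)
   qed
   then have "integral {0..a} (wave_sum a K) = (\<Sum>p\<in>prime_set X. square_wave a (ln p) * (sin (a * ln p) / ln p) / p)"
    unfolding wave_sum_def[abs_def] X_def[symmetric] by (rule integral_unique)
   then show ?thesis by (simp add: sum_divide_distrib mult_ac)
  qed
  also have "integral {0..a} (wave_sum a K) <= integral {0..a} (%t. (M + ln (2 / a) + \<epsilon> / 2 + (16 * C + 1) * a\<^sup>2) + (if t \<in> {s..a} then 10 else 0))"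
  proof (rule integral_le)
   show "wave_sum a K integrable_on {0..a}"
    unfolding wave_sum_def by (intro integrable_continuous_interval continuous_intros) (auto simp: prime_set_def prime_gt_0_nat)
   have "((%t. if t \<in> {s..a} then 10 else 0) has_integral (10 * (a - s))) {0..a}"
    using has_integral_const_real[of "10::real" s a] s by (subst has_integral_restrict) (auto simp: mult.commute)
   then show "(%t. (M + ln (2 / a) + \<epsilon> / 2 + (16 * C + 1) * a\<^sup>2) + (if t \<in> {s..a} then 10 else 0)) integrable_on {0..a}"
    by (intro integrable_add integrable_const_ivl) auto
   fix t assume t: "t \<in> {0..a}"
   have osc: "wave_int a K t - wave_int a K 0 <= a\<^sup>2 + D n + (if t \<in> {s..a} then 10 else 0)"
   proof -
    have "0 < pi * s / (2 * a)" "pi * s / (2 * a) < pi / 2" using s a by (auto simp: field_simps)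
    then have "tan (pi * s / (2 * a)) > 0" by (rule tan_gt_zero)
    then have Dn: "D n >= 0" unfolding D_def using a s by (intro mult_nonneg_nonneg) auto
    consider "t = 0" | "0 < t" "t < s" | "t >= s" using t by force
    then show ?thesis
    proof cases
     case 2
     have "\<bar>wave_int a K t - wave_int a K 0\<bar> <= t\<^sup>2 + 4 * a / (real K * pi) * (tan (pi * t / (2 * a)) / t)"
      using wave_int_osc[OF a _ 2(1)] 2 s K by simp
     moreover have "tan (pi * t / (2 * a)) / t <= tan (pi * s / (2 * a)) / s"
     proof -
      have eqq: "tan (pi * s / (2 * a)) / s = pi / (2 * a) * (tan (pi * s / (2 * a)) / (pi * s / (2 * a)))" if "s > 0" for s
       using that a by simp
      show ?thesis unfolding eqq[OF 2(1)] eqq[OF s(1)]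
       using 2 s a by (intro mult_left_mono tan_over_mono) (auto simp: field_simps)
     qed
     then have "4 * a / (real K * pi) * (tan (pi * t / (2 * a)) / t) <= D n"
      unfolding D_def K_def using a by (intro mult_left_mono) auto
     moreover have "t\<^sup>2 <= a\<^sup>2" using 2 s by (intro power_mono) auto
     ultimately show ?thesis using 2 by simp
    next
     case 3
     then have "\<bar>wave_int a K t - wave_int a K 0\<bar> <= 10"
      using t s by (intro wave_int_osc_bounded a K) auto
     moreover have "0 <= a\<^sup>2" by simp
     moreover have "t \<in> {s..a}" using 3 t by simp
     ultimately show ?thesis using Dn by (simp only: if_True)
    qed (use Dn s in auto)
   qed
   have "\<bar>wave_sum a K t - (M + ln (1/2) + wave_int a K t)\<bar> <= 12 * C * t\<^sup>2 + 4 * C * a\<^sup>2"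
    unfolding M_def by (rule wave_sum_approx[OF C a]) (use K in simp_all)
   moreover have "12 * C * t\<^sup>2 <= 12 * C * a\<^sup>2" using t C by (intro mult_left_mono power_mono) auto
   moreover have "(16 * C + 1) * a\<^sup>2 = 12 * C * a\<^sup>2 + 4 * C * a\<^sup>2 + a\<^sup>2" by (simp add: algebra_simps)
   ultimately show "wave_sum a K t <= (M + ln (2 / a) + \<epsilon> / 2 + (16 * C + 1) * a\<^sup>2) + (if t \<in> {s..a} then 10 else 0)"
    using osc n(1,2) unfolding K_def[symmetric] by linarith
  qed
  also have "... = a * (M + ln (2 / a) + \<epsilon> / 2 + (16 * C + 1) * a\<^sup>2) + 10 * (a - s)"
  proof -
   have 1: "((%t. if t \<in> {s..a} then 10 else 0) has_integral (10 * (a - s))) {0..a}"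
    using has_integral_const_real[of "10::real" s a] s by (subst has_integral_restrict) (auto simp: mult.commute)
   have 2: "((%t. M + ln (2 / a) + \<epsilon> / 2 + (16 * C + 1) * a\<^sup>2) has_integral (a * (M + ln (2 / a) + \<epsilon> / 2 + (16 * C + 1) * a\<^sup>2))) {0..a}"
    using has_integral_const_real[of "M + ln (2 / a) + \<epsilon> / 2 + (16 * C + 1) * a\<^sup>2" 0 a] a by simp
   show ?thesis by (rule integral_unique[OF has_integral_add[OF 2 1]])
  qed
  also have "... / a = (M + ln (2 / a) + \<epsilon> / 2 + (16 * C + 1) * a\<^sup>2) + 10 * (1 - \<rho>)"
   using a by (simp add: s_def field_simps)
  also have "... <= M + ln (2 / a) + (16 * C + 1) * a\<^sup>2 + \<epsilon>" using \<rho> \<epsilon> by simp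
  \<comment> \<open>The integral was estimated underneath the division by a, so the chain carries
    monotonicity of this division as a premise, discharged next.\<close>
  finally have *: "(\<And>x y. x <= y ==> x / a <= y / a) ==> (\<Sum>p\<in>primes_le N. abs_sinc (a * ln p) / p) <= M + ln (2 / a) + (16 * C + 1) * a\<^sup>2 + \<epsilon>" .
  show "(\<Sum>p\<in>primes_le N. abs_sinc (a * ln p) / p) <= M + ln (2 / a) + (16 * C + 1) * a\<^sup>2 + \<epsilon>"
   by (rule *) (use a in \<open>simp add: divide_right_mono\<close>)
 qed
 moreover have "16 * C + 1 > 0" using C by simp
 ultimately show ?thesis using that unfolding M_def by blast
qed

subsection \<open>Mean squares of Dirichlet polynomials\<close>

text \<open>Frequencies are attached to an abstract index set because products are later indexed by
  pairs of a smooth and a rough factor, with \<kappa> their product.\<close>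

definition dpoly :: "'i set => ('i => complex) => ('i => nat) => real => complex" where
 "dpoly I c \<kappa> T = (\<Sum>i\<in>I. c i * cis (- T * ln (\<kappa> i)))"

lemma cis_has_integral:
 assumes "x ~= 0" "0 <= Y"
 obtains v where "((%T. cis (- T * x)) has_integral v) {Y..2 * Y}" "norm v <= 2 / \<bar>x\<bar>"
proof -
 have e: "cis (- T * x) = exp (- \<i> * of_real x * of_real T)" for T
  by (simp add: cis_conv_exp mult_ac)
 define F where "F T = cis (- T * x) * (\<i> / of_real x)" for T
 have "((%T. cis (- T * x)) has_integral (F (2 * Y) - F Y)) {Y..2 * Y}"
 proof (rule fundamental_theorem_of_calculus)
  fix T
  have "((%z. exp (- \<i> * of_real x * z) * (\<i> / of_real x)) has_field_derivative exp (- \<i> * of_real x * of_real T)) (at (of_real T))"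
   using assms by (auto intro!: derivative_eq_intros)
  then show "(F has_vector_derivative cis (- T * x)) (at T within {Y..2 * Y})"
   unfolding F_def e by (rule has_vector_derivative_real_field)
 qed (use assms in simp)
 moreover have "norm (F (2 * Y) - F Y) <= 2 / \<bar>x\<bar>"
  using norm_triangle_ineq4[of "F (2 * Y)" "F Y"] by (simp add: F_def norm_mult norm_divide)
 ultimately show ?thesis using that by blast
qed

lemma inverse_log_diff_le:
 assumes "1 <= l" "l < k"
 shows "1 / (real k * real l * \<bar>ln (real k) - ln (real l)\<bar>) <= 1 / (real l * (real k - real l))"
proof -
 have lk: "0 < real l" "real l < real k" using assms by auto
 have "ln (real l / real k) <= real l / real k - 1" by (rule ln_le_minus_one) (use lk in auto)
 then have "1 - real l / real k <= ln (real k) - ln (real l)" using lk by (simp add: ln_div)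
 then have "(real k - real l) <= real k * (ln (real k) - ln (real l))" using lk by (simp add: field_simps)
 then have "real l * (real k - real l) <= real l * (real k * (ln (real k) - ln (real l)))"
  using lk by (intro mult_left_mono) auto
 then show ?thesis using lk by (intro divide_left_mono) (auto simp: mult_ac)
qed

text \<open>For l < k the summand is at most 1 / (l (k - l)) = (1/l + 1/(k - l)) / k, for l > k at
  most 1 / (k (l - k)). This makes three harmonic sums, each divided by k.\<close>

lemma sum_inverse_log_diff_le:
 "(\<Sum>k=1..Z. \<Sum>l\<in>{1..Z} - {k}. 1 / (real k * real l * \<bar>ln (real k) - ln (real l)\<bar>)) <= 4 * (harm Z)\<^sup>2"
proof -
 have h: "(\<Sum>l\<in>S. 1 / real l) <= harm Z" if "S \<subseteq> {1..Z}" for S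
  unfolding harm_def inverse_eq_divide using that by (intro sum_mono2) auto
 have "(\<Sum>l\<in>{1..Z} - {k}. 1 / (real k * real l * \<bar>ln (real k) - ln (real l)\<bar>)) <= 3 * harm Z / real k" if k: "k \<in> {1..Z}" for k
 proof -
  have U: "{1..Z} - {k} = {1..<k} \<union> {k<..Z}" using k by auto
  have "(\<Sum>l\<in>{1..Z} - {k}. 1 / (real k * real l * \<bar>ln (real k) - ln (real l)\<bar>)) =
   (\<Sum>l=1..<k. 1 / (real k * real l * \<bar>ln (real k) - ln (real l)\<bar>)) + (\<Sum>l\<in>{k<..Z}. 1 / (real k * real l * \<bar>ln (real k) - ln (real l)\<bar>))"
   unfolding U by (rule sum.union_disjoint) auto
  moreover have "(\<Sum>l=1..<k. 1 / (real k * real l * \<bar>ln (real k) - ln (real l)\<bar>)) <= 2 * harm Z / real k"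
  proof -
   have "(\<Sum>l=1..<k. 1 / (real k * real l * \<bar>ln (real k) - ln (real l)\<bar>)) <= (\<Sum>l=1..<k. (1 / real l + 1 / real (k - l)) / real k)"
   proof (rule sum_mono)
    fix l assume l: "l \<in> {1..<k}"
    then have "1 / (real l * (real k - real l)) = (1 / real l + 1 / real (k - l)) / real k"
     by (simp add: of_nat_diff field_simps)
    then show "1 / (real k * real l * \<bar>ln (real k) - ln (real l)\<bar>) <= (1 / real l + 1 / real (k - l)) / real k"
     using inverse_log_diff_le[of l k] l by simp
   qed
   also have "... = ((\<Sum>l=1..<k. 1 / real l) + (\<Sum>l=1..<k. 1 / real (k - l))) / real k"
    by (simp add: sum_divide_distrib sum.distrib add_divide_distrib)
   also have "(\<Sum>l=1..<k. 1 / real (k - l)) = (\<Sum>l=1..<k. 1 / real l)"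
    by (rule sum.reindex_bij_witness[of _ "%l. k - l" "%l. k - l"]) auto
   also have "((\<Sum>l=1..<k. 1 / real l) + (\<Sum>l=1..<k. 1 / real l)) / real k <= (harm Z + harm Z) / real k"
    using k by (intro divide_right_mono add_mono h) auto
   finally show ?thesis by simp
  qed
  moreover have "(\<Sum>l\<in>{k<..Z}. 1 / (real k * real l * \<bar>ln (real k) - ln (real l)\<bar>)) <= harm Z / real k"
  proof -
   have "(\<Sum>l\<in>{k<..Z}. 1 / (real k * real l * \<bar>ln (real k) - ln (real l)\<bar>)) <= (\<Sum>l\<in>{k<..Z}. 1 / real (l - k) / real k)"
   proof (rule sum_mono)
    fix l assume l: "l \<in> {k<..Z}"
    then have "1 / (real l * real k * \<bar>ln (real l) - ln (real k)\<bar>) <= 1 / (real k * (real l - real k))"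
     using k by (intro inverse_log_diff_le) auto
    then show "1 / (real k * real l * \<bar>ln (real k) - ln (real l)\<bar>) <= 1 / real (l - k) / real k"
     using l by (simp add: of_nat_diff abs_minus_commute mult.commute)
   qed
   also have "... = (\<Sum>l\<in>{k<..Z}. 1 / real (l - k)) / real k" by (simp add: sum_divide_distrib)
   also have "(\<Sum>l\<in>{k<..Z}. 1 / real (l - k)) = (\<Sum>j\<in>{1..Z - k}. 1 / real j)"
    by (rule sum.reindex_bij_witness[of _ "%j. j + k" "%l. l - k"]) auto
   also have "... / real k <= harm Z / real k" by (intro divide_right_mono h) auto
   finally show ?thesis .
  qed
  moreover have "2 * harm Z / real k + harm Z / real k = 3 * harm Z / real k" by (simp flip: add_divide_distrib)
  ultimately show ?thesis by linarith
 qed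
 then have "(\<Sum>k=1..Z. \<Sum>l\<in>{1..Z} - {k}. 1 / (real k * real l * \<bar>ln (real k) - ln (real l)\<bar>)) <= (\<Sum>k=1..Z. 3 * harm Z / real k)"
  by (rule sum_mono)
 also have "(\<Sum>k=1..Z. 3 * harm Z / real k) = 3 * (harm Z * harm Z :: real)"
  by (simp add: harm_def inverse_eq_divide sum_distrib_left)
 finally have "(\<Sum>k=1..Z. \<Sum>l\<in>{1..Z} - {k}. 1 / (real k * real l * \<bar>ln (real k) - ln (real l)\<bar>)) <= 3 * (harm Z * harm Z)" .
 moreover have "0 <= harm Z * (harm Z :: real)" by simp
 ultimately show ?thesis unfolding power2_eq_square by linarith
qed

lemma dpoly_mean_square:
 assumes I: "finite I" "inj_on \<kappa> I" and \<kappa>: "\<And>i. i \<in> I ==> 1 <= \<kappa> i & \<kappa> i <= Z"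
  and c: "\<And>i. i \<in> I ==> norm (c i) <= B / real (\<kappa> i)" and Y: "0 <= Y"
 shows "\<bar>integral {Y..2 * Y} (%T. (norm (dpoly I c \<kappa> T))\<^sup>2) - Y * (\<Sum>i\<in>I. (norm (c i))\<^sup>2)\<bar> <= 8 * B\<^sup>2 * (harm Z)\<^sup>2"
proof -
 let ?l = "%i. ln (real (\<kappa> i))"
 have "\<exists>v. ((%T. cis (- T * (?l i - ?l j))) has_integral v) {Y..2 * Y} &
   (if i = j then v = of_real Y else norm v <= 2 / \<bar>?l i - ?l j\<bar>)" if "i \<in> I" "j \<in> I" for i j
 proof (cases "i = j")
  case True
  then show ?thesis using has_integral_const_real[of "1::complex" Y "2 * Y"] Y
   by (intro exI[of _ "of_real Y"]) (simp add: scaleR_conv_of_real)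
 next
  case False
  then have "\<kappa> i ~= \<kappa> j" using I(2) that by (auto simp: inj_on_def)
  then have "?l i - ?l j ~= 0" using \<kappa>[OF that(1)] \<kappa>[OF that(2)] by simp
  from cis_has_integral[OF this Y] show ?thesis using False by metis
 qed
 then obtain v where v: "\<And>i j. i \<in> I ==> j \<in> I ==> ((%T. cis (- T * (?l i - ?l j))) has_integral v i j) {Y..2 * Y}"
  "\<And>i j. i \<in> I ==> j \<in> I ==> if i = j then v i j = of_real Y else norm (v i j) <= 2 / \<bar>?l i - ?l j\<bar>"
  by metis
 define V where "V = (\<Sum>i\<in>I. \<Sum>j\<in>I. (c i * cnj (c j)) * v i j)"
 have "((%T. \<Sum>i\<in>I. \<Sum>j\<in>I. (c i * cnj (c j)) * cis (- T * (?l i - ?l j))) has_integral V) {Y..2 * Y}"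
  unfolding V_def by (intro has_integral_sum has_integral_mult_right v I(1))
 also have "(%T. \<Sum>i\<in>I. \<Sum>j\<in>I. (c i * cnj (c j)) * cis (- T * (?l i - ?l j))) = (%T. of_real ((norm (dpoly I c \<kappa> T))\<^sup>2))"
 proof
  fix T
  have "cis (- T * ?l i) * cnj (cis (- T * ?l j)) = cis (- T * (?l i - ?l j))" for i j
   by (simp add: cis_cnj cis_mult algebra_simps)
  then have "(c i * cis (- T * ?l i)) * cnj (c j * cis (- T * ?l j)) = (c i * cnj (c j)) * cis (- T * (?l i - ?l j))" for i j
   by (metis complex_cnj_mult mult.assoc mult.left_commute)
  then have "dpoly I c \<kappa> T * cnj (dpoly I c \<kappa> T) = (\<Sum>i\<in>I. \<Sum>j\<in>I. (c i * cnj (c j)) * cis (- T * (?l i - ?l j)))"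
   by (simp only: dpoly_def cnj_sum sum_product)
  then show "(\<Sum>i\<in>I. \<Sum>j\<in>I. (c i * cnj (c j)) * cis (- T * (?l i - ?l j))) = of_real ((norm (dpoly I c \<kappa> T))\<^sup>2)"
   using complex_norm_square[of "dpoly I c \<kappa> T"] by simp
 qed
 finally have "((Re \<circ> (%T. of_real ((norm (dpoly I c \<kappa> T))\<^sup>2))) has_integral Re V) {Y..2 * Y}"
  by (rule has_integral_linear[OF _ bounded_linear_Re])
 then have "((%T. (norm (dpoly I c \<kappa> T))\<^sup>2) has_integral Re V) {Y..2 * Y}"
  by (simp only: o_def Re_complex_of_real)
 then have int: "integral {Y..2 * Y} (%T. (norm (dpoly I c \<kappa> T))\<^sup>2) = Re V" by (simp add: integral_unique)
 have "V - of_real (Y * (\<Sum>i\<in>I. (norm (c i))\<^sup>2)) = (\<Sum>i\<in>I. \<Sum>j\<in>I - {i}. (c i * cnj (c j)) * v i j)"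
 proof -
  have "(\<Sum>j\<in>I. (c i * cnj (c j)) * v i j) = of_real (Y * (norm (c i))\<^sup>2) + (\<Sum>j\<in>I - {i}. (c i * cnj (c j)) * v i j)" if i: "i \<in> I" for i
  proof -
   have "(c i * cnj (c i)) * v i i = of_real (Y * (norm (c i))\<^sup>2)"
    using v(2)[OF i i] complex_norm_square[of "c i"] by simp
   then show ?thesis using I(1) i by (simp add: sum.remove)
  qed
  then have "V = (\<Sum>i\<in>I. of_real (Y * (norm (c i))\<^sup>2) + (\<Sum>j\<in>I - {i}. (c i * cnj (c j)) * v i j))"
   unfolding V_def by (intro sum.cong) auto
  then show ?thesis by (simp add: sum.distrib sum_distrib_left)
 qed
 then have "norm (V - of_real (Y * (\<Sum>i\<in>I. (norm (c i))\<^sup>2))) = norm (\<Sum>i\<in>I. \<Sum>j\<in>I - {i}. (c i * cnj (c j)) * v i j)"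
  by (simp only:)
 also have "... <= (\<Sum>i\<in>I. norm (\<Sum>j\<in>I - {i}. (c i * cnj (c j)) * v i j))" by (rule norm_sum)
 also have "... <= (\<Sum>i\<in>I. \<Sum>j\<in>I - {i}. norm ((c i * cnj (c j)) * v i j))" by (intro sum_mono norm_sum)
 also have "... <= (\<Sum>i\<in>I. \<Sum>j\<in>I - {i}. 2 * B\<^sup>2 * (1 / (real (\<kappa> i) * real (\<kappa> j) * \<bar>?l i - ?l j\<bar>)))"
 proof (intro sum_mono)
  fix i j assume ij: "i \<in> I" "j \<in> I - {i}"
  have "norm ((c i * cnj (c j)) * v i j) = norm (c i) * norm (c j) * norm (v i j)" by (simp add: norm_mult)
  also have "... <= (B / real (\<kappa> i)) * (B / real (\<kappa> j)) * (2 / \<bar>?l i - ?l j\<bar>)"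
   using ij c[of i] c[of j] v(2)[of i j] order_trans[OF norm_ge_zero c[of i]] order_trans[OF norm_ge_zero c[of j]]
   by (intro mult_mono mult_nonneg_nonneg) auto
  finally show "norm ((c i * cnj (c j)) * v i j) <= 2 * B\<^sup>2 * (1 / (real (\<kappa> i) * real (\<kappa> j) * \<bar>?l i - ?l j\<bar>))"
   by (simp add: power2_eq_square mult_ac)
 qed
 also have "... = 2 * B\<^sup>2 * (\<Sum>i\<in>I. \<Sum>j\<in>I - {i}. 1 / (real (\<kappa> i) * real (\<kappa> j) * \<bar>?l i - ?l j\<bar>))"
  by (simp add: sum_distrib_left)
 also have "(\<Sum>i\<in>I. \<Sum>j\<in>I - {i}. 1 / (real (\<kappa> i) * real (\<kappa> j) * \<bar>?l i - ?l j\<bar>)) =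
   (\<Sum>k\<in>\<kappa> ` I. \<Sum>l\<in>\<kappa> ` I - {k}. 1 / (real k * real l * \<bar>ln (real k) - ln (real l)\<bar>))"
 proof -
  have "(\<Sum>j\<in>I - {i}. 1 / (real (\<kappa> i) * real (\<kappa> j) * \<bar>?l i - ?l j\<bar>)) =
    (\<Sum>l\<in>\<kappa> ` I - {\<kappa> i}. 1 / (real (\<kappa> i) * real l * \<bar>?l i - ln (real l)\<bar>))" if i: "i \<in> I" for i
  proof -
   have "\<kappa> ` I - {\<kappa> i} = \<kappa> ` (I - {i})" using I(2) i by (auto simp: inj_on_def)
   moreover have "inj_on \<kappa> (I - {i})" using I(2) by (rule inj_on_subset) auto
   ultimately show ?thesis by (simp add: sum.reindex)
  qed
  then show ?thesis using I(2) by (simp add: sum.reindex)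
 qed
 also have "... <= (\<Sum>k=1..Z. \<Sum>l\<in>{1..Z} - {k}. 1 / (real k * real l * \<bar>ln (real k) - ln (real l)\<bar>))"
 proof -
  have sub: "\<kappa> ` I \<subseteq> {1..Z}" using \<kappa> by auto
  have "(\<Sum>k\<in>\<kappa> ` I. \<Sum>l\<in>\<kappa> ` I - {k}. 1 / (real k * real l * \<bar>ln (real k) - ln (real l)\<bar>)) \<le>
    (\<Sum>k\<in>\<kappa> ` I. \<Sum>l\<in>{1..Z} - {k}. 1 / (real k * real l * \<bar>ln (real k) - ln (real l)\<bar>))"
   using sub by (intro sum_mono sum_mono2) auto
  also have "... <= (\<Sum>k=1..Z. \<Sum>l\<in>{1..Z} - {k}. 1 / (real k * real l * \<bar>ln (real k) - ln (real l)\<bar>))"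
   using sub by (intro sum_mono2 sum_nonneg) auto
  finally show ?thesis .
 qed
 also have "... <= 4 * (harm Z)\<^sup>2" by (rule sum_inverse_log_diff_le)
 finally have "norm (V - of_real (Y * (\<Sum>i\<in>I. (norm (c i))\<^sup>2))) <= 2 * B\<^sup>2 * (4 * (harm Z)\<^sup>2)"
  by (simp add: mult_left_mono)
 moreover have "\<bar>Re V - Y * (\<Sum>i\<in>I. (norm (c i))\<^sup>2)\<bar> <= norm (V - of_real (Y * (\<Sum>i\<in>I. (norm (c i))\<^sup>2)))"
  using abs_Re_le_cmod[of "V - of_real (Y * (\<Sum>i\<in>I. (norm (c i))\<^sup>2))"] by simp
 ultimately show ?thesis unfolding int by simp
qed

lemma dpoly_continuous [continuous_intros]: "continuous_on A (dpoly I c \<kappa>)"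
 unfolding dpoly_def cis_conv_exp by (intro continuous_intros)

subsection \<open>Sieving out small primes\<close>

definition rough :: "nat set => nat => bool" where
 "rough P k \<longleftrightarrow> k > 0 & (\<forall>p\<in>P. \<not> p dvd k)"

text \<open>Multiplying a partial sum of zeta by the factors 1 - p^(-s) sieves exactly up to X.
  Beyond X the truncation spoils the sieve and only the trivial coefficient bound survives, while
  the length grows to X times the product of the primes.\<close>

lemma rough_coefficients:
 assumes "finite P" "\<And>p. p \<in> P ==> prime p"
 shows "\<exists>b :: nat => real. (\<forall>k. \<bar>b k\<bar> <= 2 ^ card P) & (\<forall>k\<in>{1..X}. b k = (if rough P k then 1 else 0)) &
   (\<forall>s::complex. (\<Sum>n=1..X. of_nat n powr (-s)) * (\<Prod>p\<in>P. 1 - of_nat p powr (-s)) = (\<Sum>k=1..X * \<Prod>P. of_real (b k) * of_nat k powr (-s)))"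
 using assms
proof (induction P rule: finite_induct)
 case empty
 show ?case by (intro exI[of _ "%_. 1"]) (auto simp: rough_def)
next
 case (insert p P)
 have pr: "\<And>q. q \<in> P ==> prime q" using insert.prems by auto
 have "\<exists>b :: nat => real. (\<forall>k. \<bar>b k\<bar> <= 2 ^ card P) & (\<forall>k\<in>{1..X}. b k = (if rough P k then 1 else 0)) &
   (\<forall>s::complex. (\<Sum>n=1..X. of_nat n powr (-s)) * (\<Prod>p\<in>P. 1 - of_nat p powr (-s)) = (\<Sum>k=1..X * \<Prod>P. of_real (b k) * of_nat k powr (-s)))"
  by (rule insert.IH) (rule pr)
 then obtain b :: "nat => real" where b': "(\<forall>k. \<bar>b k\<bar> <= 2 ^ card P) & (\<forall>k\<in>{1..X}. b k = (if rough P k then 1 else 0)) &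
   (\<forall>s::complex. (\<Sum>n=1..X. of_nat n powr (-s)) * (\<Prod>p\<in>P. 1 - of_nat p powr (-s)) = (\<Sum>k=1..X * \<Prod>P. of_real (b k) * of_nat k powr (-s)))" ..
 note b = b'[THEN conjunct1, rule_format] b'[THEN conjunct2, THEN conjunct1, rule_format] b'[THEN conjunct2, THEN conjunct2, rule_format]
 have p: "prime p" using insert.prems by auto
 then have p1: "p >= 1" by (rule prime_ge_1_nat)
 define Z where "Z = X * \<Prod>P"
 \<comment> \<open>The coefficients are cut at Z first, since the induction hypothesis only bounds
   them beyond Z.\<close>
 define b' where "b' k = (if k <= Z then b k else 0) - (if p dvd k then b (k div p) else 0)" for k
 have 1: "\<bar>b' k\<bar> <= 2 ^ card (insert p P)" for k
 proof -
  have "\<bar>b' k\<bar> <= \<bar>b k\<bar> + \<bar>b (k div p)\<bar>" by (auto simp: b'_def)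
  also have "... <= 2 ^ card P + 2 ^ card P" by (intro add_mono b)
  finally show ?thesis using insert.hyps by simp
 qed
 have 2: "b' k = (if rough (insert p P) k then 1 else 0)" if k: "k \<in> {1..X}" for k
 proof -
  have "\<Prod>P >= 1" by (intro prod_ge_1) (rule prime_ge_1_nat[OF pr])
  then have "X * 1 <= Z" unfolding Z_def by (intro mult_le_mono) auto
  then have kZ: "k <= Z" using k by simp
  show ?thesis
  proof (cases "p dvd k")
   case True
   then obtain j where j: "k = p * j" by (elim dvdE)
   have jX: "j \<in> {1..X}" using j k p1 by (auto intro: order_trans[of j "p * j"])
   have "rough P k \<longleftrightarrow> rough P j"
   proof -
    have "q dvd p * j \<longleftrightarrow> q dvd j" if "q \<in> P" for q
     using that insert.prems insert.hyps p by (metis dvd_mult insertI2 prime_dvd_multD primes_dvd_imp_eq)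
    then show ?thesis using j k by (auto simp: rough_def)
   qed
   then have "b' k = 0" using b(2)[OF k] b(2)[OF jX] j p1 kZ by (simp add: b'_def)
   then show ?thesis using True by (simp add: rough_def)
  qed (use b(2)[OF k] kZ in \<open>auto simp: b'_def rough_def\<close>)
 qed
 have 3: "(\<Sum>n=1..X. of_nat n powr (-s)) * (\<Prod>p\<in>insert p P. 1 - of_nat p powr (-s)) = (\<Sum>k=1..X * \<Prod>(insert p P). of_real (b' k) * of_nat k powr (-s))" for s :: complex
 proof -
  have Z': "X * \<Prod>(insert p P) = p * Z" using insert.hyps by (simp add: Z_def)
  have "(\<Sum>n=1..X. of_nat n powr (-s)) * (\<Prod>p\<in>insert p P. 1 - of_nat p powr (-s)) =
    (\<Sum>k=1..Z. of_real (b k) * of_nat k powr (-s)) - of_nat p powr (-s) * (\<Sum>k=1..Z. of_real (b k) * of_nat k powr (-s))"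
   using insert.hyps b(3)[of s] by (simp add: Z_def algebra_simps)
  also have "of_nat p powr (-s) * (\<Sum>k=1..Z. of_real (b k) * of_nat k powr (-s)) = (\<Sum>k=1..Z. of_real (b k) * of_nat (p * k) powr (-s))"
   unfolding sum_distrib_left by (intro sum.cong refl) (simp add: powr_times_real)
  also have "... = (\<Sum>k\<in>{k\<in>{1..p * Z}. p dvd k}. of_real (b (k div p)) * of_nat k powr (-s))"
  proof -
   have im: "{k\<in>{1..p * Z}. p dvd k} = (%k. p * k) ` {1..Z}"
    using p1 by (auto elim!: dvdE)
   have "inj_on (%k. p * k) {1..Z}" using p1 by (auto simp: inj_on_def)
   then show ?thesis unfolding im using p1 by (subst sum.reindex) auto
  qed
  also have "... = (\<Sum>k=1..p * Z. of_real (if p dvd k then b (k div p) else 0) * of_nat k powr (-s))"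
   by (subst sum.inter_filter, simp, intro sum.cong) auto
  also have "(\<Sum>k=1..Z. of_real (b k) * of_nat k powr (-s)) = (\<Sum>k=1..p * Z. of_real (if k <= Z then b k else 0) * of_nat k powr (-s))"
  proof (rule sum.mono_neutral_cong_left)
   have "1 * Z <= p * Z" using p1 by (intro mult_le_mono) auto
   then show "{1..Z} \<subseteq> {1..p * Z}" by auto
  qed auto
  finally show ?thesis unfolding Z' by (simp add: b'_def sum_subtractf left_diff_distrib)
 qed
 show ?case using 1 2 3 by blast
qed

subsection \<open>Weights concentrated on prescribed signs\<close>

lemma prod_cis: "finite P ==> (\<Prod>p\<in>P. cis (f p)) = cis (\<Sum>p\<in>P. f p)"
 by (induction P rule: finite_induct) (auto simp: cis_mult)

text \<open>The exponents are recovered as multiplicities, because a rough factor is prime to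
  P.\<close>

lemma smooth_rough_inj:
 assumes "finite P" "\<And>p. p \<in> P ==> prime p"
  and "S \<subseteq> {k. rough P k}"
 shows "inj_on (%(e, k). (\<Prod>p\<in>P. p ^ e p) * k) (PiE P B \<times> S)"
proof (rule inj_onI, clarify)
 fix e k e' k' assume e: "e \<in> PiE P B" "e' \<in> PiE P B" and k: "k \<in> S" "k' \<in> S"
  and eq: "(\<Prod>p\<in>P. p ^ e p) * k = (\<Prod>p\<in>P. p ^ e' p) * k'"
 have pos: "(\<Prod>p\<in>P. p ^ f p) > 0" for f using assms(2) by (auto intro!: prod_pos simp: prime_gt_0_nat)
 have m: "multiplicity p ((\<Prod>p\<in>P. p ^ f p) * l) = f p" if "p \<in> P" "l \<in> S" for p f l
 proof -
  have l: "rough P l" using that assms(3) by auto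
  then have "multiplicity p l = 0" using that by (intro not_dvd_imp_multiplicity_0) (auto simp: rough_def)
  moreover have "multiplicity p (\<Prod>p\<in>P. p ^ f p) = f p"
   using assms that by (subst multiplicity_prod_prime_powers) auto
  moreover have "multiplicity p ((\<Prod>p\<in>P. p ^ f p) * l) = multiplicity p (\<Prod>p\<in>P. p ^ f p) + multiplicity p l"
   using assms(2)[OF that(1)] pos[of f] l by (intro prime_elem_multiplicity_mult_distrib) (auto simp: rough_def)
  ultimately show ?thesis by simp
 qed
 have "e = e'"
 proof (rule PiE_ext[OF e])
  fix p assume "p \<in> P"
  then show "e p = e' p" using m[of p k e] m[of p k' e'] k eq by simp
 qed
 moreover from this have "k = k'" using eq pos[of e] by simp
 ultimately show "e = e' & k = k'" by simp
qed

text \<open>For \<open>B p = {..m}\<close> and s = 1 each factor is a geometric sum in \<epsilon> p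
  * p^(-iT), largest where p^(-iT) equals the sign \<epsilon> p; its squared modulus is an
  unnormalised Fejer kernel. General exponent sets and signs are allowed so that the weight times 1
  - \<epsilon> q * q^(-iT) has the same shape.\<close>

definition sign_weight :: "nat set => (nat => real) => (nat => nat set) => (nat => nat => real) => real => complex" where
 "sign_weight P \<epsilon> B s T = (\<Prod>p\<in>P. \<Sum>j\<in>B p. of_real (s p j) * (of_real (\<epsilon> p) * cis (- T * ln (real p))) ^ j)"

text \<open>Expanded, the weight is a Dirichlet polynomial with unimodular coefficients on P-smooth
  numbers. Multiplied by a polynomial on P-rough numbers it has distinct frequencies, so the mean
  square factors: the prescribed signs at small primes do not interact with the rough part.\<close>

lemma sign_weight_mean:
 assumes P: "finite P" "\<And>p. p \<in> P ==> prime p" and B: "\<And>p. p \<in> P ==> finite (B p)"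
  and s: "\<And>p j. \<bar>s p j\<bar> = 1" and \<epsilon>: "\<And>p. \<bar>\<epsilon> p\<bar> = 1"
  and d: "\<And>e. e \<in> PiE P B ==> (\<Prod>p\<in>P. p ^ e p) <= d"
  and S: "finite S" "S \<subseteq> {k. rough P k}" "\<And>k. k \<in> S ==> k <= X"
  and g: "\<And>k. k \<in> S ==> norm (g k) <= G / real k" and Y: "0 <= Y"
 shows "\<bar>integral {Y..2 * Y} (%T. (norm (sign_weight P \<epsilon> B s T * dpoly S g id T))\<^sup>2) - Y * (real (\<Prod>p\<in>P. card (B p)) * (\<Sum>k\<in>S. (norm (g k))\<^sup>2))\<bar>
   <= 8 * (real d * G)\<^sup>2 * (harm (d * X))\<^sup>2"
proof -
 define D where "D e = (\<Prod>p\<in>P. p ^ e p)" for e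
 define c where "c e = (\<Prod>p\<in>P. complex_of_real (s p (e p) * \<epsilon> p ^ e p))" for e
 have Dpos: "D e > 0" for e unfolding D_def using P by (auto intro!: prod_pos simp: prime_gt_0_nat)
 have nc: "norm (c e) = 1" for e
  unfolding c_def prod_norm[symmetric] by (intro prod.neutral) (simp add: abs_mult power_abs s \<epsilon> flip: of_real_mult of_real_power)
 have fin: "finite (PiE P B)" by (intro finite_PiE P B)
 have w: "sign_weight P \<epsilon> B s T = (\<Sum>e\<in>PiE P B. c e * cis (- T * ln (real (D e))))" for T
 proof -
  have "sign_weight P \<epsilon> B s T = (\<Sum>e\<in>PiE P B. \<Prod>p\<in>P. of_real (s p (e p)) * (of_real (\<epsilon> p) * cis (- T * ln (real p))) ^ e p)"
   unfolding sign_weight_def by (rule prod_sum_PiE[OF P(1) B])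
  also have "... = (\<Sum>e\<in>PiE P B. c e * cis (- T * ln (real (D e))))"
  proof (rule sum.cong[OF refl])
   fix e
   have "(\<Prod>p\<in>P. of_real (s p (e p)) * (of_real (\<epsilon> p) * cis (- T * ln (real p))) ^ e p) =
     (\<Prod>p\<in>P. complex_of_real (s p (e p) * \<epsilon> p ^ e p) * cis (real (e p) * (- T * ln (real p))))"
    by (intro prod.cong refl) (simp add: power_mult_distrib Complex.DeMoivre)
   also have "... = c e * cis (\<Sum>p\<in>P. real (e p) * (- T * ln (real p)))"
    unfolding prod.distrib c_def prod_cis[OF P(1)] ..
   also have "(\<Sum>p\<in>P. real (e p) * (- T * ln (real p))) = - T * ln (real (D e))"
   proof -
    have "ln (real (D e)) = (\<Sum>p\<in>P. ln (real p ^ e p))"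
     unfolding D_def of_nat_prod of_nat_power using P by (intro ln_prod) (auto simp: prime_gt_0_nat dest: prime_gt_0_nat)
    also have "... = (\<Sum>p\<in>P. real (e p) * ln (real p))"
     using P by (intro sum.cong refl) (simp add: ln_realpow prime_gt_0_nat)
    finally show ?thesis by (simp add: sum_distrib_left mult_ac)
   qed
   finally show "(\<Prod>p\<in>P. of_real (s p (e p)) * (of_real (\<epsilon> p) * cis (- T * ln (real p))) ^ e p) = c e * cis (- T * ln (real (D e)))" .
  qed
  finally show ?thesis .
 qed
 define I where "I = PiE P B \<times> S"
 define c2 where "c2 = (%(e, k). c e * g k)"
 define \<kappa> where "\<kappa> = (%(e, k). D e * k)"
 have Spos: "k > 0" if "k \<in> S" for k using that S(2) by (auto simp: rough_def)
 have prod_eq: "sign_weight P \<epsilon> B s T * dpoly S g id T = dpoly I c2 \<kappa> T" for T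
 proof -
  have "sign_weight P \<epsilon> B s T * dpoly S g id T = (\<Sum>e\<in>PiE P B. \<Sum>k\<in>S. (c e * cis (- T * ln (real (D e)))) * (g k * cis (- T * ln (real k))))"
   unfolding w dpoly_def sum_product by simp
  also have "... = (\<Sum>e\<in>PiE P B. \<Sum>k\<in>S. (c e * g k) * cis (- T * ln (real (D e * k))))"
  proof (intro sum.cong refl)
   fix e k assume "k \<in> S"
   then have "ln (real (D e * k)) = ln (real (D e)) + ln (real k)" using Spos Dpos[of e] by (simp add: ln_mult_pos)
   then have "cis (- T * ln (real (D e * k))) = cis (- T * ln (real (D e))) * cis (- T * ln (real k))"
    by (simp add: cis_mult algebra_simps)
   then show "(c e * cis (- T * ln (real (D e)))) * (g k * cis (- T * ln (real k))) = (c e * g k) * cis (- T * ln (real (D e * k)))"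
    by (simp add: mult_ac)
  qed
  also have "... = dpoly I c2 \<kappa> T"
   unfolding dpoly_def I_def sum.cartesian_product c2_def \<kappa>_def by (intro sum.cong) auto
  finally show ?thesis .
 qed
 have "\<bar>integral {Y..2 * Y} (%T. (norm (dpoly I c2 \<kappa> T))\<^sup>2) - Y * (\<Sum>i\<in>I. (norm (c2 i))\<^sup>2)\<bar> <= 8 * (real d * G)\<^sup>2 * (harm (d * X))\<^sup>2"
 proof (rule dpoly_mean_square[OF _ _ _ _ Y])
  show "finite I" unfolding I_def by (intro finite_cartesian_product fin S)
  show "inj_on \<kappa> I" unfolding \<kappa>_def I_def D_def by (rule smooth_rough_inj[OF P S(2)])
  fix i assume "i \<in> I"
  then obtain e k where ek: "i = (e, k)" "e \<in> PiE P B" "k \<in> S" by (auto simp: I_def)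
  have De: "D e <= d" using d[OF ek(2)] by (simp add: D_def)
  show "1 <= \<kappa> i & \<kappa> i <= d * X"
   using Dpos[of e] Spos[OF ek(3)] De S(3)[OF ek(3)] by (auto simp: \<kappa>_def ek intro!: mult_le_mono Suc_leI)
  have G: "G >= 0" using order_trans[OF norm_ge_zero g[OF ek(3)]] Spos[OF ek(3)] by (simp add: zero_le_divide_iff)
  have "norm (c2 i) <= G / real k" using g[OF ek(3)] by (simp add: c2_def ek norm_mult nc)
  also have "... = real (D e) * G / (real (D e) * real k)" using Dpos[of e] by simp
  also have "... <= real d * G / (real (D e) * real k)"
   using De G by (intro divide_right_mono mult_right_mono) auto
  finally show "norm (c2 i) <= real d * G / real (\<kappa> i)" by (simp add: \<kappa>_def ek)
 qed
 moreover have "(\<Sum>i\<in>I. (norm (c2 i))\<^sup>2) = real (\<Prod>p\<in>P. card (B p)) * (\<Sum>k\<in>S. (norm (g k))\<^sup>2)"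
 proof -
  have "(\<Sum>i\<in>I. (norm (c2 i))\<^sup>2) = (\<Sum>e\<in>PiE P B. \<Sum>k\<in>S. (norm (g k))\<^sup>2)"
   unfolding I_def sum.cartesian_product by (intro sum.cong) (auto simp: c2_def norm_mult nc)
  then show ?thesis using P(1) by (simp add: card_PiE)
 qed
 ultimately show ?thesis unfolding prod_eq by simp
qed

subsection \<open>Transferring a short Euler product to the zeta function\<close>

definition dpoly_diff :: "nat set => (nat => complex) => real => complex" where
 "dpoly_diff S g = dpoly S (%k. - (\<i> * of_real (ln (real k)) * g k)) id"

lemma dpoly_shift: "dpoly S g id (T + u) = dpoly S (%k. g k * cis (- u * ln (real k))) id T"
proof -
 have "cis (- (T + u) * ln (real k)) = cis (- u * ln (real k)) * cis (- T * ln (real k))" for k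
  by (simp add: cis_mult algebra_simps)
 then show ?thesis by (simp only: dpoly_def id_apply mult.assoc)
qed

lemma dpoly_has_vector_derivative:
 "((%u. dpoly S g id (T + u)) has_vector_derivative dpoly_diff S g (T + u)) (at u within A)"
 unfolding dpoly_diff_def dpoly_def
proof (rule has_vector_derivative_sum)
 fix k
 have e: "cis (- (T + u) * ln (real k)) = exp (- (\<i> * of_real (ln (real k))) * (of_real T + of_real u))" for u
  by (simp add: cis_conv_exp algebra_simps)
 have "((%z. g k * exp (- (\<i> * of_real (ln (real k))) * (of_real T + z))) has_field_derivative
   - (\<i> * of_real (ln (real k)) * g k) * exp (- (\<i> * of_real (ln (real k))) * (of_real T + of_real u))) (at (of_real u))"
  by (auto intro!: derivative_eq_intros)
 then show "((%u. g k * cis (- (T + u) * ln (real (id k)))) has_vector_derivative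
   - (\<i> * of_real (ln (real k)) * g k) * cis (- (T + u) * ln (real (id k)))) (at u within A)"
  unfolding id_apply e by (rule has_vector_derivative_real_field)
qed

lemma continuous_on_dpoly [continuous_intros]:
 "continuous_on A f ==> continuous_on A (%x. dpoly S g \<kappa> (f x))"
 using continuous_on_compose2[OF dpoly_continuous[of UNIV]] by auto

lemma continuous_on_dpoly_diff [continuous_intros]:
 "continuous_on A f ==> continuous_on A (%x. dpoly_diff S g (f x))"
 unfolding dpoly_diff_def by (rule continuous_on_dpoly)

text \<open>A Sobolev-type majorant for the polynomial on [T - a, T + a]: squared value at the left
  end plus the integral of the squared derivative. It is quadratic, so its weighted means over T are
  accessible.\<close>

definition energy :: "nat set => (nat => complex) => real => real => real" where
 "energy S g a T = (norm (dpoly S g id (T - a)))\<^sup>2 + integral {-a..a} (%u. (norm (dpoly_diff S g (T + u)))\<^sup>2)"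

lemma energy_nonneg: "energy S g a T >= 0"
 unfolding energy_def by (intro add_nonneg_nonneg integral_nonneg) (auto intro!: integrable_continuous_interval continuous_intros)

lemma continuous_on_dpoly_diff_integral:
 "continuous_on A (%T. integral {-a..a} (%u. (norm (dpoly_diff S g (T + u)))\<^sup>2))"
proof -
 have "continuous_on A (%T. integral (cbox (-a) a) (%u. (norm (dpoly_diff S g (T + u)))\<^sup>2))"
  by (rule integral_continuous_on_param) (auto intro!: continuous_intros simp: case_prod_beta)
 then show ?thesis unfolding cbox_interval .
qed

lemma continuous_on_energy: "continuous_on A (energy S g a)"
 unfolding energy_def[abs_def] by (intro continuous_intros continuous_on_dpoly_diff_integral)

text \<open>Value at the left end plus the integral of the derivative, each linearised by x <=
  \<kappa> + x^2 / \<kappa> with \<kappa> free.\<close>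

lemma dpoly_sup_energy:
 assumes \<kappa>: "\<kappa> > 0" and t: "\<bar>t\<bar> <= a"
 shows "norm (dpoly S g id (T + t)) <= \<kappa> * (1 + 2 * a) + energy S g a T / \<kappa>"
proof -
 have sq: "x <= \<kappa> + x\<^sup>2 / \<kappa>" for x :: real
 proof -
  have "(x - \<kappa>)\<^sup>2 = x\<^sup>2 + \<kappa>\<^sup>2 - 2 * (\<kappa> * x)" by (simp add: power2_eq_square algebra_simps)
  then have "\<kappa> * x <= \<kappa>\<^sup>2 + x\<^sup>2"
   using zero_le_power2[of "x - \<kappa>"] zero_le_power2[of x] zero_le_power2[of \<kappa>] by linarith
  then have "\<kappa> * x / \<kappa> <= (\<kappa>\<^sup>2 + x\<^sup>2) / \<kappa>" using \<kappa> by (intro divide_right_mono) auto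
  then show ?thesis using \<kappa> by (simp add: add_divide_distrib power2_eq_square)
 qed
 have sub: "{-a..t} \<subseteq> {-a..a}" and at: "-a <= t" using t by auto
 have "((%u. dpoly_diff S g (T + u)) has_integral (dpoly S g id (T + t) - dpoly S g id (T + - a))) {-a..t}"
  by (rule fundamental_theorem_of_calculus[OF at]) (rule dpoly_has_vector_derivative)
 then have e: "dpoly S g id (T + t) - dpoly S g id (T - a) = integral {-a..t} (%u. dpoly_diff S g (T + u))"
  by (simp add: integral_unique)
 have "norm (integral {-a..t} (%u. dpoly_diff S g (T + u))) <= integral {-a..t} (%u. \<kappa> + (norm (dpoly_diff S g (T + u)))\<^sup>2 / \<kappa>)"
  by (rule integral_norm_bound_integral) (use sq \<kappa> in \<open>auto intro!: integrable_continuous_interval continuous_intros\<close>)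
 also have "... <= integral {-a..a} (%u. \<kappa> + (norm (dpoly_diff S g (T + u)))\<^sup>2 / \<kappa>)"
  by (rule integral_subset_le[OF sub]) (use \<kappa> in \<open>auto intro!: integrable_continuous_interval continuous_intros\<close>)
 also have "... = integral {-a..a} (%u. \<kappa>) + integral {-a..a} (%u. (norm (dpoly_diff S g (T + u)))\<^sup>2 / \<kappa>)"
  by (rule integral_add) (use \<kappa> in \<open>auto intro!: integrable_continuous_interval continuous_intros\<close>)
 also have "... = \<kappa> * (2 * a) + integral {-a..a} (%u. (norm (dpoly_diff S g (T + u)))\<^sup>2) / \<kappa>"
  using at t by simp
 finally have "norm (dpoly S g id (T + t)) <= norm (dpoly S g id (T - a)) + (\<kappa> * (2 * a) + integral {-a..a} (%u. (norm (dpoly_diff S g (T + u)))\<^sup>2) / \<kappa>)"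
  unfolding e[symmetric] using norm_triangle_sub[of "dpoly S g id (T + t)" "dpoly S g id (T - a)"] by linarith
 then show ?thesis using sq[of "norm (dpoly S g id (T - a))"]
  by (simp add: energy_def add_divide_distrib distrib_left)
qed

text \<open>A shift of T multiplies g k by a number of modulus 1 and differentiation multiplies it
  by ln k up to modulus 1, so the assumption \<open>R\<close>, made for all coefficients dominated
  by (1 + ln k) |g k|, covers both parts; for the second the order of integration is
  exchanged.\<close>

lemma energy_mean:
 fixes w :: "real => real"
 assumes w: "continuous_on {Y..Z} w" and a: "a >= 0"
  and R: "\<And>h. (\<And>k. k \<in> S ==> norm (h k) <= (1 + ln (real k)) * norm (g k)) ==>
    integral {Y..Z} (%T. w T * (norm (dpoly S h id T))\<^sup>2) <= R"
  and S: "0 \<notin> S"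
 shows "integral {Y..Z} (%T. w T * energy S g a T) <= (1 + 2 * a) * R"
proof -
 have l0: "0 <= ln (real k)" if "k \<in> S" for k using that S by (cases "k = 0") auto
 have 1: "integral {Y..Z} (%T. w T * (norm (dpoly S g id (T - a)))\<^sup>2) <= R"
  using dpoly_shift[of S g _ "- a"] l0
  by (simp only: diff_conv_add_uminus) (intro R; simp add: norm_mult mult_left_le_one_le algebra_simps)
 have 2: "integral {Y..Z} (%T. w T * (norm (dpoly_diff S g (T + u)))\<^sup>2) <= R" for u
  unfolding dpoly_diff_def dpoly_shift
  by (rule R) (use l0 in \<open>auto simp: norm_mult intro!: mult_right_mono\<close>)
 let ?F = "%T u. w T * (norm (dpoly_diff S g (T + u)))\<^sup>2"
 have cont: "continuous_on (cbox (Y, -a) (Z, a)) (%(T, u). ?F T u)"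
  unfolding case_prod_beta
  by (intro continuous_intros continuous_on_compose2[OF w]) auto
 have "integral {Y..Z} (%T. w T * integral {-a..a} (%u. (norm (dpoly_diff S g (T + u)))\<^sup>2)) = integral (cbox Y Z) (%T. integral (cbox (-a) a) (?F T))"
  by simp
 also have "... = integral (cbox (-a) a) (%u. integral (cbox Y Z) (%T. ?F T u))"
  by (rule integral_swap_continuous[OF cont])
 also have "... <= integral (cbox (-a) a) (%u. R)"
 proof (rule integral_le)
  have "continuous_on (cbox (-a) a \<times> cbox Y Z) (%(u, T). ?F T u)"
   unfolding case_prod_beta
   by (intro continuous_intros continuous_on_compose2[OF w]) auto
  then have "continuous_on (cbox (-a) a) (%u. integral (cbox Y Z) (%T. ?F T u))"
   by (rule integral_continuous_on_param)
  then show "(%u. integral (cbox Y Z) (%T. ?F T u)) integrable_on cbox (-a) a"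
   by (rule integrable_continuous)
 qed (use 2 in auto)
 also have "... = 2 * a * R" using a by simp
 finally have 3: "integral {Y..Z} (%T. w T * integral {-a..a} (%u. (norm (dpoly_diff S g (T + u)))\<^sup>2)) <= 2 * a * R" .
 have "integral {Y..Z} (%T. w T * energy S g a T) = integral {Y..Z} (%T. w T * (norm (dpoly S g id (T - a)))\<^sup>2) +
   integral {Y..Z} (%T. w T * integral {-a..a} (%u. (norm (dpoly_diff S g (T + u)))\<^sup>2))"
  unfolding energy_def distrib_left
  by (intro integral_add integrable_continuous_interval continuous_on_mult w continuous_on_dpoly_diff_integral continuous_intros)
 then show ?thesis using 1 3 by (simp add: distrib_right)
qed

lemma sign_weight_continuous [continuous_intros]: "continuous_on A (sign_weight P \<epsilon> B s)"
 unfolding sign_weight_def[abs_def] cis_conv_exp by (intro continuous_intros)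

text \<open>The factor 1 + ln k anticipates the differentiation in \<open>energy_mean\<close>; the
  squares remain summable.\<close>

lemma log_square_sum_tail:
 obtains \<tau> :: "nat => real" where "\<tau> \<longlonglongrightarrow> 0"
  "\<And>n S. finite S ==> S \<subseteq> {n<..} ==> (\<Sum>k\<in>S. ((1 + ln (real k)) / real k)\<^sup>2) <= \<tau> n"
proof -
 define f where "f k = ((1 + ln (real k)) / real k)\<^sup>2" for k
 have "\<forall>\<^sub>F k in sequentially. f k <= real k powr (-(3/2))"
  unfolding f_def by real_asymp
 then have "\<forall>\<^sub>F k in sequentially. norm (f k) <= real k powr (-(3/2))"
  by (simp add: f_def)
 then have sf: "summable f"
  by (rule summable_comparison_test_ev) (simp add: summable_real_powr_iff)
 define \<tau> where "\<tau> n = suminf f - (\<Sum>k<Suc n. f k)" for n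
 have "(%n. \<Sum>k<Suc n. f k) \<longlonglongrightarrow> suminf f"
  using summable_LIMSEQ[OF sf] by (rule LIMSEQ_Suc)
 then have "\<tau> \<longlonglongrightarrow> suminf f - suminf f" unfolding \<tau>_def by (intro tendsto_diff tendsto_const)
 moreover have "sum f S <= \<tau> n" if "finite S" "S \<subseteq> {n<..}" for n S
 proof -
  have "sum f (S \<union> {..<Suc n}) <= suminf f" using that by (intro sum_le_suminf[OF sf]) (auto simp: f_def)
  moreover have "sum f (S \<union> {..<Suc n}) = sum f S + sum f {..<Suc n}"
   using that by (intro sum.union_disjoint) auto
  ultimately show ?thesis by (simp add: \<tau>_def)
 qed
 ultimately show ?thesis using that[of \<tau>] by (simp add: f_def)
qed

lemma harm_le_ln: "n >= 1 ==> harm n <= 1 + ln (real n)"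
proof (induction n rule: dec_induct)
 case base
 then show ?case by (simp add: harm_expand)
next
 case (step n)
 have n: "real n > 0" using step by simp
 have "ln (real n / real (Suc n)) <= real n / real (Suc n) - 1" by (rule ln_le_minus_one) (use n in auto)
 moreover have "ln (real n / real (Suc n)) = ln (real n) - ln (real (Suc n))" using n by (intro ln_divide_pos) auto
 moreover have "real n / real (Suc n) - 1 = - inverse (real (Suc n))" using n by (simp add: field_simps)
 ultimately show ?case using step.IH unfolding harm_Suc by linarith
qed

lemma rough_gt:
 assumes "rough (primes_le N) k" "k >= 2"
 shows "k > N"
proof -
 obtain q where q: "prime q" "q dvd k" using prime_factor_nat[of k] assms by auto
 have "q \<notin> primes_le N" using q assms by (auto simp: rough_def)
 then have "q > N" using q by (auto simp: primes_le_def)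
 moreover have "q <= k" using q assms by (intro dvd_imp_le) auto
 ultimately show ?thesis by simp
qed

text \<open>For \<tau> of size y, truncating zeta at y^2 leaves an error O(1 / y): the remainder is
  of order |s| / y^2 and the integral term has modulus 1 / \<tau>. After multiplication by the short
  product the sum splits into the rough part up to y^2 and the part beyond, where the sieve is
  spoiled.\<close>

lemma zeta_short_product:
 assumes N: "N >= 1" and y: "y >= 1"
 obtains g :: "nat => complex" where
  "\<And>k. norm (g k) <= 2 ^ card (primes_le N) / real k"
  "\<And>k. k \<in> {1..y\<^sup>2} ==> norm (g k) <= 1 / real k"
  "\<And>\<tau>. real y / 2 <= \<tau> ==> \<tau> <= 3 * real y ==>
   norm (zeta (1 + \<i> * of_real \<tau>) * (\<Prod>p\<in>primes_le N. 1 - of_nat p powr (- (1 + \<i> * of_real \<tau>))) - 1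
     - (dpoly {k\<in>{2..y\<^sup>2}. rough (primes_le N) k} g id \<tau> + dpoly {y\<^sup>2<..y\<^sup>2 * \<Prod>(primes_le N)} g id \<tau>))
   <= 2 ^ card (primes_le N) * (10 / real y)"
proof -
 let ?P = "primes_le N"
 define X where "X = y\<^sup>2"
 define Z where "Z = X * \<Prod>?P"
 have pr: "\<And>p. p \<in> ?P ==> prime p" by (simp add: primes_le_def)
 have "\<exists>b :: nat => real. (\<forall>k. \<bar>b k\<bar> <= 2 ^ card ?P) & (\<forall>k\<in>{1..X}. b k = (if rough ?P k then 1 else 0)) &
   (\<forall>s::complex. (\<Sum>n=1..X. of_nat n powr (-s)) * (\<Prod>p\<in>?P. 1 - of_nat p powr (-s)) = (\<Sum>k=1..Z. of_real (b k) * of_nat k powr (-s)))"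
  unfolding Z_def by (rule rough_coefficients[OF finite_primes_le]) (rule pr)
 then obtain b :: "nat => real" where b': "(\<forall>k. \<bar>b k\<bar> <= 2 ^ card ?P) & (\<forall>k\<in>{1..X}. b k = (if rough ?P k then 1 else 0)) &
   (\<forall>s::complex. (\<Sum>n=1..X. of_nat n powr (-s)) * (\<Prod>p\<in>?P. 1 - of_nat p powr (-s)) = (\<Sum>k=1..Z. of_real (b k) * of_nat k powr (-s)))" ..
 note b = b'[THEN conjunct1, rule_format] b'[THEN conjunct2, THEN conjunct1, rule_format] b'[THEN conjunct2, THEN conjunct2, rule_format]
 define g where "g k = complex_of_real (b k / real k)" for k
 have ng: "norm (g k) = \<bar>b k\<bar> / real k" for k by (simp add: g_def norm_divide)
 show ?thesis
 proof (rule that[of g])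
  show "norm (g k) <= 2 ^ card ?P / real k" for k unfolding ng using b(1) by (intro divide_right_mono) auto
  show "norm (g k) <= 1 / real k" if "k \<in> {1..y\<^sup>2}" for k
   unfolding ng using b(2)[of k] that by (intro divide_right_mono) (auto simp: X_def)
  fix \<tau> assume \<tau>: "real y / 2 <= \<tau>" "\<tau> <= 3 * real y"
  have \<tau>0: "\<tau> > 0" using \<tau>(1) y by linarith
  define s where "s = 1 + \<i> * of_real \<tau>"
  have s: "Re s = 1" "s ~= 1" "s - 1 = \<i> * of_real \<tau>" using \<tau>0 by (auto simp: s_def complex_eq_iff)
  have ns: "norm s <= 4 * real y"
  proof -
   have "norm s <= 1 + \<tau>" using norm_triangle_ineq[of 1 "\<i> * of_real \<tau>"] \<tau>0 by (simp add: s_def norm_mult)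
   then show ?thesis using \<tau> y by linarith
  qed
  have X1: "real X + 1 > 0" "real (X + 1) = real X + 1" by auto
  have X2: "real (X + 1) >= real y * real y" by (simp add: X_def power2_eq_square)
  define U where "U = (\<Sum>n=1..X. of_nat n powr (-s))"
  define Pr where "Pr = (\<Prod>p\<in>?P. 1 - of_nat p powr (-s))"
  have "norm (zeta s - U - of_nat (X + 1) powr (1 - s) / (s - 1)) <= norm s * (1 + 1 / Re s) * real (X + 1) powr (- Re s)"
   using zeta_approx[of "X + 1" s] s unfolding U_def atLeastLessThanSuc_atLeastAtMost[symmetric] by simp
  also have "... = norm s * 2 / real (X + 1)" using s by (simp add: powr_minus divide_inverse)
  also have "... <= (4 * real y) * 2 / (real y * real y)"
   using ns X2 y by (intro frac_le mult_right_mono) auto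
  also have "... = 8 / real y" using y by simp
  finally have z1: "norm (zeta s - U - of_nat (X + 1) powr (1 - s) / (s - 1)) <= 8 / real y" .
  have n1: "norm (of_nat (X + 1) powr (1 - s) :: complex) = 1"
   using norm_nat_powr[of "X + 1" "1 - s"] s by simp
  have "norm (of_nat (X + 1) powr (1 - s) / (s - 1)) = 1 / \<tau>"
   unfolding norm_divide n1 s(3) using \<tau>0 by (simp add: norm_mult)
  also have "... <= 1 / (real y / 2)" using \<tau> y by (intro divide_left_mono) auto
  finally have z2: "norm (of_nat (X + 1) powr (1 - s) / (s - 1)) <= 2 / real y" by simp
  have zU: "norm (zeta s - U) <= 10 / real y"
   using norm_triangle_ineq[of "zeta s - U - of_nat (X + 1) powr (1 - s) / (s - 1)" "of_nat (X + 1) powr (1 - s) / (s - 1)"] z1 z2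
   by simp
  have nPr: "norm Pr <= 2 ^ card ?P"
  proof -
   have "norm (1 - of_nat p powr (-s) :: complex) <= 2" if "p \<in> ?P" for p
   proof -
    have p1: "real p >= 1" using prime_ge_1_nat[OF pr[OF that]] by simp
    have "norm (of_nat p powr (-s) :: complex) = inverse (real p)"
     using s p1 by (subst norm_nat_powr) (auto simp: powr_minus)
    also have "... <= 1" using p1 by (simp add: inverse_le_1_iff)
    finally show ?thesis using norm_triangle_ineq4[of 1 "of_nat p powr (-s) :: complex"] by simp
   qed
   then have "norm Pr <= (\<Prod>p\<in>?P. 2)" unfolding Pr_def prod_norm[symmetric] by (intro prod_mono) auto
   then show ?thesis by simp
  qed
  have gk: "of_real (b k) * of_nat k powr (-s) = g k * cis (- \<tau> * ln (real k))" if "k >= 1" for k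
  proof -
   have "(of_nat k :: complex) powr (-s) = exp (- s * of_real (ln (real k)))"
    using that by (simp add: powr_def Ln_of_nat)
   also have "- s * of_real (ln (real k)) = of_real (- ln (real k)) + \<i> * of_real (- \<tau> * ln (real k))"
    by (simp add: s_def algebra_simps)
   also have "exp ... = of_real (exp (- ln (real k))) * cis (- \<tau> * ln (real k))"
    unfolding exp_add cis_conv_exp exp_of_real ..
   also have "exp (- ln (real k)) = 1 / real k" using that by (simp add: exp_minus divide_inverse)
   finally show ?thesis by (simp add: g_def)
  qed
  have Q1: "\<Prod>?P >= 1" by (intro prod_ge_1) (rule prime_ge_1_nat[OF pr])
  have X1: "X >= 1" using y by (simp add: X_def)
  have XZ: "X <= Z" using mult_le_mono2[OF Q1, of X] by (simp add: Z_def)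
  have "U * Pr = (\<Sum>k=1..Z. g k * cis (- \<tau> * ln (real k)))"
   unfolding U_def Pr_def b(3) by (intro sum.cong refl gk) auto
  also have "... = g 1 * cis (- \<tau> * ln (real 1)) + ((\<Sum>k=2..X. g k * cis (- \<tau> * ln (real k))) + (\<Sum>k\<in>{X<..Z}. g k * cis (- \<tau> * ln (real k))))"
  proof -
   have "{1..Z} = insert 1 ({2..X} \<union> {X<..Z})" using X1 XZ by auto
   then have "(\<Sum>k=1..Z. g k * cis (- \<tau> * ln (real k))) = (\<Sum>k\<in>insert 1 ({2..X} \<union> {X<..Z}). g k * cis (- \<tau> * ln (real k)))"
    by (simp only:)
   also have "... = g 1 * cis (- \<tau> * ln (real 1)) + (\<Sum>k\<in>{2..X} \<union> {X<..Z}. g k * cis (- \<tau> * ln (real k)))"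
    using X1 by (intro sum.insert) auto
   also have "(\<Sum>k\<in>{2..X} \<union> {X<..Z}. g k * cis (- \<tau> * ln (real k))) = (\<Sum>k=2..X. g k * cis (- \<tau> * ln (real k))) + (\<Sum>k\<in>{X<..Z}. g k * cis (- \<tau> * ln (real k)))"
    by (intro sum.union_disjoint) auto
   finally show ?thesis .
  qed
  also have "g 1 * cis (- \<tau> * ln (real 1)) = 1"
   using b(2)[of 1] X1 pr[of 1] by (auto simp: g_def rough_def)
  also have "(\<Sum>k=2..X. g k * cis (- \<tau> * ln (real k))) = dpoly {k\<in>{2..X}. rough ?P k} g id \<tau>"
   unfolding dpoly_def by (rule sum.mono_neutral_cong_right) (use b(2) in \<open>auto simp: g_def\<close>)
  also have "(\<Sum>k\<in>{X<..Z}. g k * cis (- \<tau> * ln (real k))) = dpoly {X<..Z} g id \<tau>"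
   unfolding dpoly_def by simp
  finally have UP: "U * Pr = 1 + (dpoly {k\<in>{2..X}. rough ?P k} g id \<tau> + dpoly {X<..Z} g id \<tau>)" .
  have "zeta s * Pr - 1 - (dpoly {k\<in>{2..X}. rough ?P k} g id \<tau> + dpoly {X<..Z} g id \<tau>) = Pr * (zeta s - U)"
   using UP by (simp add: algebra_simps)
  moreover have "norm (Pr * (zeta s - U)) <= 2 ^ card ?P * (10 / real y)"
   unfolding norm_mult using nPr zU by (intro mult_mono) auto
  ultimately show "norm (zeta (1 + \<i> * of_real \<tau>) * (\<Prod>p\<in>primes_le N. 1 - of_nat p powr (- (1 + \<i> * of_real \<tau>))) - 1
     - (dpoly {k\<in>{2..y\<^sup>2}. rough (primes_le N) k} g id \<tau> + dpoly {y\<^sup>2<..y\<^sup>2 * \<Prod>(primes_le N)} g id \<tau>))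
   <= 2 ^ card (primes_le N) * (10 / real y)"
   unfolding s_def[symmetric] Pr_def[symmetric] X_def[symmetric] Z_def[symmetric] by simp
 qed
qed

section \<open>Existence of heights with prescribed signs\<close>

text \<open>The geometric sum at q collapses: (1 - x)(1 + ... + x^m) = 1 - x^(m+1). The number of
  terms drops from m + 1 to 2, so in the weighted mean |1 - \<epsilon> q * q^(-iT)|^2 is about 2 /
  (m + 1).\<close>

lemma sign_weight_defect:
 assumes P: "finite P" "q \<in> P"
 shows "sign_weight P \<epsilon> (%_. {..m}) (%_ _. 1) T * (1 - of_real (\<epsilon> q) * cis (- T * ln (real q))) =
  sign_weight P \<epsilon> ((%_. {..m})(q := {0, Suc m})) (%p j. if p = q & j = Suc m then -1 else 1) T"
proof -
 define z where "z p = of_real (\<epsilon> p) * cis (- T * ln (real p))" for p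
 have rest: "(\<Prod>p\<in>P - {q}. \<Sum>j\<in>((%_. {..m})(q := {0, Suc m})) p. of_real (if p = q & j = Suc m then -1 else 1) * z p ^ j) =
   (\<Prod>p\<in>P - {q}. \<Sum>j\<in>{..m}. of_real 1 * z p ^ j)"
  by (intro prod.cong) auto
 have fq: "(\<Sum>j\<in>((%_. {..m})(q := {0, Suc m})) q. of_real (if q = q & j = Suc m then -1 else 1) * z q ^ j) = (1 - z q) * (\<Sum>j\<in>{..m}. z q ^ j)"
  unfolding sum_gp_basic by simp
 show ?thesis
  unfolding sign_weight_def z_def[symmetric] prod.remove[OF P] rest fq by (simp only: of_real_1 mult_1 mult_ac)
qed

lemma norm_sign_weight_le:
 assumes "\<And>p. \<bar>\<epsilon> p\<bar> = 1"
 shows "norm (sign_weight P \<epsilon> (%_. {..m}) (%_ _. 1) T) <= real (Suc m) ^ card P"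
proof -
 have "norm (\<Sum>j\<in>{..m}. of_real 1 * (of_real (\<epsilon> p) * cis (- T * ln (real p))) ^ j) <= real (Suc m)" for p
  using norm_sum[of "%j. of_real 1 * (of_real (\<epsilon> p) * cis (- T * ln (real p))) ^ j" "{..m}"] assms
  by (simp add: norm_mult norm_power)
 then have "norm (sign_weight P \<epsilon> (%_. {..m}) (%_ _. 1) T) <= (\<Prod>p\<in>P. real (Suc m))"
  unfolding sign_weight_def prod_norm[symmetric] by (intro prod_mono) auto
 then show ?thesis by simp
qed

text \<open>A first moment argument over T in [y, 2y]: if the weighted mean of a nonnegative defect
  is below the mean of the weight, some T has defect below 1. The rough part starts beyond N, so N0
  depends only on a and \<eta>; m is then taken large in terms of \<open>\<eta>'\<close> and N, and
  y large in terms of all the rest.\<close>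

theorem zeta_resembles_signed_product:
 fixes a \<eta> :: real
 assumes a: "0 < a" and \<eta>: "0 < \<eta>"
 shows "\<exists>N0. \<forall>N\<ge>N0. \<forall>\<epsilon> :: nat => real. (\<forall>p. \<bar>\<epsilon> p\<bar> = 1) --> (\<forall>\<eta>'>0. \<forall>T0. \<exists>T\<ge>T0.
   (\<forall>p\<in>primes_le N. norm (cis (- T * ln (real p)) - of_real (\<epsilon> p)) <= \<eta>') &
   (\<forall>t. \<bar>t\<bar> <= a --> norm (zeta (1 + \<i> * of_real (T + t)) * (\<Prod>p\<in>primes_le N. 1 - of_nat p powr (- (1 + \<i> * of_real (T + t)))) - 1) <= \<eta>))"
proof -
 obtain \<tau> :: "nat => real" where \<tau>: "\<tau> \<longlonglongrightarrow> 0"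
  "\<And>n S. finite S ==> S \<subseteq> {n<..} ==> (\<Sum>k\<in>S. ((1 + ln (real k)) / real k)\<^sup>2) <= \<tau> n"
  by (rule log_square_sum_tail, rule that, assumption+)
 \<comment> \<open>With these values the two terms \<kappa> (1 + 2 a) add up to \<eta> / 8, and K1
   times the energies being below 1 bounds the energy terms by another \<eta> / 8. This fits into
   \<eta> / 2; the other half is reserved for the truncation error of zeta.\<close>
 define \<kappa> where "\<kappa> = \<eta> / (16 * (1 + 2 * a))"
 define A where "A = 8 / (\<kappa> * \<eta>) * (1 + 2 * a)"
 define K1 where "K1 = 8 / (\<kappa> * \<eta>)"
 have \<kappa>: "\<kappa> > 0" using a \<eta> by (simp add: \<kappa>_def)
 have K1: "K1 > 0" using \<kappa> \<eta> by (simp add: K1_def)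
 have A: "A = K1 * (1 + 2 * a)" "A > 0" using K1 a by (auto simp: A_def K1_def)
 have "\<forall>\<^sub>F N in sequentially. \<tau> N < 1 / (4 * A)" using \<tau>(1) A by (intro order_tendstoD(2)) auto
 then obtain N0 where N0: "\<And>N. N >= N0 ==> \<tau> N < 1 / (4 * A)" by (auto simp: eventually_sequentially)
 show ?thesis
 proof (intro exI[of _ "max N0 1"] allI impI)
  fix N :: nat and \<epsilon> :: "nat => real" and \<eta>' T0 :: real
  assume N: "max N0 1 <= N" and \<epsilon>: "\<forall>p. \<bar>\<epsilon> p\<bar> = 1" and \<eta>': "0 < \<eta>'"
  define P where "P = primes_le N"
  define r where "r = card P"
  have P: "finite P" "\<And>p. p \<in> P ==> prime p" unfolding P_def by (auto simp: finite_primes_le primes_le_def)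
  \<comment> \<open>Makes the sign defects of all r primes cost at most a quarter: (r /
    \<open>\<eta>'\<close>^2) * 2 / (m + 1) <= 1/4.\<close>
  obtain m :: nat where m: "8 * real r / \<eta>'\<^sup>2 <= real m" using real_arch_simple by blast
  define M where "M = real (Suc m) ^ r"
  have M1: "M >= 1" unfolding M_def by (intro one_le_power) auto
  define Q where "Q = \<Prod>P"
  have Q1: "Q >= 1" unfolding Q_def by (intro prod_ge_1) (rule prime_ge_1_nat[OF P(2)])
  define d where "d = Q ^ Suc m"
  have d1: "d >= 1" unfolding d_def using Q1 by (intro one_le_power)
  define L where "L y = 1 + ln (real (d * Q) * (real y)\<^sup>2)" for y :: nat
  define lam where "lam y = L y ^ 4 / real y" for y
  \<comment> \<open>All errors, relative to y, that vanish as y grows with N and m fixed: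
    off-diagonal terms through \<open>lam\<close> and the tail beyond y^2 through
    \<open>\<tau>\<close>.\<close>
  define E where "E y = A * (8 * (real d)\<^sup>2 * lam y + M\<^sup>2 * 4 ^ r * \<tau> (y\<^sup>2) + 8 * M\<^sup>2 * 4 ^ r * lam y) +
    real r / \<eta>'\<^sup>2 * (8 * (real d)\<^sup>2 * lam y) + 8 * (real d)\<^sup>2 * lam y" for y
  have lam0: "lam \<longlonglongrightarrow> 0"
  proof -
   have "real (d * Q) > 0" using d1 Q1 by simp
   then show ?thesis unfolding lam_def L_def by real_asymp
  qed
  have sqlim: "filterlim (%y::nat. y\<^sup>2) sequentially sequentially"
   by (rule filterlim_at_top_mono[OF filterlim_ident]) (auto simp: power2_eq_square intro!: always_eventually)
  have \<tau>0: "(%y. \<tau> (y\<^sup>2)) \<longlonglongrightarrow> 0" by (rule filterlim_compose[OF \<tau>(1) sqlim])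
  have "E \<longlonglongrightarrow> A * (8 * (real d)\<^sup>2 * 0 + M\<^sup>2 * 4 ^ r * 0 + 8 * M\<^sup>2 * 4 ^ r * 0) +
    real r / \<eta>'\<^sup>2 * (8 * (real d)\<^sup>2 * 0) + 8 * (real d)\<^sup>2 * 0"
   unfolding E_def by (intro tendsto_add tendsto_mult tendsto_const lam0 \<tau>0)
  then have "E \<longlonglongrightarrow> 0" by simp
  then have "\<forall>\<^sub>F y in sequentially. E y < 1 / 4" by (rule order_tendstoD(2)) simp
  moreover have "(%y. 2 ^ r * (10 / real y)) \<longlonglongrightarrow> 0" by real_asymp
  then have "\<forall>\<^sub>F y in sequentially. 2 ^ r * (10 / real y) < \<eta> / 2" by (rule order_tendstoD(2)) (use \<eta> in simp)
  moreover have "\<forall>\<^sub>F y in sequentially. real y >= max T0 (max 1 (2 * a))"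
   by (rule filterlim_real_sequentially[unfolded filterlim_at_top, rule_format])
  ultimately have "\<forall>\<^sub>F y in sequentially. E y < 1 / 4 & 2 ^ r * (10 / real y) < \<eta> / 2 & real y >= max T0 (max 1 (2 * a))"
   by eventually_elim auto
  then obtain y :: nat where y: "E y < 1 / 4" "2 ^ r * (10 / real y) < \<eta> / 2" "real y >= T0" "real y >= 1" "real y >= 2 * a"
   by (auto simp: eventually_sequentially)
  have y1: "y >= 1" using y(4) by simp
  have y0: "0 <= real y" by simp
  have N1: "N >= 1" using N by simp
  obtain g :: "nat => complex" where g: "\<And>k. norm (g k) <= 2 ^ r / real k"
   "\<And>k. k \<in> {1..y\<^sup>2} ==> norm (g k) <= 1 / real k"
   "\<And>\<tau>. real y / 2 <= \<tau> ==> \<tau> <= 3 * real y ==>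
    norm (zeta (1 + \<i> * of_real \<tau>) * (\<Prod>p\<in>P. 1 - of_nat p powr (- (1 + \<i> * of_real \<tau>))) - 1
      - (dpoly {k\<in>{2..y\<^sup>2}. rough P k} g id \<tau> + dpoly {y\<^sup>2<..y\<^sup>2 * Q} g id \<tau>)) <= 2 ^ r * (10 / real y)"
   by (rule zeta_short_product[OF N1 y1, folded P_def, folded r_def Q_def], rule that, assumption+)
  define X where "X = y\<^sup>2"
  define Z where "Z = X * Q"
  define S1 where "S1 = {k\<in>{2..X}. rough P k}"
  define S2 where "S2 = {X<..Z}"
  define sw where "sw = sign_weight P \<epsilon> (%_. {..m}) (%_ _. 1)"
  define w where "w T = (norm (sw T))\<^sup>2" for T
  define z where "z q T = (norm (1 - of_real (\<epsilon> q) * cis (- T * ln (real q))))\<^sup>2" for q T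
  define \<Lambda> where "\<Lambda> = L y"
  have wcont: "continuous_on B w" for B
   unfolding w_def sw_def by (intro continuous_intros)
  have zcont: "continuous_on B (z q)" for B q
   unfolding z_def cis_conv_exp by (intro continuous_intros)
  have w0: "0 <= w T" for T by (simp add: w_def)
  have wM: "w T <= M\<^sup>2" for T
   unfolding w_def sw_def M_def r_def using \<epsilon> by (intro power_mono norm_sign_weight_le) auto
  have X1: "X >= 1" using y1 by (simp add: X_def)
  have logs: "1 + ln (real n) <= \<Lambda>" "harm n <= \<Lambda>" if "1 <= n" "n <= d * Q * X" for n
  proof -
   have "real n <= real (d * Q * X)" using that by (simp only: of_nat_le_iff)
   also have "... = real (d * Q) * (real y)\<^sup>2" by (simp add: X_def)
   finally show "1 + ln (real n) <= \<Lambda>" using that by (simp add: \<Lambda>_def L_def)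
   then show "harm n <= \<Lambda>" using harm_le_ln[OF that(1)] by linarith
  qed
  have big: "d * X <= d * Q * X" "Z <= d * Q * X" "d <= d * Q * X" "X <= d * Q * X" "1 <= d * Q * X" "1 <= d * X" "1 <= Z"
   using d1 Q1 X1 by (auto simp: Z_def mult_ac Suc_le_eq)
  have \<Lambda>1: "\<Lambda> >= 1" using logs(1)[of 1] big by simp
  have sq4: "(c * x)\<^sup>2 * h\<^sup>2 <= c\<^sup>2 * \<Lambda> ^ 4" if "0 <= x" "x <= \<Lambda>" "0 <= h" "h <= \<Lambda>" for c x h :: real
  proof -
   have "x\<^sup>2 * h\<^sup>2 <= \<Lambda>\<^sup>2 * \<Lambda>\<^sup>2" using that by (intro mult_mono power_mono) auto
   then have "c\<^sup>2 * (x\<^sup>2 * h\<^sup>2) <= c\<^sup>2 * (\<Lambda>\<^sup>2 * \<Lambda>\<^sup>2)" by (intro mult_left_mono) auto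
   then show ?thesis by (simp add: power_mult_distrib mult.assoc flip: power_add)
  qed
  have dbound: "(\<Prod>p\<in>P. p ^ e p) <= d" if "\<And>p. p \<in> P ==> e p <= Suc m" for e
  proof -
   have "(\<Prod>p\<in>P. p ^ e p) <= (\<Prod>p\<in>P. p ^ Suc m)"
    using that prime_ge_1_nat[OF P(2)] by (intro prod_mono conjI power_increasing) auto
   also have "... = d" by (simp only: d_def Q_def prod_power_distrib)
   finally show ?thesis .
  qed
  have dPiE: "(\<Prod>p\<in>P. p ^ e p) <= d" if "e \<in> PiE P (%_. {..m})" for e
  proof (rule dbound)
   fix p assume "p \<in> P"
   from PiE_mem[OF that this] show "e p <= Suc m" by simp
  qed
  have dp1: "dpoly {1} (%_. 1) id T = 1" for T by (simp add: dpoly_def)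
  have r1: "{1} \<subseteq> {k. rough P k}" using P(2)[of 1] by (auto simp: rough_def)
  have Wlow: "integral {real y..2 * real y} w >= real y * M - 8 * (real d)\<^sup>2 * \<Lambda> ^ 4"
  proof -
   have "\<bar>integral {real y..2 * real y} (%T. (norm (sw T * dpoly {1} (%_. 1) id T))\<^sup>2) - real y * (real (\<Prod>p\<in>P. card {..m}) * (\<Sum>k\<in>{1::nat}. (norm (1::complex))\<^sup>2))\<bar>
     <= 8 * (real d * 1)\<^sup>2 * (harm (d * 1))\<^sup>2"
    unfolding sw_def
    by (rule sign_weight_mean[OF P, where s = "%_ _. 1"]) (use \<epsilon> r1 in \<open>auto intro: dPiE\<close>)
   then have "\<bar>integral {real y..2 * real y} w - real y * M\<bar> <= 8 * ((real d * 1)\<^sup>2 * (harm d)\<^sup>2)"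
    unfolding dp1 by (simp add: w_def[abs_def] M_def r_def del: of_nat_Suc)
   also have "... <= 8 * ((real d)\<^sup>2 * \<Lambda> ^ 4)"
    using \<Lambda>1 logs(2)[OF d1 big(3)] by (intro mult_left_mono sq4) (auto simp: harm_nonneg)
   finally show ?thesis by linarith
  qed
  have Zup: "integral {real y..2 * real y} (%T. w T * z q T) <= real y * (2 * M / real (Suc m)) + 8 * (real d)\<^sup>2 * \<Lambda> ^ 4" if q: "q \<in> P" for q
  proof -
   let ?B = "(%_. {..m})(q := {0, Suc m})" and ?s = "%p j. if p = q & j = Suc m then -1 else (1::real)"
   have "\<bar>integral {real y..2 * real y} (%T. (norm (sign_weight P \<epsilon> ?B ?s T * dpoly {1} (%_. 1) id T))\<^sup>2) - real y * (real (\<Prod>p\<in>P. card (?B p)) * (\<Sum>k\<in>{1::nat}. (norm (1::complex))\<^sup>2))\<bar>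
     <= 8 * (real d * 1)\<^sup>2 * (harm (d * 1))\<^sup>2"
   proof (rule sign_weight_mean[OF P])
    fix e assume e: "e \<in> PiE P ?B"
    show "(\<Prod>p\<in>P. p ^ e p) <= d"
    proof (rule dbound)
     fix p assume "p \<in> P"
     then have "e p \<in> ?B p" using e by (rule PiE_mem[rotated])
     then show "e p <= Suc m" by (auto split: if_splits)
    qed
   qed (use \<epsilon> r1 in auto)
   moreover have "(%T. (norm (sign_weight P \<epsilon> ?B ?s T * dpoly {1} (%_. 1) id T))\<^sup>2) = (%T. w T * z q T)"
    unfolding dp1 mult_1_right sign_weight_defect[OF P(1) q, symmetric]
    by (simp add: w_def z_def sw_def norm_mult power_mult_distrib)
   moreover have "real (\<Prod>p\<in>P. card (?B p)) * (\<Sum>k\<in>{1::nat}. (norm (1::complex))\<^sup>2) = 2 * M / real (Suc m)"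
   proof -
    have "(\<Prod>p\<in>P. card (?B p)) = card (?B q) * (\<Prod>p\<in>P - {q}. card (?B p))" by (rule prod.remove[OF P(1) q])
    also have "(\<Prod>p\<in>P - {q}. card (?B p)) = (\<Prod>p\<in>P - {q}. Suc m)" by (intro prod.cong) auto
    finally have "(\<Prod>p\<in>P. card (?B p)) = 2 * Suc m ^ (r - 1)" using P(1) q by (simp add: r_def)
    moreover have "r > 0" using P(1) q by (auto simp: r_def card_gt_0_iff)
    then have "M = real (Suc m) * real (Suc m) ^ (r - 1)" unfolding M_def by (cases r) auto
    ultimately show ?thesis by simp
   qed
   ultimately have "\<bar>integral {real y..2 * real y} (%T. w T * z q T) - real y * (2 * M / real (Suc m))\<bar> <= 8 * ((real d * 1)\<^sup>2 * (harm d)\<^sup>2)"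
    by (simp only: mult.assoc mult_1_right)
   also have "... <= 8 * ((real d)\<^sup>2 * \<Lambda> ^ 4)"
    using \<Lambda>1 logs(2)[OF d1 big(3)] by (intro mult_left_mono sq4) (auto simp: harm_nonneg)
   finally show ?thesis by linarith
  qed
  have S1: "finite S1" "S1 \<subseteq> {k. rough P k}" "0 \<notin> S1" "S1 \<subseteq> {N<..}"
   unfolding S1_def P_def using rough_gt by auto
  have S1X: "k <= X" if "k \<in> S1" for k using that by (simp add: S1_def)
  have E1: "integral {real y..2 * real y} (%T. w T * energy S1 g a T) <= (1 + 2 * a) * (real y * M * \<tau> N + 8 * (real d)\<^sup>2 * \<Lambda> ^ 4)"
  proof (rule energy_mean[OF wcont less_imp_le[OF a] _ S1(3)])
   fix h :: "nat => complex" assume h: "\<And>k. k \<in> S1 ==> norm (h k) <= (1 + ln (real k)) * norm (g k)"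
   have h1: "norm (h k) <= (1 + ln (real k)) / real k" if k: "k \<in> S1" for k
   proof -
    have "(1 + ln (real k)) * norm (g k) <= (1 + ln (real k)) * (1 / real k)"
     using k by (intro mult_left_mono g(2)) (auto simp: S1_def X_def)
    then show ?thesis using h[OF k] by simp
   qed
   have h2: "norm (h k) <= \<Lambda> / real k" if k: "k \<in> S1" for k
   proof -
    have "1 <= k" using k by (simp add: S1_def)
    then have "1 + ln (real k) <= \<Lambda>" by (rule logs(1)[OF _ order_trans[OF S1X[OF k] big(4)]])
    then show ?thesis using h1[OF k] by (meson divide_right_mono of_nat_0_le_iff order_trans)
   qed
   have "\<bar>integral {real y..2 * real y} (%T. (norm (sw T * dpoly S1 h id T))\<^sup>2) - real y * (real (\<Prod>p\<in>P. card {..m}) * (\<Sum>k\<in>S1. (norm (h k))\<^sup>2))\<bar>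
     <= 8 * (real d * \<Lambda>)\<^sup>2 * (harm (d * X))\<^sup>2"
    unfolding sw_def
    by (rule sign_weight_mean[OF P, where s = "%_ _. 1"]) (use \<epsilon> S1 S1X h2 in \<open>auto intro: dPiE\<close>)
   then have "integral {real y..2 * real y} (%T. w T * (norm (dpoly S1 h id T))\<^sup>2) <= real y * (M * (\<Sum>k\<in>S1. (norm (h k))\<^sup>2)) + 8 * ((real d * \<Lambda>)\<^sup>2 * (harm (d * X))\<^sup>2)"
    by (simp add: w_def[abs_def] M_def r_def norm_mult power_mult_distrib del: of_nat_Suc)
   also have "... <= real y * (M * \<tau> N) + 8 * ((real d)\<^sup>2 * \<Lambda> ^ 4)"
   proof (intro add_mono mult_left_mono sq4)
    have "(\<Sum>k\<in>S1. (norm (h k))\<^sup>2) <= (\<Sum>k\<in>S1. ((1 + ln (real k)) / real k)\<^sup>2)"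
     by (intro sum_mono power_mono h1) auto
    also have "... <= \<tau> N" by (intro \<tau>(2) S1)
    finally show "(\<Sum>k\<in>S1. (norm (h k))\<^sup>2) <= \<tau> N" .
    show "harm (d * X) <= \<Lambda>" by (intro logs big)
   qed (use M1 \<Lambda>1 in \<open>auto simp: harm_nonneg\<close>)
   finally show "integral {real y..2 * real y} (%T. w T * (norm (dpoly S1 h id T))\<^sup>2) <= real y * M * \<tau> N + 8 * (real d)\<^sup>2 * \<Lambda> ^ 4"
    by (simp add: mult.assoc)
  qed
  have r4: "((2::real) ^ r)\<^sup>2 = 4 ^ r"
   by (simp only: power2_eq_square power_mult_distrib[symmetric]) simp
  have S2: "finite S2" "0 \<notin> S2" "S2 \<subseteq> {X<..}" unfolding S2_def by auto
  \<comment> \<open>Beyond y^2 the coefficients are not supported on rough numbers and the product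
    structure is lost. The pointwise bound w <= M^2 is enough, since the tail
    \<open>\<tau> X\<close> tends to 0 while M and r stay fixed.\<close>
  have E2: "integral {real y..2 * real y} (%T. w T * energy S2 g a T) <= (1 + 2 * a) * (M\<^sup>2 * (real y * (4 ^ r * \<tau> X) + 8 * (4 ^ r * \<Lambda> ^ 4)))"
  proof (rule energy_mean[OF wcont less_imp_le[OF a] _ S2(2)])
   fix h :: "nat => complex" assume h: "\<And>k. k \<in> S2 ==> norm (h k) <= (1 + ln (real k)) * norm (g k)"
   have h1: "norm (h k) <= 2 ^ r * ((1 + ln (real k)) / real k)" if k: "k \<in> S2" for k
   proof -
    have "(1 + ln (real k)) * norm (g k) <= (1 + ln (real k)) * (2 ^ r / real k)"
     using k by (intro mult_left_mono g(1)) (auto simp: S2_def)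
    then show ?thesis using h[OF k] by (simp add: mult_ac)
   qed
   have h2: "norm (h k) <= (2 ^ r * \<Lambda>) / real (id k)" if k: "k \<in> S2" for k
   proof -
    have kk: "1 <= k" "k <= Z" using k by (auto simp: S2_def)
    have "1 + ln (real k) <= \<Lambda>" by (rule logs(1)[OF kk(1) order_trans[OF kk(2) big(2)]])
    then have "2 ^ r * ((1 + ln (real k)) / real k) <= 2 ^ r * (\<Lambda> / real k)"
     by (intro mult_left_mono divide_right_mono) auto
    then show ?thesis using h1[OF k] by simp
   qed
   have "\<bar>integral {real y..2 * real y} (%T. (norm (dpoly S2 h id T))\<^sup>2) - real y * (\<Sum>k\<in>S2. (norm (h k))\<^sup>2)\<bar> <= 8 * (2 ^ r * \<Lambda>)\<^sup>2 * (harm Z)\<^sup>2"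
    by (rule dpoly_mean_square[OF S2(1) _ _ h2 y0]) (auto simp: S2_def)
   then have "integral {real y..2 * real y} (%T. (norm (dpoly S2 h id T))\<^sup>2) <= real y * (\<Sum>k\<in>S2. (norm (h k))\<^sup>2) + 8 * ((2 ^ r * \<Lambda>)\<^sup>2 * (harm Z)\<^sup>2)"
    by (simp only: mult.assoc)
   also have "... <= real y * (4 ^ r * \<tau> X) + 8 * ((2 ^ r)\<^sup>2 * \<Lambda> ^ 4)"
   proof (intro add_mono mult_left_mono sq4)
    have "(\<Sum>k\<in>S2. (norm (h k))\<^sup>2) <= (\<Sum>k\<in>S2. (2 ^ r * ((1 + ln (real k)) / real k))\<^sup>2)"
     by (intro sum_mono power_mono h1) auto
    also have "... = 4 ^ r * (\<Sum>k\<in>S2. ((1 + ln (real k)) / real k)\<^sup>2)"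
     unfolding power_mult_distrib sum_distrib_left[symmetric] r4 by simp
    also have "... <= 4 ^ r * \<tau> X" by (intro mult_left_mono \<tau>(2) S2) auto
    finally show "(\<Sum>k\<in>S2. (norm (h k))\<^sup>2) <= 4 ^ r * \<tau> X" .
    show "harm Z <= \<Lambda>" by (intro logs big)
   qed (use \<Lambda>1 in \<open>auto simp: harm_nonneg\<close>)
   also note r4
   finally have D: "integral {real y..2 * real y} (%T. (norm (dpoly S2 h id T))\<^sup>2) <= real y * (4 ^ r * \<tau> X) + 8 * (4 ^ r * \<Lambda> ^ 4)" .
   have "integral {real y..2 * real y} (%T. w T * (norm (dpoly S2 h id T))\<^sup>2) <= integral {real y..2 * real y} (%T. M\<^sup>2 * (norm (dpoly S2 h id T))\<^sup>2)"
    by (intro integral_le integrable_continuous_interval continuous_on_mult wcont mult_right_mono wM) (auto intro!: continuous_intros)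
   also have "... = M\<^sup>2 * integral {real y..2 * real y} (%T. (norm (dpoly S2 h id T))\<^sup>2)" by simp
   also have "... <= M\<^sup>2 * (real y * (4 ^ r * \<tau> X) + 8 * (4 ^ r * \<Lambda> ^ 4))" by (intro mult_left_mono D) simp
   finally show "integral {real y..2 * real y} (%T. w T * (norm (dpoly S2 h id T))\<^sup>2) <= M\<^sup>2 * (real y * (4 ^ r * \<tau> X) + 8 * (4 ^ r * \<Lambda> ^ 4))" .
  qed
  \<comment> \<open>The rough energy, the sign defects and the errors \<open>E y\<close> each take
    at most y M / 4, while the weight has mean about y M; a defect of at least 1 on the whole
    interval would contradict this.\<close>
  have "\<exists>T\<in>{real y..2 * real y}. K1 * (energy S1 g a T + energy S2 g a T) + (\<Sum>q\<in>P. z q T) / \<eta>'\<^sup>2 < 1"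
  proof (rule ccontr)
   assume "\<not> ?thesis"
   then have ge: "1 <= K1 * (energy S1 g a T + energy S2 g a T) + (\<Sum>q\<in>P. z q T) / \<eta>'\<^sup>2" if "T \<in> {real y..2 * real y}" for T
    using that by (auto simp: not_less)
   let ?I = "%F. integral {real y..2 * real y} F :: real"
   have cs: "continuous_on B (%T. (\<Sum>q\<in>P. w T * z q T) / \<eta>'\<^sup>2)" "continuous_on B (%T. K1 * (w T * energy S g a T))" for B S
    using \<eta>' by (auto intro!: continuous_on_divide continuous_on_sum continuous_on_mult wcont zcont continuous_on_energy continuous_on_const)
   have "?I w <= ?I (%T. (K1 * (w T * energy S1 g a T) + K1 * (w T * energy S2 g a T)) + (\<Sum>q\<in>P. w T * z q T) / \<eta>'\<^sup>2)"
   proof (intro integral_le integrable_continuous_interval continuous_on_add wcont cs)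
    fix T assume T: "T \<in> {real y..2 * real y}"
    have "w T * 1 <= w T * (K1 * (energy S1 g a T + energy S2 g a T) + (\<Sum>q\<in>P. z q T) / \<eta>'\<^sup>2)"
     by (intro mult_left_mono ge T w0)
    then show "w T <= (K1 * (w T * energy S1 g a T) + K1 * (w T * energy S2 g a T)) + (\<Sum>q\<in>P. w T * z q T) / \<eta>'\<^sup>2"
     by (simp add: algebra_simps sum_distrib_left)
   qed
   also have "... = (?I (%T. K1 * (w T * energy S1 g a T)) + ?I (%T. K1 * (w T * energy S2 g a T))) + ?I (%T. (\<Sum>q\<in>P. w T * z q T) / \<eta>'\<^sup>2)"
    by (subst integral_add integrable_continuous_interval, intro integrable_continuous_interval continuous_on_add cs, intro integrable_continuous_interval cs,
      subst integral_add, (intro integrable_continuous_interval cs)+, rule refl)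
   also have "?I (%T. (\<Sum>q\<in>P. w T * z q T) / \<eta>'\<^sup>2) = (\<Sum>q\<in>P. ?I (%T. w T * z q T)) / \<eta>'\<^sup>2"
   proof -
    have "?I (%T. \<Sum>q\<in>P. w T * z q T) = (\<Sum>q\<in>P. ?I (%T. w T * z q T))"
     by (rule integral_sum[OF P(1)]) (intro integrable_continuous_interval continuous_on_mult wcont zcont)
    then show ?thesis by simp
   qed
   also have "... <= (\<Sum>q\<in>P. real y * (2 * M / real (Suc m)) + 8 * (real d)\<^sup>2 * \<Lambda> ^ 4) / \<eta>'\<^sup>2"
    by (intro divide_right_mono sum_mono Zup) auto
   also have "... = real r / \<eta>'\<^sup>2 * (real y * (2 * M / real (Suc m)) + 8 * (real d)\<^sup>2 * \<Lambda> ^ 4)" by (simp add: r_def)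
   also have "?I (%T. K1 * (w T * energy S1 g a T)) <= K1 * ((1 + 2 * a) * (real y * M * \<tau> N + 8 * (real d)\<^sup>2 * \<Lambda> ^ 4))"
    using K1 E1 by simp
   also have "?I (%T. K1 * (w T * energy S2 g a T)) <= K1 * ((1 + 2 * a) * (M\<^sup>2 * (real y * (4 ^ r * \<tau> X) + 8 * (4 ^ r * \<Lambda> ^ 4))))"
    using K1 E2 by simp
   finally have up: "?I w <= A * (real y * M * \<tau> N + 8 * (real d)\<^sup>2 * \<Lambda> ^ 4) + A * (M\<^sup>2 * (real y * (4 ^ r * \<tau> X) + 8 * (4 ^ r * \<Lambda> ^ 4)))
     + real r / \<eta>'\<^sup>2 * (real y * (2 * M / real (Suc m)) + 8 * (real d)\<^sup>2 * \<Lambda> ^ 4)"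
    by (simp add: A(1) mult.assoc)
   have ly: "\<Lambda> ^ 4 = lam y * real y" using y1 by (simp add: lam_def \<Lambda>_def)
   have Ey: "E y * real y = A * (8 * (real d)\<^sup>2 * \<Lambda> ^ 4) + A * (M\<^sup>2 * (real y * (4 ^ r * \<tau> X) + 8 * (4 ^ r * \<Lambda> ^ 4)))
     + real r / \<eta>'\<^sup>2 * (8 * (real d)\<^sup>2 * \<Lambda> ^ 4) + 8 * (real d)\<^sup>2 * \<Lambda> ^ 4"
    unfolding ly E_def X_def by (simp add: algebra_simps)
   have "A * \<tau> N <= 1 / 4" using N0[of N] N A(2) by (simp add: field_simps)
   then have "real y * M * (A * \<tau> N) <= real y * M * (1 / 4)" using M1 by (intro mult_left_mono) auto
   moreover have "real r / \<eta>'\<^sup>2 * (real y * (2 * M / real (Suc m))) <= real y * M * (1 / 4)"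
   proof -
    have "8 * (real r / \<eta>'\<^sup>2) <= real m" using m by simp
    moreover have "x <= (1 + y) / 8" if "8 * x <= y" for x y :: real using that by simp
    ultimately have "real r / \<eta>'\<^sup>2 <= real (Suc m) / 8" unfolding of_nat_Suc by blast
    then have "real r / \<eta>'\<^sup>2 * (real y * (2 * M / real (Suc m))) <= real (Suc m) / 8 * (real y * (2 * M / real (Suc m)))"
     using M1 by (intro mult_right_mono) auto
    also have "... = real y * M * (1 / 4)" by (simp del: of_nat_Suc)
    finally show ?thesis .
   qed
   moreover have "E y * real y <= 1 / 4 * real y" using y(1) by (intro mult_right_mono) auto
   moreover have "real y * 1 <= real y * M" using M1 by (intro mult_left_mono) auto
   moreover have "A * (real y * M * \<tau> N + 8 * (real d)\<^sup>2 * \<Lambda> ^ 4) = real y * M * (A * \<tau> N) + A * (8 * (real d)\<^sup>2 * \<Lambda> ^ 4)"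
    "real r / \<eta>'\<^sup>2 * (real y * (2 * M / real (Suc m)) + 8 * (real d)\<^sup>2 * \<Lambda> ^ 4) = real r / \<eta>'\<^sup>2 * (real y * (2 * M / real (Suc m))) + real r / \<eta>'\<^sup>2 * (8 * (real d)\<^sup>2 * \<Lambda> ^ 4)"
    by (simp_all add: distrib_left mult_ac)
   ultimately show False using Wlow up Ey y(4) by linarith
  qed
  then obtain T where T: "real y <= T" "T <= 2 * real y" "K1 * (energy S1 g a T + energy S2 g a T) + (\<Sum>q\<in>P. z q T) / \<eta>'\<^sup>2 < 1"
   by auto
  have e0: "energy S1 g a T >= 0" "energy S2 g a T >= 0" by (rule energy_nonneg)+
  have zs: "(\<Sum>q\<in>P. z q T) / \<eta>'\<^sup>2 >= 0" by (intro divide_nonneg_nonneg sum_nonneg) (auto simp: z_def)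
  have en: "K1 * (energy S1 g a T + energy S2 g a T) < 1" using T(3) zs by linarith
  have K1e: "K1 * (energy S1 g a T + energy S2 g a T) >= 0" using K1 e0 by simp
  show "\<exists>T\<ge>T0. (\<forall>p\<in>primes_le N. norm (cis (- T * ln (real p)) - of_real (\<epsilon> p)) <= \<eta>') &
    (\<forall>t. \<bar>t\<bar> <= a --> norm (zeta (1 + \<i> * of_real (T + t)) * (\<Prod>p\<in>primes_le N. 1 - of_nat p powr (- (1 + \<i> * of_real (T + t)))) - 1) <= \<eta>)"
   unfolding P_def[symmetric]
  proof (intro exI[of _ T] conjI ballI allI impI)
   show "T0 <= T" using T y by linarith
  next
   fix q assume q: "q \<in> P"
   have "z q T <= (\<Sum>q\<in>P. z q T)" by (rule member_le_sum[OF q _ P(1)]) (auto simp: z_def)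
   also have "... < \<eta>'\<^sup>2"
   proof -
    have "(\<Sum>q\<in>P. z q T) / \<eta>'\<^sup>2 < 1" using T(3) K1e by linarith
    then show ?thesis by (simp only: divide_less_eq_1_pos[OF zero_less_power[OF \<eta>']])
   qed
   finally have zq: "z q T < \<eta>'\<^sup>2" .
   have "norm (1 - of_real (\<epsilon> q) * cis (- T * ln (real q)) :: complex) <= \<eta>'"
    by (rule power2_le_imp_le[OF less_imp_le[OF zq[unfolded z_def]] less_imp_le[OF \<eta>']])
   moreover have "cis (- T * ln (real q)) - of_real (\<epsilon> q) = - of_real (\<epsilon> q) * (1 - of_real (\<epsilon> q) * cis (- T * ln (real q)))"
   proof -
    have "\<epsilon> q * \<epsilon> q = 1" using \<epsilon>[rule_format, of q] by (metis abs_mult_self_eq mult_1)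
    then have "complex_of_real (\<epsilon> q) * of_real (\<epsilon> q) = 1" by (metis of_real_1 of_real_mult)
    then show ?thesis by (simp add: right_diff_distrib mult.assoc[symmetric])
   qed
   ultimately show "norm (cis (- T * ln (real q)) - of_real (\<epsilon> q)) <= \<eta>'"
    using \<epsilon> by (simp only: norm_mult norm_minus_cancel norm_of_real)
  next
   fix t assume t: "\<bar>t\<bar> <= a"
   have rng: "real y / 2 <= T + t" "T + t <= 3 * real y" using t T y(5) by linarith+
   have s1: "norm (dpoly S1 g id (T + t)) <= \<kappa> * (1 + 2 * a) + energy S1 g a T / \<kappa>"
    and s2: "norm (dpoly S2 g id (T + t)) <= \<kappa> * (1 + 2 * a) + energy S2 g a T / \<kappa>"
    by (rule dpoly_sup_energy[OF \<kappa> t])+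
   have "x / (16 * u) * u = x / 16" if "u > 0" for x u :: real using that by simp
   from this[of "1 + 2 * a" \<eta>] have k: "\<kappa> * (1 + 2 * a) = \<eta> / 16" using a unfolding \<kappa>_def by simp
   have e8: "x / \<kappa> = \<eta> / 8 * (8 / (\<kappa> * \<eta>) * x)" for x using \<kappa> \<eta> by (simp add: field_simps)
   have "(energy S1 g a T + energy S2 g a T) / \<kappa> = \<eta> / 8 * (K1 * (energy S1 g a T + energy S2 g a T))"
    unfolding K1_def by (rule e8)
   also have "... <= \<eta> / 8 * 1" using en \<eta> by (intro mult_left_mono) auto
   finally have "energy S1 g a T / \<kappa> + energy S2 g a T / \<kappa> <= \<eta> / 8" by (simp add: add_divide_distrib)
   then have "norm (dpoly S1 g id (T + t) + dpoly S2 g id (T + t)) <= \<eta> / 2"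
    using s1 s2 \<eta> norm_triangle_ineq[of "dpoly S1 g id (T + t)" "dpoly S2 g id (T + t)"] unfolding k by linarith
   moreover have "norm (zeta (1 + \<i> * of_real (T + t)) * (\<Prod>p\<in>P. 1 - of_nat p powr (- (1 + \<i> * of_real (T + t)))) - 1
      - (dpoly S1 g id (T + t) + dpoly S2 g id (T + t))) <= \<eta> / 2"
    using g(3)[OF rng] y(2) unfolding S1_def S2_def X_def Z_def by linarith
   ultimately show "norm (zeta (1 + \<i> * of_real (T + t)) * (\<Prod>p\<in>P. 1 - of_nat p powr (- (1 + \<i> * of_real (T + t)))) - 1) <= \<eta>"
    using norm_triangle_sub[of "zeta (1 + \<i> * of_real (T + t)) * (\<Prod>p\<in>P. 1 - of_nat p powr (- (1 + \<i> * of_real (T + t)))) - 1"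
     "dpoly S1 g id (T + t) + dpoly S2 g id (T + t)"] by linarith
  qed
 qed
qed

subsection \<open>Local factors of the Euler product\<close>

text \<open>For x = cos \<theta> this is -ln |1 - r e^(i \<theta>)|.\<close>

definition euler_term :: "real => real => real" where
 "euler_term r x = - ln (1 - 2 * r * x + r\<^sup>2) / 2"

lemma euler_term_arg:
 fixes r x :: real
 assumes "0 <= r" "r < 1" "\<bar>x\<bar> <= 1"
 shows "(1 - r)\<^sup>2 <= 1 - 2 * r * x + r\<^sup>2" "1 - 2 * r * x + r\<^sup>2 <= (1 + r)\<^sup>2" "0 < 1 - 2 * r * x + r\<^sup>2"
proof -
 have "r * x <= r * 1" "r * (-1) <= r * x" using assms by (intro mult_left_mono; auto)+
 then show 1: "(1 - r)\<^sup>2 <= 1 - 2 * r * x + r\<^sup>2" and "1 - 2 * r * x + r\<^sup>2 <= (1 + r)\<^sup>2"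
  by (simp_all add: power2_eq_square algebra_simps)
 have "0 < (1 - r)\<^sup>2" using assms by simp
 then show "0 < 1 - 2 * r * x + r\<^sup>2" using 1 by linarith
qed

lemma ln_quotient_le:
 fixes u v :: real
 assumes "0 < u" "0 < v"
 shows "ln u - ln v <= (u - v) / v"
proof -
 have "ln (u / v) <= u / v - 1" using assms by (intro ln_le_minus_one) auto
 then show ?thesis using assms by (simp add: ln_divide_pos diff_divide_distrib)
qed

text \<open>The tangent at x = 1 of a function convex in x, obtained from ln u - ln v <= (u - v) /
  v. \<open>euler_term_lower_left\<close> is the tangent at x = -1, and
  \<open>euler_term_upper_left\<close> swaps the roles of u and v there.\<close>

lemma euler_term_lower_right:
 assumes "0 <= r" "r < 1" "\<bar>x\<bar> <= 1"
 shows "euler_term r x >= - ln (1 - r) - r * (1 - x) / (1 - r)\<^sup>2"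
proof -
 note v = euler_term_arg[OF assms]
 have p: "0 < (1 - r)\<^sup>2" using assms by simp
 have "ln (1 - 2 * r * x + r\<^sup>2) - ln ((1 - r)\<^sup>2) <= (1 - 2 * r * x + r\<^sup>2 - (1 - r)\<^sup>2) / (1 - r)\<^sup>2"
  by (rule ln_quotient_le[OF v(3) p])
 also have "1 - 2 * r * x + r\<^sup>2 - (1 - r)\<^sup>2 = 2 * (r * (1 - x))" by (simp add: power2_eq_square algebra_simps)
 finally show ?thesis using assms by (simp add: euler_term_def ln_realpow)
qed

lemma euler_term_lower_left:
 assumes "0 <= r" "r < 1" "\<bar>x\<bar> <= 1"
 shows "euler_term r x >= - ln (1 + r) + r * (1 + x) / (1 + r)\<^sup>2"
proof -
 note v = euler_term_arg[OF assms]
 have p: "0 < (1 + r)\<^sup>2" using assms by simp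
 have "ln (1 - 2 * r * x + r\<^sup>2) - ln ((1 + r)\<^sup>2) <= (1 - 2 * r * x + r\<^sup>2 - (1 + r)\<^sup>2) / (1 + r)\<^sup>2"
  by (rule ln_quotient_le[OF v(3) p])
 also have "1 - 2 * r * x + r\<^sup>2 - (1 + r)\<^sup>2 = - (2 * (r * (1 + x)))" by (simp add: power2_eq_square algebra_simps)
 finally show ?thesis using assms by (simp add: euler_term_def ln_realpow)
qed

lemma euler_term_upper_left:
 assumes "0 <= r" "r < 1" "\<bar>x\<bar> <= 1"
 shows "euler_term r x <= - ln (1 + r) + r * (1 + x) / (1 - r)\<^sup>2"
proof -
 note v = euler_term_arg[OF assms]
 have p: "0 < (1 + r)\<^sup>2" "0 < (1 - r)\<^sup>2" using assms by auto
 have "ln ((1 + r)\<^sup>2) - ln (1 - 2 * r * x + r\<^sup>2) <= ((1 + r)\<^sup>2 - (1 - 2 * r * x + r\<^sup>2)) / (1 - 2 * r * x + r\<^sup>2)"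
  by (rule ln_quotient_le[OF p(1) v(3)])
 also have "(1 + r)\<^sup>2 - (1 - 2 * r * x + r\<^sup>2) = 2 * (r * (1 + x))" by (simp add: power2_eq_square algebra_simps)
 also have "2 * (r * (1 + x)) / (1 - 2 * r * x + r\<^sup>2) <= 2 * (r * (1 + x)) / (1 - r)\<^sup>2"
  by (intro divide_left_mono mult_nonneg_nonneg mult_pos_pos v p) (use assms in auto)
 finally show ?thesis using assms by (simp add: euler_term_def ln_realpow)
qed

text \<open>In the expansion into r^k cos(k \<theta>) / k every cosine with k >= 2 is at most 1. The
  proof obtains this by differentiating the difference in r, starting from equality at r =
  0.\<close>

lemma euler_term_upper:
 assumes "0 <= r" "r < 1" "\<bar>x\<bar> <= 1"
 shows "euler_term r x <= r * x + log_corr r"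
proof -
 define H where "H r = r * x + log_corr r - euler_term r x" for r
 have "H 0 <= H r"
 proof (rule DERIV_nonneg_imp_nondecreasing[OF assms(1)])
  fix s assume s: "0 <= s" "s <= r"
  then have s1: "s < 1" using assms by simp
  define v where "v = 1 - 2 * s * x + s\<^sup>2"
  note va = euler_term_arg[OF s(1) s1 assms(3), folded v_def]
  define D where "D = 1 * x + (- (- (1 / (1 - s))) - 1) - (- (1 / v * (- 2 * x + 2 * s)) / 2)"
  have d1: "((%r. 1 - 2 * r * x + r\<^sup>2) has_real_derivative (- 2 * x + 2 * s)) (at s)"
   by (auto intro!: derivative_eq_intros)
  have d2: "((%r. ln (1 - 2 * r * x + r\<^sup>2)) has_real_derivative (1 / v * (- 2 * x + 2 * s))) (at s)"
   unfolding v_def by (rule DERIV_chain2[OF DERIV_ln_divide d1]) (use va(3) in \<open>simp add: v_def\<close>)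
  have d3: "((%r. ln (1 - r)) has_real_derivative - (1 / (1 - s))) (at s)"
   using s1 by (auto intro!: derivative_eq_intros simp: divide_simps)
  have "(H has_real_derivative D) (at s)"
   unfolding H_def[abs_def] log_corr_def euler_term_def D_def
   by (intro DERIV_diff DERIV_add DERIV_minus DERIV_cdivide DERIV_cmult_right d2 d3 DERIV_ident)
  moreover have "D = (1 - x) * ((1 + s) / ((1 - s) * v) - 1)"
  proof -
   have num: "1 * v + (s - x) * (1 - s) = (1 - x) * (1 + s)" by (simp add: v_def power2_eq_square algebra_simps)
   have nz: "1 - s ~= 0" "v ~= 0" using s1 va(3) by auto
   have h: "- (1 / w * (2 * u)) / 2 = - (u / w)" for w u :: real by simp
   have two: "- 2 * x + 2 * s = 2 * (s - x)" by simp
   have "D = (x - 1) + (1 / (1 - s) + (s - x) / v)"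
    unfolding D_def two h by simp
   also have "1 / (1 - s) + (s - x) / v = (1 * v + (s - x) * (1 - s)) / ((1 - s) * v)"
    by (rule add_frac_eq[OF nz])
   also have "... = (1 - x) * ((1 + s) / ((1 - s) * v))" unfolding num by simp
   finally show ?thesis by (simp add: right_diff_distrib)
  qed
  moreover have "(1 - x) * ((1 + s) / ((1 - s) * v) - 1) >= 0"
  proof (rule mult_nonneg_nonneg)
   have "(1 - s) * v <= (1 - s) * (1 + s)\<^sup>2" using va s1 by (intro mult_left_mono) auto
   also have "... = (1 - s\<^sup>2) * (1 + s)" by (simp add: power2_eq_square algebra_simps)
   also have "... <= 1 * (1 + s)" using s by (intro mult_right_mono) auto
   finally have "(1 - s) * v <= 1 + s" by simp
   moreover have "(1 - s) * v > 0" using s1 va by simp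
   ultimately have "1 <= (1 + s) / ((1 - s) * v)" by (simp only: le_divide_eq_1_pos)
   then show "0 <= (1 + s) / ((1 - s) * v) - 1" by simp
  qed (use assms in auto)
  ultimately show "\<exists>d. (H has_real_derivative d) (at s) & 0 <= d" by metis
 qed
 then show ?thesis by (simp add: H_def log_corr_def euler_term_def)
qed

lemma nat_powr_polar:
 assumes "n >= 1"
 shows "of_nat n powr (- (of_real \<sigma> + \<i> * of_real t)) = of_real (real n powr (- \<sigma>)) * cis (- t * ln (real n))"
proof -
 have "(of_nat n :: complex) powr (- (of_real \<sigma> + \<i> * of_real t)) = exp (- (of_real \<sigma> + \<i> * of_real t) * of_real (ln (real n)))"
  using assms by (simp add: powr_def Ln_of_nat)
 also have "- (of_real \<sigma> + \<i> * of_real t) * of_real (ln (real n)) = of_real (- \<sigma> * ln (real n)) + \<i> * of_real (- t * ln (real n))"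
  by (simp add: algebra_simps)
 also have "exp ... = of_real (exp (- \<sigma> * ln (real n))) * cis (- t * ln (real n))"
  unfolding exp_add cis_conv_exp exp_of_real ..
 also have "exp (- \<sigma> * ln (real n)) = real n powr (- \<sigma>)" using assms by (simp add: powr_def)
 finally show ?thesis .
qed

text \<open>The sign of c is moved into the cosine, so that signed Euler factors reduce to
  \<open>euler_term\<close> with radius |c|.\<close>

lemma minus_ln_norm_factor: "- ln (norm (1 - of_real c * cis \<theta>)) = euler_term \<bar>c\<bar> (sgn c * cos \<theta>)"
proof -
 have alg: "(1 - c * u)\<^sup>2 + (c * w)\<^sup>2 = 1 - 2 * c * u + c\<^sup>2 * (w\<^sup>2 + u\<^sup>2)" for u w :: real
  by (simp add: power2_eq_square algebra_simps)
 have "(norm (1 - of_real c * cis \<theta>))\<^sup>2 = (1 - c * cos \<theta>)\<^sup>2 + (c * sin \<theta>)\<^sup>2" by (simp add: cmod_power2)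
 also have "... = 1 - 2 * c * cos \<theta> + c\<^sup>2 * ((sin \<theta>)\<^sup>2 + (cos \<theta>)\<^sup>2)" by (rule alg)
 also have "... = 1 - 2 * c * cos \<theta> + \<bar>c\<bar>\<^sup>2" by simp
 finally have e0: "(norm (1 - of_real c * cis \<theta>))\<^sup>2 = 1 - 2 * c * cos \<theta> + \<bar>c\<bar>\<^sup>2" .
 have "c * cos \<theta> = \<bar>c\<bar> * (sgn c * cos \<theta>)" by (cases "c > 0"; cases "c = 0") (simp_all add: sgn_if)
 then have "1 - 2 * c * cos \<theta> + \<bar>c\<bar>\<^sup>2 = 1 - 2 * \<bar>c\<bar> * (sgn c * cos \<theta>) + \<bar>c\<bar>\<^sup>2" by (simp only: mult.assoc)
 with e0 have e: "(norm (1 - of_real c * cis \<theta>))\<^sup>2 = 1 - 2 * \<bar>c\<bar> * (sgn c * cos \<theta>) + \<bar>c\<bar>\<^sup>2" by (simp only:)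
 show ?thesis
 proof (cases "norm (1 - of_real c * cis \<theta>) = 0")
  case False
  then show ?thesis unfolding euler_term_def e[symmetric] by (simp add: ln_realpow)
 qed (use e in \<open>simp add: euler_term_def\<close>)
qed

lemma prod_norm_inverse:
 fixes f :: "nat => complex"
 assumes "finite P" "\<And>p. p \<in> P ==> f p ~= 0"
 shows "norm (\<Prod>p\<in>P. f p) = exp (- (\<Sum>p\<in>P. - ln (norm (f p))))"
proof -
 have "exp (\<Sum>p\<in>P. ln (norm (f p))) = (\<Prod>p\<in>P. exp (ln (norm (f p))))" by (rule exp_sum[OF assms(1)])
 also have "... = (\<Prod>p\<in>P. norm (f p))" using assms(2) by (intro prod.cong) auto
 finally show ?thesis by (simp add: sum_negf prod_norm)
qed

subsection \<open>Constants\<close>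

lemma abs_sinc_bounds: "0 <= abs_sinc x" "abs_sinc x <= 1" "1 - abs_sinc x <= x\<^sup>2 / 2"
proof -
 show "0 <= abs_sinc x" by (simp add: abs_sinc_def)
 have "\<bar>sin x\<bar> <= \<bar>x\<bar>" by (rule abs_sin_x_le_abs_x)
 then show "abs_sinc x <= 1" by (simp add: abs_sinc_def divide_le_eq_1)
 have pos: "1 - \<bar>sin y / y\<bar> <= y\<^sup>2 / 2" if y: "y > 0" for y :: real
 proof -
  have "\<exists>z>0. z < y & sin y - sin 0 = (y - 0) * cos z"
   by (rule MVT2[OF y]) (auto intro!: derivative_eq_intros)
  then obtain z where z: "0 < z" "z < y" "sin y = y * cos z" by auto
  have "1 - cos z <= z\<^sup>2 / 2" by (rule one_minus_cos_le)
  also have "... <= y\<^sup>2 / 2" using z by (intro divide_right_mono power_mono) auto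
  finally show ?thesis using z y by simp
 qed
 show "1 - abs_sinc x <= x\<^sup>2 / 2"
  using pos[of x] pos[of "-x"] by (cases "x = 0"; cases "x > 0") (auto simp: abs_sinc_def)
qed

text \<open>The counterpart of \<open>log_corr\<close> for the sign -1: -ln(1 + 1/p) = -1/p +
  \<open>alt_corr p\<close>.\<close>

definition alt_corr :: "nat => real" where
 "alt_corr p = 1 / real p - ln (1 + 1 / real p)"

lemma alt_corr_nonneg: "alt_corr p >= 0"
 unfolding alt_corr_def using ln_add_one_self_le_self[of "1 / real p"] by simp

lemma sum_log_corr_tendsto: "(%N. \<Sum>p\<in>primes_le N. log_corr (1 / p)) \<longlonglongrightarrow> log_corr_const"
proof -
 have "(%N. \<Sum>n<Suc N. prime_log_corr 0 n) \<longlonglongrightarrow> log_corr_const"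
  unfolding log_corr_const_def using summable_LIMSEQ[OF prime_log_corr_summable(1)[of 0]] by (intro LIMSEQ_Suc) simp
 moreover have "(\<Sum>n<Suc N. prime_log_corr 0 n) = (\<Sum>p\<in>primes_le N. log_corr (1 / p))" for N
 proof (rule sum.mono_neutral_cong_right)
  show "prime_log_corr 0 p = log_corr (1 / real p)" if "p \<in> primes_le N" for p
   using that by (simp add: prime_log_corr_def primes_le_def powr_minus divide_inverse)
 qed (auto simp: primes_le_def prime_log_corr_def)
 ultimately show ?thesis by simp
qed

lemma sum_log_corr_le: "(\<Sum>p\<in>primes_le N. log_corr (1 / p)) <= log_corr_const"
proof (rule incseq_le[OF _ sum_log_corr_tendsto])
 show "incseq (%N. \<Sum>p\<in>primes_le N. log_corr (1 / real p))"
 proof (rule incseq_SucI, rule sum_mono2)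
  fix N p assume "p \<in> primes_le (Suc N) - primes_le N"
  then have "real p >= 2" using prime_ge_2_nat[of p] by (simp add: primes_le_def)
  then show "0 <= log_corr (1 / real p)" by (intro log_corr_bounds) (auto simp: field_simps)
 qed (auto simp: primes_le_def)
qed

lemma zeta_2: "zeta 2 = of_real (pi\<^sup>2 / 6)"
proof -
 have "(%n. of_nat (Suc n) powr (- 2 :: complex)) sums zeta 2" by (rule zeta_sums) simp
 moreover have "of_nat (Suc n) powr (- 2 :: complex) = of_real (1 / real (Suc n) ^ 2)" for n
 proof -
  show ?thesis using nat_powr_polar[of "Suc n" 2 0] by (simp add: powr_minus divide_inverse del: of_nat_Suc)
 qed
 ultimately have "(%n. complex_of_real (1 / real (Suc n) ^ 2)) sums zeta 2" by (simp only:)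
 moreover have "(%n. complex_of_real (1 / real (Suc n) ^ 2)) sums of_real (pi\<^sup>2 / 6)"
  using inverse_squares_sums by (intro sums_of_real) (simp add: add.commute)
 ultimately show ?thesis by (rule sums_unique2)
qed

text \<open>From (1 - 1/p)(1 + 1/p) = 1 - p^(-2) one gets \<open>alt_corr p\<close> = -ln(1 -
  p^(-2)) - \<open>log_corr (1 / p)\<close>, and the Euler product at 2 supplies ln(pi^2 /
  6).\<close>

lemma sum_alt_corr_tendsto: "(%N. \<Sum>p\<in>primes_le N. alt_corr p) \<longlonglongrightarrow> ln (pi\<^sup>2 / 6) - log_corr_const"
proof -
 have "(%N. (\<Sum>p\<in>primes_le N. - ln (1 - real p powr (- 2))) - (\<Sum>p\<in>primes_le N. log_corr (1 / p))) \<longlonglongrightarrow> ln (norm (zeta (of_real 2))) - log_corr_const"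
  by (intro tendsto_diff log_zeta_tendsto sum_log_corr_tendsto) simp
 moreover have "(\<Sum>p\<in>primes_le N. - ln (1 - real p powr (- 2))) - (\<Sum>p\<in>primes_le N. log_corr (1 / p)) = (\<Sum>p\<in>primes_le N. alt_corr p)" for N
  unfolding sum_subtractf[symmetric]
 proof (intro sum.cong refl)
  fix p assume "p \<in> primes_le N"
  then have p: "real p > 1" using prime_gt_1_nat[of p] by (simp add: primes_le_def)
  have "1 - real p powr (- 2) = (1 - 1 / real p) * (1 + 1 / real p)"
   using p by (simp add: powr_minus divide_inverse algebra_simps power2_eq_square)
  then have "ln (1 - real p powr (- 2)) = ln (1 - 1 / real p) + ln (1 + 1 / real p)"
   using p by (simp only:) (rule ln_mult_pos; simp add: add_pos_pos)
  then show "- ln (1 - real p powr (- 2)) - log_corr (1 / real p) = alt_corr p"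
   by (simp add: log_corr_def alt_corr_def)
 qed
 moreover have "norm (zeta (of_real 2)) = pi\<^sup>2 / 6"
 proof -
  have z: "zeta (of_real 2) = of_real (pi\<^sup>2 / 6)" using zeta_2 by (simp only: of_real_numeral)
  show ?thesis unfolding z norm_of_real by simp
 qed
 ultimately show ?thesis by (simp only:)
qed

lemma sum_alt_corr_le: "(\<Sum>p\<in>primes_le N. alt_corr p) <= ln (pi\<^sup>2 / 6) - log_corr_const"
proof (rule incseq_le[OF _ sum_alt_corr_tendsto])
 show "incseq (%N. \<Sum>p\<in>primes_le N. alt_corr p)"
  by (rule incseq_SucI, rule sum_mono2) (auto simp: primes_le_def alt_corr_nonneg)
qed

lemma prime_log_square_sum_le:
 obtains D :: real where "D > 0" "\<And>N. (\<Sum>p\<in>primes_le N. (ln (real p) / real p)\<^sup>2) <= D"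
proof -
 obtain \<tau> :: "nat => real" where \<tau>:
  "\<And>n S. finite S ==> S \<subseteq> {n<..} ==> (\<Sum>k\<in>S. ((1 + ln (real k)) / real k)\<^sup>2) <= \<tau> n"
  using log_square_sum_tail by metis
 have "(\<Sum>p\<in>primes_le N. (ln (real p) / real p)\<^sup>2) <= \<bar>\<tau> 0\<bar> + 1" for N
 proof -
  have "(\<Sum>p\<in>primes_le N. (ln (real p) / real p)\<^sup>2) <= (\<Sum>p\<in>primes_le N. ((1 + ln (real p)) / real p)\<^sup>2)"
  proof (intro sum_mono power_mono divide_right_mono)
   fix p assume "p \<in> primes_le N"
   then have "real p >= 1" using prime_ge_1_nat[of p] by (simp add: primes_le_def)
   then show "0 <= ln (real p) / real p" by simp
  qed auto
  also have "... <= \<tau> 0" by (rule \<tau>) (auto simp: primes_le_def prime_gt_0_nat)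
  finally show ?thesis by linarith
 qed
 then show ?thesis using that[of "\<bar>\<tau> 0\<bar> + 1"] by simp
qed

subsection \<open>Averages over short windows\<close>

lemma integral_cos_window:
 assumes a: "a > 0" and l: "l > 0"
 shows "\<bar>integral {T..T + 2 * a} (%t. cos (t * l))\<bar> <= 2 * a * abs_sinc (a * l)"
proof -
 have "((%t. cos (t * l)) has_integral (sin ((T + 2 * a) * l) / l - sin (T * l) / l)) {T..T + 2 * a}"
  by (rule fundamental_theorem_of_calculus)
   (use a l in \<open>auto intro!: derivative_eq_intros simp flip: has_real_derivative_iff_has_vector_derivative\<close>)
 then have "integral {T..T + 2 * a} (%t. cos (t * l)) = (sin ((T + 2 * a) * l) - sin (T * l)) / l"
  by (simp add: integral_unique diff_divide_distrib)
 also have "sin ((T + 2 * a) * l) - sin (T * l) = 2 * sin (a * l) * cos ((T + a) * l)"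
  using sin_diff_sin[of "(T + 2 * a) * l" "T * l"] by (simp add: algebra_simps add_divide_distrib)
 finally have "\<bar>integral {T..T + 2 * a} (%t. cos (t * l))\<bar> = 2 * \<bar>sin (a * l)\<bar> * \<bar>cos ((T + a) * l)\<bar> / l"
  using l by (simp add: abs_mult)
 also have "... <= 2 * \<bar>sin (a * l)\<bar> * 1 / l" using l by (intro divide_right_mono mult_left_mono) auto
 also have "... = 2 * a * abs_sinc (a * l)" using a l by (simp add: abs_sinc_def abs_mult)
 finally show ?thesis .
qed

lemma euler_term_continuous:
 assumes "0 <= r" "r < 1"
 shows "continuous_on A (%t. euler_term r (cos (t * l)))"
proof -
 have "1 - 2 * r * cos (t * l) + r\<^sup>2 ~= 0" for t using euler_term_arg(3)[OF assms abs_cos_le_one, of "t * l"] by simp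
 then show ?thesis unfolding euler_term_def by (intro continuous_intros) auto
qed

lemma integral_attained:
 fixes f :: "real => real"
 assumes f: "continuous_on {T..T + 2 * a} f" and a: "a > 0"
 shows "integral {T..T + 2 * a} f <= 2 * a * K ==> \<exists>t\<in>{T..T + 2 * a}. f t <= K"
  and "integral {T..T + 2 * a} f >= 2 * a * K ==> \<exists>t\<in>{T..T + 2 * a}. f t >= K"
proof -
 have "\<exists>t\<in>{T..T + 2 * a}. integral {T..T + 2 * a} f >= 2 * a * f t"
 proof -
  obtain t where t: "t \<in> {T..T + 2 * a}" "\<forall>y\<in>{T..T + 2 * a}. f t <= f y"
   using continuous_attains_inf[OF compact_Icc _ f] a by force
  have "integral {T..T + 2 * a} (%_. f t) <= integral {T..T + 2 * a} f"
   using t f by (intro integral_le integrable_continuous_interval) auto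
  then show ?thesis using t(1) a by auto
 qed
 moreover have "\<exists>t\<in>{T..T + 2 * a}. integral {T..T + 2 * a} f <= 2 * a * f t"
 proof -
  obtain t where t: "t \<in> {T..T + 2 * a}" "\<forall>y\<in>{T..T + 2 * a}. f y <= f t"
   using continuous_attains_sup[OF compact_Icc _ f] a by force
  have "integral {T..T + 2 * a} f <= integral {T..T + 2 * a} (%_. f t)"
   using t f by (intro integral_le integrable_continuous_interval) auto
  then show ?thesis using t(1) a by auto
 qed
 moreover have "2 * a * x <= 2 * a * K \<longleftrightarrow> x <= K" "2 * a * K <= 2 * a * x \<longleftrightarrow> K <= x" for x using a by auto
 ultimately show "integral {T..T + 2 * a} f <= 2 * a * K ==> \<exists>t\<in>{T..T + 2 * a}. f t <= K"
  "integral {T..T + 2 * a} f >= 2 * a * K ==> \<exists>t\<in>{T..T + 2 * a}. f t >= K"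
  by (meson order_trans)+
qed

text \<open>The right-hand side of the tangent bound at \<open>x = -1\<close> decreases in \<open>r\<close>, so \<open>p powr -\<sigma>\<close> may be replaced by \<open>1 / p\<close>.\<close>

lemma alt_bound_antimono:
 fixes c q r :: real
 assumes "0 <= r" "r <= q" "q <= 1" "0 <= c" "c <= 1"
 shows "- ln (1 + q) + q * c / (1 + q)\<^sup>2 <= - ln (1 + r) + r * c / (1 + r)\<^sup>2"
proof (rule DERIV_nonpos_imp_nonincreasing[OF assms(2), where f = "%r. - ln (1 + r) + r * c / (1 + r)\<^sup>2"])
 fix s assume s: "r <= s" "s <= q"
 then have s0: "0 <= s" "s <= 1" using assms by auto
 have d: "((%r. - ln (1 + r) + r * c / (1 + r)\<^sup>2) has_real_derivative
   - (1 / (1 + s)) + (c * (1 + s)\<^sup>2 - s * c * (2 * (1 + s))) / ((1 + s)\<^sup>2 * (1 + s)\<^sup>2)) (at s)"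
  using s0 by (auto intro!: derivative_eq_intros simp: power2_eq_square)
 have "c * (1 + s)\<^sup>2 - s * c * (2 * (1 + s)) = c * ((1 + s) * (1 - s))" by (simp add: power2_eq_square algebra_simps)
 also have "... <= 1 * ((1 + s) * 1)" using s0 assms by (intro mult_mono) auto
 finally have "(c * (1 + s)\<^sup>2 - s * c * (2 * (1 + s))) / ((1 + s)\<^sup>2 * (1 + s)\<^sup>2) <= (1 + s) / ((1 + s) * (1 + s))"
 proof (intro frac_le)
  have "(1 + s) * (1 + s) * 1 <= (1 + s) * (1 + s) * ((1 + s) * (1 + s))"
   using s0 by (intro mult_left_mono) (auto simp: algebra_simps)
  then show "(1 + s) * (1 + s) <= (1 + s)\<^sup>2 * (1 + s)\<^sup>2" by (simp add: power2_eq_square)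
 qed (use s0 in auto)
 also have "... = 1 / (1 + s)" using s0 by simp
 finally have "- (1 / (1 + s)) + (c * (1 + s)\<^sup>2 - s * c * (2 * (1 + s))) / ((1 + s)\<^sup>2 * (1 + s)\<^sup>2) <= 0" by simp
 with d show "\<exists>d. ((%r. - ln (1 + r) + r * c / (1 + r)\<^sup>2) has_real_derivative d) (at s) & d <= 0" by blast
qed

text \<open>Both bounds are linear in cos(t ln p), whose mean over the window is at most
  \<open>abs_sinc (a * ln p)\<close> in modulus: from above by \<open>euler_term_upper\<close>, from
  below by the tangent at x = -1. For \<sigma> >= 1 the radius is at most 1/p, and monotonicity in
  the radius allows replacing it by 1/p.\<close>

lemma euler_term_window:
 fixes a \<sigma> T :: real and p :: nat
 assumes a: "a > 0" and p: "prime p" and \<sigma>: "\<sigma> >= 1"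
 defines "I \<equiv> integral {T..T + 2 * a} (%t. euler_term (real p powr (- \<sigma>)) (cos (t * ln (real p))))"
 shows "I <= 2 * a * (abs_sinc (a * ln (real p)) / real p + log_corr (1 / real p))"
  and "I >= 2 * a * (alt_corr p - abs_sinc (a * ln (real p)) / real p - a\<^sup>2 * (ln (real p) / real p)\<^sup>2)"
proof -
 define l where "l = ln (real p)"
 define q where "q = 1 / real p"
 define r where "r = real p powr (- \<sigma>)"
 define S where "S = abs_sinc (a * l)"
 have p2: "real p >= 2" using prime_ge_2_nat[OF p] by simp
 have l: "l > 0" using p2 by (simp add: l_def)
 have "real p powr (- \<sigma>) <= real p powr (- 1)" using p2 \<sigma> by (intro powr_mono) auto
 then have r: "0 <= r" "r <= q" using p2 by (auto simp: r_def q_def powr_minus divide_inverse)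
 have q: "0 < q" "q <= 1/2" using p2 by (auto simp: q_def field_simps)
 have r1: "r < 1" using r q by simp
 have S: "0 <= S" "S <= 1" "1 - S <= (a * l)\<^sup>2 / 2" unfolding S_def by (rule abs_sinc_bounds)+
 have I: "I = integral {T..T + 2 * a} (%t. euler_term r (cos (t * l)))" by (simp add: I_def r_def l_def)
 define c where "c = integral {T..T + 2 * a} (%t. cos (t * l))"
 have c: "\<bar>c\<bar> <= 2 * a * S" unfolding c_def S_def by (rule integral_cos_window[OF a l])
 have ec: "continuous_on A (%t. euler_term r (cos (t * l)))" for A by (rule euler_term_continuous[OF r(1) r1])
 have lin: "integral {T..T + 2 * a} (%t. u + v * cos (t * l)) = 2 * a * u + v * c" for u v
 proof -
  have "integral {T..T + 2 * a} (%t. u + v * cos (t * l)) = integral {T..T + 2 * a} (%t. u) + integral {T..T + 2 * a} (%t. v * cos (t * l))"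
   by (intro integral_add integrable_continuous_interval continuous_intros)
  then show ?thesis using a by (simp add: c_def)
 qed
 have "I <= integral {T..T + 2 * a} (%t. log_corr r + r * cos (t * l))"
  unfolding I using euler_term_upper[OF r(1) r1 abs_cos_le_one]
  by (intro integral_le integrable_continuous_interval ec continuous_intros) (simp add: add.commute)
 also have "... = 2 * a * log_corr r + r * c" by (rule lin)
 also have "r * c <= q * (2 * a * S)"
 proof -
  have "r * c <= r * \<bar>c\<bar>" using r by (intro mult_left_mono) auto
  also have "... <= q * (2 * a * S)" using r c q by (intro mult_mono) auto
  finally show ?thesis .
 qed
 also have "2 * a * log_corr r <= 2 * a * log_corr q"
  using log_corr_diff_le(1)[of r q] r q a by (intro mult_left_mono) auto
 finally have "I <= 2 * a * log_corr q + q * (2 * a * S)" by simp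
 then show "I <= 2 * a * (abs_sinc (a * ln (real p)) / real p + log_corr (1 / real p))"
  by (simp add: q_def S_def l_def algebra_simps)
 define k where "k = r / (1 + r)\<^sup>2"
 have k: "k >= 0" using r by (simp add: k_def)
 have "2 * a * (- ln (1 + r) + r * (1 - S) / (1 + r)\<^sup>2) = 2 * a * (- ln (1 + r) + k) - k * (2 * a * S)"
  by (simp add: k_def algebra_simps diff_divide_distrib)
 also have "... <= 2 * a * (- ln (1 + r) + k) + k * c"
  using mult_left_mono[OF _ k, of "- (2 * a * S)" c] c by simp
 also have "... = integral {T..T + 2 * a} (%t. (- ln (1 + r) + k) + k * cos (t * l))" by (rule lin[symmetric])
 also have "... <= I"
  unfolding I
 proof (intro integral_le integrable_continuous_interval ec continuous_intros)
  fix t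
  show "(- ln (1 + r) + k) + k * cos (t * l) <= euler_term r (cos (t * l))"
   using euler_term_lower_left[OF r(1) r1 abs_cos_le_one, of "t * l"]
   by (simp add: k_def distrib_left add_divide_distrib)
 qed
 finally have low: "2 * a * (- ln (1 + r) + r * (1 - S) / (1 + r)\<^sup>2) <= I" .
 \<comment> \<open>From 1 / (1 + q)^2 >= 1 - 2 q and 1 - S <= (a l)^2 / 2, so the linearisation
   costs a^2 (l q)^2, which is summable over the primes.\<close>
 have "alt_corr p - q * S - a\<^sup>2 * (l * q)\<^sup>2 <= - ln (1 + q) + q * (1 - S) / (1 + q)\<^sup>2"
 proof -
  have "(1 - 2 * q) * (1 + q)\<^sup>2 <= 1"
   using q by (simp add: power2_eq_square algebra_simps)
  then have "1 - 2 * q <= 1 / (1 + q)\<^sup>2" using q by (simp add: le_divide_eq)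
  then have "q * (1 - S) * (1 - 2 * q) <= q * (1 - S) * (1 / (1 + q)\<^sup>2)" using q S by (intro mult_left_mono) auto
  moreover have "q * (1 - S) * (1 - 2 * q) = q - q * S - 2 * q\<^sup>2 * (1 - S)" by (simp add: power2_eq_square algebra_simps)
  moreover have "2 * q\<^sup>2 * (1 - S) <= 2 * q\<^sup>2 * ((a * l)\<^sup>2 / 2)" using S by (intro mult_left_mono) auto
  moreover have "2 * q\<^sup>2 * ((a * l)\<^sup>2 / 2) = a\<^sup>2 * (l * q)\<^sup>2" by (simp add: power_mult_distrib)
  ultimately show ?thesis by (simp add: alt_corr_def q_def)
 qed
 also have "... <= - ln (1 + r) + r * (1 - S) / (1 + r)\<^sup>2"
  by (rule alt_bound_antimono) (use r q S in auto)
 finally have "2 * a * (alt_corr p - q * S - a\<^sup>2 * (l * q)\<^sup>2) <= 2 * a * (- ln (1 + r) + r * (1 - S) / (1 + r)\<^sup>2)"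
  using a by (intro mult_left_mono) auto
 then show "I >= 2 * a * (alt_corr p - abs_sinc (a * ln (real p)) / real p - a\<^sup>2 * (ln (real p) / real p)\<^sup>2)"
  using low by (simp add: q_def S_def l_def)
qed

lemma euler_sum_window:
 fixes a \<sigma> T :: real and N :: nat
 assumes a: "a > 0" and \<sigma>: "\<sigma> >= 1"
 defines "f \<equiv> %t. \<Sum>p\<in>primes_le N. euler_term (real p powr (- \<sigma>)) (cos (t * ln (real p)))"
 shows "\<exists>t\<in>{T..T + 2 * a}. f t <= (\<Sum>p\<in>primes_le N. abs_sinc (a * ln p) / p) + (\<Sum>p\<in>primes_le N. log_corr (1 / p))"
  and "\<exists>t\<in>{T..T + 2 * a}. f t >= (\<Sum>p\<in>primes_le N. alt_corr p) - (\<Sum>p\<in>primes_le N. abs_sinc (a * ln p) / p) - a\<^sup>2 * (\<Sum>p\<in>primes_le N. (ln p / p)\<^sup>2)"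
proof -
 have ec: "continuous_on A (%t. euler_term (real p powr (- \<sigma>)) (cos (t * ln (real p))))" if "p \<in> primes_le N" for p A
 proof (rule euler_term_continuous)
  have "real p > 1" using that prime_gt_1_nat[of p] by (simp add: primes_le_def)
  then show "real p powr (- \<sigma>) < 1" using \<sigma> by (simp add: powr_less_one)
 qed simp
 have fc: "continuous_on {T..T + 2 * a} f" unfolding f_def by (intro continuous_on_sum ec)
 have If: "integral {T..T + 2 * a} f = (\<Sum>p\<in>primes_le N. integral {T..T + 2 * a} (%t. euler_term (real p powr (- \<sigma>)) (cos (t * ln (real p)))))"
  unfolding f_def by (intro integral_sum integrable_continuous_interval ec finite_primes_le)
 have "integral {T..T + 2 * a} f <= (\<Sum>p\<in>primes_le N. 2 * a * (abs_sinc (a * ln (real p)) / real p + log_corr (1 / real p)))"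
  unfolding If by (intro sum_mono euler_term_window(1) a \<sigma>) (simp add: primes_le_def)
 also have "... = 2 * a * ((\<Sum>p\<in>primes_le N. abs_sinc (a * ln p) / p) + (\<Sum>p\<in>primes_le N. log_corr (1 / p)))"
  by (simp add: sum_distrib_left sum.distrib distrib_left)
 finally show "\<exists>t\<in>{T..T + 2 * a}. f t <= (\<Sum>p\<in>primes_le N. abs_sinc (a * ln p) / p) + (\<Sum>p\<in>primes_le N. log_corr (1 / p))"
  by (rule integral_attained(1)[OF fc a])
 have "2 * a * ((\<Sum>p\<in>primes_le N. alt_corr p) - (\<Sum>p\<in>primes_le N. abs_sinc (a * ln p) / p) - a\<^sup>2 * (\<Sum>p\<in>primes_le N. (ln p / p)\<^sup>2)) =
   (\<Sum>p\<in>primes_le N. 2 * a * (alt_corr p - abs_sinc (a * ln (real p)) / real p - a\<^sup>2 * (ln (real p) / real p)\<^sup>2))"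
  by (simp only: sum_distrib_left sum_subtractf right_diff_distrib)
 also have "... <= integral {T..T + 2 * a} f"
  unfolding If by (intro sum_mono euler_term_window(2) a \<sigma>) (simp add: primes_le_def)
 finally show "\<exists>t\<in>{T..T + 2 * a}. f t >= (\<Sum>p\<in>primes_le N. alt_corr p) - (\<Sum>p\<in>primes_le N. abs_sinc (a * ln p) / p) - a\<^sup>2 * (\<Sum>p\<in>primes_le N. (ln p / p)\<^sup>2)"
  by (rule integral_attained(2)[OF fc a])
qed

section \<open>From finite Euler products to values in every window on Re s = 1\<close>

lemma norm_euler_product:
 assumes "\<sigma> >= 1"
 shows "norm (\<Prod>p\<in>primes_le N. 1 - of_nat p powr (- (of_real \<sigma> + \<i> * of_real t))) =
   exp (- (\<Sum>p\<in>primes_le N. euler_term (real p powr (- \<sigma>)) (cos (t * ln (real p)))))"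
proof -
 have f: "1 - of_nat p powr (- (of_real \<sigma> + \<i> * of_real t)) = 1 - of_real (real p powr (- \<sigma>)) * cis (- t * ln (real p))"
  "real p powr (- \<sigma>) > 0" "real p powr (- \<sigma>) < 1" if "p \<in> primes_le N" for p
 proof -
  have p: "p > 1" using that prime_gt_1_nat[of p] by (simp add: primes_le_def)
  then show "1 - of_nat p powr (- (of_real \<sigma> + \<i> * of_real t)) = 1 - of_real (real p powr (- \<sigma>)) * cis (- t * ln (real p))"
   by (subst nat_powr_polar) auto
  show "real p powr (- \<sigma>) > 0" "real p powr (- \<sigma>) < 1" using p assms by (auto simp: powr_less_one)
 qed
 have "norm (\<Prod>p\<in>primes_le N. 1 - of_nat p powr (- (of_real \<sigma> + \<i> * of_real t)) :: complex) =
   exp (- (\<Sum>p\<in>primes_le N. - ln (norm (1 - of_nat p powr (- (of_real \<sigma> + \<i> * of_real t)) :: complex))))"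
 proof (rule prod_norm_inverse[OF finite_primes_le])
  fix p assume p: "p \<in> primes_le N"
  have "norm (of_real (real p powr (- \<sigma>)) * cis (- t * ln (real p))) < 1" using f(2,3)[OF p] by (simp add: norm_mult)
  then show "1 - of_nat p powr (- (of_real \<sigma> + \<i> * of_real t)) ~= (0 :: complex)" unfolding f(1)[OF p] by fastforce
 qed
 also have "(\<Sum>p\<in>primes_le N. - ln (norm (1 - of_nat p powr (- (of_real \<sigma> + \<i> * of_real t)) :: complex))) =
   (\<Sum>p\<in>primes_le N. euler_term (real p powr (- \<sigma>)) (cos (t * ln (real p))))"
 proof (intro sum.cong refl)
  fix p assume p: "p \<in> primes_le N"
  show "- ln (norm (1 - of_nat p powr (- (of_real \<sigma> + \<i> * of_real t)) :: complex)) = euler_term (real p powr (- \<sigma>)) (cos (t * ln (real p)))"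
   unfolding f(1)[OF p] minus_ln_norm_factor using f(2)[OF p] by (simp add: sgn_pos)
 qed
 finally show ?thesis .
qed

text \<open>Passing to the limit \<open>\<sigma> \<rightarrow> 1\<close> in \<open>(s - 1) \<zeta>(s)\<close>, which is continuous at \<open>1\<close>.\<close>

lemma zeta_reg_window_limit:
 fixes x :: "nat => real"
 assumes "\<And>n. x n \<in> {T..T + 2 * a}"
 obtains t \<phi> where "t \<in> {T..T + 2 * a}" "strict_mono (\<phi> :: nat => nat)"
  "(%n. norm (zeta_reg (of_real (1 + 1 / real (Suc (\<phi> n))) + \<i> * of_real (x (\<phi> n))))) \<longlonglongrightarrow> norm (zeta_reg (1 + \<i> * of_real t))"
  "(%n. norm (of_real (1 / real (Suc (\<phi> n))) + \<i> * of_real (x (\<phi> n)))) \<longlonglongrightarrow> \<bar>t\<bar>"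
proof -
 obtain t \<phi> where t: "t \<in> {T..T + 2 * a}" "strict_mono (\<phi> :: nat => nat)" "(x \<circ> \<phi>) \<longlonglongrightarrow> t"
  using compact_Icc[unfolded compact_def] assms by metis
 have "(%n. 1 / real (Suc n)) \<longlonglongrightarrow> 0" using LIMSEQ_inverse_real_of_nat by (simp add: inverse_eq_divide)
 then have e: "(%n. 1 / real (Suc (\<phi> n))) \<longlonglongrightarrow> 0"
  using LIMSEQ_subseq_LIMSEQ[OF _ t(2)] by (fastforce simp: o_def)
 have x: "(%n. x (\<phi> n)) \<longlonglongrightarrow> t" using t(3) by (simp add: o_def)
 have "(%n. of_real (1 + 1 / real (Suc (\<phi> n))) + \<i> * of_real (x (\<phi> n)) :: complex) \<longlonglongrightarrow> of_real (1 + 0) + \<i> * of_real t"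
  by (intro tendsto_intros e x)
 then have "(%n. of_real (1 + 1 / real (Suc (\<phi> n))) + \<i> * of_real (x (\<phi> n)) :: complex) \<longlonglongrightarrow> 1 + \<i> * of_real t" by simp
 moreover have "isCont zeta_reg (1 + \<i> * of_real t)"
  using holomorphic_on_imp_continuous_on[OF zeta_reg_holomorphic] by (simp add: continuous_on_eq_continuous_at)
 ultimately have "(%n. zeta_reg (of_real (1 + 1 / real (Suc (\<phi> n))) + \<i> * of_real (x (\<phi> n)))) \<longlonglongrightarrow> zeta_reg (1 + \<i> * of_real t)"
  by (rule isCont_tendsto_compose[rotated])
 moreover have "(%n. norm (of_real (1 / real (Suc (\<phi> n))) + \<i> * of_real (x (\<phi> n)) :: complex)) \<longlonglongrightarrow> norm (of_real 0 + \<i> * of_real t :: complex)"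
  by (intro tendsto_intros e x)
 then have "(%n. norm (of_real (1 / real (Suc (\<phi> n))) + \<i> * of_real (x (\<phi> n)) :: complex)) \<longlonglongrightarrow> \<bar>t\<bar>" by (simp add: norm_mult)
 ultimately show ?thesis using that[OF t(1,2)] tendsto_norm by blast
qed

text \<open>Uniformity in t is essential, because the good point t of a window is chosen after
  N.\<close>

lemma euler_product_approx_eventually:
 assumes "\<sigma> > 1" "e > 0"
 shows "\<forall>\<^sub>F N in sequentially. \<forall>t. norm (zeta (of_real \<sigma> + \<i> * of_real t) * (\<Prod>p\<in>primes_le N. 1 - of_nat p powr (- (of_real \<sigma> + \<i> * of_real t))) - 1) <= e"
proof -
 have "(%N. (1 + 1 / (\<sigma> - 1)) * real N powr (1 - \<sigma>)) \<longlonglongrightarrow> 0"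
  using assms by real_asymp
 then have "\<forall>\<^sub>F N in sequentially. (1 + 1 / (\<sigma> - 1)) * real N powr (1 - \<sigma>) < e" using assms by (intro order_tendstoD(2)) auto
 then show ?thesis using eventually_ge_at_top[of 1]
 proof eventually_elim
  case (elim N)
  show ?case
  proof
   fix t
   have "norm (zeta (of_real \<sigma> + \<i> * of_real t) * (\<Prod>p\<in>primes_le N. 1 - of_nat p powr (- (of_real \<sigma> + \<i> * of_real t))) - 1)
     <= (1 + 1 / (\<sigma> - 1)) * real N powr (1 - \<sigma>)"
    using euler_product_approx[of "of_real \<sigma> + \<i> * of_real t" N] assms elim by simp
   then show "norm (zeta (of_real \<sigma> + \<i> * of_real t) * (\<Prod>p\<in>primes_le N. 1 - of_nat p powr (- (of_real \<sigma> + \<i> * of_real t))) - 1) <= e"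
    using elim by linarith
  qed
 qed
qed

lemma zeta_reg_mult: "norm (zeta_reg (of_real (1 + h) + \<i> * of_real t)) = norm (of_real h + \<i> * of_real t) * norm (zeta (of_real (1 + h) + \<i> * of_real t))"
 if "h > 0" for h t :: real
proof -
 have "of_real (1 + h) + \<i> * of_real t ~= (1 :: complex)" using that by (simp add: complex_eq_iff)
 moreover have "of_real (1 + h) + \<i> * of_real t - 1 = (of_real h + \<i> * of_real t :: complex)" by simp
 ultimately show ?thesis unfolding zeta_reg_def by (simp only: if_False norm_mult)
qed

lemma zeta_reg_line: "t ~= 0 ==> norm (zeta_reg (1 + \<i> * of_real t)) = \<bar>t\<bar> * norm (zeta (1 + \<i> * of_real t))"
 by (simp add: zeta_reg_def norm_mult)

text \<open>For \<sigma> = 1 + 1/(n+1) the window mean yields a point where |zeta| is small; a limit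
  of these points in the compact window is taken in (s - 1) zeta(s). The limit point is not 0, as
  \<open>zeta_reg\<close> is 1 there while the limiting bound |t| exp K would be 0.\<close>

theorem zeta_window_small_value:
 obtains C :: real where "C > 0"
  "\<And>a T. 0 < a ==> a <= 1 ==> \<exists>t\<in>{T..T + 2 * a}. t ~= 0 &
    norm (zeta (1 + \<i> * of_real t)) <= exp (euler_mascheroni + ln (2 / a) + C * a\<^sup>2)"
proof -
 obtain C :: real where C: "C > 0" "\<And>a N. 0 < a ==> a <= 1 ==> (\<Sum>p\<in>primes_le N. abs_sinc (a * ln p) / p) \<le>
    euler_mascheroni - log_corr_const + ln (2 / a) + C * a\<^sup>2"
  by (rule sinc_prime_sum_upper, rule that, assumption+)
 have "\<exists>t\<in>{T..T + 2 * a}. t ~= 0 & norm (zeta (1 + \<i> * of_real t)) <= exp (euler_mascheroni + ln (2 / a) + C * a\<^sup>2)"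
  if a: "0 < a" "a <= 1" for a T
 proof -
  define K where "K = euler_mascheroni + ln (2 / a) + C * a\<^sup>2"
  have "\<exists>t\<in>{T..T + 2 * a}. norm (zeta (of_real (1 + 1 / real (Suc n)) + \<i> * of_real t)) <= (1 + 1 / real (Suc n)) * exp K" for n
  proof -
   define \<sigma> where "\<sigma> = 1 + 1 / real (Suc n)"
   have \<sigma>: "\<sigma> > 1" by (simp add: \<sigma>_def)
   obtain N where N: "\<And>t. norm (zeta (of_real \<sigma> + \<i> * of_real t) * (\<Prod>p\<in>primes_le N. 1 - of_nat p powr (- (of_real \<sigma> + \<i> * of_real t))) - 1) <= 1 / real (Suc n)"
    using eventually_happens[OF euler_product_approx_eventually[OF \<sigma>, of "1 / real (Suc n)"]] by auto
   obtain t where t: "t \<in> {T..T + 2 * a}" "(\<Sum>p\<in>primes_le N. euler_term (real p powr (- \<sigma>)) (cos (t * ln (real p)))) \<le>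
     (\<Sum>p\<in>primes_le N. abs_sinc (a * ln p) / p) + (\<Sum>p\<in>primes_le N. log_corr (1 / p))"
    using euler_sum_window(1)[OF a(1) less_imp_le[OF \<sigma>], of T N] by blast
   define F where "F = (\<Sum>p\<in>primes_le N. euler_term (real p powr (- \<sigma>)) (cos (t * ln (real p))))"
   have F: "F <= K" using t(2) C(2)[OF a, of N] sum_log_corr_le[of N] unfolding F_def K_def by linarith
   define Z where "Z = zeta (of_real \<sigma> + \<i> * of_real t)"
   define Pr where "Pr = (\<Prod>p\<in>primes_le N. 1 - of_nat p powr (- (of_real \<sigma> + \<i> * of_real t)) :: complex)"
   have nP: "norm Pr = exp (- F)" unfolding Pr_def F_def by (rule norm_euler_product[OF less_imp_le[OF \<sigma>]])
   have "norm (Z * Pr) <= 1 + 1 / real (Suc n)"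
    using N[of t] norm_triangle_ineq[of "Z * Pr - 1" 1] unfolding Z_def Pr_def by simp
   then have "norm Z * exp (- F) * exp F <= (1 + 1 / real (Suc n)) * exp F"
    unfolding norm_mult nP by (intro mult_right_mono) auto
   then have "norm Z <= (1 + 1 / real (Suc n)) * exp F" by (simp add: mult.assoc flip: exp_add)
   also have "... <= (1 + 1 / real (Suc n)) * exp K" using F by (intro mult_left_mono) auto
   finally show ?thesis using t(1) unfolding Z_def \<sigma>_def by blast
  qed
  then obtain x where x: "\<And>n. x n \<in> {T..T + 2 * a}"
   "\<And>n. norm (zeta (of_real (1 + 1 / real (Suc n)) + \<i> * of_real (x n))) <= (1 + 1 / real (Suc n)) * exp K" by metis
  obtain t \<phi> where t: "t \<in> {T..T + 2 * a}" "strict_mono (\<phi> :: nat => nat)"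
   "(%n. norm (zeta_reg (of_real (1 + 1 / real (Suc (\<phi> n))) + \<i> * of_real (x (\<phi> n))))) \<longlonglongrightarrow> norm (zeta_reg (1 + \<i> * of_real t))"
   "(%n. norm (of_real (1 / real (Suc (\<phi> n))) + \<i> * of_real (x (\<phi> n)) :: complex)) \<longlonglongrightarrow> \<bar>t\<bar>"
   by (rule zeta_reg_window_limit[of x T a, OF x(1)], rule that, assumption+)
  have "(%n. 1 / real (Suc n)) \<longlonglongrightarrow> 0" using LIMSEQ_inverse_real_of_nat by (simp add: inverse_eq_divide)
  from LIMSEQ_subseq_LIMSEQ[OF this t(2)] have e: "(%n. 1 / real (Suc (\<phi> n))) \<longlonglongrightarrow> 0" by (simp add: o_def)
  have "(%n. norm (of_real (1 / real (Suc (\<phi> n))) + \<i> * of_real (x (\<phi> n)) :: complex) * ((1 + 1 / real (Suc (\<phi> n))) * exp K)) \<longlonglongrightarrow> \<bar>t\<bar> * ((1 + 0) * exp K)"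
   by (intro tendsto_intros t(4) e)
  moreover have "norm (zeta_reg (of_real (1 + 1 / real (Suc (\<phi> n))) + \<i> * of_real (x (\<phi> n)))) \<le>
    norm (of_real (1 / real (Suc (\<phi> n))) + \<i> * of_real (x (\<phi> n)) :: complex) * ((1 + 1 / real (Suc (\<phi> n))) * exp K)" for n
   using x(2)[of "\<phi> n"] by (subst zeta_reg_mult) (auto intro!: mult_left_mono simp del: of_nat_Suc)
  ultimately have "norm (zeta_reg (1 + \<i> * of_real t)) <= \<bar>t\<bar> * ((1 + 0) * exp K)"
   using t(3) by (meson LIMSEQ_le)
  then have le: "norm (zeta_reg (1 + \<i> * of_real t)) <= \<bar>t\<bar> * exp K" by simp
  have t0: "t ~= 0"
  proof
   assume "t = 0"
   then show False using le by (simp add: zeta_reg_def)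
  qed
  then have "norm (zeta (1 + \<i> * of_real t)) <= exp K" using le zeta_reg_line[OF t0] by simp
  then show ?thesis using t(1) t0 by (auto simp: K_def)
 qed
 then show ?thesis using that C(1) by blast
qed

text \<open>The limit argument of \<open>zeta_window_small_value\<close> with the lower mean bound.
  The finite sum of \<open>alt_corr\<close> falls short of its limit by at most 1/(n+1), which
  disappears with n. The alternative t = 0 is the case that the limit point is the pole.\<close>

theorem zeta_window_large_value:
 obtains C :: real where "C > 0"
  "\<And>a T. 0 < a ==> a <= 1 ==> \<exists>t\<in>{T..T + 2 * a}. t = 0 \<or>
    norm (zeta (1 + \<i> * of_real t)) >= exp (ln (pi\<^sup>2 / 6) - euler_mascheroni - ln (2 / a) - C * a\<^sup>2)"
proof -
 obtain C :: real where C: "C > 0" "\<And>a N. 0 < a ==> a <= 1 ==> (\<Sum>p\<in>primes_le N. abs_sinc (a * ln p) / p) \<le>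
    euler_mascheroni - log_corr_const + ln (2 / a) + C * a\<^sup>2"
  by (rule sinc_prime_sum_upper, rule that, assumption+)
 obtain D :: real where D: "D > 0" "\<And>N. (\<Sum>p\<in>primes_le N. (ln (real p) / real p)\<^sup>2) <= D"
  by (rule prime_log_square_sum_le, rule that, assumption+)
 have "\<exists>t\<in>{T..T + 2 * a}. t = 0 \<or> norm (zeta (1 + \<i> * of_real t)) >= exp (ln (pi\<^sup>2 / 6) - euler_mascheroni - ln (2 / a) - (C + D) * a\<^sup>2)"
  if a: "0 < a" "a <= 1" for a T
 proof -
  define K where "K = ln (pi\<^sup>2 / 6) - euler_mascheroni - ln (2 / a) - (C + D) * a\<^sup>2"
  have "\<exists>t\<in>{T..T + 2 * a}. norm (zeta (of_real (1 + 1 / real (Suc n)) + \<i> * of_real t)) >= (1 - 1 / real (Suc n)) * exp (K - 1 / real (Suc n))" for n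
  proof -
   define \<sigma> where "\<sigma> = 1 + 1 / real (Suc n)"
   have \<sigma>: "\<sigma> > 1" by (simp add: \<sigma>_def)
   have "\<forall>\<^sub>F N in sequentially. (\<Sum>p\<in>primes_le N. alt_corr p) > ln (pi\<^sup>2 / 6) - log_corr_const - 1 / real (Suc n)"
    by (rule order_tendstoD(1)[OF sum_alt_corr_tendsto]) simp
   with euler_product_approx_eventually[OF \<sigma>, of "1 / real (Suc n)"]
   have "\<forall>\<^sub>F N in sequentially. (\<Sum>p\<in>primes_le N. alt_corr p) > ln (pi\<^sup>2 / 6) - log_corr_const - 1 / real (Suc n) &
    (\<forall>t. norm (zeta (of_real \<sigma> + \<i> * of_real t) * (\<Prod>p\<in>primes_le N. 1 - of_nat p powr (- (of_real \<sigma> + \<i> * of_real t))) - 1) <= 1 / real (Suc n))"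
    by (simp add: eventually_conj)
   then obtain N where N: "(\<Sum>p\<in>primes_le N. alt_corr p) > ln (pi\<^sup>2 / 6) - log_corr_const - 1 / real (Suc n)"
    "\<And>t. norm (zeta (of_real \<sigma> + \<i> * of_real t) * (\<Prod>p\<in>primes_le N. 1 - of_nat p powr (- (of_real \<sigma> + \<i> * of_real t))) - 1) <= 1 / real (Suc n)"
    using eventually_happens by force
   obtain t where t: "t \<in> {T..T + 2 * a}" "(\<Sum>p\<in>primes_le N. euler_term (real p powr (- \<sigma>)) (cos (t * ln (real p)))) \<ge>
     (\<Sum>p\<in>primes_le N. alt_corr p) - (\<Sum>p\<in>primes_le N. abs_sinc (a * ln p) / p) - a\<^sup>2 * (\<Sum>p\<in>primes_le N. (ln p / p)\<^sup>2)"
    using euler_sum_window(2)[OF a(1) less_imp_le[OF \<sigma>], of T N] by blast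
   define F where "F = (\<Sum>p\<in>primes_le N. euler_term (real p powr (- \<sigma>)) (cos (t * ln (real p))))"
   have "a\<^sup>2 * (\<Sum>p\<in>primes_le N. (ln p / p)\<^sup>2) <= a\<^sup>2 * D" by (intro mult_left_mono D) simp
   moreover have "(C + D) * a\<^sup>2 = C * a\<^sup>2 + a\<^sup>2 * D" by (simp add: algebra_simps)
   ultimately have F: "K - 1 / real (Suc n) <= F"
    using t(2) C(2)[OF a, of N] N(1) unfolding F_def K_def by linarith
   define Z where "Z = zeta (of_real \<sigma> + \<i> * of_real t)"
   define Pr where "Pr = (\<Prod>p\<in>primes_le N. 1 - of_nat p powr (- (of_real \<sigma> + \<i> * of_real t)) :: complex)"
   have nP: "norm Pr = exp (- F)" unfolding Pr_def F_def by (rule norm_euler_product[OF less_imp_le[OF \<sigma>]])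
   have "1 - 1 / real (Suc n) <= norm (Z * Pr)"
    using N(2)[of t] norm_triangle_ineq2[of 1 "1 - Z * Pr"] norm_minus_commute[of "Z * Pr" 1] unfolding Z_def Pr_def by simp
   then have "(1 - 1 / real (Suc n)) * exp F <= norm Z * exp (- F) * exp F"
    unfolding norm_mult nP by (intro mult_right_mono) auto
   then have "(1 - 1 / real (Suc n)) * exp F <= norm Z" by (simp add: mult.assoc flip: exp_add)
   moreover have "(1 - 1 / real (Suc n)) * exp (K - 1 / real (Suc n)) <= (1 - 1 / real (Suc n)) * exp F"
    using F by (intro mult_left_mono) auto
   ultimately show ?thesis using t(1) unfolding Z_def \<sigma>_def by (meson order_trans)
  qed
  then obtain x where x: "\<And>n. x n \<in> {T..T + 2 * a}"
   "\<And>n. norm (zeta (of_real (1 + 1 / real (Suc n)) + \<i> * of_real (x n))) >= (1 - 1 / real (Suc n)) * exp (K - 1 / real (Suc n))" by metis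
  obtain t \<phi> where t: "t \<in> {T..T + 2 * a}" "strict_mono (\<phi> :: nat => nat)"
   "(%n. norm (zeta_reg (of_real (1 + 1 / real (Suc (\<phi> n))) + \<i> * of_real (x (\<phi> n))))) \<longlonglongrightarrow> norm (zeta_reg (1 + \<i> * of_real t))"
   "(%n. norm (of_real (1 / real (Suc (\<phi> n))) + \<i> * of_real (x (\<phi> n)) :: complex)) \<longlonglongrightarrow> \<bar>t\<bar>"
   by (rule zeta_reg_window_limit[of x T a, OF x(1)], rule that, assumption+)
  have "(%n. 1 / real (Suc n)) \<longlonglongrightarrow> 0" using LIMSEQ_inverse_real_of_nat by (simp add: inverse_eq_divide)
  from LIMSEQ_subseq_LIMSEQ[OF this t(2)] have e: "(%n. 1 / real (Suc (\<phi> n))) \<longlonglongrightarrow> 0" by (simp add: o_def)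
  have "(%n. norm (of_real (1 / real (Suc (\<phi> n))) + \<i> * of_real (x (\<phi> n)) :: complex) * ((1 - 1 / real (Suc (\<phi> n))) * exp (K - 1 / real (Suc (\<phi> n))))) \<longlonglongrightarrow> \<bar>t\<bar> * ((1 - 0) * exp (K - 0))"
   by (intro tendsto_intros t(4) e)
  moreover have "norm (zeta_reg (of_real (1 + 1 / real (Suc (\<phi> n))) + \<i> * of_real (x (\<phi> n)))) \<ge>
    norm (of_real (1 / real (Suc (\<phi> n))) + \<i> * of_real (x (\<phi> n)) :: complex) * ((1 - 1 / real (Suc (\<phi> n))) * exp (K - 1 / real (Suc (\<phi> n))))" for n
   using x(2)[of "\<phi> n"] by (subst zeta_reg_mult) (auto intro!: mult_left_mono simp del: of_nat_Suc)
  ultimately have "\<bar>t\<bar> * ((1 - 0) * exp (K - 0)) <= norm (zeta_reg (1 + \<i> * of_real t))"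
   using t(3) by (meson LIMSEQ_le)
  then have le: "\<bar>t\<bar> * exp K <= norm (zeta_reg (1 + \<i> * of_real t))" by simp
  have "t = 0 \<or> norm (zeta (1 + \<i> * of_real t)) >= exp K"
  proof (cases "t = 0")
   case False
   then show ?thesis using le zeta_reg_line[OF False] by simp
  qed simp
  then show ?thesis using t(1) by (auto simp: K_def)
 qed
 then show ?thesis using that[of "C + D"] C(1) D(1) by simp
qed

subsection \<open>Extremal windows\<close>

text \<open>For b l <= pi the wave is 1 and 1 - cos is quadratic; beyond, the trivial bound 2 is at
  most (b l)^2 / 2.\<close>

lemma one_minus_wave_le:
 assumes b: "b > 0" and l: "l > 0" and t: "\<bar>t\<bar> <= b"
 shows "1 - square_wave b l * cos (t * l) <= (b * l)\<^sup>2 / 2"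
proof (cases "b * l <= pi")
 case True
 have "square_wave b l = (- 1) ^ 0"
  by (rule square_wave_eq) (use b l True in \<open>auto simp: field_simps\<close>)
 moreover have "1 - cos (t * l) <= (t * l)\<^sup>2 / 2" by (rule one_minus_cos_le)
 moreover have "(t * l)\<^sup>2 <= (b * l)\<^sup>2"
  using b l t by (simp only: abs_le_square_iff[symmetric] abs_mult) (intro mult_right_mono; simp)
 ultimately show ?thesis by simp
next
 case False
 have "\<bar>square_wave b l * cos (t * l)\<bar> <= 1" unfolding abs_mult abs_square_wave by simp
 moreover have "2 * 2 <= (b * l) * (b * l)" using False pi_gt3 by (intro mult_mono) auto
 ultimately show ?thesis by (simp add: power2_eq_square abs_le_iff)
qed

lemma abs_ln_norm_diff_le:
 fixes u v :: complex
 assumes "norm u >= 1/2" "norm v >= 1/2" "norm (u - v) <= e / 2"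
 shows "\<bar>ln (norm u) - ln (norm v)\<bar> <= e"
proof -
 have q: "ln x - ln y <= e" if "x >= 1/2" "y >= 1/2" "\<bar>x - y\<bar> <= e / 2" for x y :: real
 proof -
  have xy: "x - y <= e / 2" "0 <= e / 2" "0 <= y" using that by linarith+
  have "ln x - ln y <= (x - y) / y" using that by (intro ln_quotient_le) auto
  also have "... <= (e / 2) / y" by (rule divide_right_mono[OF xy(1,3)])
  also have "... <= (e / 2) / (1/2)" by (rule divide_left_mono[OF that(2) xy(2)]) (use that in simp)
  finally show ?thesis by simp
 qed
 have "\<bar>norm u - norm v\<bar> <= e / 2" using norm_triangle_ineq3[of u v] assms(3) by linarith
 then show ?thesis using q[of "norm u" "norm v"] q[of "norm v" "norm u"] assms by (simp add: abs_le_iff abs_minus_commute)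
qed

text \<open>Turns the cut K pi / b in ln p into a bound for p, so that \<open>wave_sum b K\<close>
  runs over \<open>primes_le (cutoff b K)\<close>.\<close>

abbreviation cutoff :: "real => nat => nat" where
 "cutoff b K == nat \<lfloor>exp (real K * pi / b)\<rfloor>"

text \<open>\<kappa> = 1 aims at large and \<kappa> = -1 at small |zeta|. Each Euler factor at T + t
  is compared with the one in which p^(-iT) is replaced by its prescribed sign: an error
  \<open>\<eta>'\<close> per prime adds up to e / 2, and \<eta> accounts for the other e /
  2.\<close>

lemma signed_window:
 assumes a: "0 < a" and b: "0 < b" "b <= 1" and e: "0 < e" and \<kappa>: "\<bar>\<kappa>\<bar> = 1"
 shows "\<exists>n\<ge>n1. \<exists>T>a. n <= cutoff b (2 * n + 1) & (\<forall>t. \<bar>t\<bar> <= a -->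
   exp ((\<Sum>p\<in>primes_le (cutoff b (2 * n + 1)). euler_term (1 / p) (\<kappa> * square_wave b (ln p) * cos (t * ln p))) - e)
    <= norm (zeta (1 + \<i> * of_real (T + t))) &
   norm (zeta (1 + \<i> * of_real (T + t))) \<le>
   exp ((\<Sum>p\<in>primes_le (cutoff b (2 * n + 1)). euler_term (1 / p) (\<kappa> * square_wave b (ln p) * cos (t * ln p))) + e))"
proof -
 \<comment> \<open>Then 1 - \<eta> = exp(-e/2) and also 1 + \<eta> <= exp(e/2), because exp(e/2) +
   exp(-e/2) >= 2.\<close>
 define \<eta> where "\<eta> = 1 - exp (- e / 2)"
 have \<eta>: "0 < \<eta>" "1 - \<eta> = exp (- e / 2)" using e by (auto simp: \<eta>_def)
 have \<eta>2: "1 + \<eta> <= exp (e / 2)"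
  using exp_ge_add_one_self[of "- e / 2"] exp_ge_add_one_self[of "e / 2"] unfolding \<eta>_def by linarith
 obtain N0 where N0: "\<And>N \<epsilon> \<eta>' T0. N >= N0 ==> \<forall>p. \<bar>\<epsilon> p\<bar> = 1 ==> \<eta>' > 0 ==> \<exists>T\<ge>T0.
   (\<forall>p\<in>primes_le N. norm (cis (- T * ln (real p)) - of_real (\<epsilon> p)) <= \<eta>') &
   (\<forall>t. \<bar>t\<bar> <= a --> norm (zeta (1 + \<i> * of_real (T + t)) * (\<Prod>p\<in>primes_le N. 1 - of_nat p powr (- (1 + \<i> * of_real (T + t)))) - 1) <= \<eta>)"
  using zeta_resembles_signed_product[OF a \<eta>(1)] by presburger
 define n where "n = max n1 N0"
 define N where "N = cutoff b (2 * n + 1)"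
 have nN: "n <= N" unfolding N_def
 proof (rule le_nat_floor)
  have "real n * 1 <= real (2 * n + 1) * (pi / b)" using b pi_gt3 by (intro mult_mono) (auto simp: field_simps)
  then have "real n <= real (2 * n + 1) * pi / b" by simp
  then show "real n <= exp (real (2 * n + 1) * pi / b)"
   using exp_ge_add_one_self[of "real (2 * n + 1) * pi / b"] by linarith
 qed
 then have NN: "N >= N0" by (simp add: n_def)
 define P where "P = primes_le N"
 have P: "finite P" "\<And>p. p \<in> P ==> real p >= 2" unfolding P_def using prime_ge_2_nat by (auto simp: primes_le_def)
 define \<epsilon> where "\<epsilon> p = \<kappa> * square_wave b (ln (real p))" for p :: nat
 have \<epsilon>: "\<bar>\<epsilon> p\<bar> = 1" for p using \<kappa> by (simp add: \<epsilon>_def abs_mult)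
 define \<eta>' where "\<eta>' = e / (2 * (real (card P) + 1))"
 have \<eta>': "\<eta>' > 0" using e by (simp add: \<eta>'_def add_nonneg_pos)
 have rate: "real (card P) * \<eta>' <= e / 2"
 proof -
  have "real (card P) * \<eta>' <= (real (card P) + 1) * \<eta>'" using \<eta>' by (intro mult_right_mono) auto
  also have "... = e / 2" unfolding \<eta>'_def by (simp add: field_simps)
  finally show ?thesis .
 qed
 obtain T where T: "T >= a + 1" "\<And>p. p \<in> P ==> norm (cis (- T * ln (real p)) - of_real (\<epsilon> p)) <= \<eta>'"
  "\<And>t. \<bar>t\<bar> <= a ==> norm (zeta (1 + \<i> * of_real (T + t)) * (\<Prod>p\<in>P. 1 - of_nat p powr (- (1 + \<i> * of_real (T + t)))) - 1) <= \<eta>"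
  using N0[OF NN _ \<eta>', of \<epsilon> "a + 1"] \<epsilon> unfolding P_def by blast
 have main: "exp ((\<Sum>p\<in>P. euler_term (1 / p) (\<epsilon> p * cos (t * ln p))) - e) <= norm (zeta (1 + \<i> * of_real (T + t))) &
   norm (zeta (1 + \<i> * of_real (T + t))) <= exp ((\<Sum>p\<in>P. euler_term (1 / p) (\<epsilon> p * cos (t * ln p))) + e)" if t: "\<bar>t\<bar> <= a" for t
 proof -
  define A where "A p = (1 - of_nat p powr (- (1 + \<i> * of_real (T + t))) :: complex)" for p :: nat
  define Z where "Z = norm (zeta (1 + \<i> * of_real (T + t)))"
  define F where "F = (\<Sum>p\<in>P. euler_term (1 / p) (\<epsilon> p * cos (t * ln p)))"
  define G where "G = (\<Sum>p\<in>P. - ln (norm (A p)))"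
  have half: "norm (1 - of_real c * cis \<theta>) >= 1/2" if "\<bar>c\<bar> <= 1/2" for c \<theta>
   using norm_triangle_ineq2[of 1 "of_real c * cis \<theta>"] that by (simp add: norm_mult)
  have A: "A p = 1 - of_real (1 / real p) * cis (- (T + t) * ln (real p))" if "p \<in> P" for p
   using nat_powr_polar[of p 1 "T + t"] P(2)[OF that] by (simp add: A_def powr_minus divide_inverse)
  have fac: "norm (A p) >= 1/2" "\<bar>- ln (norm (A p)) - euler_term (1 / p) (\<epsilon> p * cos (t * ln p))\<bar> <= \<eta>'" if p: "p \<in> P" for p
  proof -
   have ph: "\<bar>1 / real p\<bar> <= 1/2" "\<bar>\<epsilon> p / real p\<bar> <= 1/2" using P(2)[OF p] \<epsilon>[of p] by (auto simp: field_simps abs_divide)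
   define B where "B = (1 - of_real (\<epsilon> p / real p) * cis (- t * ln (real p)) :: complex)"
   show h: "norm (A p) >= 1/2" unfolding A[OF p] by (rule half[OF ph(1)])
   have hB: "norm B >= 1/2" unfolding B_def by (rule half[OF ph(2)])
   have "A p - B = of_real (1 / real p) * cis (- t * ln (real p)) * (of_real (\<epsilon> p) - cis (- T * ln (real p)))"
   proof -
    have "cis (- (T + t) * ln (real p)) = cis (- t * ln (real p)) * cis (- T * ln (real p))" by (simp add: cis_mult algebra_simps)
    then show ?thesis unfolding A[OF p] B_def by (simp only:) (simp add: algebra_simps)
   qed
   then have "norm (A p - B) = 1 / real p * norm (cis (- T * ln (real p)) - of_real (\<epsilon> p))"
    by (simp only: norm_mult norm_cis norm_of_real norm_minus_commute) simp
   also have "... <= 1 / 2 * \<eta>'" using ph(1) T(2)[OF p] by (intro mult_mono) auto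
   finally have "\<bar>ln (norm (A p)) - ln (norm B)\<bar> <= \<eta>'" by (intro abs_ln_norm_diff_le h hB) simp
   moreover have "- ln (norm B) = euler_term (1 / p) (\<epsilon> p * cos (t * ln p))"
   proof -
    have "\<bar>\<epsilon> p / real p\<bar> = 1 / real p" using \<epsilon>[of p] by (simp add: abs_divide)
    moreover have "sgn (\<epsilon> p / real p) = \<epsilon> p" using \<epsilon>[of p] P(2)[OF p] by (auto simp: abs_if sgn_if split: if_splits)
    ultimately show ?thesis unfolding B_def minus_ln_norm_factor by (simp only: mult_minus_left cos_minus)
   qed
   ultimately show "\<bar>- ln (norm (A p)) - euler_term (1 / p) (\<epsilon> p * cos (t * ln p))\<bar> <= \<eta>'" by linarith
  qed
  have "\<bar>G - F\<bar> <= (\<Sum>p\<in>P. \<bar>- ln (norm (A p)) - euler_term (1 / p) (\<epsilon> p * cos (t * ln p))\<bar>)"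
   unfolding G_def F_def sum_subtractf[symmetric] by (rule sum_abs)
  also have "... <= real (card P) * \<eta>'" by (rule sum_bounded_above) (rule fac(2))
  finally have GF: "\<bar>G - F\<bar> <= e / 2" using rate by linarith
  have A0: "A p ~= 0" if "p \<in> P" for p using fac(1)[OF that] by auto
  have prod: "norm (\<Prod>p\<in>P. A p) = exp (- G)" unfolding G_def by (rule prod_norm_inverse[OF P(1) A0])
  define W where "W = zeta (1 + \<i> * of_real (T + t)) * (\<Prod>p\<in>P. A p)"
  have W: "norm (W - 1) <= \<eta>" using T(3)[OF t] by (simp add: W_def A_def)
  have "1 - \<eta> <= norm W" "norm W <= 1 + \<eta>"
   using W norm_triangle_ineq[of "W - 1" 1] norm_triangle_ineq2[of 1 "1 - W"] norm_minus_commute[of W 1] by simp_all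
  then have W2: "exp (- e / 2) <= Z * exp (- G)" "Z * exp (- G) <= exp (e / 2)"
   using \<eta>(2) \<eta>2 by (simp_all add: W_def norm_mult prod Z_def)
  have ZG: "Z = Z * exp (- G) * exp G" by (simp add: mult.assoc flip: exp_add)
  have "F - e <= - e / 2 + G" "e / 2 + G <= F + e" using GF by linarith+
  then have mono: "exp (F - e) <= exp (- e / 2 + G)" "exp (e / 2 + G) <= exp (F + e)"
   by (simp_all only: exp_le_cancel_iff)
  have "exp (F - e) <= exp (- e / 2 + G)" by (rule mono(1))
  also have "... = exp (- e / 2) * exp G" by (rule exp_add)
  also have "... <= Z * exp (- G) * exp G" using W2 by (intro mult_right_mono) auto
  finally have 1: "exp (F - e) <= Z" unfolding ZG[symmetric] .
  have "Z * exp (- G) * exp G <= exp (e / 2) * exp G" using W2 by (intro mult_right_mono) auto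
  also have "... = exp (e / 2 + G)" by (rule exp_add[symmetric])
  also note mono(2)
  finally have 2: "Z <= exp (F + e)" unfolding ZG[symmetric] .
  from 1 2 show ?thesis by (simp add: Z_def F_def)
 qed
 show ?thesis
 proof (intro exI[of _ n] exI[of _ T] conjI, unfold N_def[symmetric] P_def[symmetric])
  show "\<forall>t. \<bar>t\<bar> <= a -->
   exp ((\<Sum>p\<in>P. euler_term (1 / p) (\<kappa> * square_wave b (ln p) * cos (t * ln p))) - e) <= norm (zeta (1 + \<i> * of_real (T + t))) &
   norm (zeta (1 + \<i> * of_real (T + t))) <= exp ((\<Sum>p\<in>P. euler_term (1 / p) (\<kappa> * square_wave b (ln p) * cos (t * ln p))) + e)"
   using main unfolding \<epsilon>_def by blast
 qed (use T(1) nN in \<open>simp_all add: n_def\<close>)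
qed

text \<open>For |t| <= a the wave sum is bounded below by its constant main value up to O(a^2). It
  enters with the \<open>log_corr\<close> terms for the sign +1, and negatively with the
  \<open>alt_corr\<close> terms for the sign -1. Since wave times cosine is near 1 at small primes,
  the tangent estimates lose only O((b ln p / p)^2) per prime.\<close>

theorem extremal_windows:
 obtains C :: real where "C > 0"
  "\<And>a. 0 < a ==> a <= 1/2 ==> \<exists>T>0. \<forall>t\<in>{T..T + 2 * a}.
    norm (zeta (1 + \<i> * of_real t)) >= exp (euler_mascheroni + ln (2 / a) - C * a\<^sup>2)"
  "\<And>a. 0 < a ==> a <= 1/2 ==> \<exists>T>0. \<forall>t\<in>{T..T + 2 * a}.
    norm (zeta (1 + \<i> * of_real t)) <= exp (ln (pi\<^sup>2 / 6) - euler_mascheroni - ln (2 / a) + C * a\<^sup>2)"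
proof -
 obtain C :: real where C: "C > 0" "\<And>a b \<epsilon>. 0 < a ==> a < b ==> b <= 1 ==> \<epsilon> > 0 ==> \<exists>n0. \<forall>n\<ge>n0. \<forall>t. \<bar>t\<bar> <= a -->
    wave_sum b (2 * n + 1) t >= euler_mascheroni - log_corr_const + ln (2 / b) - C * b\<^sup>2 - \<epsilon>"
  by (rule wave_sum_lower, rule that, assumption+)
 obtain D :: real where D: "D > 0" "\<And>N. (\<Sum>p\<in>primes_le N. (ln (real p) / real p)\<^sup>2) <= D"
  by (rule prime_log_square_sum_le, rule that, assumption+)
 \<comment> \<open>Per a^2: 4 for the losses in ln(2/b), in the wave sum, in the tail of
   \<open>log_corr\<close> and in the signed window; 4 C and 16 D because b <= 2 a.\<close>
 define C' where "C' = 4 + 4 * C + 16 * D"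
 have "(\<exists>T>0. \<forall>t\<in>{T..T + 2 * a}. norm (zeta (1 + \<i> * of_real t)) >= exp (euler_mascheroni + ln (2 / a) - C' * a\<^sup>2)) &
   (\<exists>T>0. \<forall>t\<in>{T..T + 2 * a}. norm (zeta (1 + \<i> * of_real t)) <= exp (ln (pi\<^sup>2 / 6) - euler_mascheroni - ln (2 / a) + C' * a\<^sup>2))"
  if a: "0 < a" "a <= 1/2" for a
 proof -
  \<comment> \<open>Strictly larger than a, at most 2 a, and with ln(2/b) = ln(2/a) - a^2
    exactly.\<close>
  define b where "b = a * exp (a\<^sup>2)"
  have a2: "0 < a\<^sup>2" "a\<^sup>2 <= 1/4" using a power_mono[of a "1/2" 2] by (auto simp: power2_eq_square)
  have "exp (a\<^sup>2) <= 1 + a\<^sup>2 + (a\<^sup>2)\<^sup>2" using a2 by (intro exp_bound) auto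
  moreover have "(a\<^sup>2)\<^sup>2 <= 1\<^sup>2" using a2 by (intro power_mono) auto
  ultimately have "exp (a\<^sup>2) <= 9 / 4" using a2 by simp
  moreover have "(a\<^sup>2)\<^sup>2 <= (1/4)\<^sup>2" using a2 by (intro power_mono) auto
  ultimately have ea: "exp (a\<^sup>2) <= 2" using \<open>exp (a\<^sup>2) <= 1 + a\<^sup>2 + (a\<^sup>2)\<^sup>2\<close> a2 by (simp add: power2_eq_square)
  have "a * exp (a\<^sup>2) <= a * 2" using a ea by (intro mult_left_mono) auto
  then have b2a: "b <= 2 * a" by (simp add: b_def)
  have "a * 1 < a * exp (a\<^sup>2)" using a a2 by (intro mult_strict_left_mono) auto
  then have ab: "a < b" by (simp add: b_def)
  have b: "0 < b" "b <= 1" using ab b2a a by auto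
  have bb: "b\<^sup>2 <= 4 * a\<^sup>2" using power_mono[OF b2a, of 2] b by (simp add: power_mult_distrib)
  have lnb: "ln (2 / b) = ln (2 / a) - a\<^sup>2" using a by (simp add: b_def ln_divide_pos ln_mult_pos)
  obtain n0 where n0: "\<And>n t. n >= n0 ==> \<bar>t\<bar> <= a ==> wave_sum b (2 * n + 1) t >= euler_mascheroni - log_corr_const + ln (2 / b) - C * b\<^sup>2 - a\<^sup>2"
   using C(2)[OF a(1) ab b(2) a2(1)] by blast
  have "\<forall>\<^sub>F N in sequentially. (\<Sum>p\<in>primes_le N. log_corr (1 / p)) > log_corr_const - a\<^sup>2"
   by (rule order_tendstoD(1)[OF sum_log_corr_tendsto]) (use a2 in simp)
  then obtain N2 where N2: "\<And>N. N >= N2 ==> (\<Sum>p\<in>primes_le N. log_corr (1 / p)) > log_corr_const - a\<^sup>2"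
   by (auto simp: eventually_sequentially)
  have Cb: "C * b\<^sup>2 <= C * (4 * a\<^sup>2)" using C bb by (intro mult_left_mono) auto
  have Db: "4 * b\<^sup>2 * (\<Sum>p\<in>primes_le N. (ln p / p)\<^sup>2) <= 4 * (4 * a\<^sup>2) * D" for N
   using D bb by (intro mult_mono sum_nonneg) auto
  have C'a: "C' * a\<^sup>2 = 4 * a\<^sup>2 + C * (4 * a\<^sup>2) + 4 * (4 * a\<^sup>2) * D" by (simp add: C'_def algebra_simps)
  have prm: "0 < 1 / real p" "1 / real p <= 1/2" "ln (real p) > 0" if "p \<in> primes_le N" for p N
  proof -
   have "real p >= 2" using that prime_ge_2_nat[of p] by (simp add: primes_le_def)
   then show "0 < 1 / real p" "1 / real p <= 1/2" "ln (real p) > 0" by (auto simp: field_simps)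
  qed
  \<comment> \<open>Replaces 1 / (1 - q)^2 by 1 + 8 q, so that the excess 8 q^2 y is covered by the
    summable (l q)^2.\<close>
  have loss: "q * y / (1 - q)\<^sup>2 <= q * y + 4 * b\<^sup>2 * (l * q)\<^sup>2" if "0 < q" "q <= 1/2" "y >= 0" "y <= (b * l)\<^sup>2 / 2" for q y l
  proof -
   have "1 <= (1 - q)\<^sup>2 * (1 + 8 * q)"
   proof -
    have "(1 - q)\<^sup>2 * (1 + 8 * q) - 1 = q * (6 - 15 * q + 8 * q\<^sup>2)" by (simp add: power2_eq_square algebra_simps)
    moreover have "6 - 15 * q + 8 * q\<^sup>2 = 2 * (1/2 - q)\<^sup>2 * 4 + (4 - 7 * q)" by (simp add: power2_eq_square algebra_simps)
    moreover have "0 <= 4 - 7 * q" using that by simp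
    ultimately show ?thesis using that by (smt (verit) mult_nonneg_nonneg zero_le_power2)
   qed
   then have "1 / (1 - q)\<^sup>2 <= 1 + 8 * q" using that by (simp add: divide_le_eq mult.commute)
   then have "q * y * (1 / (1 - q)\<^sup>2) <= q * y * (1 + 8 * q)" using that by (intro mult_left_mono) auto
   also have "... = q * y + 8 * q\<^sup>2 * y" by (simp add: power2_eq_square algebra_simps)
   also have "... <= q * y + 8 * q\<^sup>2 * ((b * l)\<^sup>2 / 2)" using that by (intro add_left_mono mult_left_mono) auto
   also have "8 * q\<^sup>2 * ((b * l)\<^sup>2 / 2) = 4 * b\<^sup>2 * (l * q)\<^sup>2" by (simp add: power_mult_distrib)
   finally show ?thesis by simp
  qed
  have xw: "\<bar>square_wave b (ln p) * cos (t * ln p)\<bar> <= 1" for p t :: real unfolding abs_mult abs_square_wave by simp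
  have ws: "wave_sum b K t = (\<Sum>p\<in>primes_le (cutoff b K). 1 / p * (square_wave b (ln p) * cos (t * ln p)))" for K t
   unfolding wave_sum_def prime_set_eq by simp
  have low: "(\<Sum>p\<in>primes_le (cutoff b K). euler_term (1 / p) (1 * square_wave b (ln p) * cos (t * ln p))) \<ge>
    (\<Sum>p\<in>primes_le (cutoff b K). log_corr (1 / p)) + wave_sum b K t - 4 * b\<^sup>2 * (\<Sum>p\<in>primes_le (cutoff b K). (ln p / p)\<^sup>2)"
   if t: "\<bar>t\<bar> <= a" for K t
   unfolding ws sum_distrib_left sum.distrib[symmetric] sum_subtractf[symmetric]
  proof (rule sum_mono)
   fix p assume p: "p \<in> primes_le (cutoff b K)"
   let ?q = "1 / real p" and ?x = "square_wave b (ln p) * cos (t * ln p)"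
   note pp = prm[OF p]
   have x1: "1 - ?x <= (b * ln p)\<^sup>2 / 2" using t ab by (intro one_minus_wave_le b pp) auto
   have "euler_term ?q ?x >= - ln (1 - ?q) - ?q * (1 - ?x) / (1 - ?q)\<^sup>2"
    by (rule euler_term_lower_right) (use pp xw[of p t] in auto)
   moreover have "?q * (1 - ?x) / (1 - ?q)\<^sup>2 <= ?q * (1 - ?x) + 4 * b\<^sup>2 * (ln p * ?q)\<^sup>2"
    by (rule loss) (use pp x1 xw[of p t] in \<open>auto simp: abs_le_iff\<close>)
   moreover have "?q * (1 - ?x) = ?q - ?q * ?x" by (simp only: right_diff_distrib mult_1_right)
   moreover have "- ln (1 - ?q) = log_corr ?q + ?q" by (simp add: log_corr_def)
   ultimately have "euler_term ?q ?x >= log_corr ?q + ?q * ?x - 4 * b\<^sup>2 * (ln p * ?q)\<^sup>2" by linarith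
   then show "log_corr ?q + ?q * ?x - 4 * b\<^sup>2 * (ln p / p)\<^sup>2 <= euler_term ?q (1 * square_wave b (ln p) * cos (t * ln p))"
    by simp
  qed
  have up: "(\<Sum>p\<in>primes_le (cutoff b K). euler_term (1 / p) (- 1 * square_wave b (ln p) * cos (t * ln p))) \<le>
    (\<Sum>p\<in>primes_le (cutoff b K). alt_corr p) - wave_sum b K t + 4 * b\<^sup>2 * (\<Sum>p\<in>primes_le (cutoff b K). (ln p / p)\<^sup>2)"
   if t: "\<bar>t\<bar> <= a" for K t
   unfolding ws sum_distrib_left sum_subtractf[symmetric] sum.distrib[symmetric]
  proof (rule sum_mono)
   fix p assume p: "p \<in> primes_le (cutoff b K)"
   let ?q = "1 / real p" and ?x = "square_wave b (ln p) * cos (t * ln p)"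
   note pp = prm[OF p]
   have x1: "1 - ?x <= (b * ln p)\<^sup>2 / 2" using t ab by (intro one_minus_wave_le b pp) auto
   have "euler_term ?q (- ?x) <= - ln (1 + ?q) + ?q * (1 + - ?x) / (1 - ?q)\<^sup>2"
    by (rule euler_term_upper_left) (use pp xw[of p t] in auto)
   moreover have "?q * (1 - ?x) / (1 - ?q)\<^sup>2 <= ?q * (1 - ?x) + 4 * b\<^sup>2 * (ln p * ?q)\<^sup>2"
    by (rule loss) (use pp x1 xw[of p t] in \<open>auto simp: abs_le_iff\<close>)
   moreover have "?q * (1 - ?x) = ?q - ?q * ?x" by (simp only: right_diff_distrib mult_1_right)
   moreover have "- ln (1 + ?q) = alt_corr p - ?q" by (simp add: alt_corr_def)
   ultimately have "euler_term ?q (- ?x) <= alt_corr p - ?q * ?x + 4 * b\<^sup>2 * (ln p * ?q)\<^sup>2"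
    unfolding diff_conv_add_uminus[symmetric] by linarith
   then show "euler_term ?q (- 1 * square_wave b (ln p) * cos (t * ln p)) <= alt_corr p - ?q * ?x + 4 * b\<^sup>2 * (ln p / p)\<^sup>2"
    by simp
  qed
  have shift: "\<exists>T>0. \<forall>t\<in>{T..T + 2 * a}. Q t" if "T > a" "\<And>t. \<bar>t\<bar> <= a ==> Q (T + t)" for T and Q :: "real => bool"
  proof (intro exI[of _ "T - a"] conjI ballI)
   show "T - a > 0" using that by simp
   fix s assume "s \<in> {T - a..T - a + 2 * a}"
   then have "\<bar>s - T\<bar> <= a" by auto
   from that(2)[OF this] show "Q s" by simp
  qed
  show ?thesis
  proof
   obtain n T where n: "n >= max n0 N2" "T > a" "n <= cutoff b (2 * n + 1)"
    "\<And>t. \<bar>t\<bar> <= a ==> exp ((\<Sum>p\<in>primes_le (cutoff b (2 * n + 1)). euler_term (1 / p) (1 * square_wave b (ln p) * cos (t * ln p))) - a\<^sup>2)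
    <= norm (zeta (1 + \<i> * of_real (T + t)))"
    using signed_window[OF a(1) b a2(1), of 1 "max n0 N2"] by auto
   show "\<exists>T>0. \<forall>t\<in>{T..T + 2 * a}. norm (zeta (1 + \<i> * of_real t)) >= exp (euler_mascheroni + ln (2 / a) - C' * a\<^sup>2)"
   proof (rule shift[OF n(2)])
    fix t :: real assume t: "\<bar>t\<bar> <= a"
    have "cutoff b (2 * n + 1) >= N2" using n(1,3) by linarith
    from N2[OF this] low[OF t, of "2 * n + 1"] n0[of n t] t n(1) Cb Db[of "cutoff b (2 * n + 1)"]
    have "euler_mascheroni + ln (2 / a) - C' * a\<^sup>2 <= (\<Sum>p\<in>primes_le (cutoff b (2 * n + 1)). euler_term (1 / p) (1 * square_wave b (ln p) * cos (t * ln p))) - a\<^sup>2"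
     unfolding lnb C'a by linarith
    then show "exp (euler_mascheroni + ln (2 / a) - C' * a\<^sup>2) <= norm (zeta (1 + \<i> * of_real (T + t)))"
     using n(4)[OF t] by (meson exp_le_cancel_iff order_trans)
   qed
  next
   obtain n T where n: "n >= n0" "T > a" "n <= cutoff b (2 * n + 1)"
    "\<And>t. \<bar>t\<bar> <= a ==> norm (zeta (1 + \<i> * of_real (T + t))) \<le>
     exp ((\<Sum>p\<in>primes_le (cutoff b (2 * n + 1)). euler_term (1 / p) (- 1 * square_wave b (ln p) * cos (t * ln p))) + a\<^sup>2)"
    using signed_window[OF a(1) b a2(1), of "- 1" n0] by auto
   show "\<exists>T>0. \<forall>t\<in>{T..T + 2 * a}. norm (zeta (1 + \<i> * of_real t)) <= exp (ln (pi\<^sup>2 / 6) - euler_mascheroni - ln (2 / a) + C' * a\<^sup>2)"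
   proof (rule shift[OF n(2)])
    fix t :: real assume t: "\<bar>t\<bar> <= a"
    from sum_alt_corr_le[of "cutoff b (2 * n + 1)"] up[OF t, of "2 * n + 1"] n0[OF n(1) t] Cb Db[of "cutoff b (2 * n + 1)"] a2
    have "(\<Sum>p\<in>primes_le (cutoff b (2 * n + 1)). euler_term (1 / p) (- 1 * square_wave b (ln p) * cos (t * ln p))) + a\<^sup>2 <= ln (pi\<^sup>2 / 6) - euler_mascheroni - ln (2 / a) + C' * a\<^sup>2"
     unfolding lnb C'a by linarith
    then show "norm (zeta (1 + \<i> * of_real (T + t))) <= exp (ln (pi\<^sup>2 / 6) - euler_mascheroni - ln (2 / a) + C' * a\<^sup>2)"
     using n(4)[OF t] by (meson exp_le_cancel_iff order_trans)
   qed
  qed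
 qed
 moreover have "C' > 0" using C D by (simp add: C'_def)
 ultimately show ?thesis using that[of C'] by blast
qed

subsection \<open>Suprema and infima over windows\<close>

text \<open>At 0 the value infinity is the limit, since |t| |zeta| is the modulus of
  \<open>zeta_reg\<close>, which is at least 1/2 nearby; for |t| < 1/8 the bound of
  \<open>zeta_reg_near_1\<close> is at most 1/8 * (2 * 2).\<close>

lemma abs_zeta_1_line_continuous: "continuous_on UNIV abs_zeta_1_line"
proof (rule continuous_at_imp_continuous_on, rule ballI)
 fix t :: real
 show "isCont abs_zeta_1_line t"
 proof (cases "t = 0")
  case False
  have "continuous_on (- {0}) (%t. zeta (1 + \<i> * of_real t))"
   by (rule continuous_on_compose2[OF holomorphic_on_imp_continuous_on[OF zeta_holomorphic]])
    (auto intro!: continuous_intros)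
  then have "continuous_on (- {0}) (%t. ereal (norm (zeta (1 + \<i> * of_real t))))"
   by (intro continuous_on_ereal continuous_on_norm)
  then have "continuous_on (- {0}) abs_zeta_1_line"
   by (rule continuous_on_eq) (simp add: abs_zeta_1_line_def)
  then show ?thesis using False by (simp add: continuous_on_eq_continuous_at open_Compl)
 next
  case True
  have "(abs_zeta_1_line \<longlongrightarrow> \<infinity>) (at 0)"
   unfolding tendsto_PInfty
  proof
   fix r :: real
   have "\<forall>\<^sub>F s in at 0. \<bar>s\<bar> < min (1/8) (1 / (2 * (\<bar>r\<bar> + 1))) & s ~= (0::real)"
    unfolding eventually_at by (intro exI[of _ "min (1/8) (1 / (2 * (\<bar>r\<bar> + 1)))"]) (auto simp: dist_real_def)
   then show "\<forall>\<^sub>F s in at 0. ereal r < abs_zeta_1_line s"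
   proof eventually_elim
    case (elim s)
    define w where "w = 1 + \<i> * of_real s"
    have w: "Re w = 1" "norm (w - 1) = \<bar>s\<bar>" by (simp_all add: w_def norm_mult)
    have "norm w <= 2" using norm_triangle_ineq[of 1 "\<i> * of_real s"] elim by (simp add: w_def norm_mult)
    then have "\<bar>s\<bar> * (norm w * (1 + 1 / Re w)) <= 1/8 * (2 * 2)" using elim w by (intro mult_mono) auto
    then have "norm (zeta_reg w - 1) <= 1/2" using zeta_reg_near_1[of w] w by simp
    then have "1/2 <= norm (zeta_reg w)" using norm_triangle_ineq2[of 1 "1 - zeta_reg w"] norm_minus_commute[of "zeta_reg w" 1] by simp
    then have z: "1/2 <= \<bar>s\<bar> * norm (zeta w)" using zeta_reg_line[of s] elim by (simp add: w_def)
    have s: "\<bar>s\<bar> > 0" "\<bar>s\<bar> * (\<bar>r\<bar> + 1) < 1/2"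
    proof -
     show "\<bar>s\<bar> > 0" using elim by simp
     have "\<bar>s\<bar> < 1 / (2 * (\<bar>r\<bar> + 1))" using elim by simp
     moreover have "x * y < 1/2" if "x < 1 / (2 * y)" "y > 0" for x y :: real
      using that by (simp add: field_simps)
     ultimately show "\<bar>s\<bar> * (\<bar>r\<bar> + 1) < 1/2" by simp
    qed
    have "\<bar>r\<bar> + 1 < norm (zeta w)"
    proof (rule ccontr)
     assume "\<not> \<bar>r\<bar> + 1 < norm (zeta w)"
     then have "\<bar>s\<bar> * norm (zeta w) <= \<bar>s\<bar> * (\<bar>r\<bar> + 1)" using s by (intro mult_left_mono) auto
     then show False using z s by linarith
    qed
    then have "r < norm (zeta w)" by linarith
    then show ?case using elim by (simp add: abs_zeta_1_line_def w_def)
   qed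
  qed
  then show ?thesis using True by (simp add: isCont_def abs_zeta_1_line_def)
 qed
qed

lemma abs_zeta_1_line_nonneg: "0 <= abs_zeta_1_line t"
 by (simp add: abs_zeta_1_line_def)

context
 fixes T \<delta> :: real
 assumes \<delta>: "\<delta> > 0"
begin

text \<open>Continuity into the extended reals on a compact interval makes \<open>GREATEST\<close> a
  genuine maximum with an attaining point, whether or not the window contains the pole.\<close>

lemma window_max:
 obtains t where "t \<in> {T..T + \<delta>}" "(GREATEST y. y \<in> abs_zeta_1_line ` {T..T + \<delta>}) = abs_zeta_1_line t"
  "\<And>s. s \<in> {T..T + \<delta>} ==> abs_zeta_1_line s <= abs_zeta_1_line t"
proof -
 have "continuous_on {T..T + \<delta>} abs_zeta_1_line" by (rule continuous_on_subset[OF abs_zeta_1_line_continuous]) simp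
 moreover have "{T..T + \<delta>} ~= {}" using \<delta> by simp
 ultimately obtain t where t: "t \<in> {T..T + \<delta>}" "\<forall>s\<in>{T..T + \<delta>}. abs_zeta_1_line s <= abs_zeta_1_line t"
  using continuous_attains_sup[OF compact_Icc] by blast
 have "(GREATEST y. y \<in> abs_zeta_1_line ` {T..T + \<delta>}) = abs_zeta_1_line t"
  by (rule Greatest_equality) (use t in auto)
 then show ?thesis using that t by blast
qed

lemma window_min:
 obtains t where "t \<in> {T..T + \<delta>}" "(LEAST y. y \<in> abs_zeta_1_line ` {T..T + \<delta>}) = abs_zeta_1_line t"
  "\<And>s. s \<in> {T..T + \<delta>} ==> abs_zeta_1_line t <= abs_zeta_1_line s"
proof -
 have "continuous_on {T..T + \<delta>} abs_zeta_1_line" by (rule continuous_on_subset[OF abs_zeta_1_line_continuous]) simp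
 moreover have "{T..T + \<delta>} ~= {}" using \<delta> by simp
 ultimately obtain t where t: "t \<in> {T..T + \<delta>}" "\<forall>s\<in>{T..T + \<delta>}. abs_zeta_1_line t <= abs_zeta_1_line s"
  using continuous_attains_inf[OF compact_Icc] by blast
 have "(LEAST y. y \<in> abs_zeta_1_line ` {T..T + \<delta>}) = abs_zeta_1_line t"
  by (rule Least_equality) (use t in auto)
 then show ?thesis using that t by blast
qed

end

lemma ereal_abs_diff_le: "ereal (x - y) <= I ==> I <= ereal (x + y) ==> \<bar>I - ereal x\<bar> <= ereal y"
 by (cases I) auto

lemma exp_le_linear: "0 <= x ==> x <= K ==> exp x <= 1 + x * exp K" for x K :: real
proof -
 assume x: "0 <= x" "x <= K"
 have "(1 - x) * exp x <= exp (- x) * exp x" using exp_ge_add_one_self[of "-x"] by (intro mult_right_mono) auto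
 then have "exp x <= 1 + x * exp x" by (simp add: algebra_simps flip: exp_add)
 also have "... <= 1 + x * exp K" using x by (intro add_left_mono mult_left_mono) auto
 finally show ?thesis .
qed

lemma exp_quadratic_bounds:
 fixes C \<delta> :: real
 assumes "C > 0" "0 < \<delta>" "\<delta> <= 1"
 shows "exp (- C * (\<delta> / 2)\<^sup>2) >= 1 - C * \<delta>\<^sup>2" "exp (C * (\<delta> / 2)\<^sup>2) <= 1 + C * exp C * \<delta>\<^sup>2"
proof -
 have d: "(\<delta> / 2)\<^sup>2 <= \<delta>\<^sup>2" "\<delta>\<^sup>2 <= 1"
  using assms power_mono[of "\<delta> / 2" \<delta> 2] by (simp_all add: power_le_one)
 have Cd: "C * (\<delta> / 2)\<^sup>2 <= C * \<delta>\<^sup>2" "C * \<delta>\<^sup>2 <= C * 1" using assms d by (intro mult_left_mono; simp)+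
 show "exp (- C * (\<delta> / 2)\<^sup>2) >= 1 - C * \<delta>\<^sup>2" using exp_ge_add_one_self[of "- C * (\<delta> / 2)\<^sup>2"] Cd by simp
 have "exp (C * (\<delta> / 2)\<^sup>2) <= 1 + C * (\<delta> / 2)\<^sup>2 * exp C"
 proof (rule exp_le_linear)
  show "C * (\<delta> / 2)\<^sup>2 <= C" using Cd by linarith
 qed (use assms in simp)
 also have "... <= 1 + C * \<delta>\<^sup>2 * exp C" using Cd by (intro add_left_mono mult_right_mono) auto
 finally show "exp (C * (\<delta> / 2)\<^sup>2) <= 1 + C * exp C * \<delta>\<^sup>2" by (simp add: mult_ac)
qed

text \<open>For \<delta> <= 1 the window theorems apply with a = \<delta> / 2, and exp(O(a^2)) = 1 +
  O(\<delta>^2) gives the error terms. For \<delta> > 1 the error terms dominate the main terms, so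
  crude bounds suffice.\<close>

theorem theorem8:
 "(\<exists>C. \<forall>\<delta>::real. \<delta> > 0 \<longrightarrow>
   \<bar>(INF T::real. GREATEST y. y \<in> abs_zeta_1_line ` {T..T + \<delta>})
    - ereal (exp (- euler_mascheroni) * pi ^ 2 / 24 * \<delta>)\<bar> \<le> ereal (C * \<delta> ^ 3)) \<and>
  (\<exists>C. \<forall>\<delta>::real. \<delta> > 0 \<longrightarrow>
   \<bar>(SUP T::real. LEAST y. y \<in> abs_zeta_1_line ` {T..T + \<delta>})
    - ereal (4 * exp euler_mascheroni / \<delta>)\<bar> \<le> ereal (C * \<delta>))"
proof -
 obtain C1 :: real where C1: "C1 > 0" "\<And>a T. 0 < a ==> a <= 1 ==> \<exists>t\<in>{T..T + 2 * a}. t = 0 \<or>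
    norm (zeta (1 + \<i> * of_real t)) >= exp (ln (pi\<^sup>2 / 6) - euler_mascheroni - ln (2 / a) - C1 * a\<^sup>2)"
  by (rule zeta_window_large_value, rule that, assumption+)
 obtain C3 :: real where C3: "C3 > 0" "\<And>a T. 0 < a ==> a <= 1 ==> \<exists>t\<in>{T..T + 2 * a}. t ~= 0 &
    norm (zeta (1 + \<i> * of_real t)) <= exp (euler_mascheroni + ln (2 / a) + C3 * a\<^sup>2)"
  by (rule zeta_window_small_value, rule that, assumption+)
 obtain C2 :: real where C2: "C2 > 0"
  "\<And>a. 0 < a ==> a <= 1/2 ==> \<exists>T>0. \<forall>t\<in>{T..T + 2 * a}.
    norm (zeta (1 + \<i> * of_real t)) >= exp (euler_mascheroni + ln (2 / a) - C2 * a\<^sup>2)"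
  "\<And>a. 0 < a ==> a <= 1/2 ==> \<exists>T>0. \<forall>t\<in>{T..T + 2 * a}.
    norm (zeta (1 + \<i> * of_real t)) <= exp (ln (pi\<^sup>2 / 6) - euler_mascheroni - ln (2 / a) + C2 * a\<^sup>2)"
  by (rule extremal_windows, rule that, assumption+)
 define c where "c = exp (- euler_mascheroni) * pi\<^sup>2 / (24 :: real)"
 define d where "d = 4 * exp (euler_mascheroni :: real)"
 have cd: "c > 0" "d > 0" by (simp_all add: c_def d_def)
 define G where "G \<delta> T = (GREATEST y. y \<in> abs_zeta_1_line ` {T..T + \<delta>})" for \<delta> T
 define L where "L \<delta> T = (LEAST y. y \<in> abs_zeta_1_line ` {T..T + \<delta>})" for \<delta> T
 \<comment> \<open>Here 2 / a = 4 / \<delta>, which produces (pi^2 / 6) / 4 = pi^2 / 24.\<close>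
 have e1: "exp (ln (pi\<^sup>2 / 6) - euler_mascheroni - ln (2 / (\<delta> / 2)) + x) = c * \<delta> * exp x" if "\<delta> > 0" for \<delta> x :: real
 proof -
  have four: "2 / (\<delta> / 2) = 4 / \<delta>" by simp
  have "exp (u - g - w + x) = exp u * exp (- g) / exp w * exp x" for u g w :: real
   by (simp only: exp_add exp_diff exp_minus divide_inverse)
  then have "exp (ln (pi\<^sup>2 / 6) - euler_mascheroni - ln (2 / (\<delta> / 2)) + x) = exp (ln (pi\<^sup>2 / 6)) * exp (- euler_mascheroni) / exp (ln (4 / \<delta>)) * exp x"
   unfolding four .
  also have "... = pi\<^sup>2 / 6 * exp (- euler_mascheroni) / (4 / \<delta>) * exp x" using that by simp
  finally show ?thesis by (simp add: c_def)
 qed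
 have e2: "exp (euler_mascheroni + ln (2 / (\<delta> / 2)) + x) = d / \<delta> * exp x" if "\<delta> > 0" for \<delta> x :: real
 proof -
  have "exp (euler_mascheroni + ln (2 / (\<delta> / 2)) + x) = exp euler_mascheroni * exp (ln (4 / \<delta>)) * exp x"
   by (simp add: exp_add)
  also have "exp (ln (4 / \<delta>)) = 4 / \<delta>" using that by simp
  finally show ?thesis by (simp add: d_def)
 qed
 have Gge: "y <= G \<delta> T" if "\<delta> > 0" "t \<in> {T..T + \<delta>}" "y <= abs_zeta_1_line t" for y \<delta> T t
  unfolding G_def by (rule window_max[OF that(1), of T]) (use that in \<open>auto intro: order_trans\<close>)
 have Gle: "G \<delta> T <= y" if "\<delta> > 0" "\<And>t. t \<in> {T..T + \<delta>} ==> abs_zeta_1_line t <= y" for y \<delta> T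
  unfolding G_def by (rule window_max[OF that(1), of T]) (use that in auto)
 have Lle: "L \<delta> T <= y" if "\<delta> > 0" "t \<in> {T..T + \<delta>}" "abs_zeta_1_line t <= y" for y \<delta> T t
  unfolding L_def by (rule window_min[OF that(1), of T]) (use that in \<open>auto intro: order_trans\<close>)
 have Lge: "y <= L \<delta> T" if "\<delta> > 0" "\<And>t. t \<in> {T..T + \<delta>} ==> y <= abs_zeta_1_line t" for y \<delta> T
  unfolding L_def by (rule window_min[OF that(1), of T]) (use that in auto)
 \<comment> \<open>The first two summands serve \<delta> <= 1. For \<delta> > 1 the summand 7 covers
   |zeta| <= 5 + 2 \<delta> <= 7 \<delta>^3 on [1, 1 + \<delta>], a window away from the pole, and c
   covers the main term.\<close>
 define K1 where "K1 = c * C1 + c * (C2 * exp C2) + 7 + c"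
 have part1: "\<bar>(INF T. G \<delta> T) - ereal (c * \<delta>)\<bar> <= ereal (K1 * \<delta> ^ 3)" if \<delta>: "\<delta> > 0" for \<delta>
 proof (cases "\<delta> <= 1")
  case True
  have a: "0 < \<delta> / 2" "\<delta> / 2 <= 1" "\<delta> / 2 <= 1/2" using \<delta> True by auto
  have K: "c * \<delta> * (C1 * \<delta>\<^sup>2) <= K1 * \<delta> ^ 3" "c * \<delta> * (C2 * exp C2 * \<delta>\<^sup>2) <= K1 * \<delta> ^ 3"
  proof -
   have "c * C1 * \<delta> ^ 3 <= K1 * \<delta> ^ 3" "c * (C2 * exp C2) * \<delta> ^ 3 <= K1 * \<delta> ^ 3"
    using cd C1 C2 \<delta> by (auto intro!: mult_right_mono simp: K1_def)
   then show "c * \<delta> * (C1 * \<delta>\<^sup>2) <= K1 * \<delta> ^ 3" "c * \<delta> * (C2 * exp C2 * \<delta>\<^sup>2) <= K1 * \<delta> ^ 3"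
    by (simp_all add: power2_eq_square power3_eq_cube mult_ac)
  qed
  show ?thesis
  proof (rule ereal_abs_diff_le)
   show "ereal (c * \<delta> - K1 * \<delta> ^ 3) <= (INF T. G \<delta> T)"
   proof (rule INF_greatest)
    fix T
    obtain t where t: "t \<in> {T..T + \<delta>}" "t = 0 \<or> norm (zeta (1 + \<i> * of_real t)) >= exp (ln (pi\<^sup>2 / 6) - euler_mascheroni - ln (2 / (\<delta> / 2)) - C1 * (\<delta> / 2)\<^sup>2)"
     using C1(2)[OF a(1,2), of T] by auto
    have "c * \<delta> - K1 * \<delta> ^ 3 <= c * \<delta> * (1 - C1 * \<delta>\<^sup>2)" using K(1) by (simp add: right_diff_distrib)
    also have "... <= c * \<delta> * exp (- C1 * (\<delta> / 2)\<^sup>2)" using cd \<delta> by (intro mult_left_mono exp_quadratic_bounds C1 True) auto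
    also have "... = exp (ln (pi\<^sup>2 / 6) - euler_mascheroni - ln (2 / (\<delta> / 2)) - C1 * (\<delta> / 2)\<^sup>2)"
     using e1[OF \<delta>, of "- C1 * (\<delta> / 2)\<^sup>2"] by simp
    finally have "ereal (c * \<delta> - K1 * \<delta> ^ 3) <= abs_zeta_1_line t" using t(2) by (auto simp: abs_zeta_1_line_def)
    then show "ereal (c * \<delta> - K1 * \<delta> ^ 3) <= G \<delta> T" by (rule Gge[OF \<delta> t(1)])
   qed
   obtain T where T: "T > 0" "\<And>t. t \<in> {T..T + \<delta>} ==> norm (zeta (1 + \<i> * of_real t)) <= exp (ln (pi\<^sup>2 / 6) - euler_mascheroni - ln (2 / (\<delta> / 2)) + C2 * (\<delta> / 2)\<^sup>2)"
    using C2(3)[OF a(1,3)] by auto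
   have le: "exp (ln (pi\<^sup>2 / 6) - euler_mascheroni - ln (2 / (\<delta> / 2)) + C2 * (\<delta> / 2)\<^sup>2) <= c * \<delta> + K1 * \<delta> ^ 3"
   proof -
    have "exp (ln (pi\<^sup>2 / 6) - euler_mascheroni - ln (2 / (\<delta> / 2)) + C2 * (\<delta> / 2)\<^sup>2) = c * \<delta> * exp (C2 * (\<delta> / 2)\<^sup>2)" by (rule e1[OF \<delta>])
    also have "... <= c * \<delta> * (1 + C2 * exp C2 * \<delta>\<^sup>2)" using cd \<delta> by (intro mult_left_mono exp_quadratic_bounds C2 True) auto
    also have "... = c * \<delta> + c * \<delta> * (C2 * exp C2 * \<delta>\<^sup>2)" by (simp add: distrib_left)
    finally show ?thesis using K(2) by linarith
   qed
   have "G \<delta> T <= ereal (c * \<delta> + K1 * \<delta> ^ 3)"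
   proof (rule Gle[OF \<delta>])
    fix t assume t: "t \<in> {T..T + \<delta>}"
    then have "t ~= 0" using T(1) by auto
    then show "abs_zeta_1_line t <= ereal (c * \<delta> + K1 * \<delta> ^ 3)" using T(2)[OF t] le by (simp add: abs_zeta_1_line_def)
   qed
   then show "(INF T. G \<delta> T) <= ereal (c * \<delta> + K1 * \<delta> ^ 3)" by (rule INF_lower2[rotated]) simp
  qed
 next
  case False
  have d1: "1 <= \<delta> ^ 3" "\<delta> <= \<delta> ^ 3" using False self_le_power[of \<delta> 3] by (auto intro: one_le_power)
  have cd1: "c * \<delta> <= c * \<delta> ^ 3" using cd d1 by (intro mult_left_mono) auto
  have K1: "(7 + c) * \<delta> ^ 3 <= K1 * \<delta> ^ 3" using cd C1 C2 \<delta> by (intro mult_right_mono) (auto simp: K1_def)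
  have K1': "7 * \<delta> ^ 3 + c * \<delta> ^ 3 <= K1 * \<delta> ^ 3" using K1 by (simp add: distrib_right)
  show ?thesis
  proof (rule ereal_abs_diff_le)
   have "ereal (c * \<delta> - K1 * \<delta> ^ 3) <= 0" using cd1 K1' d1 by simp
   also have "0 <= (INF T. G \<delta> T)"
   proof (rule INF_greatest)
    fix T
    have "T \<in> {T..T + \<delta>}" using \<delta> by simp
    then show "0 <= G \<delta> T" by (rule Gge[OF \<delta> _ abs_zeta_1_line_nonneg])
   qed
   finally show "ereal (c * \<delta> - K1 * \<delta> ^ 3) <= (INF T. G \<delta> T)" .
   have "G \<delta> 1 <= ereal (c * \<delta> + K1 * \<delta> ^ 3)"
   proof (rule Gle[OF \<delta>])
    fix t assume t: "t \<in> {1..1 + \<delta>}"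
    define s where "s = 1 + \<i> * of_real t"
    have s: "Re s = 1" "s ~= 1" "norm (s - 1) = t" using t by (auto simp: s_def norm_mult complex_eq_iff)
    have "norm s <= 1 + t" using norm_triangle_ineq[of 1 "\<i> * of_real t"] t by (simp add: s_def norm_mult)
    moreover have "norm (zeta s - 1 / (s - 1)) <= norm s * 2" using zeta_approx[of 1 s] s by simp
    moreover have "norm (1 / (s - 1)) <= 1" using t s by (simp add: norm_divide)
    ultimately have "norm (zeta s) <= (1 + t) * 2 + 1"
     using norm_triangle_ineq[of "zeta s - 1 / (s - 1)" "1 / (s - 1)"] by simp
    also have "... <= 5 + 2 * \<delta>" using t by simp
    also have "... <= c * \<delta> + K1 * \<delta> ^ 3"
    proof -
     have "0 <= c * \<delta>" "0 <= c * \<delta> ^ 3" using cd \<delta> by auto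
     then show ?thesis using d1 K1' by linarith
    qed
    finally show "abs_zeta_1_line t <= ereal (c * \<delta> + K1 * \<delta> ^ 3)" using t by (simp add: abs_zeta_1_line_def s_def)
   qed
   then show "(INF T. G \<delta> T) <= ereal (c * \<delta> + K1 * \<delta> ^ 3)" by (rule INF_lower2[rotated]) simp
  qed
 qed
 \<comment> \<open>The bound for windows of length 1, that is a = 1/2. A longer window contains such
   a window, and its minimum is no larger.\<close>
 define k where "k = exp (euler_mascheroni + ln (2 / (1/2)) + C3 * (1/2)\<^sup>2 :: real)"
 define K2 where "K2 = d * C2 + d * (C3 * exp C3) + k + d"
 have part2: "\<bar>(SUP T. L \<delta> T) - ereal (d / \<delta>)\<bar> <= ereal (K2 * \<delta>)" if \<delta>: "\<delta> > 0" for \<delta>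
 proof (cases "\<delta> <= 1")
  case True
  have a: "0 < \<delta> / 2" "\<delta> / 2 <= 1" "\<delta> / 2 <= 1/2" using \<delta> True by auto
  have K: "d / \<delta> * (C2 * \<delta>\<^sup>2) <= K2 * \<delta>" "d / \<delta> * (C3 * exp C3 * \<delta>\<^sup>2) <= K2 * \<delta>"
  proof -
   have "k > 0" by (simp add: k_def)
   then have "d * C2 * \<delta> <= K2 * \<delta>" "d * (C3 * exp C3) * \<delta> <= K2 * \<delta>"
    using cd C3 C2 \<delta> by (auto intro!: mult_right_mono simp: K2_def)
   then show "d / \<delta> * (C2 * \<delta>\<^sup>2) <= K2 * \<delta>" "d / \<delta> * (C3 * exp C3 * \<delta>\<^sup>2) <= K2 * \<delta>"
    using \<delta> by (simp_all add: power2_eq_square mult_ac)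
  qed
  show ?thesis
  proof (rule ereal_abs_diff_le)
   show "(SUP T. L \<delta> T) <= ereal (d / \<delta> + K2 * \<delta>)"
   proof (rule SUP_least)
    fix T
    obtain t where t: "t \<in> {T..T + \<delta>}" "t ~= 0" "norm (zeta (1 + \<i> * of_real t)) <= exp (euler_mascheroni + ln (2 / (\<delta> / 2)) + C3 * (\<delta> / 2)\<^sup>2)"
     using C3(2)[OF a(1,2), of T] by auto
    have "exp (euler_mascheroni + ln (2 / (\<delta> / 2)) + C3 * (\<delta> / 2)\<^sup>2) = d / \<delta> * exp (C3 * (\<delta> / 2)\<^sup>2)" by (rule e2[OF \<delta>])
    also have "... <= d / \<delta> * (1 + C3 * exp C3 * \<delta>\<^sup>2)" using cd \<delta> by (intro mult_left_mono exp_quadratic_bounds C3 True) auto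
    also have "... = d / \<delta> + d / \<delta> * (C3 * exp C3 * \<delta>\<^sup>2)" by (simp add: distrib_left)
    also have "... <= d / \<delta> + K2 * \<delta>" using K(2) by linarith
    finally have "abs_zeta_1_line t <= ereal (d / \<delta> + K2 * \<delta>)" using t(2,3) by (simp add: abs_zeta_1_line_def)
    then show "L \<delta> T <= ereal (d / \<delta> + K2 * \<delta>)" by (rule Lle[OF \<delta> t(1)])
   qed
   obtain T where T: "T > 0" "\<And>t. t \<in> {T..T + \<delta>} ==> norm (zeta (1 + \<i> * of_real t)) >= exp (euler_mascheroni + ln (2 / (\<delta> / 2)) - C2 * (\<delta> / 2)\<^sup>2)"
    using C2(2)[OF a(1,3)] by auto
   have le: "d / \<delta> - K2 * \<delta> <= exp (euler_mascheroni + ln (2 / (\<delta> / 2)) - C2 * (\<delta> / 2)\<^sup>2)"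
   proof -
    have "d / \<delta> - K2 * \<delta> <= d / \<delta> - d / \<delta> * (C2 * \<delta>\<^sup>2)" using K(1) by linarith
    also have "... = d / \<delta> * (1 - C2 * \<delta>\<^sup>2)" by (simp add: right_diff_distrib)
    also have "... <= d / \<delta> * exp (- C2 * (\<delta> / 2)\<^sup>2)" using cd \<delta> by (intro mult_left_mono exp_quadratic_bounds C2 True) auto
    also have "... = exp (euler_mascheroni + ln (2 / (\<delta> / 2)) - C2 * (\<delta> / 2)\<^sup>2)"
     using e2[OF \<delta>, of "- C2 * (\<delta> / 2)\<^sup>2"] by simp
    finally show ?thesis .
   qed
   have "ereal (d / \<delta> - K2 * \<delta>) <= L \<delta> T"
   proof (rule Lge[OF \<delta>])
    fix t assume t: "t \<in> {T..T + \<delta>}"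
    then show "ereal (d / \<delta> - K2 * \<delta>) <= abs_zeta_1_line t" using T(2)[OF t] le by (simp add: abs_zeta_1_line_def)
   qed
   then show "ereal (d / \<delta> - K2 * \<delta>) <= (SUP T. L \<delta> T)" by (rule SUP_upper2[rotated]) simp
  qed
 next
  case False
  have k: "k > 0" by (simp add: k_def)
  have dd: "0 <= d / \<delta>" "d / \<delta> <= d * \<delta>"
  proof -
   show "0 <= d / \<delta>" using cd \<delta> by simp
   have "1 / \<delta> <= \<delta>" using False mult_mono[of 1 \<delta> 1 \<delta>] by (simp add: divide_le_eq)
   then show "d / \<delta> <= d * \<delta>" using mult_left_mono[of "1 / \<delta>" \<delta> d] cd by simp
  qed
  have K: "k <= k * \<delta>" "(k + d) * \<delta> <= K2 * \<delta>"
   using False k cd C2 C3 \<delta> by (auto simp: K2_def intro!: mult_right_mono)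
  have K': "k * \<delta> + d * \<delta> <= K2 * \<delta>" using K(2) by (simp add: distrib_right)
  show ?thesis
  proof (rule ereal_abs_diff_le)
   show "(SUP T. L \<delta> T) <= ereal (d / \<delta> + K2 * \<delta>)"
   proof (rule SUP_least)
    fix T
    obtain t where t: "t \<in> {T..T + 1}" "t ~= 0" "norm (zeta (1 + \<i> * of_real t)) <= k"
     using C3(2)[of "1/2" T] by (auto simp: k_def)
    have "0 <= d * \<delta>" using cd \<delta> by simp
    then have "k <= d / \<delta> + K2 * \<delta>" using K(1) K' dd by linarith
    then have "abs_zeta_1_line t <= ereal (d / \<delta> + K2 * \<delta>)" using t(2,3) by (simp add: abs_zeta_1_line_def)
    moreover have "t \<in> {T..T + \<delta>}" using t(1) False by auto
    ultimately show "L \<delta> T <= ereal (d / \<delta> + K2 * \<delta>)" by (intro Lle[OF \<delta>])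
   qed
   have "0 <= k * \<delta>" using k \<delta> by simp
   then have "ereal (d / \<delta> - K2 * \<delta>) <= 0" using dd K' by simp
   also have "0 <= L \<delta> 0" by (rule Lge[OF \<delta>]) (rule abs_zeta_1_line_nonneg)
   also have "... <= (SUP T. L \<delta> T)" by (rule SUP_upper) simp
   finally show "ereal (d / \<delta> - K2 * \<delta>) <= (SUP T. L \<delta> T)" .
  qed
 qed
 show ?thesis
  using part1 part2 unfolding G_def L_def c_def d_def by blast
qed

end
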